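(* Both \textsc{Max-Min Fair Matching} and \textsc{MoV Fair Matching} are polynomial-time solvable on instances with $|C|=2$, and NP-hard on instances with $|C|\ge 3$. The polynomial-time result even holds in the presence of arbitrary size lower bounds, i.e., when additionally an integer $p$ is given and the matching $M$ must satisfy $|M(v)|\ge p$ for every $v\in V$.
   Context: Let $G=(U\cup V,E)$ be a bipartite graph with left side $U$ and right side $V$ ($U\cap V=\emptyset$). For a vertex $w$ and $M\subseteq E$, let $M(w)=\{w' \mid \{w,w'\}\in M\}$. A many-to-one matching is a set $M\subseteq E$ with $|M(u)|\le 1$ for every $u\in U$; it is left-perfect if $|M(u)|=1$ for every $u\in U$. Let $C$ be a finite set of colors and $\mathrm{col}\colon U\to C$; for $U'\subseteq U$ and $c\in C$ let $U'_c=\{u\in U'\mid \mathrm{col}(u)=c\}$. Define $\mathrm{MaxMin}(U')=\max_{c\in C}|U'_c|-\min_{c\in C}|U'_c|$, and $\mathrm{MoV}(U')$ as the largest value minus the second largest value in the list $(|U'_c|)_{c\in C}$ (counted with multiplicity; colors absent from $U'$ count $0$). For a measure $\Pi\in\{\mathrm{MaxMin},\mathrm{MoV}\}$ and integer $\ell\ge0$, $U'$ is $\ell$-fair if $\Pi(U')\le \ell$, and $M$ is $\ell$-fair if $M(v)$ is $\ell$-fair for all $v\in V$. \textsc{$\Pi$ Fair Matching} (called \textsc{Max-Min Fair Matching} resp. \textsc{MoV Fair Matching}): given $G$, $C$, $\mathrm{col}$, $\ell\in\mathbb{N}$, decide whether there exists a left-perfect many-to-one matching in $G$ that is $\ell$-fair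 with respect to $\Pi$. *)

theory Defs
  imports
    "HOL-Library.Multiset"
    "HOL-Computational_Algebra.Polynomial"
begin

section \<open>Deterministic multi-tape Turing machines\<close>

text \<open>
  States are the numbers below \<open>num_states\<close> and tape symbols the numbers below
  \<open>num_symbols\<close>, so the transition function \<open>delta\<close> is only ever used on a finite domain
  and is a finite table. Symbol 0 is the blank; symbols 1 and 2 represent the bits
  \<^const>\<open>False\<close> and \<^const>\<open>True\<close>. Tapes are infinite in both directions.
\<close>

datatype move = Move_Left | Stay | Move_Right

record tm =
  num_tapes :: nat
  num_states :: nat
  num_symbols :: nat
  start_state :: nat
  accept_state :: nat
  reject_state :: nat
  delta :: "nat \<Rightarrow> nat list \<Rightarrow> nat \<times> (nat \<times> move) list"

definition wf_tm :: "tm \<Rightarrow> bool" where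
  "wf_tm M \<longleftrightarrow>
     1 \<le> num_tapes M \<and> 3 \<le> num_symbols M \<and>
     start_state M < num_states M \<and> accept_state M < num_states M \<and>
     reject_state M < num_states M \<and> accept_state M \<noteq> reject_state M \<and>
     (\<forall>q ss. q < num_states M \<and> length ss = num_tapes M \<and> (\<forall>s\<in>set ss. s < num_symbols M) \<longrightarrow>
        fst (delta M q ss) < num_states M \<and>
        length (snd (delta M q ss)) = num_tapes M \<and>
        (\<forall>a\<in>set (snd (delta M q ss)). fst a < num_symbols M))"

text \<open>A configuration: state, contents of each tape, head position on each tape.\<close>

type_synonym config = "nat \<times> (nat \<Rightarrow> int \<Rightarrow> nat) \<times> (nat \<Rightarrow> int)"

fun offset :: "move \<Rightarrow> int" where
  "offset Move_Left = -1"
| "offset Stay = 0"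
| "offset Move_Right = 1"

definition string_tape :: "bool list \<Rightarrow> int \<Rightarrow> nat" where
  "string_tape x j =
     (if 0 \<le> j \<and> j < int (length x) then (if x ! nat j then 2 else 1) else 0)"

definition tm_init :: "tm \<Rightarrow> bool list \<Rightarrow> config" where
  "tm_init M x = (start_state M, (\<lambda>i. if i = 0 then string_tape x else (\<lambda>_. 0)), (\<lambda>_. 0))"

definition tm_halted :: "tm \<Rightarrow> config \<Rightarrow> bool" where
  "tm_halted M cfg \<longleftrightarrow> fst cfg \<in> {accept_state M, reject_state M}"

definition tm_step :: "tm \<Rightarrow> config \<Rightarrow> config" where
  "tm_step M cfg =
     (if tm_halted M cfg then cfg
      else case cfg of (q, T, h) \<Rightarrow>
        (case delta M q (map (\<lambda>i. T i (h i)) [0..<num_tapes M]) of (q', acts) \<Rightarrow>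
           (q',
            (\<lambda>i. if i < num_tapes M then (T i)(h i := fst (acts ! i)) else T i),
            (\<lambda>i. if i < num_tapes M then h i + offset (snd (acts ! i)) else h i))))"

definition tm_run :: "tm \<Rightarrow> bool list \<Rightarrow> nat \<Rightarrow> config" where
  "tm_run M x t = (tm_step M ^^ t) (tm_init M x)"

text \<open>
  The output of a halted machine is the bit string that starts in cell 0 of the first tape
  and is terminated by a blank.
\<close>

definition tm_output :: "config \<Rightarrow> bool list \<Rightarrow> bool" where
  "tm_output cfg y \<longleftrightarrow>
     (\<forall>j. 0 \<le> j \<and> j \<le> int (length y) \<longrightarrow> fst (snd cfg) 0 j = string_tape y j)"


section \<open>Polynomial time and NP-hardness\<close>

text \<open>
  A decision problem consists of a set of admissible instances, an encoding of instances as bit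
  strings, and the predicate that singles out the yes-instances. Only admissible instances are
  ever given to a decision procedure.
\<close>

definition poly_time_solvable ::
  "'i set \<Rightarrow> ('i \<Rightarrow> bool list) \<Rightarrow> ('i \<Rightarrow> bool) \<Rightarrow> bool" where
  "poly_time_solvable Inst enc yes \<longleftrightarrow>
     (\<exists>M (p :: nat poly). wf_tm M \<and>
        (\<forall>I\<in>Inst. \<exists>t \<le> poly p (length (enc I)).
           fst (tm_run M (enc I) t) = (if yes I then accept_state M else reject_state M)))"

definition poly_time_computable :: "(bool list \<Rightarrow> bool list) \<Rightarrow> bool" where
  "poly_time_computable f \<longleftrightarrow>
     (\<exists>M (p :: nat poly). wf_tm M \<and>
        (\<forall>x. \<exists>t \<le> poly p (length x).
           tm_halted M (tm_run M x t) \<and> tm_output (tm_run M x t) (f x)))"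

text \<open>Self-delimiting pairing: every bit of the first component is preceded by \<^const>\<open>True\<close>.\<close>

definition pair_enc :: "bool list \<Rightarrow> bool list \<Rightarrow> bool list" where
  "pair_enc x y = concat (map (\<lambda>b. [True, b]) x) @ False # y"

definition NP :: "bool list set set" where
  "NP = {L. \<exists>R (q :: nat poly).
     poly_time_solvable UNIV (\<lambda>z. z) (\<lambda>z. z \<in> R) \<and>
     (\<forall>x. x \<in> L \<longleftrightarrow> (\<exists>w. length w \<le> poly q (length x) \<and> pair_enc x w \<in> R))}"

definition NP_hard :: "'i set \<Rightarrow> ('i \<Rightarrow> bool list) \<Rightarrow> ('i \<Rightarrow> bool) \<Rightarrow> bool" where
  "NP_hard Inst enc yes \<longleftrightarrow>
     (\<forall>L\<in>NP. \<exists>f. poly_time_computable f \<and>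
        (\<forall>x. \<exists>I\<in>Inst. f x = enc I \<and> (x \<in> L \<longleftrightarrow> yes I)))"

lemma NP_hard_mono: "NP_hard A enc yes \<Longrightarrow> A \<subseteq> B \<Longrightarrow> NP_hard B enc yes"
  unfolding NP_hard_def by (meson subsetD)


section \<open>Fair matchings\<close>

definition bipartite_graph :: "'a set \<Rightarrow> 'a set \<Rightarrow> 'a set set \<Rightarrow> bool" where
  "bipartite_graph U V E \<longleftrightarrow>
     finite U \<and> finite V \<and> U \<inter> V = {} \<and> E \<subseteq> {{u, v} |u v. u \<in> U \<and> v \<in> V}"

definition matched :: "'a set set \<Rightarrow> 'a \<Rightarrow> 'a set" where
  "matched M w = {w'. {w, w'} \<in> M}"

definition many_to_one_matching :: "'a set \<Rightarrow> 'a set set \<Rightarrow> 'a set set \<Rightarrow> bool" where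
  "many_to_one_matching U E M \<longleftrightarrow> M \<subseteq> E \<and> (\<forall>u\<in>U. card (matched M u) \<le> 1)"

definition left_perfect :: "'a set \<Rightarrow> 'a set set \<Rightarrow> bool" where
  "left_perfect U M \<longleftrightarrow> (\<forall>u\<in>U. card (matched M u) = 1)"

definition color_count :: "('a \<Rightarrow> 'c) \<Rightarrow> 'a set \<Rightarrow> 'c \<Rightarrow> nat" where
  "color_count col U' c = card {u \<in> U'. col u = c}"

text \<open>A fairness measure maps the color set, the coloring and a vertex set to a number.\<close>

type_synonym ('a, 'c) measure = "'c set \<Rightarrow> ('a \<Rightarrow> 'c) \<Rightarrow> 'a set \<Rightarrow> nat"

definition max_min :: "('a, 'c) measure" where
  "max_min C col U' = Max (color_count col U' ` C) - Min (color_count col U' ` C)"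

text \<open>Meaningful for at least two colors.\<close>

definition mov :: "('a, 'c) measure" where
  "mov C col U' =
     (let xs = rev (sorted_list_of_multiset (image_mset (color_count col U') (mset_set C)))
      in xs ! 0 - xs ! 1)"

definition fair_set ::
  "('a, 'c) measure \<Rightarrow> 'c set \<Rightarrow> ('a \<Rightarrow> 'c) \<Rightarrow> nat \<Rightarrow> 'a set \<Rightarrow> bool" where
  "fair_set \<Pi> C col l U' \<longleftrightarrow> \<Pi> C col U' \<le> l"

definition fair_matching ::
  "('a, 'c) measure \<Rightarrow> 'a set \<Rightarrow> 'c set \<Rightarrow> ('a \<Rightarrow> 'c) \<Rightarrow> nat \<Rightarrow> 'a set set \<Rightarrow> bool" where
  "fair_matching \<Pi> V C col l M \<longleftrightarrow> (\<forall>v\<in>V. fair_set \<Pi> C col l (matched M v))"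


section \<open>The computational problems\<close>

record instance_data =
  left_side :: "nat set"
  right_side :: "nat set"
  edges :: "nat set set"
  colors :: "nat set"
  coloring :: "nat \<Rightarrow> nat"
  threshold :: nat

definition fair_instance :: "instance_data \<Rightarrow> bool" where
  "fair_instance I \<longleftrightarrow>
     bipartite_graph (left_side I) (right_side I) (edges I) \<and>
     finite (colors I) \<and> coloring I ` left_side I \<subseteq> colors I"

definition fair_solution :: "(nat, nat) measure \<Rightarrow> instance_data \<Rightarrow> nat set set \<Rightarrow> bool" where
  "fair_solution \<Pi> I M \<longleftrightarrow>
     many_to_one_matching (left_side I) (edges I) M \<and>
     left_perfect (left_side I) M \<and>
     fair_matching \<Pi> (right_side I) (colors I) (coloring I) (threshold I) M"

definition has_fair_matching :: "(nat, nat) measure \<Rightarrow> instance_data \<Rightarrow> bool" where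
  "has_fair_matching \<Pi> I \<longleftrightarrow> (\<exists>M. fair_solution \<Pi> I M)"

definition has_fair_matching_lb :: "(nat, nat) measure \<Rightarrow> instance_data \<times> int \<Rightarrow> bool" where
  "has_fair_matching_lb \<Pi> = (\<lambda>(I, p).
     \<exists>M. fair_solution \<Pi> I M \<and> (\<forall>v\<in>right_side I. int (card (matched M v)) \<ge> p))"

text \<open>Binary numerals, least significant bit first; integers are preceded by a sign bit.\<close>

fun nat_enc :: "nat \<Rightarrow> bool list" where
  "nat_enc n = (if n = 0 then [] else odd n # nat_enc (n div 2))"

declare nat_enc.simps [simp del]

definition int_enc :: "int \<Rightarrow> bool list" where
  "int_enc p = (p < 0) # nat_enc (nat \<bar>p\<bar>)"

definition unary_enc :: "nat \<Rightarrow> bool list" where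
  "unary_enc n = replicate n True @ [False]"

text \<open>
  Graphs are given by their adjacency matrix, with the vertices of either side and the colors
  listed in increasing order of their names: after the three sizes there is one row per left
  vertex, consisting of its color as an indicator vector over \<open>colors I\<close> followed by its adjacency
  vector over \<open>right_side I\<close>. The threshold follows in binary.
  Thus instances are encoded up to order-preserving renaming of vertices and colors, which
  does not affect the answer.
\<close>

definition instance_enc :: "instance_data \<Rightarrow> bool list" where
  "instance_enc I =
     unary_enc (card (left_side I)) @ unary_enc (card (right_side I)) @ unary_enc (card (colors I)) @
     concat (map (\<lambda>u.
        map (\<lambda>c. coloring I u = c) (sorted_list_of_set (colors I)) @
        map (\<lambda>v. {u, v} \<in> edges I) (sorted_list_of_set (right_side I)))
       (sorted_list_of_set (left_side I))) @
     nat_enc (threshold I)"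

definition instance_lb_enc :: "instance_data \<times> int \<Rightarrow> bool list" where
  "instance_lb_enc = (\<lambda>(I, p). pair_enc (instance_enc I) (int_enc p))"

definition instances_with_colors :: "nat \<Rightarrow> instance_data set" where
  "instances_with_colors k = {I. fair_instance I \<and> card (colors I) = k}"

end

theory Submission
  imports Defs
begin

text \<open>With two colors both measures are the difference of the two color counts, so a solution is a choice of a
  right vertex for every left vertex and of a pair of admissible counts for every right vertex such
  that the corresponding vectors sum up to zero. The perceptron algorithm looks for a vector with positive
  inner product with all sums of choices. If there is no fair matching, then such a vector exists with entries
  of absolute value at most 2: split every right vertex into slots that take a vertex of one color, a pair
  or at most one vertex of each color, and apply Hall's theorem to a bipartite double of the graph of
  left vertices and slots. Hence polynomially many rounds decide the question, also with lower bounds.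

  For at least three colors and threshold 0, variable and clause gadgets reduce satisfiability, which is NP-hard
  because the runs of a Turing machine are described by Horn clauses. Polynomial running times are obtained
  by compiling programs that work on trees, stored on stacks, to Turing machines.\<close>

section \<open>Structured tape programs\<close>

text \<open>The admissible pairs of counts at a right vertex, with difference at most l and sum at
  least p, are not a product of two intervals, so the two colors cannot be treated separately. Slots
  that take one vertex of each color belong to both sides of an otherwise bipartite graph, which is
  why Hall's theorem is used in a double of it. All that the algorithm gets from this is the size of
  a certificate: a violating set yields potentials between -1 and 2. No matching is ever
  constructed. The number of rounds is polynomial in the dimension, the number of choice lists and
  the size of their entries, so all weights stay polynomially bounded and can be kept in unary, and
  all programs arise from composition, case distinction and iteration with bounded intermediate
  results. On the hardness side, threshold 0 turns fairness into equalities: all colors occur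
  equally often at a node, or the largest count is attained twice. Vertices left over by a gadget
  must go to a node that is fair itself; this dictates the collector nodes and the vertices reserved
  for them.\<close>

datatype com =
  Write nat nat | Shift nat move | Seq com com (infixr ";;" 60)
| Cond nat "nat set" com com | Loop nat "nat set" com

type_synonym tapes = "(nat \<Rightarrow> int \<Rightarrow> nat) \<times> (nat \<Rightarrow> int)"

text \<open>Every construct costs exactly one step, because unfolding it in the control state is
  itself one machine step; so \<open>exec_prog_step\<close> can count exactly.\<close>

inductive exec :: "com \<Rightarrow> tapes \<Rightarrow> nat \<Rightarrow> tapes \<Rightarrow> bool" where
  Write: "exec (Write i s) (T, h) 1 (T(i := (T i)(h i := s)), h)"
| Shift: "exec (Shift i m) (T, h) 1 (T, h(i := h i + offset m))"
| Seq: "exec a C t C1 \<Longrightarrow> exec b C1 u C2 \<Longrightarrow> exec (a ;; b) C (Suc (t + u)) C2"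
| CondT: "T i (h i) \<in> A \<Longrightarrow> exec a (T, h) t C \<Longrightarrow> exec (Cond i A a b) (T, h) (Suc t) C"
| CondF: "T i (h i) \<notin> A \<Longrightarrow> exec b (T, h) t C \<Longrightarrow> exec (Cond i A a b) (T, h) (Suc t) C"
| LoopT: "T i (h i) \<in> A \<Longrightarrow> exec a (T, h) t C1 \<Longrightarrow> exec (Loop i A a) C1 u C2 \<Longrightarrow>
    exec (Loop i A a) (T, h) (Suc (t + u)) C2"
| LoopF: "T i (h i) \<notin> A \<Longrightarrow> exec (Loop i A a) (T, h) 1 (T, h)"

fun tapes_of :: "com \<Rightarrow> nat set" where
  "tapes_of (Write i s) = {i}"
| "tapes_of (Shift i m) = {i}"
| "tapes_of (a ;; b) = tapes_of a \<union> tapes_of b"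
| "tapes_of (Cond i A a b) = insert i (tapes_of a \<union> tapes_of b)"
| "tapes_of (Loop i A a) = insert i (tapes_of a)"

fun symbols_ok :: "com \<Rightarrow> bool" where
  "symbols_ok (Write i s) \<longleftrightarrow> s < 3"
| "symbols_ok (Shift i m) \<longleftrightarrow> True"
| "symbols_ok (a ;; b) \<longleftrightarrow> symbols_ok a \<and> symbols_ok b"
| "symbols_ok (Cond i A a b) \<longleftrightarrow> symbols_ok a \<and> symbols_ok b"
| "symbols_ok (Loop i A a) \<longleftrightarrow> symbols_ok a"

text \<open>The control state of a running program is the list of programs still to be executed.\<close>

fun next_prog :: "com list \<Rightarrow> (nat \<Rightarrow> nat) \<Rightarrow> com list" where
  "next_prog [] r = []"
| "next_prog (Write i s # cs) r = cs"
| "next_prog (Shift i m # cs) r = cs"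
| "next_prog ((a ;; b) # cs) r = a # b # cs"
| "next_prog (Cond i A a b # cs) r = (if r i \<in> A then a # cs else b # cs)"
| "next_prog (Loop i A a # cs) r = (if r i \<in> A then a # Loop i A a # cs else cs)"

fun next_act :: "com list \<Rightarrow> (nat \<Rightarrow> nat) \<Rightarrow> nat \<Rightarrow> nat \<times> move" where
  "next_act (Write i s # cs) r j = (if j = i then s else r j, Stay)"
| "next_act (Shift i m # cs) r j = (r j, if j = i then m else Stay)"
| "next_act cs r j = (r j, Stay)"

definition prog_step :: "com list \<times> tapes \<Rightarrow> com list \<times> tapes" where
  "prog_step = (\<lambda>(cs, T, h). let r = (\<lambda>i. T i (h i)) in
     (next_prog cs r, (\<lambda>i. (T i)(h i := fst (next_act cs r i))),
      (\<lambda>i. h i + offset (snd (next_act cs r i)))))"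

lemma exec_prog_step: "exec c C t C' \<Longrightarrow> (prog_step ^^ t) (c # cs, C) = (cs, C')"
proof (induction arbitrary: cs rule: exec.induct)
  case (Seq a C t C1 b u C2)
  have "prog_step ((a ;; b) # cs, C) = (a # b # cs, C)"
    by (cases C) (simp add: prog_step_def)
  then have "(prog_step ^^ Suc (u + t)) ((a ;; b) # cs, C) = (prog_step ^^ (u + t)) (a # b # cs, C)"
    by (simp add: funpow_swap1)
  also have "\<dots> = (cs, C2)"
    by (simp only: funpow_add o_apply Seq.IH)
  finally show ?case by (simp only: add.commute)
next
  case (LoopT T i h A a t C1 u C2)
  have "prog_step (Loop i A a # cs, T, h) = (a # Loop i A a # cs, T, h)"
    using LoopT by (simp add: prog_step_def)
  then have "(prog_step ^^ Suc (u + t)) (Loop i A a # cs, T, h) = (prog_step ^^ (u + t)) (a # Loop i A a # cs, T, h)"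
    by (simp add: funpow_swap1)
  also have "\<dots> = (cs, C2)"
    by (simp only: funpow_add o_apply LoopT.IH)
  finally show ?case by (simp only: add.commute)
next
  case (CondT T i h A a t C b)
  have "prog_step (Cond i A a b # cs, T, h) = (a # cs, T, h)"
    using CondT by (simp add: prog_step_def)
  then show ?case by (simp add: funpow_swap1 CondT.IH)
next
  case (CondF T i h A b t C a)
  have "prog_step (Cond i A a b # cs, T, h) = (b # cs, T, h)"
    using CondF by (simp add: prog_step_def)
  then show ?case by (simp add: funpow_swap1 CondF.IH)
qed (auto simp: prog_step_def fun_eq_iff)

text \<open>Covers the control states that can arise before \<open>c\<close> in front of
  \<open>cs\<close> is finished. A loop gives its body only one continuation, hence the set is
  finite and can supply the states of a machine.\<close>

fun conts :: "com \<Rightarrow> com list \<Rightarrow> com list set" where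
  "conts (a ;; b) cs = insert ((a ;; b) # cs) (conts a (b # cs) \<union> conts b cs)"
| "conts (Cond i A a b) cs = insert (Cond i A a b # cs) (conts a cs \<union> conts b cs)"
| "conts (Loop i A a) cs = insert (Loop i A a # cs) (conts a (Loop i A a # cs))"
| "conts c cs = {c # cs}"

lemma conts_self: "c # cs \<in> conts c cs"
  by (cases c) auto

lemma finite_conts: "finite (conts c cs)"
  by (induction c arbitrary: cs) auto

lemma next_prog_conts: "ds \<in> conts c cs \<Longrightarrow> next_prog ds r \<in> insert cs (conts c cs)"
proof (induction c arbitrary: cs)
  case (Seq a b)
  then show ?case using conts_self[of a "b # cs"] conts_self[of b cs]
    by fastforce
next
  case (Cond i A a b)
  from Cond.prems consider "ds = Cond i A a b # cs" | "ds \<in> conts a cs" | "ds \<in> conts b cs" by auto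
  then show ?case using Cond.IH conts_self by cases auto
next
  case (Loop i A a)
  then show ?case using conts_self[of a "Loop i A a # cs"]
    by fastforce
qed auto

lemma next_act_symbol:
  assumes "ds \<in> conts c cs" "symbols_ok c" "r i < 3" "cs \<noteq> [] \<longrightarrow> fst (next_act cs r i) < 3"
  shows "fst (next_act ds r i) < 3"
  using assms
proof (induction c arbitrary: ds cs)
  case (Seq a b)
  have *: "fst (next_act (b # cs) r i) < 3"
    using Seq.IH(2)[OF conts_self] Seq.prems by auto
  from Seq.prems(1) consider "ds = (a ;; b) # cs" | "ds \<in> conts a (b # cs)" | "ds \<in> conts b cs" by auto
  then show ?case using Seq * by cases auto
next
  case (Loop j A a)
  have *: "fst (next_act (Loop j A a # cs) r i) < 3"
    using Loop.prems by auto
  from Loop.prems(1) consider "ds = Loop j A a # cs" | "ds \<in> conts a (Loop j A a # cs)" by auto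
  then show ?case using Loop * by cases auto
qed auto

lemma next_act_other:
  assumes "ds \<in> conts c cs" "i \<notin> tapes_of c" "cs \<noteq> [] \<longrightarrow> next_act cs r i = (r i, Stay)"
  shows "next_act ds r i = (r i, Stay)"
  using assms
proof (induction c arbitrary: ds cs)
  case (Seq a b)
  have *: "next_act (b # cs) r i = (r i, Stay)"
    using Seq.IH(2)[OF conts_self] Seq.prems by auto
  from Seq.prems(1) consider "ds = (a ;; b) # cs" | "ds \<in> conts a (b # cs)" | "ds \<in> conts b cs" by auto
  then show ?case using Seq * by cases auto
next
  case (Loop j A a)
  have *: "next_act (Loop j A a # cs) r i = (r i, Stay)"
    using Loop.prems by auto
  from Loop.prems(1) consider "ds = Loop j A a # cs" | "ds \<in> conts a (Loop j A a # cs)" by auto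
  then show ?case using Loop * by cases auto
qed auto

lemma next_prog_cong: "(\<And>i. i \<in> (case ds of c # cs \<Rightarrow> tapes_of c | [] \<Rightarrow> {}) \<Longrightarrow> r i = r' i) \<Longrightarrow> next_prog ds r = next_prog ds r'"
  by (induction ds r rule: next_prog.induct) auto

lemma conts_tapes:
  assumes "ds \<in> conts c cs"
  shows "\<exists>d ds'. ds = d # ds' \<and> tapes_of d \<subseteq> tapes_of c"
  using assms by (induction c arbitrary: cs) fastforce+

text \<open>The states of the machine are the finitely many control states. The empty one spends one
  further step on reading tape \<open>r\<close>, which accounts for \<open>Suc t\<close>.\<close>

lemma tm_of_com:
  assumes k: "tapes_of c \<subseteq> {..<k}" "symbols_ok c" and r: "r < k"
  shows "\<exists>M. wf_tm M \<and> (\<forall>x t T' h'. exec c (snd (tm_init M x)) t (T', h') \<longrightarrow>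
     tm_run M x (Suc t) = (if T' r (h' r) = 2 then accept_state M else reject_state M, T', h'))"
proof -
  define S where "S = insert [] (conts c [])"
  have finS: "finite S" by (simp add: S_def finite_conts)
  obtain e0 where e0: "bij_betw e0 S {0..<card S}"
    using ex_bij_betw_finite_nat[OF finS] by blast
  \<comment> \<open>Shifted by two, as states 0 and 1 are reserved for accepting and
    rejecting.\<close>
  define e where "e = (\<lambda>ds. e0 ds + 2)"
  define d where "d = (\<lambda>n. inv_into S e0 (n - 2))"
  have e_lt: "e ds < card S + 2" if "ds \<in> S" for ds
    using bij_betwE[OF e0] that by (auto simp: e_def)
  have de: "d (e ds) = ds" if "ds \<in> S" for ds
    using bij_betw_inv_into_left[OF e0 that] by (simp add: e_def d_def)
  have dS: "d n \<in> S" if "2 \<le> n" "n < card S + 2" for n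
  proof -
    have "n - 2 \<in> {0..<card S}" using that by auto
    then have "n - 2 \<in> e0 ` S" using e0 by (simp add: bij_betw_def)
    then show ?thesis unfolding d_def by (rule inv_into_into)
  qed
  define rd where "rd = (\<lambda>ss i. if i < k then ss ! i else (0::nat))"
  define \<delta> where "\<delta> = (\<lambda>q ss. if q < 2 then (q, map (\<lambda>s. (s, Stay)) ss) else
     if d q = [] then ((if rd ss r = 2 then 0 else 1), map (\<lambda>s. (s, Stay)) ss)
     else (e (next_prog (d q) (rd ss)), map (next_act (d q) (rd ss)) [0..<k]))"
  define M where "M = \<lparr>num_tapes = k, num_states = card S + 2, num_symbols = 3,
     start_state = e [c], accept_state = 0, reject_state = 1, delta = \<delta>\<rparr>"
  have start: "[c] \<in> S" using conts_self[of c "[]"] by (simp add: S_def)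
  have nextS: "next_prog ds f \<in> S" if "ds \<in> S" for ds f
    using that next_prog_conts[of ds c "[]" f] by (auto simp: S_def)
  have "wf_tm M"
    unfolding wf_tm_def M_def
  proof (simp, intro conjI allI impI)
    show "Suc 0 \<le> k" using r by simp
    show "e [c] < Suc (Suc (card S))" using e_lt[OF start] by simp
    fix q and ss :: "nat list"
    assume a: "q < Suc (Suc (card S)) \<and> length ss = k \<and> (\<forall>s\<in>set ss. s < 3)"
    show "fst (\<delta> q ss) < Suc (Suc (card S))"
      using a e_lt nextS dS[of q] by (auto simp: \<delta>_def)
    show "length (snd (\<delta> q ss)) = k"
      using a by (auto simp: \<delta>_def)
    have "fst (next_act (d q) (rd ss) i) < 3" if "2 \<le> q" "d q \<noteq> []" for i
    proof -
      have "d q \<in> conts c []" using dS[of q] that a by (auto simp: S_def)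
      moreover have "rd ss i < 3" using a by (auto simp: rd_def)
      ultimately show ?thesis using next_act_symbol k(2) by blast
    qed
    then show "\<forall>a\<in>set (snd (\<delta> q ss)). fst a < 3"
      using a by (auto simp: \<delta>_def)
  qed
  moreover have step: "tm_step M (e ds, C) = (e (fst (prog_step (ds, C))), snd (prog_step (ds, C)))"
    if "ds \<in> S" "ds \<noteq> []" for ds C
  proof -
    obtain T h where C: "C = (T, h)" by (cases C)
    have ds: "ds \<in> conts c []" using that by (simp add: S_def)
    let ?f = "\<lambda>i. T i (h i)"
    let ?ss = "map ?f [0..<k]"
    have rd: "rd ?ss i = ?f i" if "i < k" for i using that by (simp add: rd_def)
    have np: "next_prog ds (rd ?ss) = next_prog ds ?f"
    proof (rule next_prog_cong)
      fix i assume "i \<in> (case ds of c # cs \<Rightarrow> tapes_of c | [] \<Rightarrow> {})"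
      with conts_tapes[OF ds] k have "i < k" by auto
      then show "rd ?ss i = ?f i" by (rule rd)
    qed
    have na: "next_act ds (rd ?ss) i = next_act ds ?f i" if "i < k" for i
      using rd[OF that] by (cases "(ds, ?f, i)" rule: next_act.cases) auto
    have oth: "next_act ds ?f i = (?f i, Stay)" if "\<not> i < k" for i
      by (rule next_act_other[OF ds]) (use that k in auto)
    have "\<not> tm_halted M (e ds, T, h)" by (simp add: tm_halted_def M_def e_def)
    moreover have "\<delta> (e ds) ?ss = (e (next_prog ds ?f), map (next_act ds (rd ?ss)) [0..<k])"
      using that de[OF that(1)] by (auto simp: \<delta>_def np) (simp_all add: e_def)
    ultimately show ?thesis
      by (auto simp: tm_step_def M_def C prog_step_def Let_def na oth fun_eq_iff)
  qed
  moreover have "tm_run M x (Suc t) = (if T' r (h' r) = 2 then accept_state M else reject_state M, T', h')"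
    if "exec c (snd (tm_init M x)) t (T', h')" for x t T' h'
  proof -
    let ?C = "snd (tm_init M x)"
    have inv: "(tm_step M ^^ u) (e ds, C) = (e [], T', h')"
      if "(prog_step ^^ u) (ds, C) = ([], T', h')" "ds \<in> S" "\<forall>v<u. fst ((prog_step ^^ v) (ds, C)) \<noteq> []" for u ds C
      using that
    proof (induction u arbitrary: ds C)
      case (Suc u)
      have nz: "ds \<noteq> []" using Suc.prems(3) by (metis funpow_0 fst_conv zero_less_Suc)
      obtain ds' C' where p: "prog_step (ds, C) = (ds', C')" by (cases "prog_step (ds, C)")
      have "ds' \<in> S" using p nextS[OF Suc.prems(2)] by (auto simp: prog_step_def Let_def split: prod.splits)
      moreover have "(prog_step ^^ u) (ds', C') = ([], T', h')" using Suc.prems(1) p by (simp add: funpow_swap1)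
      moreover have "\<forall>v<u. fst ((prog_step ^^ v) (ds', C')) \<noteq> []"
      proof (intro allI impI)
        fix v assume "v < u"
        then have "fst ((prog_step ^^ Suc v) (ds, C)) \<noteq> []" using Suc.prems(3) by blast
        then show "fst ((prog_step ^^ v) (ds', C')) \<noteq> []" using p by (simp add: funpow_swap1)
      qed
      ultimately have "(tm_step M ^^ u) (e ds', C') = (e [], T', h')" using Suc.IH by blast
      then show ?case using step[OF Suc.prems(2) nz] p by (simp add: funpow_swap1)
    qed (auto)
    have ex: "(prog_step ^^ t) ([c], ?C) = ([], T', h')" using exec_prog_step[OF that] .
    have stuck: "fst ((prog_step ^^ v) ([], C)) = [] \<and> snd ((prog_step ^^ v) ([], C)) = C" for v C
      by (induction v) (auto simp: prog_step_def Let_def split: prod.splits)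
    show ?thesis
    proof -
      \<comment> \<open>\<open>inv\<close> requires a nonempty control state before the end, so it
        is applied up to the first time at which the control state is empty. The deciding step
        follows, and the halted machine idles through the remaining steps.\<close>
      define t0 where "t0 = (LEAST u. fst ((prog_step ^^ u) ([c], ?C)) = [])"
      have t0: "fst ((prog_step ^^ t0) ([c], ?C)) = []" "t0 \<le> t"
        unfolding t0_def using ex by (auto intro: LeastI[of _ t] Least_le)
      then obtain C0 where C0: "(prog_step ^^ t0) ([c], ?C) = ([], C0)" by (metis prod.collapse)
      have "(prog_step ^^ (t - t0 + t0)) ([c], ?C) = (prog_step ^^ (t - t0)) ([], C0)"
        unfolding funpow_add o_apply C0 ..
      then have "C0 = (T', h')" using ex stuck[of "t - t0" C0] t0 by (metis le_add_diff_inverse2 snd_conv)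
      then have "(tm_step M ^^ t0) (e [c], ?C) = (e [], T', h')"
        using inv[of t0 "[c]" ?C] C0 start not_less_Least unfolding t0_def by blast
      moreover have "tm_init M x = (e [c], ?C)" by (simp add: tm_init_def M_def)
      moreover have "tm_step M (e [], T', h') = (if T' r (h' r) = 2 then 0 else 1, T', h')"
        using de[of "[]"] r by (auto simp: tm_step_def M_def \<delta>_def tm_halted_def rd_def S_def fun_eq_iff)
          (auto simp: e_def)
      ultimately have "(tm_step M ^^ Suc t0) (tm_init M x) = (if T' r (h' r) = 2 then 0 else 1, T', h')"
        by simp
      moreover have "(tm_step M ^^ v) (q, T', h') = (q, T', h')" if "q \<in> {0, 1}" for v q
        using that by (induction v) (auto simp: tm_step_def tm_halted_def M_def)
      moreover have "Suc t = (t - t0) + Suc t0" using t0 by simp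
      ultimately have "(tm_step M ^^ Suc t) (tm_init M x) = (if T' r (h' r) = 2 then 0 else 1, T', h')"
        by (simp only: funpow_add o_apply) simp
      then show ?thesis by (simp add: tm_run_def M_def)
    qed
  qed
  ultimately show ?thesis by blast
qed

section \<open>Stacks\<close>

text \<open>A tape is used as a stack that grows to the left, with the head on the topmost symbol and blanks on
  both sides. A state records for each tape the position at which its stack ends and the content
  of the stack.\<close>

type_synonym state = "(nat \<Rightarrow> int) \<times> (nat \<Rightarrow> nat list)"

definition view :: "state \<Rightarrow> tapes \<Rightarrow> bool" where
  "view S C \<longleftrightarrow> (\<forall>i. snd C i + int (length (snd S i)) = fst S i \<and>
     (\<forall>j. fst C i (snd C i + j) = (if 0 \<le> j \<and> nat j < length (snd S i) then snd S i ! nat j else 0)))"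

definition stack :: "state \<Rightarrow> nat \<Rightarrow> nat list" where "stack S i = snd S i"
definition upd :: "nat \<Rightarrow> nat list \<Rightarrow> state \<Rightarrow> state" where "upd i xs S = (fst S, (snd S)(i := xs))"

text \<open>The number \<open>t\<close> is only an upper bound on the time, so that bounds can be
  rounded up freely.\<close>

definition runs :: "com \<Rightarrow> state \<Rightarrow> nat \<Rightarrow> state \<Rightarrow> bool" where
  "runs c S t S' \<longleftrightarrow> (\<forall>C. view S C \<longrightarrow> (\<exists>C' u. u \<le> t \<and> exec c C u C' \<and> view S' C'))"

fun top :: "nat list \<Rightarrow> nat" where
  "top [] = 0"
| "top (s # xs) = s"

definition push :: "nat \<Rightarrow> nat \<Rightarrow> com" where
  "push i s = Shift i Move_Left ;; Write i s"

definition pop :: "nat \<Rightarrow> com" where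
  "pop i = Write i 0 ;; Shift i Move_Right"

definition skip :: com where "skip = Shift 4 Stay"

lemma view_top: "view S (T, h) \<Longrightarrow> T i (h i) = top (stack S i)"
  unfolding view_def stack_def by (drule spec[of _ i], drule conjunct2, drule spec[of _ 0]) (cases "snd S i"; simp)

lemma exec_Write': "C' = ((fst C)(i := (fst C i)(snd C i := s)), snd C) \<Longrightarrow> exec (Write i s) C (Suc 0) C'"
  using exec.Write by (cases C) simp

lemma exec_Shift': "C' = (fst C, (snd C)(i := snd C i + offset m)) \<Longrightarrow> exec (Shift i m) C (Suc 0) C'"
  using exec.Shift by (cases C) simp

lemma runsI1:
  assumes "\<And>C. view S C \<Longrightarrow> \<exists>C'. exec c C t C' \<and> view S' C'"
  shows "runs c S t S'"
  using assms unfolding runs_def by blast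

lemma runs_push: "S' = upd i (s # stack S i) S \<Longrightarrow> runs (push i s) S 3 S'"
proof (rule runsI1)
  fix C assume v: "view S C" and S': "S' = upd i (s # stack S i) S"
  obtain T h where C: "C = (T, h)" by (cases C)
  let ?C' = "(T(i := (T i)(h i - 1 := s)), h(i := h i - 1))"
  have "exec (push i s) C (Suc (Suc 0 + Suc 0)) ?C'"
    unfolding push_def by (rule exec.Seq exec_Write' exec_Shift' refl)+ (simp add: C)
  moreover have "view S' ?C'"
    unfolding view_def
  proof (intro allI conjI)
    have *: "h i' + int (length (snd S i')) = fst S i'"
      "T i' (h i' + j) = (if 0 \<le> j \<and> nat j < length (snd S i') then snd S i' ! nat j else 0)" for i' j
      using v by (simp_all add: view_def C)
    fix i'
    show "snd ?C' i' + int (length (snd S' i')) = fst S' i'"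
      using *(1)[of i'] *(1)[of i] by (auto simp: S' upd_def stack_def)
    fix j :: int
    have e: "h i + (j - 1) = h i - 1 + j" by simp
    note s = *(2)[of i "j - 1", unfolded e]
    consider "i' \<noteq> i" | "i' = i" "j < 0" | "i' = i" "j = 0" | "i' = i" "j > 0" by linarith
    then show "fst ?C' i' (snd ?C' i' + j) = (if 0 \<le> j \<and> nat j < length (snd S' i') then snd S' i' ! nat j else 0)"
    proof cases
      case 4
      then have "nat j = Suc (nat (j - 1))" by simp
      then show ?thesis using 4 s by (auto simp: S' upd_def stack_def)
    qed (use *(2)[of i' j] s in \<open>auto simp: S' upd_def stack_def\<close>)
  qed
  ultimately show "\<exists>C'. exec (push i s) C 3 C' \<and> view S' C'"
    unfolding numeral_3_eq_3 by fastforce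
qed

lemma runs_pop: "stack S i = s # xs \<Longrightarrow> S' = upd i xs S \<Longrightarrow> runs (pop i) S 3 S'"
proof (rule runsI1)
  fix C assume v: "view S C" and S: "stack S i = s # xs" and S': "S' = upd i xs S"
  obtain T h where C: "C = (T, h)" by (cases C)
  let ?C' = "(T(i := (T i)(h i := 0)), h(i := h i + 1))"
  have "exec (pop i) C (Suc (Suc 0 + Suc 0)) ?C'"
    unfolding pop_def by (rule exec.Seq exec_Write' exec_Shift' refl)+ (simp add: C)
  moreover have "view S' ?C'"
    unfolding view_def
  proof (intro allI conjI)
    have *: "h i' + int (length (snd S i')) = fst S i'"
      "T i' (h i' + j) = (if 0 \<le> j \<and> nat j < length (snd S i') then snd S i' ! nat j else 0)" for i' j
      using v by (simp_all add: view_def C)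
    have S: "snd S i = s # xs" using S by (simp add: stack_def)
    fix i'
    show "snd ?C' i' + int (length (snd S' i')) = fst S' i'"
      using *(1)[of i'] *(1)[of i] by (auto simp: S' upd_def S)
    fix j :: int
    have "j < -1 \<or> j = -1 \<or> j \<ge> 0" by linarith
    then consider "i' \<noteq> i" | "i' = i" "j < -1" | "i' = i" "j = -1" | "i' = i" "j \<ge> 0" by blast
    then show "fst ?C' i' (snd ?C' i' + j) = (if 0 \<le> j \<and> nat j < length (snd S' i') then snd S' i' ! nat j else 0)"
    proof cases
      case 4
      then have "nat (j + 1) = Suc (nat j)" by simp
      then show ?thesis using 4 *(2)[of i "j + 1"] by (auto simp: S' upd_def S algebra_simps)
    qed (use *(2)[of i' j] *(2)[of i "j + 1"] in \<open>auto simp: S' upd_def algebra_simps\<close>)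
  qed
  ultimately show "\<exists>C'. exec (pop i) C 3 C' \<and> view S' C'"
    unfolding numeral_3_eq_3 by fastforce
qed

text \<open>An empty stack has no content to carry along, so moving the head just moves its end.
  This is how the output is brought to cell 0.\<close>

lemma runs_shift_empty:
  assumes "stack S i = []" "S' = ((fst S)(i := fst S i + offset m), snd S)"
  shows "runs (Shift i m) S 1 S'"
proof (rule runsI1)
  fix C assume v: "view S C"
  obtain T h where C: "C = (T, h)" by (cases C)
  let ?C' = "(T, h(i := h i + offset m))"
  have "exec (Shift i m) C 1 ?C'" using exec.Shift[of i m T h] by (simp add: C)
  moreover have "view S' ?C'"
    unfolding view_def
  proof (intro allI conjI)
    have *: "h i' + int (length (snd S i')) = fst S i'"
      "T i' (h i' + j) = (if 0 \<le> j \<and> nat j < length (snd S i') then snd S i' ! nat j else 0)" for i' j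
      using v by (simp_all add: view_def C)
    fix i'
    show "snd ?C' i' + int (length (snd S' i')) = fst S' i'"
      using *(1)[of i'] *(1)[of i] by (auto simp: assms)
    show "fst ?C' i' (snd ?C' i' + j) = (if 0 \<le> j \<and> nat j < length (snd S' i') then snd S' i' ! nat j else 0)" for j
      using *(2)[of i' j] *(2)[of i' "j + offset m"] assms by (auto simp: stack_def algebra_simps)
  qed
  ultimately show "\<exists>C'. exec (Shift i m) C 1 C' \<and> view S' C'" by blast
qed

lemma runs_mono: "runs c \<sigma> t \<sigma>' \<Longrightarrow> t \<le> u \<Longrightarrow> runs c \<sigma> u \<sigma>'"
  unfolding runs_def by (meson le_trans)

lemma runs_skip: "runs skip S 3 S"
proof -
  have "exec (Shift 4 Stay) C (Suc 0) C" for C by (rule exec_Shift') simp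
  then have "runs skip S (Suc 0) S" unfolding skip_def by (intro runsI1) blast
  then show ?thesis by (rule runs_mono) simp
qed

lemma runs_Seq: "runs a \<sigma> t \<sigma>1 \<Longrightarrow> runs b \<sigma>1 u \<sigma>2 \<Longrightarrow> runs (a ;; b) \<sigma> (Suc (t + u)) \<sigma>2"
  unfolding runs_def by (meson exec.Seq add_mono Suc_le_mono)

lemma runs_CondT: "top (stack \<sigma> i) \<in> A \<Longrightarrow> runs a \<sigma> t \<sigma>' \<Longrightarrow> runs (Cond i A a b) \<sigma> (Suc t) \<sigma>'"
  unfolding runs_def by (metis exec.CondT prod.collapse view_top Suc_le_mono)

lemma runs_CondF: "top (stack \<sigma> i) \<notin> A \<Longrightarrow> runs b \<sigma> t \<sigma>' \<Longrightarrow> runs (Cond i A a b) \<sigma> (Suc t) \<sigma>'"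
  unfolding runs_def by (metis exec.CondF prod.collapse view_top Suc_le_mono)

lemma runs_LoopF: "top (stack \<sigma> i) \<notin> A \<Longrightarrow> runs (Loop i A a) \<sigma> 1 \<sigma>"
  by (rule runsI1) (metis exec.LoopF prod.collapse view_top)

lemma runs_LoopT:
  assumes "top (stack \<sigma> i) \<in> A" "runs a \<sigma> t \<sigma>1" "runs (Loop i A a) \<sigma>1 u \<sigma>2"
  shows "runs (Loop i A a) \<sigma> (Suc (t + u)) \<sigma>2"
  unfolding runs_def
proof (intro allI impI)
  fix C assume v: "view \<sigma> C"
  obtain T h where C: "C = (T, h)" by (cases C)
  obtain C1 t1 where 1: "t1 \<le> t" "exec a C t1 C1" "view \<sigma>1 C1" using assms(2) v unfolding runs_def by blast
  obtain C2 t2 where 2: "t2 \<le> u" "exec (Loop i A a) C1 t2 C2" "view \<sigma>2 C2" using assms(3) 1 unfolding runs_def by blast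
  have "exec (Loop i A a) C (Suc (t1 + t2)) C2"
    using exec.LoopT[of T i h A a t1 C1 t2 C2] 1 2 view_top[of \<sigma> T h i] v assms(1) C by simp
  then show "\<exists>C' u'. u' \<le> Suc (t + u) \<and> exec (Loop i A a) C u' C' \<and> view \<sigma>2 C'"
    using 1 2 by (metis Suc_le_mono add_mono)
qed

section \<open>Trees on stacks\<close>

datatype tree = Leaf | Node tree tree

text \<open>Preorder over the two nonblank symbols is self-delimiting: trees can be piled up on one
  stack and read back without separators.\<close>

fun pre :: "tree \<Rightarrow> nat list" where
  "pre Leaf = [1]"
| "pre (Node a b) = 2 # pre a @ pre b"

lemma set_pre: "set (pre a) \<subseteq> {1, 2}"
  by (induction a) auto

lemma length_pre_pos: "0 < length (pre a)"
  by (cases a) auto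

text \<open>Tape 1 holds the arguments and results; tapes 2, 3 and 4 are scratch.\<close>

definition stk :: "state \<Rightarrow> nat list \<Rightarrow> nat list \<Rightarrow> nat list \<Rightarrow> nat list \<Rightarrow> state" where
  "stk S a b c d = (fst S, (snd S)(1 := a, 2 := b, 3 := c, 4 := d))"

lemma stk_simps [simp]:
  "stack (stk \<sigma> a b c d) (Suc 0) = a" "stack (stk \<sigma> a b c d) 2 = b"
  "stack (stk \<sigma> a b c d) 3 = c" "stack (stk \<sigma> a b c d) 4 = d"
  "upd (Suc 0) x (stk \<sigma> a b c d) = stk \<sigma> x b c d" "upd 2 x (stk \<sigma> a b c d) = stk \<sigma> a x c d"
  "upd 3 x (stk \<sigma> a b c d) = stk \<sigma> a b x d" "upd 4 x (stk \<sigma> a b c d) = stk \<sigma> a b c x"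
  by (auto simp: stk_def fun_eq_iff upd_def stack_def)

text \<open>Move the topmost tree from tape 1, reversed, to those of the tapes 2 and 3 that are selected.
  The number of trees still to be read is kept in unary on tape 4.\<close>

definition put :: "bool \<Rightarrow> bool \<Rightarrow> nat \<Rightarrow> com" where
  "put p q s = (if p then push 2 s else skip) ;; (if q then push 3 s else skip) ;; pop 1"

definition mvt :: "bool \<Rightarrow> bool \<Rightarrow> com" where
  "mvt p q = push 4 1 ;; Loop 4 {1} (Cond 1 {1} (put p q 1 ;; pop 4) (put p q 2 ;; push 4 1))"

lemma runs_put: "runs (put p q s) (stk \<sigma> (s # a) b c d) 11
    (stk \<sigma> a (if p then s # b else b) (if q then s # c else c) d)"
proof -
  let ?b = "if p then s # b else b" and ?c = "if q then s # c else c"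
  have 1: "runs (if p then push 2 s else skip) (stk \<sigma> (s # a) b c d) 3 (stk \<sigma> (s # a) ?b c d)"
    by (auto intro: runs_push runs_skip)
  have 2: "runs (if q then push 3 s else skip) (stk \<sigma> (s # a) ?b c d) 3 (stk \<sigma> (s # a) ?b ?c d)"
    by (cases q) (auto intro: runs_push runs_skip)
  have 3: "runs (pop 1) (stk \<sigma> (s # a) ?b ?c d) 3 (stk \<sigma> a ?b ?c d)"
    by (rule runs_pop) simp_all
  show ?thesis unfolding put_def using runs_Seq[OF 1 runs_Seq[OF 2 3]] by simp
qed

text \<open>Generalized to a list of trees, whose number is the counter on tape 4. A node symbol
  replaces one pending tree by two, hence the induction on the total length of the code.\<close>

lemma runs_mvt_loop:
  "runs (Loop 4 {1} (Cond 1 {1} (put p q 1 ;; pop 4) (put p q 2 ;; push 4 1)))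
     (stk \<sigma> (concat (map pre ts) @ a) b c (replicate (length ts) 1))
     (20 * length (concat (map pre ts)) + 1)
     (stk \<sigma> a (if p then rev (concat (map pre ts)) @ b else b)
        (if q then rev (concat (map pre ts)) @ c else c) [])"
  (is "runs ?L _ _ _")
proof (induction "length (concat (map pre ts))" arbitrary: ts b c rule: less_induct)
  case less
  show ?case
  proof (cases ts)
    case Nil
    then show ?thesis using runs_LoopF[of "stk \<sigma> a b c []" 4 "{1}"] by simp
  next
    case (Cons t ts')
    show ?thesis
    proof (cases t)
      case Leaf
      let ?b = "if p then 1 # b else b" and ?c = "if q then 1 # c else c"
      have body: "runs (Cond 1 {1} (put p q 1 ;; pop 4) (put p q 2 ;; push 4 1))
        (stk \<sigma> (1 # concat (map pre ts') @ a) b c (replicate (length ts) 1)) (Suc (Suc (11 + 3)))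
        (stk \<sigma> (concat (map pre ts') @ a) ?b ?c (replicate (length ts') 1))"
        by (rule runs_CondT, simp, rule runs_Seq[OF runs_put runs_pop]) (simp_all add: Cons)
      have "runs ?L (stk \<sigma> (1 # concat (map pre ts') @ a) b c (replicate (length ts) 1))
        (Suc (Suc (Suc (11 + 3)) + (20 * length (concat (map pre ts')) + 1)))
        (stk \<sigma> a (if p then rev (concat (map pre ts')) @ ?b else ?b)
        (if q then rev (concat (map pre ts')) @ ?c else ?c) [])"
        by (rule runs_LoopT[OF _ body less]) (simp_all add: Cons Leaf)
      then have "runs ?L (stk \<sigma> (1 # concat (map pre ts') @ a) b c (replicate (length ts) 1))
        (20 * length (concat (map pre ts)) + 1)
        (stk \<sigma> a (if p then rev (concat (map pre ts')) @ ?b else ?b)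
        (if q then rev (concat (map pre ts')) @ ?c else ?c) [])"
        by (rule runs_mono) (simp add: Cons Leaf)
      then show ?thesis by (cases p; cases q; simp add: Cons Leaf)
    next
      case (Node t1 t2)
      let ?b = "if p then 2 # b else b" and ?c = "if q then 2 # c else c"
      let ?ts = "t1 # t2 # ts'"
      have body: "runs (Cond 1 {1} (put p q 1 ;; pop 4) (put p q 2 ;; push 4 1))
        (stk \<sigma> (2 # concat (map pre ?ts) @ a) b c (replicate (length ts) 1)) (Suc (Suc (11 + 3)))
        (stk \<sigma> (concat (map pre ?ts) @ a) ?b ?c (replicate (length ?ts) 1))"
        by (rule runs_CondF, simp, rule runs_Seq[OF runs_put runs_push]) (simp add: Cons)
      have "runs ?L (stk \<sigma> (2 # concat (map pre ?ts) @ a) b c (replicate (length ts) 1))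
        (Suc (Suc (Suc (11 + 3)) + (20 * length (concat (map pre ?ts)) + 1)))
        (stk \<sigma> a (if p then rev (concat (map pre ?ts)) @ ?b else ?b)
        (if q then rev (concat (map pre ?ts)) @ ?c else ?c) [])"
        by (rule runs_LoopT[OF _ body less]) (simp_all add: Cons Node)
      then have "runs ?L (stk \<sigma> (2 # concat (map pre ?ts) @ a) b c (replicate (length ts) 1))
        (20 * length (concat (map pre ts)) + 1)
        (stk \<sigma> a (if p then rev (concat (map pre ?ts)) @ ?b else ?b)
        (if q then rev (concat (map pre ?ts)) @ ?c else ?c) [])"
        by (rule runs_mono) (simp add: Cons Node)
      then show ?thesis by (cases p; cases q; simp add: Cons Node)
    qed
  qed
qed

lemma runs_mvt: "runs (mvt p q) (stk \<sigma> (pre t @ a) b c []) (20 * length (pre t) + 5)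
   (stk \<sigma> a (if p then rev (pre t) @ b else b) (if q then rev (pre t) @ c else c) [])"
proof -
  have "runs (mvt p q) (stk \<sigma> (pre t @ a) b c []) (Suc (3 + (20 * length (pre t) + 1)))
   (stk \<sigma> a (if p then rev (pre t) @ b else b) (if q then rev (pre t) @ c else c) [])"
    unfolding mvt_def
    using runs_mvt_loop[of p q \<sigma> "[t]" a b c]
    by (intro runs_Seq[OF runs_push]) (cases p; cases q; simp)+
  then show ?thesis by (rule runs_mono) simp
qed

text \<open>\<open>mvt\<close> leaves a tree reversed on a scratch tape; emptying that tape onto
  tape 1 reverses it back.\<close>

definition flush :: "nat \<Rightarrow> com" where
  "flush i = Loop i {1, 2} (Cond i {1} (pop i ;; push 1 1) (pop i ;; push 1 2))"

lemma stack_upd: "stack (upd i xs S) j = (if i = j then xs else stack S j)"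
  by (simp add: stack_def upd_def)

lemma upd_upd: "upd i xs (upd i ys S) = upd i xs S"
  by (simp add: upd_def)

lemma upd_stack: "stack S i = xs \<Longrightarrow> upd i xs S = S"
  by (cases S) (auto simp: stack_def upd_def)

lemma runs_flush:
  assumes "set (stack S i) \<subseteq> {1, 2}" "i \<noteq> 1"
  shows "runs (flush i) S (20 * length (stack S i) + 1) (upd i [] (upd 1 (rev (stack S i) @ stack S 1) S))"
  using assms
proof (induction "stack S i" arbitrary: S)
  case Nil
  then show ?case unfolding flush_def using runs_LoopF[of S i "{1, 2}"]
    by (auto simp: upd_stack stack_upd)
next
  case (Cons s xs)
  let ?S1 = "upd 1 (s # stack S 1) (upd i xs S)"
  have s: "s = 1 \<or> s = 2" using Cons by (metis insert_iff list.set_intros(1) subsetD empty_iff)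
  have xs: "set xs \<subseteq> {1, 2}" using Cons.hyps(2)[symmetric] Cons.prems by auto
  have ps: "runs (pop i ;; push 1 s) S (Suc (3 + 3)) ?S1"
    by (rule runs_Seq[OF runs_pop[OF Cons.hyps(2)[symmetric] refl] runs_push]) (use Cons.prems(2) in \<open>simp add: stack_upd\<close>)
  have body: "runs (Cond i {1} (pop i ;; push 1 1) (pop i ;; push 1 2)) S (Suc (Suc (3 + 3))) ?S1"
  proof (cases "s = 1")
    case True
    show ?thesis by (rule runs_CondT) (use True ps Cons.hyps(2)[symmetric] in auto)
  next
    case False
    show ?thesis by (rule runs_CondF) (use False s ps Cons.hyps(2)[symmetric] in auto)
  qed
  have IH: "runs (flush i) ?S1 (20 * length (stack ?S1 i) + 1) (upd i [] (upd 1 (rev (stack ?S1 i) @ stack ?S1 1) ?S1))"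
    by (rule Cons.hyps(1)) (use Cons.prems(2) xs in \<open>auto simp: stack_upd\<close>)
  have "runs (flush i) S (Suc (Suc (Suc (3 + 3)) + (20 * length (stack ?S1 i) + 1))) (upd i [] (upd 1 (rev (stack ?S1 i) @ stack ?S1 1) ?S1))"
    unfolding flush_def
    by (rule runs_LoopT[OF _ body IH[unfolded flush_def]]) (use s Cons.hyps(2)[symmetric] in auto)
  moreover have "upd i [] (upd 1 (rev (stack ?S1 i) @ stack ?S1 1) ?S1) = upd i [] (upd 1 (rev (stack S i) @ stack S 1) S)"
  proof -
    have "upd i [] (upd 1 r (upd i xs S)) = upd i [] (upd 1 r S)" for r
      by (auto simp: upd_def fun_eq_iff)
    then show ?thesis using Cons.prems(2) Cons.hyps(2)[symmetric] by (simp add: stack_upd upd_upd)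
  qed
  moreover have "length (stack S i) = Suc (length (stack ?S1 i))"
    using Cons.prems(2) Cons.hyps(2)[symmetric] by (simp add: stack_upd)
  ultimately show ?case by (auto elim!: runs_mono)
qed

lemma runs_flush2: "set b \<subseteq> {1, 2} \<Longrightarrow> runs (flush 2) (stk \<sigma> a b c d) (20 * length b + 1) (stk \<sigma> (rev b @ a) [] c d)"
  using runs_flush[of "stk \<sigma> a b c d" 2] by simp

lemma runs_flush3: "set c \<subseteq> {1, 2} \<Longrightarrow> runs (flush 3) (stk \<sigma> a b c d) (20 * length c + 1) (stk \<sigma> (rev c @ a) b [] d)"
  using runs_flush[of "stk \<sigma> a b c d" 3] by simp

definition dup :: com where "dup = mvt True True ;; flush 2 ;; flush 3"
definition drp :: com where "drp = mvt False False"
definition swp :: com where "swp = mvt True False ;; mvt False True ;; flush 2 ;; flush 3"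

lemma runs_dup: "runs dup (stk \<sigma> (pre t @ a) [] [] []) (70 * length (pre t)) (stk \<sigma> (pre t @ pre t @ a) [] [] [])"
proof -
  have m: "runs (mvt True True) (stk \<sigma> (pre t @ a) [] [] []) (20 * length (pre t) + 5) (stk \<sigma> a (rev (pre t)) (rev (pre t)) [])"
    using runs_mvt[of True True \<sigma> t a "[]" "[]"] by simp
  have f2: "runs (flush 2) (stk \<sigma> a (rev (pre t)) (rev (pre t)) []) (20 * length (rev (pre t)) + 1) (stk \<sigma> (pre t @ a) [] (rev (pre t)) [])"
    using runs_flush2[of "rev (pre t)"] set_pre[of t] by auto
  have f3: "runs (flush 3) (stk \<sigma> (pre t @ a) [] (rev (pre t)) []) (20 * length (rev (pre t)) + 1) (stk \<sigma> (pre t @ pre t @ a) [] [] [])"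
    using runs_flush3[of "rev (pre t)" \<sigma> "pre t @ a"] set_pre[of t] by auto
  show ?thesis unfolding dup_def
    by (rule runs_mono[OF runs_Seq[OF m runs_Seq[OF f2 f3]]])
      (insert length_pre_pos[of t], unfold length_rev, linarith)
qed

lemma runs_drp: "runs drp (stk \<sigma> (pre t @ a) [] [] []) (25 * length (pre t)) (stk \<sigma> a [] [] [])"
proof -
  have m: "runs (mvt False False) (stk \<sigma> (pre t @ a) [] [] []) (20 * length (pre t) + 5) (stk \<sigma> a [] [] [])"
    using runs_mvt[of False False \<sigma> t a "[]" "[]"] by simp
  show ?thesis unfolding drp_def
    by (rule runs_mono[OF m]) (insert length_pre_pos[of t], linarith)
qed

lemma runs_swp: "runs swp (stk \<sigma> (pre t @ pre u @ a) [] [] []) (50 * (length (pre t) + length (pre u)))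
   (stk \<sigma> (pre u @ pre t @ a) [] [] [])"
proof -
  have f2: "runs (flush 2) (stk \<sigma> a (rev (pre t)) (rev (pre u)) []) (20 * length (rev (pre t)) + 1) (stk \<sigma> (pre t @ a) [] (rev (pre u)) [])"
    using runs_flush2[of "rev (pre t)"] set_pre[of t] by auto
  have f3: "runs (flush 3) (stk \<sigma> (pre t @ a) [] (rev (pre u)) []) (20 * length (rev (pre u)) + 1) (stk \<sigma> (pre u @ pre t @ a) [] [] [])"
    using runs_flush3[of "rev (pre u)" \<sigma> "pre t @ a"] set_pre[of u] by auto
  have m1: "runs (mvt True False) (stk \<sigma> (pre t @ pre u @ a) [] [] []) (20 * length (pre t) + 5) (stk \<sigma> (pre u @ a) (rev (pre t)) [] [])"
    using runs_mvt[of True False \<sigma> t "pre u @ a" "[]" "[]"] by simp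
  have m2: "runs (mvt False True) (stk \<sigma> (pre u @ a) (rev (pre t)) [] []) (20 * length (pre u) + 5) (stk \<sigma> a (rev (pre t)) (rev (pre u)) [])"
    using runs_mvt[of False True \<sigma> u "a" "rev (pre t)" "[]"] by simp
  show ?thesis unfolding swp_def
    by (rule runs_mono[OF runs_Seq[OF m1 runs_Seq[OF m2 runs_Seq[OF f2 f3]]]])
      (insert length_pre_pos[of t] length_pre_pos[of u], unfold length_rev distrib_left, linarith)
qed

section \<open>Typed polynomial-time functions\<close>

class enc = fixes tr :: "'a \<Rightarrow> tree"

instantiation tree :: enc
begin
definition tr_tree :: "tree \<Rightarrow> tree" where "tr_tree t = t"
instance ..
end

instantiation bool :: enc
begin
definition tr_bool :: "bool \<Rightarrow> tree" where "tr_bool b = (if b then Node Leaf Leaf else Leaf)"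
instance ..
end

text \<open>Unary numbers have the shape of lists, so one loop construct serves both. Numbers given
  in binary are capped when they are decoded.\<close>

instantiation nat :: enc
begin
primrec tr_nat :: "nat \<Rightarrow> tree" where
  "tr_nat 0 = Leaf"
| "tr_nat (Suc n) = Node Leaf (tr_nat n)"
instance ..
end

instantiation prod :: (enc, enc) enc
begin
definition tr_prod :: "'a \<times> 'b \<Rightarrow> tree" where "tr_prod p = Node (tr (fst p)) (tr (snd p))"
instance ..
end

instantiation list :: (enc) enc
begin
primrec tr_list :: "'a list \<Rightarrow> tree" where
  "tr_list [] = Leaf"
| "tr_list (x # xs) = Node (tr x) (tr_list xs)"
instance ..
end

instantiation int :: enc
begin
definition tr_int :: "int \<Rightarrow> tree" where "tr_int z = tr (nat z, nat (- z))"
instance ..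
end

section \<open>Sizes of encodings and polynomial bounds\<close>

definition sz :: "'a::enc \<Rightarrow> nat" where "sz x = length (pre (tr x))"

lemma sz_pos: "1 \<le> sz x"
  unfolding sz_def using length_pre_pos[of "tr x"] by linarith

lemma sz_prod [simp]: "sz (a, b) = Suc (sz a + sz b)"
  by (simp add: sz_def tr_prod_def)

lemma sz_Nil [simp]: "sz [] = 1"
  by (simp add: sz_def)

lemma sz_Cons [simp]: "sz (x # xs) = Suc (sz x + sz xs)"
  by (simp add: sz_def)

lemma sz_nat [simp]: "sz (n::nat) = 2 * n + 1"
  by (induction n) (auto simp: sz_def)

lemma sz_bool: "sz (b::bool) \<le> 3"
  by (simp add: sz_def tr_bool_def)

lemma sz_int: "sz (z::int) = 2 * nat \<bar>z\<bar> + 3"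
proof -
  have "sz z = sz (nat z, nat (- z))" by (simp add: sz_def tr_int_def tr_prod_def)
  then show ?thesis by (cases "z \<ge> 0") auto
qed

lemma sz_append: "sz (xs @ ys) + 1 = sz xs + sz ys"
  by (induction xs) auto

lemma sz_mem: "x \<in> set xs \<Longrightarrow> sz x < sz xs"
  by (induction xs) auto

lemma length_sz: "length xs < sz xs"
  by (induction xs) auto

lemma sz_list_le: "(\<And>x. x \<in> set xs \<Longrightarrow> sz x \<le> B) \<Longrightarrow> sz xs \<le> 1 + length xs * (1 + B)"
  by (induction xs) (auto, force)

lemma poly_mono_nat: "a \<le> b \<Longrightarrow> poly p a \<le> poly (p :: nat poly) b"
  by (induction p) (auto intro!: mult_mono add_mono)

definition pb :: "('a::enc \<Rightarrow> nat) \<Rightarrow> bool" where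
  "pb f \<longleftrightarrow> (\<exists>p :: nat poly. \<forall>x. f x \<le> poly p (sz x))"

lemma pbE:
  assumes "pb f" obtains p :: "nat poly" where "\<And>x. f x \<le> poly p (sz x)"
  using assms unfolding pb_def by blast

lemma pb_le: "pb g \<Longrightarrow> (\<And>x. f x \<le> g x) \<Longrightarrow> pb f"
  unfolding pb_def by (meson le_trans)

lemma pb_const: "pb (\<lambda>x. c)"
  unfolding pb_def by (rule exI[of _ "[:c:]"]) simp

lemma pb_sz: "pb sz"
  unfolding pb_def by (rule exI[of _ "[:0, 1:]"]) simp

lemma pb_add: "pb f \<Longrightarrow> pb g \<Longrightarrow> pb (\<lambda>x. f x + g x)"
  unfolding pb_def by (metis poly_add add_mono)

lemma pb_mult: "pb f \<Longrightarrow> pb g \<Longrightarrow> pb (\<lambda>x. f x * g x)"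
  unfolding pb_def by (metis poly_mult mult_le_mono)

lemma pb_Suc: "pb f \<Longrightarrow> pb (\<lambda>x. Suc (f x))"
  using pb_add[OF pb_const[of 1], of f] by simp

lemma pb_poly:
  assumes "pb f" shows "pb (\<lambda>x. poly p (f x))"
proof -
  from assms obtain q :: "nat poly" where "\<And>x. f x \<le> poly q (sz x)" by (rule pbE) blast
  then have "poly p (f x) \<le> poly (pcompose p q) (sz x)" for x
    by (simp add: poly_pcompose poly_mono_nat)
  then show ?thesis unfolding pb_def by blast
qed

lemma pb_comp: "pb f \<Longrightarrow> pb (\<lambda>x. sz (h x)) \<Longrightarrow> pb (\<lambda>x. f (h x))"
  by (erule pbE) (rule pb_le[OF pb_poly])

lemmas pb_intros = pb_const pb_sz pb_add pb_mult pb_Suc pb_poly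

section \<open>Programs computing functions on trees, and their combinators\<close>

definition wf_com :: "com \<Rightarrow> bool" where
  "wf_com c \<longleftrightarrow> tapes_of c \<subseteq> {1, 2, 3, 4} \<and> symbols_ok c"

text \<open>The rest \<open>r\<close> of tape 1 is arbitrary, so a program may run above data that
  another one has saved there.\<close>

definition computes :: "com \<Rightarrow> ('a::enc \<Rightarrow> 'b::enc) \<Rightarrow> ('a \<Rightarrow> nat) \<Rightarrow> bool" where
  "computes c f \<tau> \<longleftrightarrow> (\<forall>x r \<sigma>. runs c (stk \<sigma> (pre (tr x) @ r) [] [] []) (\<tau> x) (stk \<sigma> (pre (tr (f x)) @ r) [] [] []))"

text \<open>Carrying a bound on the size of the result allows time bounds to be composed without
  inspecting programs.\<close>

definition pt :: "('a::enc \<Rightarrow> 'b::enc) \<Rightarrow> bool" where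
  "pt f \<longleftrightarrow> pb (\<lambda>x. sz (f x)) \<and> (\<exists>c \<tau>. wf_com c \<and> pb \<tau> \<and> computes c f \<tau>)"

lemma pt_sz: "pt f \<Longrightarrow> pb (\<lambda>x. sz (f x))"
  by (simp add: pt_def)

lemma ptE:
  assumes "pt f"
  obtains c \<tau> where "wf_com c" "pb \<tau>"
    "\<And>x r \<sigma>. runs c (stk \<sigma> (pre (tr x) @ r) [] [] []) (\<tau> x) (stk \<sigma> (pre (tr (f x)) @ r) [] [] [])"
  using assms unfolding pt_def computes_def by blast

lemma ptI:
  assumes "wf_com c" "pb \<tau>" "pb (\<lambda>x. sz (f x))"
    "\<And>x r \<sigma>. runs c (stk \<sigma> (pre (tr x) @ r) [] [] []) (\<tau> x) (stk \<sigma> (pre (tr (f x)) @ r) [] [] [])"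
  shows "pt f"
  using assms unfolding pt_def computes_def by blast

lemma wf_com_simps [simp]:
  "wf_com (a ;; b) \<longleftrightarrow> wf_com a \<and> wf_com b"
  "wf_com (Cond 1 A a b) \<longleftrightarrow> wf_com a \<and> wf_com b"
  "wf_com (Cond (Suc 0) A a b) \<longleftrightarrow> wf_com a \<and> wf_com b"
  "wf_com (Loop 1 A a) \<longleftrightarrow> wf_com a"
  "wf_com (Loop (Suc 0) A a) \<longleftrightarrow> wf_com a"
  "wf_com dup" "wf_com drp" "wf_com swp" "wf_com skip" "wf_com (pop 1)" "wf_com (pop (Suc 0))"
  by (auto simp: wf_com_def dup_def drp_def swp_def mvt_def put_def flush_def push_def pop_def skip_def)

lemma wf_push [simp]: "s < 3 \<Longrightarrow> wf_com (push 1 s)" "s < 3 \<Longrightarrow> wf_com (push (Suc 0) s)"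
  by (auto simp: wf_com_def push_def)

lemma runs_dup': "runs dup (stk \<sigma> (pre (tr x) @ a) [] [] []) (70 * sz x) (stk \<sigma> (pre (tr x) @ pre (tr x) @ a) [] [] [])"
  unfolding sz_def by (rule runs_dup)

lemma runs_drp': "runs drp (stk \<sigma> (pre (tr x) @ a) [] [] []) (25 * sz x) (stk \<sigma> a [] [] [])"
  unfolding sz_def by (rule runs_drp)

lemma runs_swp': "runs swp (stk \<sigma> (pre (tr x) @ pre (tr y) @ a) [] [] []) (50 * (sz x + sz y))
   (stk \<sigma> (pre (tr y) @ pre (tr x) @ a) [] [] [])"
  unfolding sz_def by (rule runs_swp)

lemma runs_push1: "runs (push 1 s) (stk \<sigma> a [] [] []) 3 (stk \<sigma> (s # a) [] [] [])"
  by (rule runs_push) simp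

lemma runs_pop1: "runs (pop 1) (stk \<sigma> (s # a) [] [] []) 3 (stk \<sigma> a [] [] [])"
  by (rule runs_pop) simp_all

lemma pt_id: "pt (\<lambda>x. x)"
  by (rule ptI[of skip "\<lambda>_. 3"]) (auto intro: pb_intros runs_skip)

text \<open>The class depends on codes only. Thus \<open>Cons\<close> and \<open>Suc\<close> are
  pairing in disguise, and an integer is a pair of numbers.\<close>

lemma pt_retype: "pt f \<Longrightarrow> (\<And>x. tr (g x) = tr (f x)) \<Longrightarrow> pt g"
  by (simp add: pt_def computes_def sz_def)

lemma pt_comp:
  assumes "pt f" "pt g" shows "pt (\<lambda>x. f (g x))"
proof -
  from assms(1) obtain cf \<tau>f where f: "wf_com cf" "pb \<tau>f"
    "\<And>x r \<sigma>. runs cf (stk \<sigma> (pre (tr x) @ r) [] [] []) (\<tau>f x) (stk \<sigma> (pre (tr (f x)) @ r) [] [] [])"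
    by (rule ptE) blast
  from assms(2) obtain cg \<tau>g where g: "wf_com cg" "pb \<tau>g"
    "\<And>x r \<sigma>. runs cg (stk \<sigma> (pre (tr x) @ r) [] [] []) (\<tau>g x) (stk \<sigma> (pre (tr (g x)) @ r) [] [] [])"
    by (rule ptE) blast
  show ?thesis
  proof (rule ptI[of "cg ;; cf"])
    show "pb (\<lambda>x. Suc (\<tau>g x + \<tau>f (g x)))"
      using f g assms by (intro pb_intros pb_comp[of \<tau>f g] pt_sz)
    show "pb (\<lambda>x. sz (f (g x)))" using pb_comp[OF pt_sz[OF assms(1)] pt_sz[OF assms(2)]] .
    show "runs (cg ;; cf) (stk \<sigma> (pre (tr x) @ r) [] [] []) (Suc (\<tau>g x + \<tau>f (g x)))
      (stk \<sigma> (pre (tr (f (g x))) @ r) [] [] [])" for x r \<sigma>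
      by (rule runs_Seq[OF g(3) f(3)])
  qed (use f g in simp)
qed

lemma pt_pair:
  assumes "pt f" "pt g" shows "pt (\<lambda>x. (f x, g x))"
proof -
  from assms(1) obtain cf \<tau>f where f: "wf_com cf" "pb \<tau>f"
    "\<And>x r \<sigma>. runs cf (stk \<sigma> (pre (tr x) @ r) [] [] []) (\<tau>f x) (stk \<sigma> (pre (tr (f x)) @ r) [] [] [])"
    by (rule ptE) blast
  from assms(2) obtain cg \<tau>g where g: "wf_com cg" "pb \<tau>g"
    "\<And>x r \<sigma>. runs cg (stk \<sigma> (pre (tr x) @ r) [] [] []) (\<tau>g x) (stk \<sigma> (pre (tr (g x)) @ r) [] [] [])"
    by (rule ptE) blast
  let ?\<tau> = "\<lambda>x. Suc (70 * sz x + Suc (\<tau>g x + Suc (50 * (sz (g x) + sz x) + Suc (\<tau>f x + 3))))"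
  show ?thesis
  proof (rule ptI[of "dup ;; cg ;; swp ;; cf ;; push 1 2"])
    show "pb ?\<tau>" using f g assms by (intro pb_intros pt_sz)
    show "pb (\<lambda>x. sz (f x, g x))" unfolding sz_prod using assms by (intro pb_intros pt_sz)
    fix x r \<sigma>
    show "runs (dup ;; cg ;; swp ;; cf ;; push 1 2) (stk \<sigma> (pre (tr x) @ r) [] [] []) (?\<tau> x)
      (stk \<sigma> (pre (tr (f x, g x)) @ r) [] [] [])"
      using runs_Seq[OF runs_dup' runs_Seq[OF g(3) runs_Seq[OF runs_swp' runs_Seq[OF f(3) runs_push1[of 2]]]]]
      by (simp add: tr_prod_def)
  qed (use f g in simp)
qed

lemma tr_prod_pre: "pre (tr p) = 2 # pre (tr (fst p)) @ pre (tr (snd p))"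
  by (simp add: tr_prod_def)

lemma pt_fst: "pt f \<Longrightarrow> pt (\<lambda>x. fst (f x))"
proof (rule pt_comp[of fst f])
  show "pt (fst :: 'b \<times> 'c \<Rightarrow> 'b)"
  proof (rule ptI[of "pop 1 ;; swp ;; drp"])
    show "pb (\<lambda>x::'b \<times> 'c. 100 * sz x + 5)" by (intro pb_intros)
    show "pb (\<lambda>x::'b \<times> 'c. sz (fst x))" by (rule pb_le[OF pb_sz]) (auto simp: sz_def tr_prod_def)
    fix x :: "'b \<times> 'c" and r \<sigma>
    have "runs (pop 1 ;; swp ;; drp) (stk \<sigma> (2 # pre (tr (fst x)) @ pre (tr (snd x)) @ r) [] [] [])
      (Suc (3 + Suc (50 * (sz (fst x) + sz (snd x)) + 25 * sz (snd x)))) (stk \<sigma> (pre (tr (fst x)) @ r) [] [] [])"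
      by (rule runs_Seq[OF runs_pop1 runs_Seq[OF runs_swp' runs_drp']])
    then show "runs (pop 1 ;; swp ;; drp) (stk \<sigma> (pre (tr x) @ r) [] [] []) (100 * sz x + 5)
      (stk \<sigma> (pre (tr (fst x)) @ r) [] [] [])"
      by (simp add: tr_prod_pre) (erule runs_mono, simp add: sz_def tr_prod_pre)
  qed simp
qed

lemma pt_snd: "pt f \<Longrightarrow> pt (\<lambda>x. snd (f x))"
proof (rule pt_comp[of snd f])
  show "pt (snd :: 'b \<times> 'c \<Rightarrow> 'c)"
  proof (rule ptI[of "pop 1 ;; drp"])
    show "pb (\<lambda>x::'b \<times> 'c. 100 * sz x + 5)" by (intro pb_intros)
    show "pb (\<lambda>x::'b \<times> 'c. sz (snd x))" by (rule pb_le[OF pb_sz]) (auto simp: sz_def tr_prod_def)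
    fix x :: "'b \<times> 'c" and r \<sigma>
    have "runs (pop 1 ;; drp) (stk \<sigma> (2 # pre (tr (fst x)) @ pre (tr (snd x)) @ r) [] [] [])
      (Suc (3 + 25 * sz (fst x))) (stk \<sigma> (pre (tr (snd x)) @ r) [] [] [])"
      by (rule runs_Seq[OF runs_pop1 runs_drp'])
    then show "runs (pop 1 ;; drp) (stk \<sigma> (pre (tr x) @ r) [] [] []) (100 * sz x + 5)
      (stk \<sigma> (pre (tr (snd x)) @ r) [] [] [])"
      by (simp add: tr_prod_pre) (erule runs_mono, simp add: sz_def tr_prod_pre)
  qed simp
qed

fun push_list :: "nat list \<Rightarrow> com" where
  "push_list [] = skip"
| "push_list (s # xs) = push_list xs ;; push 1 s"

lemma runs_push_list: "runs (push_list xs) (stk \<sigma> a [] [] []) (4 * length xs + 3) (stk \<sigma> (xs @ a) [] [] [])"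
proof (induction xs)
  case (Cons s xs)
  show ?case using runs_Seq[OF Cons.IH runs_push1[of s]] by (auto elim!: runs_mono)
qed (simp add: runs_skip)

lemma wf_push_list: "set xs \<subseteq> {1, 2} \<Longrightarrow> wf_com (push_list xs)"
  by (induction xs) auto

lemma pt_const: "pt (\<lambda>x. c)"
proof (rule ptI[of "drp ;; push_list (pre (tr c))" "\<lambda>x. Suc (25 * sz x + (4 * length (pre (tr c)) + 3))"])
  show "wf_com (drp ;; push_list (pre (tr c)))" using wf_push_list[OF set_pre] by simp
  show "runs (drp ;; push_list (pre (tr c))) (stk \<sigma> (pre (tr x) @ r) [] [] []) (Suc (25 * sz x + (4 * length (pre (tr c)) + 3)))
    (stk \<sigma> (pre (tr c) @ r) [] [] [])" for x r \<sigma>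
    by (rule runs_Seq[OF runs_drp' runs_push_list])
qed (intro pb_intros)+

lemma pt_if:
  assumes "pt b" "pt f" "pt g" shows "pt (\<lambda>x. if b x then f x else g x)"
proof -
  from assms(1) obtain cb \<tau>b where b: "wf_com cb" "pb \<tau>b"
    "\<And>x r \<sigma>. runs cb (stk \<sigma> (pre (tr x) @ r) [] [] []) (\<tau>b x) (stk \<sigma> (pre (tr (b x)) @ r) [] [] [])"
    by (rule ptE) blast
  from assms(2) obtain cf \<tau>f where f: "wf_com cf" "pb \<tau>f"
    "\<And>x r \<sigma>. runs cf (stk \<sigma> (pre (tr x) @ r) [] [] []) (\<tau>f x) (stk \<sigma> (pre (tr (f x)) @ r) [] [] [])"
    by (rule ptE) blast
  from assms(3) obtain cg \<tau>g where g: "wf_com cg" "pb \<tau>g"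
    "\<And>x r \<sigma>. runs cg (stk \<sigma> (pre (tr x) @ r) [] [] []) (\<tau>g x) (stk \<sigma> (pre (tr (g x)) @ r) [] [] [])"
    by (rule ptE) blast
  let ?c = "dup ;; cb ;; Cond 1 {1} (drp ;; drp ;; push_list [] ;; cg) (drp ;; cf)"
  let ?c = "dup ;; cb ;; Cond 1 {1} (drp ;; cg) (drp ;; cf)"
  let ?\<tau> = "\<lambda>x. Suc (70 * sz x + Suc (\<tau>b x + Suc (Suc (75 + (\<tau>f x + \<tau>g x)))))"
  show ?thesis
  proof (rule ptI[of ?c])
    show "pb ?\<tau>" using b f g assms by (intro pb_intros pt_sz)
    show "pb (\<lambda>x. sz (if b x then f x else g x))"
      by (rule pb_le[OF pb_add[OF pt_sz[OF assms(2)] pt_sz[OF assms(3)]]]) auto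
    fix x r \<sigma>
    have "runs (Cond 1 {1} (drp ;; cg) (drp ;; cf)) (stk \<sigma> (pre (tr (b x)) @ pre (tr x) @ r) [] [] [])
      (Suc (Suc (75 + (\<tau>f x + \<tau>g x)))) (stk \<sigma> (pre (tr (if b x then f x else g x)) @ r) [] [] [])"
    proof (cases "b x")
      case True
      have "runs (drp ;; cf) (stk \<sigma> (pre (tr (b x)) @ pre (tr x) @ r) [] [] []) (Suc (25 * sz (b x) + \<tau>f x))
        (stk \<sigma> (pre (tr (f x)) @ r) [] [] [])"
        by (rule runs_Seq[OF runs_drp' f(3)])
      then have "runs (drp ;; cf) (stk \<sigma> (pre (tr (b x)) @ pre (tr x) @ r) [] [] []) (Suc (75 + (\<tau>f x + \<tau>g x)))
        (stk \<sigma> (pre (tr (f x)) @ r) [] [] [])"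
        by (rule runs_mono) (use sz_bool[of "b x"] in simp)
      then show ?thesis using True by (intro runs_CondF) (simp_all add: tr_bool_def)
    next
      case False
      have "runs (drp ;; cg) (stk \<sigma> (pre (tr (b x)) @ pre (tr x) @ r) [] [] []) (Suc (25 * sz (b x) + \<tau>g x))
        (stk \<sigma> (pre (tr (g x)) @ r) [] [] [])"
        by (rule runs_Seq[OF runs_drp' g(3)])
      then have "runs (drp ;; cg) (stk \<sigma> (pre (tr (b x)) @ pre (tr x) @ r) [] [] []) (Suc (75 + (\<tau>f x + \<tau>g x)))
        (stk \<sigma> (pre (tr (g x)) @ r) [] [] [])"
        by (rule runs_mono) (use sz_bool[of "b x"] in simp)
      then show ?thesis using False by (intro runs_CondT) (simp_all add: tr_bool_def)
    qed
    then show "runs ?c (stk \<sigma> (pre (tr x) @ r) [] [] []) (?\<tau> x)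
      (stk \<sigma> (pre (tr (if b x then f x else g x)) @ r) [] [] [])"
      by (rule runs_Seq[OF runs_dup' runs_Seq[OF b(3)]])
  qed (use b f g in simp)
qed

text \<open>Case distinctions on lists and on numbers both inspect the root of a tree;
  \<open>R\<close> is described by the code of \<open>g x\<close> so that one proof covers all such
  types.\<close>

lemma pt_case_gen:
  fixes g :: "'x::enc \<Rightarrow> 'g::enc" and h :: "'x \<Rightarrow> 'b::enc \<Rightarrow> 'c::enc \<Rightarrow> 'r::enc"
  assumes "pt g" "pt f" "pt (\<lambda>p. h (fst p) (fst (snd p)) (snd (snd p)))"
    and cases: "\<And>x. tr (g x) = Leaf \<and> R x = f x \<or> (\<exists>a as. tr (g x) = Node (tr a) (tr as) \<and> R x = h x a as)"
  shows "pt R"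
proof -
  from assms(1) obtain cg \<tau>g where g: "wf_com cg" "pb \<tau>g"
    "\<And>x r \<sigma>. runs cg (stk \<sigma> (pre (tr x) @ r) [] [] []) (\<tau>g x) (stk \<sigma> (pre (tr (g x)) @ r) [] [] [])"
    by (rule ptE) blast
  from assms(2) obtain cf \<tau>f where f: "wf_com cf" "pb \<tau>f"
    "\<And>x r \<sigma>. runs cf (stk \<sigma> (pre (tr x) @ r) [] [] []) (\<tau>f x) (stk \<sigma> (pre (tr (f x)) @ r) [] [] [])"
    by (rule ptE) blast
  from assms(3) obtain ch \<tau>h where h: "wf_com ch" "pb \<tau>h"
    "\<And>p r \<sigma>. runs ch (stk \<sigma> (pre (tr p) @ r) [] [] []) (\<tau>h p)
      (stk \<sigma> (pre (tr (h (fst p) (fst (snd p)) (snd (snd p)))) @ r) [] [] [])"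
    by (rule ptE) blast
  from h(2) obtain ph :: "nat poly" where ph: "\<And>p. \<tau>h p \<le> poly ph (sz p)" by (rule pbE) blast
  from pt_sz[OF assms(3)] obtain qh :: "nat poly"
    where qh: "\<And>p. sz (h (fst p) (fst (snd p)) (snd (snd p))) \<le> poly qh (sz p)" by (rule pbE) blast
  let ?s = "\<lambda>x. Suc (sz x + sz (g x))"
  let ?c = "dup ;; cg ;; Cond 1 {1} (pop 1 ;; cf) (swp ;; push 1 2 ;; ch)"
  let ?\<tau> = "\<lambda>x. Suc (70 * sz x + Suc (\<tau>g x + Suc (Suc (100 * ?s x + (\<tau>f x + poly ph (?s x))))))"
  have szh: "sz (x, a, as) = ?s x" if "tr (g x) = Node (tr a) (tr as)" for x a as
    using that by (simp add: sz_def tr_prod_def)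
  show ?thesis
  proof (rule ptI[of ?c])
    show "pb ?\<tau>" using f g h assms by (intro pb_intros pt_sz)
    have "pb (\<lambda>x. sz (f x) + poly qh (?s x))" using assms by (intro pb_intros pt_sz)
    then show "pb (\<lambda>x. sz (R x))"
    proof (rule pb_le)
      fix x
      from cases[of x] show "sz (R x) \<le> sz (f x) + poly qh (?s x)"
      proof (elim disjE exE conjE)
        fix a as assume *: "tr (g x) = Node (tr a) (tr as)" "R x = h x a as"
        show ?thesis using qh[of "(x, a, as)"] unfolding szh[OF *(1)] by (simp add: *)
      qed simp
    qed
    fix x r \<sigma>
    have "runs (Cond 1 {1} (pop 1 ;; cf) (swp ;; push 1 2 ;; ch)) (stk \<sigma> (pre (tr (g x)) @ pre (tr x) @ r) [] [] [])
      (Suc (Suc (100 * ?s x + (\<tau>f x + poly ph (?s x))))) (stk \<sigma> (pre (tr (R x)) @ r) [] [] [])"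
      using cases[of x]
    proof (elim disjE exE conjE)
      assume *: "tr (g x) = Leaf" "R x = f x"
      have "runs (pop 1 ;; cf) (stk \<sigma> (pre (tr (g x)) @ pre (tr x) @ r) [] [] []) (Suc (3 + \<tau>f x))
        (stk \<sigma> (pre (tr (f x)) @ r) [] [] [])"
        using runs_Seq[OF runs_pop1[of \<sigma> 1] f(3)] * by simp
      then have "runs (pop 1 ;; cf) (stk \<sigma> (pre (tr (g x)) @ pre (tr x) @ r) [] [] []) (Suc (100 * ?s x + (\<tau>f x + poly ph (?s x))))
        (stk \<sigma> (pre (tr (f x)) @ r) [] [] [])"
        by (rule runs_mono) simp
      then show ?thesis using * by (intro runs_CondT) simp_all
    next
      fix a as assume *: "tr (g x) = Node (tr a) (tr as)" "R x = h x a as"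
      have eq: "2 # pre (tr x) @ pre (tr (g x)) @ r = pre (tr (x, a, as)) @ r"
        by (simp add: * tr_prod_def)
      have "runs (swp ;; push 1 2 ;; ch) (stk \<sigma> (pre (tr (g x)) @ pre (tr x) @ r) [] [] [])
        (Suc (50 * (sz (g x) + sz x) + Suc (3 + \<tau>h (x, a, as))))
        (stk \<sigma> (pre (tr (h (fst (x, a, as)) (fst (snd (x, a, as))) (snd (snd (x, a, as))))) @ r) [] [] [])"
        using h(3)[of \<sigma> "(x, a, as)" r] unfolding eq[symmetric]
        by (intro runs_Seq[OF runs_swp' runs_Seq[OF runs_push1]])
      moreover have "\<tau>h (x, a, as) \<le> poly ph (?s x)"
        using ph[of "(x, a, as)"] unfolding szh[OF *(1)] .
      ultimately have "runs (swp ;; push 1 2 ;; ch) (stk \<sigma> (pre (tr (g x)) @ pre (tr x) @ r) [] [] [])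
        (Suc (100 * ?s x + (\<tau>f x + poly ph (?s x))))
        (stk \<sigma> (pre (tr (h x a as)) @ r) [] [] [])"
        by (auto elim!: runs_mono)
      then show ?thesis using * by (intro runs_CondF) simp_all
    qed
    then show "runs ?c (stk \<sigma> (pre (tr x) @ r) [] [] []) (?\<tau> x) (stk \<sigma> (pre (tr (R x)) @ r) [] [] [])"
      by (rule runs_Seq[OF runs_dup' runs_Seq[OF g(3)]])
  qed (use f g h in simp)
qed

fun spine :: "tree \<Rightarrow> nat" where
  "spine Leaf = 0"
| "spine (Node a b) = Suc (spine b)"

text \<open>The only source of iteration. The counter is the right spine of a tree, which is the
  value of a number or the length of a list. The bound on all intermediate states is essential:
  repeated doubling would satisfy the other hypotheses.\<close>

lemma pt_funpow:
  fixes n :: "'a::enc \<Rightarrow> 'n::enc" and f :: "'s::enc \<Rightarrow> 's"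
  assumes "pt n" "pt s" "pt f" "pb b"
    and bound: "\<And>x i. i \<le> spine (tr (n x)) \<Longrightarrow> sz ((f ^^ i) (s x)) \<le> b x"
  shows "pt (\<lambda>x. (f ^^ spine (tr (n x))) (s x))"
proof -
  from assms(1) obtain cn \<tau>n where n: "wf_com cn" "pb \<tau>n"
    "\<And>x r \<sigma>. runs cn (stk \<sigma> (pre (tr x) @ r) [] [] []) (\<tau>n x) (stk \<sigma> (pre (tr (n x)) @ r) [] [] [])"
    by (rule ptE) blast
  from assms(2) obtain cs \<tau>s where s: "wf_com cs" "pb \<tau>s"
    "\<And>x r \<sigma>. runs cs (stk \<sigma> (pre (tr x) @ r) [] [] []) (\<tau>s x) (stk \<sigma> (pre (tr (s x)) @ r) [] [] [])"
    by (rule ptE) blast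
  from assms(3) obtain cf \<tau>f where f: "wf_com cf" "pb \<tau>f"
    "\<And>x r \<sigma>. runs cf (stk \<sigma> (pre (tr x) @ r) [] [] []) (\<tau>f x) (stk \<sigma> (pre (tr (f x)) @ r) [] [] [])"
    by (rule ptE) blast
  from f(2) obtain p :: "nat poly" where p: "\<And>y. \<tau>f y \<le> poly p (sz y)" by (rule pbE) blast
  define body where "body = pop 1 ;; drp ;; swp ;; cf ;; swp"
  let ?c = "dup ;; cs ;; swp ;; cn ;; Loop 1 {2} body ;; pop 1"
  \<comment> \<open>The cost of one round for a counter of size at most \<open>m\<close> and states
    of size at most \<open>k\<close>.\<close>
  let ?B = "\<lambda>m k. 50 + 200 * (m + k) + poly p k"
  let ?\<tau> = "\<lambda>x. Suc (70 * sz x + Suc (\<tau>s x + Suc (50 * (sz (s x) + sz x) + Suc (\<tau>n x + Suc ((sz (n x) * ?B (sz (n x)) (b x) + 1) + 3)))))"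
  have loop: "runs (Loop 1 {2} body) (stk \<sigma> (pre m @ pre (tr y) @ r) [] [] []) (length (pre m) * ?B M K + 1)
      (stk \<sigma> (1 # pre (tr ((f ^^ spine m) y)) @ r) [] [] [])"
    if "\<And>i. i \<le> spine m \<Longrightarrow> sz ((f ^^ i) y) \<le> K" "length (pre m) \<le> M" for m y M K r \<sigma>
    using that
  proof (induction m arbitrary: y)
    case Leaf
    have "runs (Loop 1 {2} body) (stk \<sigma> (1 # pre (tr y) @ r) [] [] []) 1 (stk \<sigma> (1 # pre (tr y) @ r) [] [] [])"
      by (rule runs_LoopF) simp
    then show ?case by (auto elim!: runs_mono)
  next
    case (Node a m)
    have y: "sz y \<le> K" "sz (f y) \<le> K" using Node.prems(1)[of 0] Node.prems(1)[of 1] by auto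
    have "runs body (stk \<sigma> (2 # pre (tr a) @ pre (tr m) @ pre (tr y) @ r) [] [] [])
      (Suc (3 + Suc (25 * sz a + Suc (50 * (sz m + sz y) + Suc (\<tau>f y + 50 * (sz (f y) + sz m))))))
      (stk \<sigma> (pre (tr m) @ pre (tr (f y)) @ r) [] [] [])"
      unfolding body_def
      by (rule runs_Seq[OF runs_pop1 runs_Seq[OF runs_drp' runs_Seq[OF runs_swp' runs_Seq[OF f(3) runs_swp']]]])
    moreover have "poly p (sz y) \<le> poly p K" using y by (intro poly_mono_nat)
    moreover have "sz a + sz m < M" using Node.prems(2) by (simp add: sz_def tr_tree_def)
    ultimately have body: "runs body (stk \<sigma> (pre (Node a m) @ pre (tr y) @ r) [] [] [])
      (40 + 200 * (M + K) + poly p K) (stk \<sigma> (pre m @ pre (tr (f y)) @ r) [] [] [])"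
      using y p[of y] by (auto simp: tr_tree_def elim!: runs_mono)
    have IH: "runs (Loop 1 {2} body) (stk \<sigma> (pre m @ pre (tr (f y)) @ r) [] [] []) (length (pre m) * ?B M K + 1)
      (stk \<sigma> (1 # pre (tr ((f ^^ spine m) (f y))) @ r) [] [] [])"
    proof (rule Node.IH(2))
      show "sz ((f ^^ i) (f y)) \<le> K" if "i \<le> spine m" for i
        using Node.prems(1)[of "Suc i"] that by (simp add: funpow_swap1)
    qed (use Node.prems(2) in simp)
    have "runs (Loop 1 {2} body) (stk \<sigma> (pre (Node a m) @ pre (tr y) @ r) [] [] [])
      (Suc ((40 + 200 * (M + K) + poly p K) + (length (pre m) * ?B M K + 1))) (stk \<sigma> (1 # pre (tr ((f ^^ spine m) (f y))) @ r) [] [] [])"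
      by (rule runs_LoopT[OF _ body IH]) simp
    then show ?case
      unfolding spine.simps funpow.simps(2) funpow_swap1 o_apply
      by (rule runs_mono) (simp add: add_mult_distrib)
  qed
  have "sz (s x) \<le> b x" for x using bound[of 0 x] by simp
  show ?thesis
  proof (rule ptI[of ?c])
    show "pb ?\<tau>" using n s f assms by (intro pb_intros pt_sz)
    show "pb (\<lambda>x. sz ((f ^^ spine (tr (n x))) (s x)))" using bound by (intro pb_le[OF assms(4)]) simp
    fix x r \<sigma>
    have L: "runs (Loop 1 {2} body) (stk \<sigma> (pre (tr (n x)) @ pre (tr (s x)) @ r) [] [] []) (sz (n x) * ?B (sz (n x)) (b x) + 1)
      (stk \<sigma> (1 # pre (tr ((f ^^ spine (tr (n x))) (s x))) @ r) [] [] [])"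
      using bound unfolding sz_def by (intro loop) (auto simp: sz_def)
    show "runs ?c (stk \<sigma> (pre (tr x) @ r) [] [] []) (?\<tau> x) (stk \<sigma> (pre (tr ((f ^^ spine (tr (n x))) (s x))) @ r) [] [] [])"
      by (rule runs_Seq[OF runs_dup' runs_Seq[OF s(3) runs_Seq[OF runs_swp' runs_Seq[OF n(3) runs_Seq[OF L runs_pop1]]]]])
  qed (use n s f in \<open>simp add: body_def\<close>)
qed

section \<open>A library of polynomial-time functions\<close>

named_theorems pt_intro

lemmas [pt_intro] = pt_id pt_const pt_pair pt_fst pt_snd pt_if

lemma spine_nat [simp]: "spine (tr (n::nat)) = n"
  by (induction n) auto

lemma spine_list [simp]: "spine (tr xs) = length (xs::'a::enc list)"
  by (induction xs) auto

lemma pt_Cons [pt_intro]: "pt f \<Longrightarrow> pt g \<Longrightarrow> pt (\<lambda>x. f x # g x)"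
  by (rule pt_retype[OF pt_pair]) (auto simp: tr_prod_def)

lemma pt_Suc [pt_intro]: "pt f \<Longrightarrow> pt (\<lambda>x. Suc (f x))"
  by (rule pt_retype[OF pt_pair[OF pt_const[of False]]]) (auto simp: tr_prod_def tr_bool_def)

lemma pt_case_list [pt_intro]:
  assumes "pt g" "pt f" "pt (\<lambda>p. h (fst p) (fst (snd p)) (snd (snd p)))"
  shows "pt (\<lambda>x. case g x of [] \<Rightarrow> f x | a # as \<Rightarrow> h x a as)"
  by (rule pt_case_gen[OF assms]) (auto split: list.split)

lemma pt_case_nat [pt_intro]:
  assumes "pt g" "pt f" "pt (\<lambda>p. h (fst p) (snd p))"
  shows "pt (\<lambda>x. case g x of 0 \<Rightarrow> f x | Suc m \<Rightarrow> h x m)"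
proof (rule pt_case_gen[where h = "\<lambda>x (a::bool) m. h x m", OF assms(1,2)])
  show "pt (\<lambda>p::'a \<times> bool \<times> nat. h (fst p) (snd (snd p)))"
    using pt_comp[OF assms(3) pt_pair[OF pt_fst[OF pt_id] pt_snd[OF pt_snd[OF pt_id]]]] by simp
  show "tr (g x) = Leaf \<and> (case g x of 0 \<Rightarrow> f x | Suc m \<Rightarrow> h x m) = f x \<or>
    (\<exists>(a::bool) as. tr (g x) = Node (tr a) (tr as) \<and> (case g x of 0 \<Rightarrow> f x | Suc m \<Rightarrow> h x m) = h x as)" for x
    by (cases "g x") (auto simp: tr_bool_def intro!: exI[of _ False])
qed

lemma pt_tl [pt_intro]: "pt f \<Longrightarrow> pt (\<lambda>x. tl (f x))"
  unfolding tl_def by (intro pt_intro)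

lemma pt_pred: "pt f \<Longrightarrow> pt (\<lambda>x. f x - Suc 0)"
proof -
  assume "pt f"
  then have "pt (\<lambda>x. case f x of 0 \<Rightarrow> 0 | Suc m \<Rightarrow> m)" by (intro pt_intro)
  moreover have "(\<lambda>x. case f x of 0 \<Rightarrow> 0 | Suc m \<Rightarrow> m) = (\<lambda>x. f x - Suc 0)"
    by (auto simp: fun_eq_iff split: nat.split)
  ultimately show ?thesis by simp
qed

lemma pt_not [pt_intro]: assumes "pt f" shows "pt (\<lambda>x. \<not> f x)"
proof -
  have "pt (\<lambda>x. if f x then False else True)" using assms by (intro pt_intro)
  moreover have "(\<lambda>x. if f x then False else True) = (\<lambda>x. \<not> f x)" by auto
  ultimately show ?thesis by (simp only:)
qed

lemma pt_conj [pt_intro]: assumes "pt f" "pt g" shows "pt (\<lambda>x. f x \<and> g x)"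
proof -
  have "pt (\<lambda>x. if f x then g x else False)" using assms by (intro pt_intro)
  moreover have "(\<lambda>x. if f x then g x else False) = (\<lambda>x. f x \<and> g x)" by auto
  ultimately show ?thesis by (simp only:)
qed

lemma pt_disj [pt_intro]: assumes "pt f" "pt g" shows "pt (\<lambda>x. f x \<or> g x)"
proof -
  have "pt (\<lambda>x. if f x then True else g x)" using assms by (intro pt_intro)
  moreover have "(\<lambda>x. if f x then True else g x) = (\<lambda>x. f x \<or> g x)" by auto
  ultimately show ?thesis by (simp only:)
qed

lemma pt_iterate:
  fixes n :: "'x::enc \<Rightarrow> nat" and f :: "'x \<Rightarrow> 's::enc \<Rightarrow> 's"
  assumes "pt n" "pt s" "pt (\<lambda>p. f (fst p) (snd p))" "pb b"
    and bound: "\<And>x i. i \<le> n x \<Longrightarrow> sz ((f x ^^ i) (s x)) \<le> b x"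
  shows "pt (\<lambda>x. (f x ^^ n x) (s x))"
proof -
  let ?f = "\<lambda>p. (fst p, f (fst p) (snd p))"
  have eq: "(?f ^^ i) (x, y) = (x, (f x ^^ i) y)" for i x y
    by (induction i) auto
  have "pt (\<lambda>x. (?f ^^ spine (tr (n x))) (x, s x))"
  proof (rule pt_funpow)
    show "pb (\<lambda>x. sz x + b x + 1)" using assms by (intro pb_intros)
    show "sz ((?f ^^ i) (x, s x)) \<le> sz x + b x + 1" if "i \<le> spine (tr (n x))" for x i
      using bound[of i x] that by (simp add: eq)
  qed (use assms in \<open>auto intro!: pt_intro\<close>)
  then have "pt (\<lambda>x. snd ((?f ^^ n x) (x, s x)))" by (intro pt_intro) simp
  then show ?thesis by (simp add: eq)
qed

lemma pt_fold:
  fixes g :: "'x::enc \<Rightarrow> 'e::enc list" and f :: "'x \<Rightarrow> 'e \<Rightarrow> 's::enc \<Rightarrow> 's"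
  assumes "pt (\<lambda>p. f (fst p) (fst (snd p)) (snd (snd p)))" "pt g" "pt s" "pb b"
    and bound: "\<And>x ys zs. g x = ys @ zs \<Longrightarrow> sz (fold (f x) ys (s x)) \<le> b x"
  shows "pt (\<lambda>x. fold (f x) (g x) (s x))"
proof -
  define F where "F = (\<lambda>p. (fst p, tl (fst (snd p)), case fst (snd p) of [] \<Rightarrow> snd (snd p) | a # as \<Rightarrow> f (fst p) a (snd (snd p))))"
  have eq: "(F ^^ i) (x, ys, y) = (x, drop i ys, fold (f x) (take i ys) y)" for i x ys y
  proof (induction i arbitrary: ys y)
    case (Suc i)
    have "(F ^^ Suc i) (x, ys, y) = (F ^^ i) (F (x, ys, y))" by (simp only: funpow_swap1 funpow.simps(2) o_apply)
    also have "\<dots> = (x, drop (Suc i) ys, fold (f x) (take (Suc i) ys) y)"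
      by (cases ys) (simp_all add: F_def Suc.IH[unfolded F_def])
    finally show ?case .
  qed simp
  have "pt (\<lambda>x. (F ^^ spine (tr (g x))) (x, g x, s x))"
  proof (rule pt_funpow)
    have "pt (\<lambda>p. f (fst (fst p)) (fst (snd p)) (snd (snd (fst p))))"
      using pt_comp[OF assms(1), of "\<lambda>p. (fst (fst p), fst (snd p), snd (snd (fst p)))"]
      by (simp add: pt_intro)
    then show "pt F" unfolding F_def by (intro pt_intro)
    show "pb (\<lambda>x. sz x + sz (g x) + b x + 2)" using assms by (intro pb_intros pt_sz)
    show "sz ((F ^^ i) (x, g x, s x)) \<le> sz x + sz (g x) + b x + 2" if "i \<le> spine (tr (g x))" for x i
      using bound[of x "take i (g x)" "drop i (g x)"] sz_append[of "take i (g x)" "drop i (g x)"] sz_pos[of "take i (g x)"]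
      by (simp add: eq)
  qed (use assms in \<open>auto intro!: pt_intro\<close>)
  then have "pt (\<lambda>x. snd (snd ((F ^^ length (g x)) (x, g x, s x))))" by (intro pt_intro) simp
  then show ?thesis by (simp add: eq)
qed

text \<open>If a step enlarges the accumulator by an amount that depends only on the parameter and
  the list entry, the total growth is a sum of polynomially many polynomial terms.\<close>

lemma pt_fold_add:
  fixes g :: "'x::enc \<Rightarrow> 'e::enc list" and f :: "'x \<Rightarrow> 'e \<Rightarrow> 's::enc \<Rightarrow> 's"
  assumes f: "pt (\<lambda>p. f (fst p) (fst (snd p)) (snd (snd p)))" and g: "pt g" and s: "pt s" and B: "pb B"
    and bound: "\<And>x a y. sz (f x a y) \<le> sz y + B (x, a)"
  shows "pt (\<lambda>x. fold (f x) (g x) (s x))"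
proof -
  from B obtain p :: "nat poly" where p: "\<And>x a. B (x, a) \<le> poly p (sz (x, a))" by (rule pbE) blast
  have *: "sz (fold (f x) ys y) \<le> sz y + length ys * poly p (Suc (sz x + sz (g x)))"
    if "set ys \<subseteq> set (g x)" for x ys y
    using that
  proof (induction ys arbitrary: y)
    case (Cons a ys)
    have "sz (x, a) \<le> Suc (sz x + sz (g x))" using sz_mem[of a "g x"] Cons.prems by simp
    then have "sz (f x a y) \<le> sz y + poly p (Suc (sz x + sz (g x)))"
      using bound[of x a y] p[of x a] poly_mono_nat[of "sz (x, a)" _ p] by (meson add_left_mono le_trans)
    then show ?case using Cons.IH[of "f x a y"] Cons.prems by simp
  qed simp
  have "sz (fold (f x) ys (s x)) \<le> sz (s x) + sz (g x) * poly p (Suc (sz x + sz (g x)))"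
    if "g x = ys @ zs" for x ys zs
  proof -
    have "length ys \<le> sz (g x)" using that length_sz[of "g x"] by simp
    then have "length ys * poly p (Suc (sz x + sz (g x))) \<le> sz (g x) * poly p (Suc (sz x + sz (g x)))" by simp
    moreover have "sz (fold (f x) ys (s x)) \<le> sz (s x) + length ys * poly p (Suc (sz x + sz (g x)))"
      using that by (intro *) auto
    ultimately show ?thesis by linarith
  qed
  then show ?thesis
    by (intro pt_fold[OF f g s, of "\<lambda>x. sz (s x) + sz (g x) * poly p (Suc (sz x + sz (g x)))"])
      (auto intro!: pb_intros pt_sz g s)
qed

section \<open>Lists, truth values and natural numbers\<close>

lemma pt_rev [pt_intro]: "pt f \<Longrightarrow> pt (\<lambda>x. rev (f x))"
  unfolding rev_conv_fold
  by (rule pt_fold_add[where B = "\<lambda>p. sz p"]) (auto intro!: pt_intro pb_intros)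

lemma pt_append [pt_intro]: "pt f \<Longrightarrow> pt g \<Longrightarrow> pt (\<lambda>x. f x @ g x)"
proof -
  assume "pt f" "pt g"
  then have "pt (\<lambda>x. fold Cons (rev (f x)) (g x))"
    by (intro pt_fold_add[where B = "\<lambda>p. sz p"]) (auto intro!: pt_intro pb_intros)
  moreover have "fold Cons (rev xs) ys = xs @ ys" for xs ys :: "'b list"
    by (simp add: fold_Cons_rev)
  ultimately show ?thesis by simp
qed

lemma pt_length [pt_intro]: "pt f \<Longrightarrow> pt (\<lambda>x. length (f x))"
proof -
  assume "pt f"
  then have "pt (\<lambda>x. fold (\<lambda>_. Suc) (f x) 0)"
    by (intro pt_fold_add[where B = "\<lambda>p. 2"]) (auto intro!: pt_intro pb_intros)
  moreover have "fold (\<lambda>_. Suc) xs n = n + length xs" for xs :: "'b list" and n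
    by (induction xs arbitrary: n) auto
  ultimately show ?thesis by simp
qed

lemma pt_map [pt_intro]:
  assumes "pt (\<lambda>p. f (fst p) (snd p))" "pt g"
  shows "pt (\<lambda>x. map (f x) (g x))"
proof -
  have "pt (\<lambda>x. fold (\<lambda>a s. f x a # s) (g x) [])"
  proof (rule pt_fold_add[where B = "\<lambda>p. Suc (sz (f (fst p) (snd p)))"])
    have "pt (\<lambda>p. f (fst p) (fst (snd p)))"
      using pt_comp[OF assms(1), of "\<lambda>p. (fst p, fst (snd p))"] by (simp add: pt_intro)
    then show "pt (\<lambda>p. f (fst p) (fst (snd p)) # snd (snd p))" by (intro pt_intro)
    show "pb (\<lambda>p. Suc (sz (f (fst p) (snd p))))" using assms by (intro pb_intros pt_sz)
  qed (auto intro!: pt_intro assms)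
  then have "pt (\<lambda>x. rev (fold (\<lambda>a s. f x a # s) (g x) []))" by (rule pt_rev)
  moreover have "fold (\<lambda>a s. f x a # s) xs ys = rev (map (f x) xs) @ ys" for x xs ys
    by (induction xs arbitrary: ys) auto
  ultimately show ?thesis by simp
qed

lemma pt_concat [pt_intro]:
  assumes "pt f" shows "pt (\<lambda>x. concat (f x))"
proof -
  have "sz (s @ xs) \<le> sz s + sz (x, xs)" for s xs and x :: 'a
    using sz_append[of s xs] by simp
  then have "pt (\<lambda>x. fold (\<lambda>xs s. s @ xs) (f x) [])"
    using assms by (intro pt_fold_add[where B = "\<lambda>p. sz p"]) (auto intro!: pt_intro pb_intros)
  moreover have "fold (\<lambda>xs s. s @ xs) xss ys = ys @ concat xss" for xss and ys :: "'b list"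
    by (induction xss arbitrary: ys) auto
  ultimately show ?thesis by simp
qed

lemma pt_filter [pt_intro]:
  assumes "pt (\<lambda>p. P (fst p) (snd p))" "pt g"
  shows "pt (\<lambda>x. filter (P x) (g x))"
proof -
  have "pt (\<lambda>x. concat (map (\<lambda>a. if P x a then [a] else []) (g x)))"
    using assms by (intro pt_intro)
  moreover have "concat (map (\<lambda>a. if P x a then [a] else []) xs) = filter (P x) xs" for x xs
    by (induction xs) auto
  ultimately show ?thesis by simp
qed

lemma pt_list_all [pt_intro]:
  assumes "pt (\<lambda>p. P (fst p) (snd p))" "pt g"
  shows "pt (\<lambda>x. list_all (P x) (g x))"
proof -
  have "pt (\<lambda>x. case filter (\<lambda>a. \<not> P x a) (g x) of [] \<Rightarrow> True | a # as \<Rightarrow> False)"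
    using assms by (intro pt_intro)
  moreover have "(case filter (\<lambda>a. \<not> P x a) xs of [] \<Rightarrow> True | a # as \<Rightarrow> False) = list_all (P x) xs" for x xs
    by (induction xs) auto
  ultimately show ?thesis by simp
qed

lemma pt_list_ex [pt_intro]:
  assumes "pt (\<lambda>p. P (fst p) (snd p))" "pt g"
  shows "pt (\<lambda>x. list_ex (P x) (g x))"
proof -
  have "pt (\<lambda>x. \<not> list_all (\<lambda>a. \<not> P x a) (g x))" using assms by (intro pt_intro)
  moreover have "(\<not> list_all (\<lambda>a. \<not> P x a) xs) = list_ex (P x) xs" for x xs
    by (induction xs) auto
  ultimately show ?thesis by simp
qed

lemma pt_add [pt_intro]:
  assumes "pt f" "pt g" shows "pt (\<lambda>x. f x + (g x :: nat))"
proof -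
  have "pt (\<lambda>x. (Suc ^^ f x) (g x))"
  proof (rule pt_iterate[where b = "\<lambda>x. 2 * (sz (f x) + sz (g x))"])
    show "pb (\<lambda>x. 2 * (sz (f x) + sz (g x)))" using assms by (intro pb_intros pt_sz)
  qed (use assms in \<open>auto intro!: pt_intro\<close>)
  then show ?thesis by simp
qed

lemma pt_sum_list [pt_intro]:
  assumes "pt f" shows "pt (\<lambda>x. sum_list (f x :: nat list))"
proof -
  have "pt (\<lambda>x. fold (+) (f x) 0)"
    using assms by (intro pt_fold_add[where B = "\<lambda>p. sz p"]) (auto intro!: pt_intro pb_intros)
  then show ?thesis by (simp add: fold_plus_sum_list_rev)
qed

lemma pt_replicate [pt_intro]:
  assumes "pt f" "pt g" shows "pt (\<lambda>x. replicate (f x) (g x))"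
proof -
  have eq: "((#) y ^^ i) [] = replicate i y" for i and y :: 'b
    by (induction i) auto
  have "pt (\<lambda>x. (((#) (g x)) ^^ f x) [])"
  proof (rule pt_iterate[where b = "\<lambda>x. 1 + sz (f x) * (1 + sz (g x))"])
    show "pb (\<lambda>x. 1 + sz (f x) * (1 + sz (g x)))" using assms by (intro pb_intros pt_sz)
    have "pt (\<lambda>p. g (fst p) # snd p)"
      using pt_comp[OF assms(2) pt_fst[OF pt_id]] by (intro pt_intro)
    then show "pt (\<lambda>p. g (fst p) # snd p)" .
    fix x i assume "i \<le> f x"
    have "sz (replicate i (g x)) \<le> 1 + i * (1 + sz (g x))"
      using sz_list_le[of "replicate i (g x)" "sz (g x)"] by simp
    also have "\<dots> \<le> 1 + sz (f x) * (1 + sz (g x))"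
      using \<open>i \<le> f x\<close> by (intro add_left_mono mult_right_mono) auto
    finally show "sz (((#) (g x) ^^ i) []) \<le> 1 + sz (f x) * (1 + sz (g x))" by (simp add: eq)
  qed (use assms in \<open>auto intro!: pt_intro\<close>)
  then show ?thesis by (simp add: eq)
qed

lemma pt_mult [pt_intro]:
  assumes "pt f" "pt g" shows "pt (\<lambda>x. f x * (g x :: nat))"
proof -
  have "pt (\<lambda>x. sum_list (replicate (f x) (g x)))" using assms by (intro pt_intro)
  then show ?thesis by (simp add: sum_list_replicate)
qed

lemma pt_diff [pt_intro]:
  assumes "pt f" "pt g" shows "pt (\<lambda>x. f x - (g x :: nat))"
proof -
  have eq: "((\<lambda>n. n - Suc 0) ^^ i) m = m - i" for i m :: nat by (induction i) auto
  have "pt (\<lambda>x. ((\<lambda>n. n - Suc 0) ^^ g x) (f x))"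
  proof (rule pt_iterate[where b = "\<lambda>x. sz (f x)"])
    show "pb (\<lambda>x. sz (f x))" using assms by (intro pt_sz)
  qed (use assms in \<open>auto intro!: pt_intro pt_pred simp: eq\<close>)
  then show ?thesis by (simp add: eq)
qed

lemma pt_eq0: "pt f \<Longrightarrow> pt (\<lambda>x. f x = (0::nat))"
proof -
  assume "pt f"
  then have "pt (\<lambda>x. case f x of 0 \<Rightarrow> True | Suc m \<Rightarrow> False)" by (intro pt_intro)
  moreover have "(case n of 0 \<Rightarrow> True | Suc m \<Rightarrow> False) = (n = 0)" for n by (cases n) auto
  ultimately show ?thesis by simp
qed

lemma pt_le [pt_intro]: "pt f \<Longrightarrow> pt g \<Longrightarrow> pt (\<lambda>x. f x \<le> (g x :: nat))"
  using pt_eq0[OF pt_diff[of f g]] by simp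

lemma pt_less [pt_intro]: "pt f \<Longrightarrow> pt g \<Longrightarrow> pt (\<lambda>x. f x < (g x :: nat))"
  unfolding less_eq_Suc_le by (intro pt_intro)

lemma pt_nat_eq [pt_intro]: "pt f \<Longrightarrow> pt g \<Longrightarrow> pt (\<lambda>x. f x = (g x :: nat))"
  unfolding order_eq_iff by (intro pt_intro)

lemma pt_upt [pt_intro]:
  assumes "pt f" shows "pt (\<lambda>x. [0..<f x])"
proof -
  have eq: "((\<lambda>s. s @ [length s]) ^^ i) [] = [0..<i]" for i by (induction i) auto
  have "pt (\<lambda>x. ((\<lambda>s. s @ [length s]) ^^ f x) [])"
  proof (rule pt_iterate[where b = "\<lambda>x. 1 + sz (f x) * (1 + sz (f x))"])
    show "pb (\<lambda>x. 1 + sz (f x) * (1 + sz (f x)))" using assms by (intro pb_intros pt_sz)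
    fix x i assume "i \<le> f x"
    then have "sz [0..<i] \<le> 1 + i * (1 + sz (f x))"
      using sz_list_le[of "[0..<i]" "sz (f x)"] by simp
    also have "\<dots> \<le> 1 + sz (f x) * (1 + sz (f x))"
      using \<open>i \<le> f x\<close> by (intro add_left_mono mult_right_mono) auto
    finally show "sz (((\<lambda>s. s @ [length s]) ^^ i) []) \<le> 1 + sz (f x) * (1 + sz (f x))" by (simp add: eq)
  qed (use assms in \<open>auto intro!: pt_intro\<close>)
  then show ?thesis by (simp add: eq)
qed

lemma pt_drop [pt_intro]:
  assumes "pt f" "pt g" shows "pt (\<lambda>x. drop (f x) (g x))"
proof -
  have eq: "(tl ^^ i) xs = drop i xs" for i and xs :: "'b list"
    by (induction i) (auto simp: drop_Suc tl_drop)
  have "pt (\<lambda>x. (tl ^^ f x) (g x))"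
  proof (rule pt_iterate[where b = "\<lambda>x. sz (g x)"])
    show "pb (\<lambda>x. sz (g x))" using assms by (intro pt_sz)
    show "sz ((tl ^^ i) (g x)) \<le> sz (g x)" for x i
      using sz_append[of "take i (g x)" "drop i (g x)"] sz_pos[of "take i (g x)"] by (simp add: eq)
  qed (use assms in \<open>auto intro!: pt_intro\<close>)
  then show ?thesis by (simp add: eq)
qed

lemma pt_nth_default [pt_intro]:
  assumes "pt d" "pt f" "pt g" shows "pt (\<lambda>x. nth_default (d x) (f x) (g x))"
proof -
  have "pt (\<lambda>x. case drop (g x) (f x) of [] \<Rightarrow> d x | a # as \<Rightarrow> a)" using assms by (intro pt_intro)
  moreover have "(case drop i xs of [] \<Rightarrow> y | a # as \<Rightarrow> a) = nth_default y xs i" for i xs and y :: 'b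
    by (cases "i < length xs") (auto simp: nth_default_def Cons_nth_drop_Suc[symmetric])
  ultimately show ?thesis by simp
qed

lemma pt_nat_list_eq [pt_intro]:
  assumes "pt f" "pt g" shows "pt (\<lambda>x. f x = (g x :: nat list))"
proof -
  note * = pt_comp[OF assms(1) pt_fst[OF pt_id]] pt_comp[OF assms(2) pt_fst[OF pt_id]]
  have "pt (\<lambda>x. length (f x) = length (g x) \<and>
    list_all (\<lambda>i. nth_default 0 (f x) i = nth_default 0 (g x) i) [0..<length (f x)])"
    by (rule pt_conj pt_list_all pt_nat_eq pt_nth_default pt_length pt_upt pt_const pt_snd pt_id assms *)+
  moreover have "(length xs = length ys \<and> list_all (\<lambda>i. nth_default 0 xs i = nth_default 0 ys i) [0..<length xs]) = (xs = ys)"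
    (is "?L = ?R") for xs ys :: "nat list"
  proof
    assume L: ?L
    then have "\<forall>i<length xs. xs ! i = ys ! i" by (auto simp: list_all_iff nth_default_def)
    then show ?R using L by (intro nth_equalityI) auto
  qed (simp add: list_all_iff)
  ultimately show ?thesis by simp
qed

lemma pt_poly [pt_intro]: "pt f \<Longrightarrow> pt (\<lambda>x. poly p (f x :: nat))"
  by (induction p) (simp_all add: pt_intro)

subsection \<open>Integers\<close>

lemma pt_int_diff: "pt f \<Longrightarrow> pt g \<Longrightarrow> pt (\<lambda>x. int (f x) - int (g x))"
proof -
  assume "pt f" "pt g"
  then have "pt (\<lambda>x. (f x - g x, g x - f x))" by (intro pt_intro)
  moreover have "nat (int a - int b) = a - b" for a b by simp
  ultimately show ?thesis by (elim pt_retype) (simp add: tr_int_def nat_diff_distrib')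
qed

lemma pt_pos: "pt f \<Longrightarrow> pt (\<lambda>x. nat (f x))" and pt_neg: "pt f \<Longrightarrow> pt (\<lambda>x. nat (- f x))"
proof -
  assume "pt f"
  then have *: "pt (\<lambda>x. (nat (f x), nat (- f x)))" by (elim pt_retype) (simp add: tr_int_def)
  show "pt (\<lambda>x. nat (f x))" using pt_fst[OF *] by simp
  show "pt (\<lambda>x. nat (- f x))" using pt_snd[OF *] by simp
qed

lemma pt_int [pt_intro]: "pt f \<Longrightarrow> pt (\<lambda>x. int (f x))"
  using pt_int_diff[of f "\<lambda>_. 0"] by (simp add: pt_intro)

lemma pt_int_add [pt_intro]:
  assumes "pt f" "pt g" shows "pt (\<lambda>x. f x + (g x :: int))"
proof -
  have "pt (\<lambda>x. int (nat (f x) + nat (g x)) - int (nat (- f x) + nat (- g x)))"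
    using assms by (intro pt_int_diff pt_intro pt_pos pt_neg)
  moreover have "int (nat a + nat b) - int (nat (- a) + nat (- b)) = a + b" for a b by auto
  ultimately show ?thesis by simp
qed

lemma pt_int_minus [pt_intro]:
  assumes "pt f" shows "pt (\<lambda>x. - (f x :: int))"
proof -
  have "pt (\<lambda>x. int (nat (- f x)) - int (nat (f x)))"
    using assms by (intro pt_int_diff pt_pos pt_neg)
  moreover have "int (nat (- a)) - int (nat a) = - a" for a by auto
  ultimately show ?thesis by simp
qed

lemma pt_int_mult [pt_intro]:
  assumes "pt f" "pt g" shows "pt (\<lambda>x. f x * (g x :: int))"
proof -
  have "pt (\<lambda>x. int (nat (f x) * nat (g x) + nat (- f x) * nat (- g x))
      - int (nat (f x) * nat (- g x) + nat (- f x) * nat (g x)))"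
    using assms by (intro pt_int_diff pt_intro pt_pos pt_neg)
  moreover have "int (nat a * nat b + nat (- a) * nat (- b)) - int (nat a * nat (- b) + nat (- a) * nat b) = a * b" for a b
    by (cases "a \<ge> 0"; cases "b \<ge> 0") auto
  ultimately show ?thesis by simp
qed

lemma pt_int_le [pt_intro]:
  assumes "pt f" "pt g" shows "pt (\<lambda>x. f x \<le> (g x :: int))"
proof -
  have "pt (\<lambda>x. nat (f x) + nat (- g x) \<le> nat (g x) + nat (- f x))"
    using assms by (intro pt_intro pt_pos pt_neg)
  moreover have "(nat a + nat (- b) \<le> nat b + nat (- a)) = (a \<le> b)" for a b by auto
  ultimately show ?thesis by simp
qed

lemma pt_int_sum_list [pt_intro]:
  assumes "pt f" shows "pt (\<lambda>x. sum_list (f x :: int list))"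
proof -
  have "pt (\<lambda>x. fold (+) (f x) 0)"
  proof (rule pt_fold_add[where B = "\<lambda>p. sz p"])
    show "sz (a + y) \<le> sz y + sz (x, a)" for x :: 'a and a y :: int
      by (simp add: sz_int)
  qed (use assms in \<open>auto intro!: pt_intro pb_intros\<close>)
  then show ?thesis by (simp add: fold_plus_sum_list_rev)
qed

section \<open>Input and output\<close>

definition bit :: "bool \<Rightarrow> nat" where "bit b = (if b then 2 else 1)"

definition sh :: "int \<Rightarrow> state \<Rightarrow> state" where
  "sh d S = ((fst S)(0 := fst S 0 + d), snd S)"

lemma stack_sh [simp]: "stack (sh d S) i = stack S i"
  by (simp add: sh_def stack_def)

definition read1 :: com where
  "read1 = Loop 0 {1, 2} (Cond 0 {1} (pop 0 ;; push 2 1 ;; push 5 1) (pop 0 ;; push 2 2 ;; push 5 1))"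

text \<open>The input arrives reversed on tape 2, so building the list by prepending restores its
  order. The code of each cell is pushed from its last symbol to its first.\<close>

definition read2 :: com where
  "read2 = Loop 2 {1, 2} (Cond 2 {1} (pop 2 ;; push 1 1 ;; push 1 2)
     (pop 2 ;; push 1 1 ;; push 1 1 ;; push 1 2 ;; push 1 2))"

text \<open>Tape 5 remembers in unary how far the head of tape 0 has moved to the right.\<close>

definition write1 :: com where
  "write1 = Loop 5 {1} (pop 5 ;; Shift 0 Move_Left)"

text \<open>While the bits are collected on tape 2, the head of tape 0 advances one cell per bit.
  Pushing the bits to the left from there ends in cell 0 and leaves a blank behind the last
  bit.\<close>

definition write2 :: com where
  "write2 = Loop 1 {2} (pop 1 ;; Cond 1 {1} (pop 1 ;; push 2 1) (pop 1 ;; pop 1 ;; pop 1 ;; push 2 2) ;;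
     Shift 0 Move_Right)"

definition write3 :: com where
  "write3 = Loop 2 {1, 2} (Cond 2 {1} (pop 2 ;; push 0 1) (pop 2 ;; push 0 2))"

lemma runs_read1:
  "stack S 0 = map bit xs \<Longrightarrow> runs read1 S (20 * length xs + 1)
    (upd 0 [] (upd 2 (rev (map bit xs) @ stack S 2) (upd 5 (replicate (length xs) 1 @ stack S 5) S)))"
proof (induction xs arbitrary: S)
  case Nil
  then show ?case unfolding read1_def using runs_LoopF[of S 0 "{1, 2}"]
    by (auto simp: upd_stack stack_upd)
next
  case (Cons x xs)
  let ?S1 = "upd 5 (1 # stack S 5) (upd 2 (bit x # stack S 2) (upd 0 (map bit xs) S))"
  have S: "stack S 0 = bit x # map bit xs" using Cons.prems by simp
  have *: "runs (pop 0 ;; push 2 (bit x) ;; push 5 1) S (Suc (3 + Suc (3 + 3))) ?S1"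
    by (intro runs_Seq[OF runs_pop[OF S refl] runs_Seq[OF runs_push[OF refl] runs_push]]) (simp add: stack_upd)
  have body: "runs (Cond 0 {1} (pop 0 ;; push 2 1 ;; push 5 1) (pop 0 ;; push 2 2 ;; push 5 1)) S (Suc (Suc (3 + Suc (3 + 3)))) ?S1"
  proof (cases x)
    case True
    show ?thesis by (rule runs_CondF) (use * S True in \<open>simp_all add: bit_def\<close>)
  next
    case False
    show ?thesis by (rule runs_CondT) (use * S False in \<open>simp_all add: bit_def\<close>)
  qed
  have IH: "runs read1 ?S1 (20 * length xs + 1)
    (upd 0 [] (upd 2 (rev (map bit xs) @ stack ?S1 2) (upd 5 (replicate (length xs) 1 @ stack ?S1 5) ?S1)))"
    by (rule Cons.IH) (simp add: stack_upd)
  have "runs read1 S (Suc (Suc (Suc (3 + Suc (3 + 3))) + (20 * length xs + 1)))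
    (upd 0 [] (upd 2 (rev (map bit xs) @ stack ?S1 2) (upd 5 (replicate (length xs) 1 @ stack ?S1 5) ?S1)))"
    unfolding read1_def by (rule runs_LoopT[OF _ body IH[unfolded read1_def]]) (use S in \<open>simp add: bit_def\<close>)
  moreover have "upd 0 [] (upd 2 (rev (map bit xs) @ stack ?S1 2) (upd 5 (replicate (length xs) 1 @ stack ?S1 5) ?S1))
    = upd 0 [] (upd 2 (rev (map bit (x # xs)) @ stack S 2) (upd 5 (replicate (length (x # xs)) 1 @ stack S 5) S))"
    by (auto simp: upd_def stack_def fun_eq_iff replicate_append_same[symmetric] simp flip: replicate_append_same)
  ultimately show ?case by (auto elim!: runs_mono)
qed

lemma runs_read2:
  fixes ys :: "bool list"
  assumes "stack S 2 = map bit us" "stack S 1 = pre (tr ys)"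
  shows "runs read2 S (30 * length us + 1) (upd 2 [] (upd 1 (pre (tr (rev us @ ys))) S))"
  using assms
proof (induction us arbitrary: S ys)
  case Nil
  then show ?case unfolding read2_def using runs_LoopF[of S 2 "{1, 2}"]
    by (auto simp: upd_stack stack_upd)
next
  case (Cons u us)
  let ?S1 = "upd 2 (map bit us) (upd 1 (pre (tr (u # ys))) S)"
  have S: "stack S 2 = bit u # map bit us" using Cons.prems by simp
  have body: "runs (Cond 2 {1} (pop 2 ;; push 1 1 ;; push 1 2)
     (pop 2 ;; push 1 1 ;; push 1 1 ;; push 1 2 ;; push 1 2)) S (Suc (Suc (3 + Suc (3 + Suc (3 + Suc (3 + 3)))))) ?S1"
  proof (cases u)
    case True
    have "runs (pop 2 ;; push 1 1 ;; push 1 1 ;; push 1 2 ;; push 1 2) S (Suc (3 + Suc (3 + Suc (3 + Suc (3 + 3))))) ?S1"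
      by (rule runs_Seq[OF runs_pop[OF S refl] runs_Seq[OF runs_push[OF refl] runs_Seq[OF runs_push[OF refl]
          runs_Seq[OF runs_push[OF refl] runs_push]]]])
        (use Cons.prems(2) in \<open>simp add: True stack_upd tr_bool_def upd_def stack_def fun_eq_iff\<close>)
    then show ?thesis using S True by (intro runs_CondF) (auto simp: bit_def)
  next
    case False
    have "runs (pop 2 ;; push 1 1 ;; push 1 2) S (Suc (3 + Suc (3 + 3))) ?S1"
      by (rule runs_Seq[OF runs_pop[OF S refl] runs_Seq[OF runs_push[OF refl] runs_push]])
        (use Cons.prems(2) in \<open>simp add: False stack_upd tr_bool_def upd_def stack_def fun_eq_iff\<close>)
    then show ?thesis using S False by (intro runs_CondT) (auto simp: bit_def elim!: runs_mono)
  qed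
  have IH: "runs read2 ?S1 (30 * length us + 1) (upd 2 [] (upd 1 (pre (tr (rev us @ u # ys))) ?S1))"
    by (rule Cons.IH) (simp_all add: stack_upd)
  have "runs read2 S (Suc (Suc (Suc (3 + Suc (3 + Suc (3 + Suc (3 + 3))))) + (30 * length us + 1)))
    (upd 2 [] (upd 1 (pre (tr (rev us @ u # ys))) ?S1))"
    unfolding read2_def by (rule runs_LoopT[OF _ body IH[unfolded read2_def]]) (use S in \<open>simp add: bit_def\<close>)
  moreover have "upd 2 [] (upd 1 (pre (tr (rev us @ u # ys))) ?S1) = upd 2 [] (upd 1 (pre (tr (rev (u # us) @ ys))) S)"
    by (auto simp: upd_def fun_eq_iff)
  ultimately show ?case by (auto elim!: runs_mono)
qed

lemma runs_write1:
  "stack S 5 = replicate n 1 \<Longrightarrow> stack S 0 = [] \<Longrightarrow> runs write1 S (10 * n + 1) (sh (- int n) (upd 5 [] S))"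
proof (induction n arbitrary: S)
  case 0
  then show ?case unfolding write1_def using runs_LoopF[of S 5 "{1}"]
    by (auto simp: upd_stack stack_upd sh_def)
next
  case (Suc n)
  let ?S1 = "sh (-1) (upd 5 (replicate n 1) S)"
  have body: "runs (pop 5 ;; Shift 0 Move_Left) S (Suc (3 + 1)) ?S1"
    by (rule runs_Seq[OF runs_pop[OF _ refl] runs_shift_empty])
      (use Suc.prems in \<open>auto simp: stack_upd sh_def upd_def stack_def\<close>)
  have IH: "runs write1 ?S1 (10 * n + 1) (sh (- int n) (upd 5 [] ?S1))"
    by (rule Suc.IH) (use Suc.prems in \<open>auto simp: stack_upd\<close>)
  have "runs write1 S (Suc (Suc (3 + 1) + (10 * n + 1))) (sh (- int n) (upd 5 [] ?S1))"
    unfolding write1_def by (rule runs_LoopT[OF _ body IH[unfolded write1_def]]) (use Suc.prems in simp)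
  moreover have "sh (- int n) (upd 5 [] ?S1) = sh (- int (Suc n)) (upd 5 [] S)"
    by (auto simp: upd_def sh_def fun_eq_iff)
  ultimately show ?case by (auto elim!: runs_mono)
qed

lemma runs_write2:
  fixes ys :: "bool list"
  assumes "stack S 1 = pre (tr ys)" "stack S 0 = []"
  shows "runs write2 S (30 * length ys + 1)
    (sh (int (length ys)) (upd 1 [1] (upd 2 (rev (map bit ys) @ stack S 2) S)))"
  using assms
proof (induction ys arbitrary: S)
  case Nil
  then have "sh 0 (upd 1 [1] (upd 2 (stack S 2) S)) = S"
    by (cases S) (auto simp: upd_def sh_def stack_def fun_eq_iff)
  then show ?case unfolding write2_def using runs_LoopF[of S 1 "{2}"] Nil by simp
next
  case (Cons y ys)
  let ?S0 = "upd 1 (pre (tr ys)) (upd 2 (bit y # stack S 2) S)"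
  let ?S1 = "sh 1 ?S0"
  have S: "stack S 1 = 2 # pre (tr y) @ pre (tr ys)" using Cons.prems by simp
  have c: "runs (Cond 1 {1} (pop 1 ;; push 2 1) (pop 1 ;; pop 1 ;; pop 1 ;; push 2 2))
    (upd 1 (pre (tr y) @ pre (tr ys)) S) (Suc (Suc (3 + Suc (3 + Suc (3 + 3))))) ?S0"
  proof (cases y)
    case True
    have "runs (pop 1 ;; pop 1 ;; pop 1 ;; push 2 2) (upd 1 (2 # 1 # 1 # pre (tr ys)) S)
      (Suc (3 + Suc (3 + Suc (3 + 3)))) ?S0"
      by (rule runs_Seq[OF runs_pop[OF _ refl] runs_Seq[OF runs_pop[OF _ refl] runs_Seq[OF runs_pop[OF _ refl] runs_push]]])
        (simp_all add: stack_upd, auto simp: True bit_def upd_def stack_def fun_eq_iff)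
    then show ?thesis using True by (intro runs_CondF) (auto simp: stack_upd tr_bool_def)
  next
    case False
    have "runs (pop 1 ;; push 2 1) (upd 1 (1 # pre (tr ys)) S) (Suc (3 + 3)) ?S0"
      by (rule runs_Seq[OF runs_pop[OF _ refl] runs_push])
        (simp_all add: stack_upd, auto simp: False bit_def upd_def stack_def fun_eq_iff)
    then show ?thesis using False by (intro runs_CondT) (auto simp: stack_upd tr_bool_def elim!: runs_mono)
  qed
  have body: "runs (pop 1 ;; Cond 1 {1} (pop 1 ;; push 2 1) (pop 1 ;; pop 1 ;; pop 1 ;; push 2 2) ;; Shift 0 Move_Right)
    S (Suc (3 + Suc (Suc (Suc (3 + Suc (3 + Suc (3 + 3)))) + 1))) ?S1"
    by (rule runs_Seq[OF runs_pop[OF S refl] runs_Seq[OF c runs_shift_empty]])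
      (use Cons.prems(2) in \<open>auto simp: stack_upd sh_def\<close>)
  have IH: "runs write2 ?S1 (30 * length ys + 1)
    (sh (int (length ys)) (upd 1 [1] (upd 2 (rev (map bit ys) @ stack ?S1 2) ?S1)))"
    by (rule Cons.IH) (use Cons.prems in \<open>auto simp: stack_upd\<close>)
  have "runs write2 S (Suc (Suc (3 + Suc (Suc (Suc (3 + Suc (3 + Suc (3 + 3)))) + 1)) + (30 * length ys + 1)))
    (sh (int (length ys)) (upd 1 [1] (upd 2 (rev (map bit ys) @ stack ?S1 2) ?S1)))"
    unfolding write2_def by (rule runs_LoopT[OF _ body IH[unfolded write2_def]]) (use S in simp)
  moreover have "sh (int (length ys)) (upd 1 [1] (upd 2 (rev (map bit ys) @ stack ?S1 2) ?S1))
    = sh (int (length (y # ys))) (upd 1 [1] (upd 2 (rev (map bit (y # ys)) @ stack S 2) S))"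
    by (auto simp: upd_def sh_def stack_def fun_eq_iff)
  ultimately show ?case by (auto elim!: runs_mono)
qed

lemma runs_write3:
  assumes "stack S 2 = map bit us"
  shows "runs write3 S (20 * length us + 1) (upd 2 [] (upd 0 (rev (map bit us) @ stack S 0) S))"
  using assms
proof (induction us arbitrary: S)
  case Nil
  then show ?case unfolding write3_def using runs_LoopF[of S 2 "{1, 2}"]
    by (auto simp: upd_stack stack_upd)
next
  case (Cons u us)
  let ?S1 = "upd 0 (bit u # stack S 0) (upd 2 (map bit us) S)"
  have S: "stack S 2 = bit u # map bit us" using Cons.prems by simp
  have *: "runs (pop 2 ;; push 0 (bit u)) S (Suc (3 + 3)) ?S1"
    by (rule runs_Seq[OF runs_pop[OF S refl] runs_push]) (simp add: stack_upd)
  have body: "runs (Cond 2 {1} (pop 2 ;; push 0 1) (pop 2 ;; push 0 2)) S (Suc (Suc (3 + 3))) ?S1"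
  proof (cases u)
    case True
    show ?thesis by (rule runs_CondF) (use * S True in \<open>simp_all add: bit_def\<close>)
  next
    case False
    show ?thesis by (rule runs_CondT) (use * S False in \<open>simp_all add: bit_def\<close>)
  qed
  have IH: "runs write3 ?S1 (20 * length us + 1) (upd 2 [] (upd 0 (rev (map bit us) @ stack ?S1 0) ?S1))"
    by (rule Cons.IH) (simp add: stack_upd)
  have "runs write3 S (Suc (Suc (Suc (3 + 3)) + (20 * length us + 1))) (upd 2 [] (upd 0 (rev (map bit us) @ stack ?S1 0) ?S1))"
    unfolding write3_def by (rule runs_LoopT[OF _ body IH[unfolded write3_def]]) (use S in \<open>simp add: bit_def\<close>)
  moreover have "upd 2 [] (upd 0 (rev (map bit us) @ stack ?S1 0) ?S1) = upd 2 [] (upd 0 (rev (map bit (u # us)) @ stack S 0) S)"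
    by (auto simp: upd_def stack_def fun_eq_iff)
  ultimately show ?case by (auto elim!: runs_mono)
qed

definition init_state :: "bool list \<Rightarrow> state" where
  "init_state x = (\<lambda>i. if i = 0 then int (length x) else 0, \<lambda>i. if i = 0 then map bit x else [])"

text \<open>Consuming the input has left the head of tape 0 behind its last cell; tape 5 remembers
  the distance.\<close>

definition work_state :: "bool list \<Rightarrow> state" where
  "work_state x = (\<lambda>i. if i = 0 then int (length x) else 0, \<lambda>i. if i = 5 then replicate (length x) 1 else [])"

lemma view_init: "view (init_state x) (snd (tm_init M x))"
  by (auto simp: view_def init_state_def tm_init_def string_tape_def bit_def nat_less_iff)

lemma runs_read: "runs (read1 ;; push 1 1 ;; read2) (init_state x) (60 * length x + 7)
    (stk (work_state x) (pre (tr x)) [] [] [])"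
proof -
  let ?S0 = "init_state x"
  let ?S1 = "upd 0 [] (upd 2 (rev (map bit x) @ stack ?S0 2) (upd 5 (replicate (length x) 1 @ stack ?S0 5) ?S0))"
  let ?S2 = "upd 1 [1] ?S1"
  have 1: "runs read1 ?S0 (20 * length x + 1) ?S1"
    by (rule runs_read1) (simp add: init_state_def stack_def)
  have 2: "runs (push 1 1) ?S1 3 ?S2"
    by (rule runs_push) (simp add: stack_upd, simp add: init_state_def stack_def)
  have 3: "runs read2 ?S2 (30 * length (rev x) + 1) (upd 2 [] (upd 1 (pre (tr (rev (rev x) @ []))) ?S2))"
    by (rule runs_read2) (simp_all add: stack_upd rev_map, simp add: init_state_def stack_def)
  have "upd 2 [] (upd 1 (pre (tr (rev (rev x) @ []))) ?S2) = stk (work_state x) (pre (tr x)) [] [] []"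
    by (auto simp: upd_def stk_def work_state_def init_state_def stack_def fun_eq_iff)
  then show ?thesis using runs_Seq[OF 1 runs_Seq[OF 2 3]] by (auto elim!: runs_mono)
qed

lemma sz_bits: "sz (x :: bool list) \<le> 4 * length x + 1"
  using sz_list_le[of x 3] sz_bool by auto

theorem pt_decides:
  assumes "pt f" and I: "\<And>I. I \<in> Inst \<Longrightarrow> f (e I) = yes I"
  shows "poly_time_solvable Inst e yes"
proof -
  from assms(1) obtain c \<tau> where c: "wf_com c" "pb \<tau>"
    "\<And>x r \<sigma>. runs c (stk \<sigma> (pre (tr x) @ r) [] [] []) (\<tau> x) (stk \<sigma> (pre (tr (f x)) @ r) [] [] [])"
    by (rule ptE) blast
  note c0 = c(3)[where r = "[]", unfolded append_Nil2]
  from c(2) obtain p :: "nat poly" where p: "\<And>x. \<tau> x \<le> poly p (sz x)" by (rule pbE) blast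
  let ?c = "(read1 ;; push 1 1 ;; read2) ;; c"
  have "tapes_of ?c \<subseteq> {..<6}" "symbols_ok ?c"
    using c(1) by (auto simp: wf_com_def read1_def read2_def push_def pop_def)
  from tm_of_com[OF this, of 1] obtain M where M: "wf_tm M"
    "\<And>x t T' h'. exec ?c (snd (tm_init M x)) t (T', h') \<Longrightarrow>
       tm_run M x (Suc t) = (if T' 1 (h' 1) = 2 then accept_state M else reject_state M, T', h')"
    by auto
  \<comment> \<open>\<open>[:1, 4:]\<close> is the bound of \<open>sz_bits\<close> on the size of
    the input list in terms of its length.\<close>
  define q where "q = [:9, 60:] + pcompose p [:1, 4:]"
  have "\<exists>t \<le> poly q (length x). fst (tm_run M x t) = (if f x then accept_state M else reject_state M)" for x
  proof -
    have "runs ?c (init_state x) (Suc (60 * length x + 7 + \<tau> x)) (stk (work_state x) (pre (tr (f x))) [] [] [])"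
      by (rule runs_Seq[OF runs_read c0])
    then obtain T h u where u: "u \<le> Suc (60 * length x + 7 + \<tau> x)" "exec ?c (snd (tm_init M x)) u (T, h)"
      "view (stk (work_state x) (pre (tr (f x))) [] [] []) (T, h)"
      using view_init[of x M] unfolding runs_def by (metis prod.collapse)
    have "T 1 (h 1) = top (pre (tr (f x)))" using view_top[OF u(3), of 1] by simp
    then have "fst (tm_run M x (Suc u)) = (if f x then accept_state M else reject_state M)"
      using M(2)[OF u(2)] by (simp add: tr_bool_def)
    moreover have "Suc u \<le> poly q (length x)"
    proof -
      have "\<tau> x \<le> poly p (4 * length x + 1)"
        using p[of x] poly_mono_nat[OF sz_bits[of x], of p] by linarith
      then show ?thesis using u(1) by (simp add: q_def poly_pcompose algebra_simps)
    qed
    ultimately show ?thesis by blast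
  qed
  then show ?thesis using M(1) I unfolding poly_time_solvable_def by metis
qed

theorem pt_computable:
  fixes f :: "bool list \<Rightarrow> bool list"
  assumes "pt f"
  shows "poly_time_computable f"
proof -
  from assms(1) obtain c \<tau> where c: "wf_com c" "pb \<tau>"
    "\<And>x r \<sigma>. runs c (stk \<sigma> (pre (tr x) @ r) [] [] []) (\<tau> x) (stk \<sigma> (pre (tr (f x)) @ r) [] [] [])"
    by (rule ptE) blast
  note c0 = c(3)[where r = "[]", unfolded append_Nil2]
  from c(2) obtain p :: "nat poly" where p: "\<And>x. \<tau> x \<le> poly p (sz x)" by (rule pbE) blast
  from pt_sz[OF assms] obtain r :: "nat poly" where r: "\<And>x. sz (f x) \<le> poly r (sz x)" by (rule pbE) blast
  let ?w = "write1 ;; write2 ;; write3"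
  let ?c = "(read1 ;; push 1 1 ;; read2) ;; c ;; ?w"
  have "tapes_of ?c \<subseteq> {..<6}" "symbols_ok ?c"
    using c(1) by (auto simp: wf_com_def read1_def read2_def push_def pop_def write1_def write2_def write3_def)
  from tm_of_com[OF this, of 1] obtain M where M: "wf_tm M"
    "\<And>x t T' h'. exec ?c (snd (tm_init M x)) t (T', h') \<Longrightarrow>
       tm_run M x (Suc t) = (if T' 1 (h' 1) = 2 then accept_state M else reject_state M, T', h')"
    by auto
  define q where "q = [:20, 70:] + pcompose p [:1, 4:] + [:50:] * pcompose r [:1, 4:]"
  have "\<exists>t \<le> poly q (length x). tm_halted M (tm_run M x t) \<and> tm_output (tm_run M x t) (f x)" for x
  proof -
    let ?y = "f x"
    let ?S0 = "stk (work_state x) (pre (tr ?y)) [] [] []"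
    let ?S1 = "sh (- int (length x)) (upd 5 [] ?S0)"
    let ?S2 = "sh (int (length ?y)) (upd 1 [1] (upd 2 (rev (map bit ?y) @ stack ?S1 2) ?S1))"
    let ?S3 = "upd 2 [] (upd 0 (rev (map bit (rev ?y)) @ stack ?S2 0) ?S2)"
    have st: "stack ?S0 0 = []" "stack ?S0 5 = replicate (length x) 1"
      by (auto simp: stk_def work_state_def stack_def)
    have 1: "runs write1 ?S0 (10 * length x + 1) ?S1" by (rule runs_write1) (simp_all add: st)
    have 2: "runs write2 ?S1 (30 * length ?y + 1) ?S2" by (rule runs_write2) (simp_all add: st stack_upd)
    have 3: "runs write3 ?S2 (20 * length (rev ?y) + 1) ?S3"
      by (rule runs_write3) (simp add: stack_upd rev_map)
    have "runs ?c (init_state x) (Suc (60 * length x + 7 + Suc (\<tau> x + Suc ((10 * length x + 1) + Suc ((30 * length ?y + 1) + (20 * length (rev ?y) + 1)))))) ?S3"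
      by (rule runs_Seq[OF runs_read runs_Seq[OF c0 runs_Seq[OF 1 runs_Seq[OF 2 3]]]])
    then obtain T h u where u: "u \<le> (Suc (60 * length x + 7 + Suc (\<tau> x + Suc ((10 * length x + 1) + Suc ((30 * length ?y + 1) + (20 * length (rev ?y) + 1))))))"
      "exec ?c (snd (tm_init M x)) u (T, h)" "view ?S3 (T, h)"
      using view_init[of x M] unfolding runs_def by (metis prod.collapse)
    have run: "tm_run M x (Suc u) = (if T 1 (h 1) = 2 then accept_state M else reject_state M, T, h)"
      by (rule M(2)[OF u(2)])
    then have "tm_halted M (tm_run M x (Suc u))" by (simp add: tm_halted_def)
    moreover have "tm_output (tm_run M x (Suc u)) (f x)"
    proof -
      have S3: "snd ?S3 0 = map bit ?y" "fst ?S3 0 = int (length ?y)"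
        using st by (auto simp: upd_def sh_def stack_def rev_map stk_def work_state_def)
      have "h 0 + int (length (snd ?S3 0)) = fst ?S3 0"
        "\<And>j. T 0 (h 0 + j) = (if 0 \<le> j \<and> nat j < length (snd ?S3 0) then snd ?S3 0 ! nat j else 0)"
        using u(3) unfolding view_def by (simp_all only: fst_conv snd_conv)
      then have "T 0 j = (if 0 \<le> j \<and> nat j < length ?y then map bit ?y ! nat j else 0)" for j
        unfolding S3 by simp
      then show ?thesis by (auto simp: run tm_output_def string_tape_def bit_def nat_less_iff)
    qed
    moreover have "Suc u \<le> poly q (length x)"
    proof -
      have "\<tau> x \<le> poly p (4 * length x + 1)"
        using p[of x] poly_mono_nat[OF sz_bits[of x], of p] by linarith
      moreover have "length ?y \<le> poly r (4 * length x + 1)"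
        using r[of x] poly_mono_nat[OF sz_bits[of x], of r] length_sz[of ?y] by linarith
      ultimately show ?thesis using u(1) by (simp add: q_def poly_pcompose algebra_simps)
    qed
    ultimately show ?thesis by blast
  qed
  then show ?thesis using M(1) unfolding poly_time_computable_def by blast
qed

section \<open>Satisfiability\<close>

text \<open>A clause consists of its negative and its positive atoms; atoms are lists of numbers.\<close>

type_synonym clause = "nat list list \<times> nat list list"

definition sat :: "(nat list \<Rightarrow> bool) \<Rightarrow> clause \<Rightarrow> bool" where
  "sat \<nu> cl \<longleftrightarrow> ((\<forall>a\<in>set (fst cl). \<nu> a) \<longrightarrow> (\<exists>a\<in>set (snd cl). \<nu> a))"

text \<open>Atoms, with cell \<open>c\<close> standing for tape position \<open>c - W\<close>: \<open>[0, t, q]\<close> for state \<open>q\<close> at time \<open>t\<close>,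
  \<open>[1, t, i, c]\<close> for head \<open>i\<close> at cell \<open>c\<close>, \<open>[2, t, i, c, s]\<close> for symbol \<open>s\<close> in cell \<open>c\<close> of tape \<open>i\<close>,
  \<open>[3, t, i, s]\<close> for head \<open>i\<close> reading \<open>s\<close>, and \<open>[4, t, e]\<close> for using row \<open>e\<close> of the transition table.
  All clauses but those that guess the certificate are definite Horn clauses. Hence a satisfying
  assignment need not describe a run, but it contains all atoms that are true of the run on
  the guessed certificate.\<close>

definition mvn :: "move \<Rightarrow> nat" where
  "mvn m = (case m of Move_Left \<Rightarrow> 0 | Stay \<Rightarrow> 1 | Move_Right \<Rightarrow> 2)"

text \<open>With moves numbered 0, 1, 2 the next cell is \<open>c + mvn m - 1\<close>, which stays
  within the natural numbers when \<open>1 \<le> c\<close>.\<close>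

lemma offset_mvn: "offset m = int (mvn m) - 1"
  by (cases m) (auto simp: mvn_def)

text \<open>Halting states loop, so that it suffices to test the state at time
  \<open>T\<close>.\<close>

definition tot_delta :: "tm \<Rightarrow> nat \<Rightarrow> nat list \<Rightarrow> nat \<times> (nat \<times> move) list" where
  "tot_delta M q ss = (if q \<in> {accept_state M, reject_state M} then (q, map (\<lambda>s. (s, Stay)) ss) else delta M q ss)"

definition entries :: "tm \<Rightarrow> (nat \<times> nat list) list" where
  "entries M = List.product [0..<num_states M] (List.n_lists (num_tapes M) [0..<num_symbols M])"

text \<open>Depends on the machine alone and is therefore a constant of the reduction. Naming a row
  by its index lets one atom replace its long premise in all further clauses.\<close>

definition step_table :: "tm \<Rightarrow> (nat \<times> nat \<times> (nat \<times> nat) list \<times> nat \<times> (nat \<times> nat \<times> nat) list) list" where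
  "step_table M = map (\<lambda>e. let q = fst (entries M ! e); ss = snd (entries M ! e); d = tot_delta M q ss in
     (e, q, zip [0..<num_tapes M] ss, fst d,
      map (\<lambda>i. (i, fst (snd d ! i), mvn (snd (snd d ! i)))) [0..<num_tapes M])) [0..<length (entries M)]"

definition trans_clauses :: "(nat \<times> nat \<times> (nat \<times> nat) list \<times> nat \<times> (nat \<times> nat \<times> nat) list) list \<Rightarrow> nat \<Rightarrow> nat \<Rightarrow> clause list" where
  "trans_clauses tb C t = concat (map (\<lambda>r.
     [([0, t, fst (snd r)] # map (\<lambda>p. [3, t, fst p, snd p]) (fst (snd (snd r))), [[4, t, fst r]]),
      ([[4, t, fst r]], [[0, Suc t, fst (snd (snd (snd r)))]])] @
     concat (map (\<lambda>a. concat (map (\<lambda>c.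
       [([[4, t, fst r], [1, t, fst a, c]], [[1, Suc t, fst a, c + snd (snd a) - 1]]),
        ([[4, t, fst r], [1, t, fst a, c]], [[2, Suc t, fst a, c, fst (snd a)]])]) [0..<C]))
       (snd (snd (snd (snd r)))))) tb)"

text \<open>That the head is away from \<open>c\<close> would be a negated premise, hence a second
  positive atom. Saying instead that it is at some \<open>d\<close> other than \<open>c\<close>
  keeps the clause definite.\<close>

definition frame_clauses :: "nat \<Rightarrow> nat \<Rightarrow> nat \<Rightarrow> nat \<Rightarrow> clause list" where
  "frame_clauses k ns C t = concat (map (\<lambda>i. concat (map (\<lambda>c. concat (map (\<lambda>s.
     ([[1, t, i, c], [2, t, i, c, s]], [[3, t, i, s]]) #
     map (\<lambda>d. ([[1, t, i, d], [2, t, i, c, s]], [[2, Suc t, i, c, s]])) (filter (\<lambda>d. \<not> d = c) [0..<C]))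
     [0..<ns])) [0..<C])) [0..<k])"

text \<open>The cells for the certificate, directly behind \<open>z\<close>, are the only ones with
  a choice; blank is among the options because the certificate may be shorter than
  \<open>m\<close>.\<close>

definition init_atoms :: "nat \<Rightarrow> bool list \<Rightarrow> nat \<Rightarrow> nat \<Rightarrow> nat list list" where
  "init_atoms W z m c = (if c < W then [[2, 0, 0, c, 0]]
     else if c - W < length z then [[2, 0, 0, c, if nth_default False z (c - W) then 2 else 1]]
     else if c - W < length z + m then [[2, 0, 0, c, 1], [2, 0, 0, c, 2], [2, 0, 0, c, 0]]
     else [[2, 0, 0, c, 0]])"

text \<open>The last group propagates blanks to the right, so that no certificate bit can follow a
  blank.\<close>

definition init_clauses :: "nat \<Rightarrow> nat \<Rightarrow> nat \<Rightarrow> nat \<Rightarrow> bool list \<Rightarrow> nat \<Rightarrow> clause list" where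
  "init_clauses q0 k C W z m = ([], [[0, 0, q0]]) # map (\<lambda>i. ([], [[1, 0, i, W]])) [0..<k] @
     concat (map (\<lambda>i. map (\<lambda>c. ([], [[2, 0, Suc i, c, 0]])) [0..<C]) [0..<k]) @
     map (\<lambda>c. ([], init_atoms W z m c)) [0..<C] @
     map (\<lambda>c. ([[2, 0, 0, c, 0]], [[2, 0, 0, Suc c, 0]])) (filter (\<lambda>c. W + length z \<le> c) [0..<C])"

text \<open>Position 0 is the middle one of the \<open>2 * W + 1\<close> cells, so for
  \<open>T < W\<close> no head leaves them. The last clause is the only one without a positive
  atom.\<close>

definition cnf :: "tm \<Rightarrow> nat \<Rightarrow> nat \<Rightarrow> bool list \<Rightarrow> nat \<Rightarrow> clause list" where
  "cnf M T W z m = concat (map (\<lambda>t. trans_clauses (step_table M) (Suc (2 * W)) t @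
       frame_clauses (num_tapes M) (num_symbols M) (Suc (2 * W)) t) [0..<T]) @
     init_clauses (start_state M) (num_tapes M) (Suc (2 * W)) W z m @ [([[0, T, reject_state M]], [])]"

lemma pt_cnf:
  assumes "pt T" "pt W" "pt z" "pt m"
  shows "pt (\<lambda>x. cnf M (T x) (W x) (z x) (m x))"
proof -
  note [pt_intro] = assms
  have "pt (\<lambda>p. trans_clauses (step_table M) (fst p) (snd p))"
    unfolding trans_clauses_def by (intro pt_intro)
  note 1 = pt_comp[OF this, unfolded fst_conv snd_conv, of "\<lambda>x. (f x, g x)" for f g, unfolded fst_conv snd_conv, OF pt_pair]
  have "pt (\<lambda>p. frame_clauses (num_tapes M) (num_symbols M) (fst p) (snd p))"
    unfolding frame_clauses_def by (intro pt_intro)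
  note 2 = pt_comp[OF this, unfolded fst_conv snd_conv, of "\<lambda>x. (f x, g x)" for f g, unfolded fst_conv snd_conv, OF pt_pair]
  have "pt (\<lambda>p. init_clauses (start_state M) (num_tapes M) (fst p) (fst (snd p)) (fst (snd (snd p))) (snd (snd (snd p))))"
    unfolding init_clauses_def init_atoms_def by (intro pt_intro)
  note 3 = pt_comp[OF this, of "\<lambda>x. (f x, g x, h x, i x)" for f g h i, unfolded fst_conv snd_conv, OF pt_pair[OF _ pt_pair[OF _ pt_pair]]]
  have W: "pt (\<lambda>p. W (fst p))" by (rule pt_comp[OF assms(2) pt_fst[OF pt_id]])
  show ?thesis unfolding cnf_def by (intro pt_intro 1 2 3 W)
qed


section \<open>Clause families read as conditions on an assignment\<close>

lemma ball_upt: "(\<forall>c\<in>{0..<n}. P c) \<longleftrightarrow> (\<forall>c<n. P (c::nat))"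
  by auto

lemma sat_trans_clauses: "(\<forall>cl\<in>set (trans_clauses tb C t). sat \<nu> cl) \<longleftrightarrow> (\<forall>r\<in>set tb.
   (\<nu> [0, t, fst (snd r)] \<and> (\<forall>p\<in>set (fst (snd (snd r))). \<nu> [3, t, fst p, snd p]) \<longrightarrow> \<nu> [4, t, fst r]) \<and>
   (\<nu> [4, t, fst r] \<longrightarrow> \<nu> [0, Suc t, fst (snd (snd (snd r)))]) \<and>
   (\<forall>a\<in>set (snd (snd (snd (snd r)))). \<forall>c<C. \<nu> [4, t, fst r] \<and> \<nu> [1, t, fst a, c] \<longrightarrow>
      \<nu> [1, Suc t, fst a, c + snd (snd a) - 1] \<and> \<nu> [2, Suc t, fst a, c, fst (snd a)]))"
  unfolding trans_clauses_def
  by (simp add: sat_def ball_Un ball_UN ball_upt) blast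

lemma sat_frame_clauses: "(\<forall>cl\<in>set (frame_clauses k ns C t). sat \<nu> cl) \<longleftrightarrow> (\<forall>i<k. \<forall>c<C. \<forall>s<ns.
   (\<nu> [1, t, i, c] \<and> \<nu> [2, t, i, c, s] \<longrightarrow> \<nu> [3, t, i, s]) \<and>
   (\<forall>d<C. d \<noteq> c \<and> \<nu> [1, t, i, d] \<and> \<nu> [2, t, i, c, s] \<longrightarrow> \<nu> [2, Suc t, i, c, s]))"
  unfolding frame_clauses_def by (simp add: sat_def ball_Un ball_UN ball_upt) blast

lemma sat_init_clauses: "(\<forall>cl\<in>set (init_clauses q0 k C W z m). sat \<nu> cl) \<longleftrightarrow>
   \<nu> [0, 0, q0] \<and> (\<forall>i<k. \<nu> [1, 0, i, W]) \<and> (\<forall>i<k. \<forall>c<C. \<nu> [2, 0, Suc i, c, 0]) \<and>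
   (\<forall>c<C. \<exists>a\<in>set (init_atoms W z m c). \<nu> a) \<and>
   (\<forall>c<C. W + length z \<le> c \<and> \<nu> [2, 0, 0, c, 0] \<longrightarrow> \<nu> [2, 0, 0, Suc c, 0])"
  unfolding init_clauses_def
  by (simp add: sat_def ball_Un ball_UN ball_upt) blast

lemma sat_cnf: "(\<forall>cl\<in>set (cnf M T W z m). sat \<nu> cl) \<longleftrightarrow>
   (\<forall>t<T. (\<forall>cl\<in>set (trans_clauses (step_table M) (Suc (2 * W)) t). sat \<nu> cl) \<and>
     (\<forall>cl\<in>set (frame_clauses (num_tapes M) (num_symbols M) (Suc (2 * W)) t). sat \<nu> cl)) \<and>
   (\<forall>cl\<in>set (init_clauses (start_state M) (num_tapes M) (Suc (2 * W)) W z m). sat \<nu> cl) \<and>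
   \<not> \<nu> [0, T, reject_state M]"
  unfolding cnf_def by (auto simp: ball_Un ball_UN sat_def)

subsection \<open>Runs of Turing machines\<close>

definition reads :: "tm \<Rightarrow> config \<Rightarrow> nat list" where
  "reads M cfg = map (\<lambda>i. fst (snd cfg) i (snd (snd cfg) i)) [0..<num_tapes M]"

lemma tm_step_tot: "tm_step M (q, T, h) = (let d = tot_delta M q (reads M (q, T, h)) in
   (fst d, \<lambda>i. if i < num_tapes M then (T i)(h i := fst (snd d ! i)) else T i,
    \<lambda>i. if i < num_tapes M then h i + offset (snd (snd d ! i)) else h i))"
  by (auto simp: tm_step_def tot_delta_def tm_halted_def reads_def Let_def fun_eq_iff split: prod.split)

lemma tm_run_Suc: "tm_run M x (Suc t) = tm_step M (tm_run M x t)"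
  by (simp add: tm_run_def)

definition tm_inv :: "tm \<Rightarrow> nat \<Rightarrow> config \<Rightarrow> bool" where
  "tm_inv M t cfg \<longleftrightarrow> fst cfg < num_states M \<and> (\<forall>i j. fst (snd cfg) i j < num_symbols M) \<and>
     (\<forall>i. \<bar>snd (snd cfg) i\<bar> \<le> int t)"

lemma tm_inv_run:
  assumes "wf_tm M" shows "tm_inv M t (tm_run M x t)"
proof (induction t)
  case 0
  show ?case using assms by (auto simp: tm_inv_def tm_run_def tm_init_def string_tape_def wf_tm_def)
next
  case (Suc t)
  obtain q T h where c: "tm_run M x t = (q, T, h)" by (metis prod_cases3)
  let ?d = "tot_delta M q (reads M (q, T, h))"
  have r: "length (reads M (q, T, h)) = num_tapes M" "\<forall>s\<in>set (reads M (q, T, h)). s < num_symbols M"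
    using Suc c by (auto simp: reads_def tm_inv_def)
  moreover have "fst (delta M q ss) < num_states M \<and> length (snd (delta M q ss)) = num_tapes M \<and>
      (\<forall>a\<in>set (snd (delta M q ss)). fst a < num_symbols M)"
    if "q < num_states M" "length ss = num_tapes M" "\<forall>s\<in>set ss. s < num_symbols M" for ss
    using assms that unfolding wf_tm_def by blast
  ultimately have "fst ?d < num_states M" "length (snd ?d) = num_tapes M" "\<forall>a\<in>set (snd ?d). fst a < num_symbols M"
    using Suc c by (simp_all add: tot_delta_def tm_inv_def)
  moreover have "\<bar>h i + offset m\<bar> \<le> int (Suc t)" if "\<bar>h i\<bar> \<le> int t" for i m
    using that by (cases m) auto
  ultimately show ?case using Suc c
    by (auto simp: tm_run_Suc tm_step_tot tm_inv_def Let_def intro: order_trans)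
qed

lemma reads_entry:
  assumes "tm_inv M t cfg"
  obtains e where "e < length (entries M)" "entries M ! e = (fst cfg, reads M cfg)"
proof -
  have "(fst cfg, reads M cfg) \<in> set (entries M)"
    using assms by (auto simp: entries_def set_n_lists reads_def tm_inv_def)
  then show ?thesis using that by (metis in_set_conv_nth)
qed

lemma table_row: "e < length (entries M) \<Longrightarrow> entries M ! e = (q, ss) \<Longrightarrow>
  (e, q, zip [0..<num_tapes M] ss, fst (tot_delta M q ss),
      map (\<lambda>i. (i, fst (snd (tot_delta M q ss) ! i), mvn (snd (snd (tot_delta M q ss) ! i)))) [0..<num_tapes M])
   \<in> set (step_table M)"
  by (auto simp: step_table_def Let_def intro!: image_eqI[of _ _ e])

lemma tm_halted_stays:
  assumes "tm_halted M (tm_run M x t)" "t \<le> u" shows "tm_run M x u = tm_run M x t"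
  using assms(2) by (induction rule: dec_induct) (use assms(1) in \<open>simp_all add: tm_run_Suc tm_step_def\<close>)

text \<open>A certificate is extracted from the initial atoms; by induction on time all facts of its
  run hold under \<open>\<nu>\<close>, whatever else \<open>\<nu>\<close> makes true. If the run
  rejected, the last clause would be violated.\<close>

lemma cnf_sound:
  assumes wf: "wf_tm M" and W: "T < W" "length z + m \<le> W"
    and sat: "\<forall>cl\<in>set (cnf M T W z m). sat \<nu> cl"
  shows "\<exists>w. length w \<le> m \<and> fst (tm_run M (z @ w) T) \<noteq> reject_state M"
proof -
  let ?C = "Suc (2 * W)" and ?k = "num_tapes M"
  have St: "\<And>t. t < T \<Longrightarrow> \<forall>cl\<in>set (trans_clauses (step_table M) ?C t). sat \<nu> cl"
    and Sf: "\<And>t. t < T \<Longrightarrow> \<forall>cl\<in>set (frame_clauses ?k (num_symbols M) ?C t). sat \<nu> cl"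
    and Si: "\<forall>cl\<in>set (init_clauses (start_state M) ?k ?C W z m). sat \<nu> cl"
    and rej: "\<not> \<nu> [0, T, reject_state M]"
    using sat unfolding sat_cnf by blast+
  have i1: "\<nu> [0, 0, start_state M]" and i2: "\<And>i. i < ?k \<Longrightarrow> \<nu> [1, 0, i, W]"
    and i3: "\<And>i c. i < ?k \<Longrightarrow> c < ?C \<Longrightarrow> \<nu> [2, 0, Suc i, c, 0]"
    and i4: "\<And>c. c < ?C \<Longrightarrow> \<exists>a\<in>set (init_atoms W z m c). \<nu> a"
    and i5: "\<And>c. c < ?C \<Longrightarrow> W + length z \<le> c \<Longrightarrow> \<nu> [2, 0, 0, c, 0] \<Longrightarrow> \<nu> [2, 0, 0, Suc c, 0]"
    using Si unfolding sat_init_clauses by blast+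
  define bl where "bl = (\<lambda>j. \<nu> [2, 0, 0, W + length z + j, 0])"
  have bl_end: "bl m"
  proof -
    have "W + length z + m < ?C" using W by simp
    then have "\<exists>a\<in>set (init_atoms W z m (W + length z + m)). \<nu> a" by (rule i4)
    then show ?thesis by (simp add: init_atoms_def bl_def)
  qed
  \<comment> \<open>The certificate ends at the first cell marked blank; the cell behind the guessed
    region is forced to be blank.\<close>
  define n where "n = (LEAST j. bl j)"
  have n: "bl n" "n \<le> m" "\<And>j. j < n \<Longrightarrow> \<not> bl j"
    unfolding n_def by (rule LeastI[of bl, OF bl_end], rule Least_le[of bl, OF bl_end], rule not_less_Least)
  \<comment> \<open>A cell may carry both bits under \<open>\<nu>\<close>. One of them is picked,
    and for the induction it only matters that its atom is true.\<close>
  define w where "w = map (\<lambda>j. \<nu> [2, 0, 0, W + length z + j, 2]) [0..<n]"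
  have lw: "length w = n" by (simp add: w_def)
  have bl_mono: "bl j" if "n \<le> j" "W + length z + j \<le> ?C" for j
    using that
  proof (induction j rule: dec_induct)
    case (step j)
    then have "bl j" by simp
    then show ?case using i5[of "W + length z + j"] step.prems unfolding bl_def by simp
  qed (use n in simp)
  have tape0: "\<nu> [2, 0, 0, c, string_tape (z @ w) (int c - int W)]" if "c < ?C" for c
  proof -
    have init: "if c < W then \<nu> [2, 0, 0, c, 0]
      else if c - W < length z then \<nu> [2, 0, 0, c, if nth_default False z (c - W) then 2 else 1]
      else if c - W < length z + m then \<nu> [2, 0, 0, c, 1] \<or> \<nu> [2, 0, 0, c, 2] \<or> \<nu> [2, 0, 0, c, 0]
      else \<nu> [2, 0, 0, c, 0]"
    proof -
      have "\<exists>a\<in>set (init_atoms W z m c). \<nu> a" using i4 that by blast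
      then show ?thesis by (auto simp: init_atoms_def split: if_splits)
    qed
    consider "c < W" | j where "c = W + j" "j < length z" | j where "c = W + length z + j"
      by (metis le_add_diff_inverse not_less add.assoc)
    then show ?thesis
    proof cases
      case 1
      then show ?thesis using init by (simp add: string_tape_def)
    next
      case 2
      then show ?thesis using init by (auto simp: string_tape_def nth_append nth_default_def)
    next
      case 3
      show ?thesis
      proof (cases "j < n")
        case True
        then have "\<not> bl j" using n by simp
        then have "\<nu> [2, 0, 0, c, 1] \<or> \<nu> [2, 0, 0, c, 2]"
          using init 3 True n(2) by (auto simp: bl_def)
        moreover have "string_tape (z @ w) (int c - int W) = (if \<nu> [2, 0, 0, c, 2] then 2 else 1)"
          using 3 True lw by (simp add: string_tape_def nth_append nat_add_distrib w_def)
        ultimately show ?thesis by auto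
      next
        case False
        then have "bl j" using bl_mono that 3 by simp
        moreover have "string_tape (z @ w) (int c - int W) = 0"
          using 3 False lw by (simp add: string_tape_def)
        ultimately show ?thesis using 3 by (simp add: bl_def)
      qed
    qed
  qed
  let ?R = "tm_run M (z @ w)"
  have main: "t \<le> T \<Longrightarrow> \<nu> [0, t, fst (?R t)] \<and>
     (\<forall>i<?k. \<nu> [1, t, i, nat (snd (snd (?R t)) i + int W)] \<and>
        (\<forall>c<?C. \<nu> [2, t, i, c, fst (snd (?R t)) i (int c - int W)]))" for t
  proof (induction t)
    case 0
    have "\<nu> [2, 0, i, c, fst (snd (?R 0)) i (int c - int W)]" if "i < ?k" "c < ?C" for i c
    proof (cases i)
      case (Suc i')
      then show ?thesis using i3[of i' c] that by (simp add: tm_run_def tm_init_def)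
    qed (use that tape0 in \<open>simp add: tm_run_def tm_init_def\<close>)
    then show ?case using i1 i2 by (simp add: tm_run_def tm_init_def)
  next
    case (Suc t)
    then have IH: "\<nu> [0, t, fst (?R t)]" "\<And>i. i < ?k \<Longrightarrow> \<nu> [1, t, i, nat (snd (snd (?R t)) i + int W)]"
      "\<And>i c. i < ?k \<Longrightarrow> c < ?C \<Longrightarrow> \<nu> [2, t, i, c, fst (snd (?R t)) i (int c - int W)]"
      and t: "t < T" by auto
    obtain q Tp h where c: "?R t = (q, Tp, h)" by (metis prod_cases3)
    have inv: "tm_inv M t (q, Tp, h)" using tm_inv_run[OF wf, of t "z @ w"] c by simp
    then obtain e where e: "e < length (entries M)" "entries M ! e = (q, reads M (q, Tp, h))"
      using reads_entry by (metis fst_conv)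
    let ?ss = "reads M (q, Tp, h)"
    let ?d = "tot_delta M q ?ss"
    \<comment> \<open>From \<open>t < T < W\<close> the head cell is in range and positive, so the
      subtraction in the movement clauses is not truncated.\<close>
    define hc where "hc = (\<lambda>i. nat (h i + int W))"
    have hc: "int (hc i) = h i + int W" "hc i < ?C" "1 \<le> hc i" for i
    proof -
      have "\<bar>h i\<bar> \<le> int t" using inv by (simp add: tm_inv_def)
      then show "int (hc i) = h i + int W" "hc i < ?C" "1 \<le> hc i" using t W by (auto simp: hc_def)
    qed
    note tr = bspec[OF St[OF t, unfolded sat_trans_clauses] table_row[OF e], unfolded fst_conv snd_conv]
    have fr1: "\<And>i c s. i < ?k \<Longrightarrow> c < ?C \<Longrightarrow> s < num_symbols M \<Longrightarrow> \<nu> [1, t, i, c] \<Longrightarrow> \<nu> [2, t, i, c, s] \<Longrightarrow> \<nu> [3, t, i, s]"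
      and fr2: "\<And>i c d s. i < ?k \<Longrightarrow> c < ?C \<Longrightarrow> d < ?C \<Longrightarrow> s < num_symbols M \<Longrightarrow> d \<noteq> c \<Longrightarrow> \<nu> [1, t, i, d] \<Longrightarrow>
        \<nu> [2, t, i, c, s] \<Longrightarrow> \<nu> [2, Suc t, i, c, s]"
      using Sf[OF t] unfolding sat_frame_clauses by blast+
    have rd: "\<nu> [3, t, i, Tp i (h i)]" if "i < ?k" for i
    proof -
      have "\<nu> [1, t, i, hc i]" "\<nu> [2, t, i, hc i, Tp i (h i)]"
        using IH(2)[OF that] IH(3)[OF that hc(2)[of i]] c hc(1)[of i] by (simp_all add: hc_def)
      moreover have "Tp i (h i) < num_symbols M" using inv by (simp add: tm_inv_def)
      ultimately show ?thesis using fr1 that hc(2)[of i] by blast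
    qed
    have "\<nu> [4, t, e]"
    proof (rule mp[OF conjunct1[OF tr]], intro conjI ballI)
      show "\<nu> [0, t, q]" using IH(1) c by simp
      fix p assume "p \<in> set (zip [0..<?k] ?ss)"
      then show "\<nu> [3, t, fst p, snd p]" using rd[of "fst p"] by (auto simp: reads_def in_set_zip)
    qed
    then have q': "\<nu> [0, Suc t, fst ?d]" using tr by blast
    have mv: "\<nu> [1, Suc t, i, hc i + mvn (snd (snd ?d ! i)) - 1] \<and> \<nu> [2, Suc t, i, hc i, fst (snd ?d ! i)]"
      if i: "i < ?k" for i
    proof -
      have 1: "\<nu> [1, t, i, hc i]" using IH(2)[OF that] c by (simp add: hc_def)
      have "(i, fst (snd ?d ! i), mvn (snd (snd ?d ! i))) \<in>
        set (map (\<lambda>i. (i, fst (snd ?d ! i), mvn (snd (snd ?d ! i)))) [0..<?k])" using i by simp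
      from spec[OF bspec[OF conjunct2[OF conjunct2[OF tr]] this], of "hc i"] show ?thesis
        using 1 \<open>\<nu> [4, t, e]\<close> hc(2)[of i] by simp
    qed
    have R: "?R (Suc t) = (fst ?d, \<lambda>i. if i < ?k then (Tp i)(h i := fst (snd ?d ! i)) else Tp i,
      \<lambda>i. if i < ?k then h i + offset (snd (snd ?d ! i)) else h i)"
      by (simp add: tm_run_Suc c tm_step_tot Let_def)
    show ?case
    proof (intro conjI allI impI)
      show "\<nu> [0, Suc t, fst (?R (Suc t))]"
        using q' by (simp add: R)
      fix i assume i: "i < ?k"
      have "nat (h i + offset (snd (snd ?d ! i)) + int W) = hc i + mvn (snd (snd ?d ! i)) - 1"
        using hc(1)[of i] hc(3)[of i] by (simp add: offset_mvn)
      then show "\<nu> [1, Suc t, i, nat (snd (snd (?R (Suc t))) i + int W)]"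
        using mv[OF i] i by (simp add: R)
      fix c' assume c': "c' < ?C"
      show "\<nu> [2, Suc t, i, c', fst (snd (?R (Suc t))) i (int c' - int W)]"
      proof (cases "c' = hc i")
        case True
        then have "int c' - int W = h i" using hc(1)[of i] by simp
        then show ?thesis using mv[OF i] i True by (simp add: R)
      next
        case False
        then have "int c' - int W \<noteq> h i" using hc(1)[of i] by auto
        moreover have "\<nu> [1, t, i, hc i]" using IH(2)[OF i] c by (simp add: hc_def)
        moreover have "\<nu> [2, t, i, c', Tp i (int c' - int W)]" using IH(3)[OF i c'] c by simp
        moreover have "Tp i (int c' - int W) < num_symbols M" using inv by (simp add: tm_inv_def)
        ultimately have "\<nu> [2, Suc t, i, c', Tp i (int c' - int W)]"
          using fr2[OF i c' hc(2)[of i]] False by blast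
        then show ?thesis using \<open>int c' - int W \<noteq> h i\<close> i by (simp add: R)
      qed
    qed
  qed
  have "fst (?R T) \<noteq> reject_state M" using main[of T] rej by auto
  then show ?thesis using n(2) lw by blast
qed

lemma cnf_complete:
  assumes wf: "wf_tm M" and W: "T < W"
    and w: "length w \<le> m" "fst (tm_run M (z @ w) T) \<noteq> reject_state M"
  shows "\<exists>\<nu>. \<forall>cl\<in>set (cnf M T W z m). sat \<nu> cl"
proof -
  let ?C = "Suc (2 * W)" and ?k = "num_tapes M" and ?R = "tm_run M (z @ w)"
  define \<nu> where "\<nu> = (\<lambda>a. (\<exists>t q. a = [0, t, q] \<and> q = fst (?R t)) \<or>
    (\<exists>t i c. a = [1, t, i, c] \<and> int c = snd (snd (?R t)) i + int W) \<or>
    (\<exists>t i c s. a = [2, t, i, c, s] \<and> s = fst (snd (?R t)) i (int c - int W)) \<or>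
    (\<exists>t i s. a = [3, t, i, s] \<and> s = fst (snd (?R t)) i (snd (snd (?R t)) i)) \<or>
    (\<exists>t e. a = [4, t, e] \<and> entries M ! e = (fst (?R t), reads M (?R t))))"
  have \<nu>: "\<nu> [0, t, q] \<longleftrightarrow> q = fst (?R t)" "\<nu> [1, t, i, c] \<longleftrightarrow> int c = snd (snd (?R t)) i + int W"
    "\<nu> [2, t, i, c, s] \<longleftrightarrow> s = fst (snd (?R t)) i (int c - int W)"
    "\<nu> [3, t, i, s] \<longleftrightarrow> s = fst (snd (?R t)) i (snd (snd (?R t)) i)"
    "\<nu> [4, t, e] \<longleftrightarrow> entries M ! e = (fst (?R t), reads M (?R t))" for t q i c s e
    by (simp_all add: \<nu>_def)
  have R: "?R (Suc t) = (let d = tot_delta M (fst (?R t)) (reads M (?R t)) in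
      (fst d, \<lambda>i. if i < ?k then (fst (snd (?R t)) i)(snd (snd (?R t)) i := fst (snd d ! i)) else fst (snd (?R t)) i,
      \<lambda>i. if i < ?k then snd (snd (?R t)) i + offset (snd (snd d ! i)) else snd (snd (?R t)) i))" for t
    using tm_step_tot[of M "fst (?R t)" "fst (snd (?R t))" "snd (snd (?R t))"] by (simp add: tm_run_Suc)
  have "\<forall>cl\<in>set (trans_clauses (step_table M) ?C t). sat \<nu> cl" if t: "t < T" for t
    unfolding sat_trans_clauses
  proof
    fix r assume "r \<in> set (step_table M)"
    then obtain e q ss where e: "e < length (entries M)" "entries M ! e = (q, ss)"
      and r: "r = (e, q, zip [0..<?k] ss, fst (tot_delta M q ss),
      map (\<lambda>i. (i, fst (snd (tot_delta M q ss) ! i), mvn (snd (snd (tot_delta M q ss) ! i)))) [0..<?k])"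
      by (auto simp: step_table_def Let_def) (metis prod.collapse)
    have len: "length ss = ?k"
      using nth_mem[OF e(1)] e(2) by (auto simp: entries_def set_n_lists)
    have inv: "tm_inv M t (?R t)" by (rule tm_inv_run[OF wf])
    have ss: "ss = reads M (?R t)" if "\<forall>p\<in>set (zip [0..<?k] ss). snd p = fst (snd (?R t)) (fst p) (snd (snd (?R t)) (fst p))"
    proof (rule nth_equalityI)
      fix i assume i: "i < length ss"
      then have "(i, ss ! i) \<in> set (zip [0..<?k] ss)" using len by (auto simp: in_set_zip intro!: exI[of _ i])
      then show "ss ! i = reads M (?R t) ! i" using that i len by (auto simp: reads_def)
    qed (simp add: len reads_def)
    \<comment> \<open>Again head cells are positive as \<open>t < T < W\<close>.\<close>
    have hc: "1 \<le> c" if "int c = snd (snd (?R t)) i + int W" for i c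
    proof -
      have "\<bar>snd (snd (?R t)) i\<bar> \<le> int t" using inv by (simp add: tm_inv_def)
      then show ?thesis using that t W by linarith
    qed
    show "(\<nu> [0, t, fst (snd r)] \<and> (\<forall>p\<in>set (fst (snd (snd r))). \<nu> [3, t, fst p, snd p]) \<longrightarrow> \<nu> [4, t, fst r]) \<and>
     (\<nu> [4, t, fst r] \<longrightarrow> \<nu> [0, Suc t, fst (snd (snd (snd r)))]) \<and>
     (\<forall>a\<in>set (snd (snd (snd (snd r)))). \<forall>c<?C. \<nu> [4, t, fst r] \<and> \<nu> [1, t, fst a, c] \<longrightarrow>
      \<nu> [1, Suc t, fst a, c + snd (snd a) - 1] \<and> \<nu> [2, Suc t, fst a, c, fst (snd a)])"
      unfolding r fst_conv snd_conv
    proof (intro conjI impI ballI allI)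
      assume a: "\<nu> [0, t, q] \<and> (\<forall>p\<in>set (zip [0..<?k] ss). \<nu> [3, t, fst p, snd p])"
      then have "ss = reads M (?R t)" using \<nu>(4) by (intro ss) blast
      then show "\<nu> [4, t, e]" using a \<nu>(1,5) e by simp
    next
      assume "\<nu> [4, t, e]"
      then show "\<nu> [0, Suc t, fst (tot_delta M q ss)]" unfolding \<nu> e(2) by (simp add: R Let_def)
    next
      fix a c
      assume "a \<in> set (map (\<lambda>i. (i, fst (snd (tot_delta M q ss) ! i), mvn (snd (snd (tot_delta M q ss) ! i)))) [0..<?k])"
        and 4: "\<nu> [4, t, e] \<and> \<nu> [1, t, fst a, c]"
      then obtain i where i: "i < ?k"
        and a: "a = (i, fst (snd (tot_delta M q ss) ! i), mvn (snd (snd (tot_delta M q ss) ! i)))" by auto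
      have q: "q = fst (?R t)" "ss = reads M (?R t)" using 4 unfolding \<nu> e(2) by auto
      have c: "int c = snd (snd (?R t)) i + int W" using 4 unfolding \<nu> a fst_conv by blast
      have "snd (snd (?R (Suc t))) i = snd (snd (?R t)) i + offset (snd (snd (tot_delta M q ss) ! i))"
        "fst (snd (?R (Suc t))) i (snd (snd (?R t)) i) = fst (snd (tot_delta M q ss) ! i)"
        using i unfolding R q by (simp_all add: Let_def)
      then show "\<nu> [1, Suc t, fst a, c + snd (snd a) - 1]" "\<nu> [2, Suc t, fst a, c, fst (snd a)]"
        unfolding \<nu> a fst_conv snd_conv using c hc[OF c] by (simp_all add: offset_mvn)
    qed
  qed
  moreover have "\<forall>cl\<in>set (frame_clauses ?k (num_symbols M) ?C t). sat \<nu> cl" for t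
    unfolding sat_frame_clauses \<nu> by (auto simp: R Let_def)
  moreover have nat_sub: "nat (int c - int W) = c - W" for c by auto
  have "\<forall>cl\<in>set (init_clauses (start_state M) ?k ?C W z m). sat \<nu> cl"
    unfolding sat_init_clauses using w(1)
    by (auto simp: \<nu> \<nu>(2)[unfolded One_nat_def] nat_sub init_atoms_def tm_run_def tm_init_def string_tape_def nth_default_def nth_append)
  moreover have "\<not> \<nu> [0, T, reject_state M]" using w(2) by (auto simp: \<nu>)
  ultimately show ?thesis unfolding sat_cnf by blast
qed

theorem NP_to_cnf:
  assumes "L \<in> NP"
  obtains F :: "bool list \<Rightarrow> clause list" where "pt F" "\<And>x. F x \<noteq> []"
    "\<And>x. x \<in> L \<longleftrightarrow> (\<exists>\<nu>. \<forall>cl\<in>set (F x). sat \<nu> cl)"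
proof -
  from assms obtain R and q :: "nat poly" where R: "poly_time_solvable UNIV (\<lambda>z. z) (\<lambda>z. z \<in> R)"
    and L: "\<And>x. x \<in> L \<longleftrightarrow> (\<exists>w. length w \<le> poly q (length x) \<and> pair_enc x w \<in> R)"
    unfolding NP_def by auto
  from R obtain M and p :: "nat poly" where wf: "wf_tm M" and M: "\<And>z. \<exists>t \<le> poly p (length z).
      fst (tm_run M z t) = (if z \<in> R then accept_state M else reject_state M)"
    unfolding poly_time_solvable_def by auto
  define z where "z = (\<lambda>x. pair_enc x [])"
  define m where "m = (\<lambda>x::bool list. poly q (length x))"
  \<comment> \<open>A single time for all certificates of length at most \<open>m x\<close>: the
    bound is monotone, and a halted run stays where it is.\<close>
  define T where "T = (\<lambda>x. poly p (length (z x) + m x))"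
  define W where "W = (\<lambda>x. Suc (T x + length (z x) + m x))"
  define F where "F = (\<lambda>x. cnf M (T x) (W x) (z x) (m x))"
  \<comment> \<open>Pairing leaves its second component unchanged at the end, so guessing a
    certificate is guessing a plain suffix.\<close>
  have pair: "pair_enc x w = z x @ w" for x w by (simp add: z_def pair_enc_def)
  have pz: "pt z" unfolding z_def pair_enc_def by (intro pt_intro)
  have pm: "pt m" unfolding m_def by (intro pt_intro)
  have pT: "pt T" unfolding T_def by (intro pt_intro pz pm)
  have "pt F" unfolding F_def by (intro pt_cnf pz pm pT) (unfold W_def, intro pt_intro pz pm pT)
  moreover have "F x \<noteq> []" for x by (simp add: F_def cnf_def)
  moreover have "x \<in> L \<longleftrightarrow> (\<exists>\<nu>. \<forall>cl\<in>set (F x). sat \<nu> cl)" for x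
  proof -
    have acc: "fst (tm_run M (z x @ w) (T x)) = (if z x @ w \<in> R then accept_state M else reject_state M)"
      if "length w \<le> m x" for w
    proof -
      obtain t where t: "t \<le> poly p (length (z x @ w))"
        "fst (tm_run M (z x @ w) t) = (if z x @ w \<in> R then accept_state M else reject_state M)" using M by blast
      have "poly p (length (z x @ w)) \<le> T x" unfolding T_def using that by (intro poly_mono_nat) simp
      then have "tm_run M (z x @ w) (T x) = tm_run M (z x @ w) t"
        using t by (intro tm_halted_stays) (auto simp: tm_halted_def)
      then show ?thesis using t by simp
    qed
    have ne: "accept_state M \<noteq> reject_state M" using wf by (simp add: wf_tm_def)
    have "x \<in> L \<longleftrightarrow> (\<exists>w. length w \<le> m x \<and> fst (tm_run M (z x @ w) (T x)) \<noteq> reject_state M)"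
      using L[of x] acc ne unfolding pair by (auto simp: m_def)
    also have "\<dots> \<longleftrightarrow> (\<exists>\<nu>. \<forall>cl\<in>set (F x). sat \<nu> cl)"
      unfolding F_def using cnf_sound[OF wf, of "T x" "W x" "z x" "m x"] cnf_complete[OF wf, of "T x" "W x" _ "m x" "z x"]
      by (auto simp: W_def)
    finally show ?thesis .
  qed
  ultimately show ?thesis using that by blast
qed

section \<open>Fair matchings as functions\<close>

definition mm_count :: "'c set \<Rightarrow> ('c \<Rightarrow> nat) \<Rightarrow> nat" where
  "mm_count C f = Max (f ` C) - Min (f ` C)"

definition mov_count :: "'c set \<Rightarrow> ('c \<Rightarrow> nat) \<Rightarrow> nat" where
  "mov_count C f = (let xs = rev (sorted_list_of_multiset (image_mset f (mset_set C))) in xs ! 0 - xs ! 1)"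

lemma max_min_count: "max_min C col U' = mm_count C (color_count col U')"
  by (simp add: max_min_def mm_count_def)

lemma mov_count: "mov C col U' = mov_count C (color_count col U')"
  by (simp add: mov_def mov_count_def)

lemma mm_count_le:
  assumes "finite C" "C \<noteq> {}"
  shows "mm_count C f \<le> l \<longleftrightarrow> (\<forall>c\<in>C. \<forall>d\<in>C. f c \<le> f d + l)"
proof
  assume *: "mm_count C f \<le> l"
  show "\<forall>c\<in>C. \<forall>d\<in>C. f c \<le> f d + l"
  proof (intro ballI)
    fix c d assume "c \<in> C" "d \<in> C"
    then have "f c \<le> Max (f ` C)" "Min (f ` C) \<le> f d" using assms by auto
    then show "f c \<le> f d + l" using * by (simp add: mm_count_def)
  qed
next
  assume *: "\<forall>c\<in>C. \<forall>d\<in>C. f c \<le> f d + l"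
  have "Max (f ` C) \<in> f ` C" "Min (f ` C) \<in> f ` C" using assms by (auto intro: Max_in Min_in)
  then show "mm_count C f \<le> l" using * by (fastforce simp: mm_count_def le_diff_conv add.commute)
qed

lemma finite_arg_max:
  assumes "finite C" "C \<noteq> {}"
  obtains a where "a \<in> C" "\<And>e. e \<in> C \<Longrightarrow> f e \<le> (f a :: nat)"
proof -
  have "Max (f ` C) \<in> f ` C" using assms by (intro Max_in) auto
  then obtain a where "a \<in> C" "f a = Max (f ` C)" by force
  then show thesis using assms by (intro that[of a]) auto
qed

text \<open>Splitting off an index \<open>a\<close> of a largest count, and \<open>b\<close> of a
  largest count among the others, exhibits the sorted list as \<open>ys @ [f b, f a]\<close>. Any
  witnesses \<open>c\<close> and \<open>d\<close> differ, so one of them is not \<open>a\<close> and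
  has a count bounded by \<open>f b\<close>.\<close>

lemma mov_count_le:
  assumes C: "finite C" "2 \<le> card C"
  shows "mov_count C f \<le> l \<longleftrightarrow> (\<exists>c\<in>C. \<exists>d\<in>C. c \<noteq> d \<and> (\<forall>e\<in>C. f e \<le> f c) \<and> f c \<le> f d + l)"
proof -
  have "C \<noteq> {}" using C by auto
  then obtain a where a: "a \<in> C" "\<And>e. e \<in> C \<Longrightarrow> f e \<le> f a"
    using finite_arg_max[OF C(1)] by metis
  have C': "finite (C - {a})" "C - {a} \<noteq> {}"
  proof -
    have "card (C - {a}) > 0" using C a by (simp add: card_Diff_singleton_if)
    then show "C - {a} \<noteq> {}" by (metis card.empty less_irrefl)
  qed (use C in simp)
  then obtain b where b: "b \<in> C" "b \<noteq> a" "\<And>e. e \<in> C \<Longrightarrow> e \<noteq> a \<Longrightarrow> f e \<le> f b"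
    using finite_arg_max[OF C', of f] by (metis Diff_iff insert_iff empty_iff)
  define ys where "ys = sorted_list_of_multiset (image_mset f (mset_set (C - {a} - {b})))"
  have "mset_set C = add_mset a (add_mset b (mset_set (C - {a} - {b})))"
    using a b C by (metis C'(1) Diff_iff insert_iff empty_iff mset_set.remove)
  then have "image_mset f (mset_set C) = mset (ys @ [f b, f a])"
    by (simp add: ys_def)
  moreover have "sorted (ys @ [f b, f a])"
  proof -
    have "set ys \<subseteq> f ` (C - {a} - {b})" using C by (auto simp: ys_def)
    then have "\<forall>y\<in>set ys. y \<le> f b" using b by auto
    moreover have "f b \<le> f a" using a b by auto
    ultimately show ?thesis by (auto simp: sorted_append ys_def)
  qed
  ultimately have "sorted_list_of_multiset (image_mset f (mset_set C)) = ys @ [f b, f a]"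
    by (simp add: sorted_sort_id del: mset_append)
  then have "mov_count C f = f a - f b" by (simp add: mov_count_def)
  then have *: "mov_count C f \<le> l \<longleftrightarrow> f a \<le> f b + l" by auto
  show ?thesis
  proof
    assume "mov_count C f \<le> l"
    then show "\<exists>c\<in>C. \<exists>d\<in>C. c \<noteq> d \<and> (\<forall>e\<in>C. f e \<le> f c) \<and> f c \<le> f d + l"
      using * a b by metis
  next
    assume "\<exists>c\<in>C. \<exists>d\<in>C. c \<noteq> d \<and> (\<forall>e\<in>C. f e \<le> f c) \<and> f c \<le> f d + l"
    then obtain c d where cd: "c \<in> C" "d \<in> C" "c \<noteq> d" "\<forall>e\<in>C. f e \<le> f c" "f c \<le> f d + l" by blast
    have "f d \<le> f b \<or> f c \<le> f b" using b(3)[of c] b(3)[of d] cd by auto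
    moreover have "f a \<le> f c" using a cd by auto
    moreover have "f d \<le> f a" "f c \<le> f a" using a cd by auto
    ultimately show "mov_count C f \<le> l" unfolding * using cd(5) by linarith
  qed
qed

text \<open>Left-perfectness makes a matching the graph of a function, and disjoint sides orient its
  edges. The predicate \<open>Q\<close> makes room for the size bound.\<close>

lemma fair_matching_function:
  assumes I: "fair_instance I"
  shows "(\<exists>M. fair_solution \<Pi> I M \<and> (\<forall>v\<in>right_side I. Q (matched M v))) \<longleftrightarrow>
    (\<exists>\<phi>. (\<forall>u\<in>left_side I. \<phi> u \<in> right_side I \<and> {u, \<phi> u} \<in> edges I) \<and>
      (\<forall>v\<in>right_side I. \<Pi> (colors I) (coloring I) {u \<in> left_side I. \<phi> u = v} \<le> threshold I \<and>
         Q {u \<in> left_side I. \<phi> u = v}))"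
    (is "?L \<longleftrightarrow> ?R")
proof -
  have B: "left_side I \<inter> right_side I = {}"
    "\<And>e. e \<in> edges I \<Longrightarrow> \<exists>u v. e = {u, v} \<and> u \<in> left_side I \<and> v \<in> right_side I"
    using I by (auto simp: fair_instance_def bipartite_graph_def)
  show ?thesis
  proof
    assume ?L
    then obtain M where M: "fair_solution \<Pi> I M" "\<forall>v\<in>right_side I. Q (matched M v)" by blast
    then have ME: "M \<subseteq> edges I" and lp: "\<And>u. u \<in> left_side I \<Longrightarrow> card (matched M u) = 1"
      by (auto simp: fair_solution_def many_to_one_matching_def left_perfect_def)
    then have "\<exists>v. matched M u = {v}" if "u \<in> left_side I" for u
      using that by (simp add: card_1_singleton_iff)
    then obtain \<phi> where \<phi>: "\<And>u. u \<in> left_side I \<Longrightarrow> matched M u = {\<phi> u}" by metis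
    have edge: "{u, \<phi> u} \<in> M" if "u \<in> left_side I" for u
      using \<phi>[OF that] by (auto simp: matched_def)
    have right: "\<phi> u \<in> right_side I" if "u \<in> left_side I" for u
      using B(2)[of "{u, \<phi> u}"] edge[OF that] ME B(1) that by (auto simp: doubleton_eq_iff)
    have mv: "matched M v = {u \<in> left_side I. \<phi> u = v}" if "v \<in> right_side I" for v
    proof (intro set_eqI iffI)
      fix u assume "u \<in> matched M v"
      then have uv: "{v, u} \<in> M" by (simp add: matched_def)
      then have u: "u \<in> left_side I" using B(2)[of "{v, u}"] ME B(1) that by (auto simp: doubleton_eq_iff)
      moreover have "v \<in> matched M u" using uv by (simp add: matched_def insert_commute)
      ultimately show "u \<in> {u \<in> left_side I. \<phi> u = v}" using \<phi> by auto
    next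
      fix u assume "u \<in> {u \<in> left_side I. \<phi> u = v}"
      then show "u \<in> matched M v" using edge[of u] by (auto simp: matched_def insert_commute)
    qed
    show ?R
      using M mv edge right ME
      by (intro exI[of _ \<phi>]) (auto simp: fair_solution_def fair_matching_def fair_set_def)
  next
    assume ?R
    then obtain \<phi> where \<phi>: "\<And>u. u \<in> left_side I \<Longrightarrow> \<phi> u \<in> right_side I" "\<And>u. u \<in> left_side I \<Longrightarrow> {u, \<phi> u} \<in> edges I"
      and fair: "\<And>v. v \<in> right_side I \<Longrightarrow> \<Pi> (colors I) (coloring I) {u \<in> left_side I. \<phi> u = v} \<le> threshold I"
      "\<And>v. v \<in> right_side I \<Longrightarrow> Q {u \<in> left_side I. \<phi> u = v}" by blast
    define M where "M = (\<lambda>u. {u, \<phi> u}) ` left_side I"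
    have mu: "matched M u = {\<phi> u}" if "u \<in> left_side I" for u
      using that \<phi>(1) B(1) by (auto simp: matched_def M_def doubleton_eq_iff disjoint_iff)
    have mv: "matched M v = {u \<in> left_side I. \<phi> u = v}" if "v \<in> right_side I" for v
      using that \<phi>(1) B(1) by (auto simp: matched_def M_def doubleton_eq_iff disjoint_iff)
    have "fair_solution \<Pi> I M"
      using mu mv fair \<phi> by (auto simp: fair_solution_def many_to_one_matching_def left_perfect_def
          fair_matching_def fair_set_def M_def)
    then show ?L using mv fair by auto
  qed
qed

lemma has_fair_matching_function:
  assumes "fair_instance I"
  shows "has_fair_matching \<Pi> I \<longleftrightarrow>
    (\<exists>\<phi>. (\<forall>u\<in>left_side I. \<phi> u \<in> right_side I \<and> {u, \<phi> u} \<in> edges I) \<and>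
      (\<forall>v\<in>right_side I. \<Pi> (colors I) (coloring I) {u \<in> left_side I. \<phi> u = v} \<le> threshold I))"
  using fair_matching_function[OF assms, of \<Pi> "\<lambda>_. True"] by (simp add: has_fair_matching_def)

section \<open>Constructing instances\<close>

text \<open>For threshold 0, whose binary code is the empty word, so nothing follows the
  rows.\<close>

definition inst_bits :: "nat \<Rightarrow> 'a list \<Rightarrow> 'b list \<Rightarrow> ('a \<Rightarrow> nat) \<Rightarrow> ('a \<Rightarrow> 'b \<Rightarrow> bool) \<Rightarrow> bool list" where
  "inst_bits k Us Vs col adj = unary_enc (length Us) @ unary_enc (length Vs) @ unary_enc k @
     concat (map (\<lambda>u. map (\<lambda>c. col u = c) [0..<k] @ map (adj u) Vs) Us)"

definition fair_assignment :: "((nat \<Rightarrow> nat) \<Rightarrow> bool) \<Rightarrow> 'a list \<Rightarrow> 'b list \<Rightarrow> ('a \<Rightarrow> nat) \<Rightarrow> ('a \<Rightarrow> 'b \<Rightarrow> bool) \<Rightarrow> ('a \<Rightarrow> 'b) \<Rightarrow> bool" where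
  "fair_assignment P Us Vs col adj \<phi> \<longleftrightarrow> (\<forall>u\<in>set Us. \<phi> u \<in> set Vs \<and> adj u (\<phi> u)) \<and>
     (\<forall>v\<in>set Vs. P (\<lambda>c. card {u \<in> set Us. col u = c \<and> \<phi> u = v}))"

text \<open>Vertices are named by their positions, right vertices after left ones. Listing names in
  increasing order then reproduces the given lists, and the reductions may use vertices of any
  type.\<close>

lemma instance_exists:
  assumes Us: "distinct Us" and Vs: "distinct Vs" and col: "\<And>u. u \<in> set Us \<Longrightarrow> col u < k"
  shows "\<exists>I\<in>instances_with_colors k. instance_enc I = inst_bits k Us Vs col adj \<and> colors I = {0..<k} \<and>
    (\<forall>\<Pi> P. (\<forall>U'. \<Pi> {0..<k} (coloring I) U' \<le> 0 \<longleftrightarrow> P (color_count (coloring I) U')) \<longrightarrow>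
      (has_fair_matching \<Pi> I \<longleftrightarrow> (\<exists>\<phi>. fair_assignment P Us Vs col adj \<phi>)))"
proof -
  let ?N = "length Us" and ?N' = "length Vs"
  define I where "I = \<lparr>left_side = {0..<?N}, right_side = {?N..<?N + ?N'},
    edges = {{i, ?N + j} |i j. i < ?N \<and> j < ?N' \<and> adj (Us ! i) (Vs ! j)},
    colors = {0..<k}, coloring = (\<lambda>i. col (Us ! i)), threshold = 0\<rparr>"
  have edge: "{i, ?N + j} \<in> edges I \<longleftrightarrow> adj (Us ! i) (Vs ! j)" if "i < ?N" "j < ?N'" for i j
    using that by (auto simp: I_def doubleton_eq_iff)
  have I: "fair_instance I"
    using col unfolding fair_instance_def bipartite_graph_def I_def
    by (auto simp: subset_iff) (metis atLeastLessThan_iff le_add1 nat_add_left_cancel_less zero_le)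
  have "I \<in> instances_with_colors k" using I by (simp add: instances_with_colors_def) (simp add: I_def)
  moreover have "instance_enc I = inst_bits k Us Vs col adj"
  proof -
    have 1: "map (\<lambda>v. {i, v} \<in> edges I) [?N..<?N + ?N'] = map (adj (Us ! i)) Vs" if "i < ?N" for i
      using edge[OF that] by (intro nth_equalityI) auto
    have "concat (map (\<lambda>i. map (\<lambda>c. col (Us ! i) = c) [0..<k] @ map (\<lambda>v. {i, v} \<in> edges I) [?N..<?N + ?N']) [0..<?N])
      = concat (map (\<lambda>i. (\<lambda>u. map (\<lambda>c. col u = c) [0..<k] @ map (adj u) Vs) (Us ! i)) [0..<?N])"
      using 1 by (intro arg_cong[of _ _ concat] map_cong) auto
    also have "\<dots> = concat (map (\<lambda>u. map (\<lambda>c. col u = c) [0..<k] @ map (adj u) Vs) (map ((!) Us) [0..<?N]))"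
      unfolding map_map by (simp add: comp_def)
    also have "\<dots> = concat (map (\<lambda>u. map (\<lambda>c. col u = c) [0..<k] @ map (adj u) Vs) Us)"
      unfolding map_nth ..
    finally show ?thesis
      by (simp add: instance_enc_def inst_bits_def I_def nat_enc.simps sorted_list_of_set_range)
  qed
  moreover have "colors I = {0..<k}" by (simp add: I_def)
  moreover have "has_fair_matching \<Pi> I \<longleftrightarrow> (\<exists>\<phi>. fair_assignment P Us Vs col adj \<phi>)"
    if P: "\<And>U'. \<Pi> {0..<k} (coloring I) U' \<le> 0 \<longleftrightarrow> P (color_count (coloring I) U')" for \<Pi> P
  proof -
    have LR: "left_side I = {0..<?N}" "right_side I = {?N..<?N + ?N'}" "colors I = {0..<k}" "threshold I = 0"
      by (simp_all add: I_def)
    have cnt: "color_count (coloring I) {i \<in> {0..<?N}. \<psi> i = ?N + j} = (\<lambda>c. card {u \<in> set Us. col u = c \<and> \<phi> u = Vs ! j})"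
      if j: "j < ?N'" and eq: "\<And>i. i < ?N \<Longrightarrow> \<psi> i = ?N + j \<longleftrightarrow> \<phi> (Us ! i) = Vs ! j" for \<psi> \<phi> j
    proof
      fix c
      have "{u \<in> set Us. col u = c \<and> \<phi> u = Vs ! j} = (!) Us ` {i \<in> {i \<in> {0..<?N}. \<psi> i = ?N + j}. coloring I i = c}"
        using eq by (auto simp: I_def in_set_conv_nth)
      moreover have "inj_on ((!) Us) {i \<in> {i \<in> {0..<?N}. \<psi> i = ?N + j}. coloring I i = c}"
        using Us by (auto simp: inj_on_def nth_eq_iff_index_eq)
      ultimately show "color_count (coloring I) {i \<in> {0..<?N}. \<psi> i = ?N + j} c = card {u \<in> set Us. col u = c \<and> \<phi> u = Vs ! j}"
        by (simp add: color_count_def card_image)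
    qed
    show ?thesis unfolding has_fair_matching_function[OF I] LR
    proof
      assume "\<exists>\<psi>. (\<forall>u\<in>{0..<?N}. \<psi> u \<in> {?N..<?N + ?N'} \<and> {u, \<psi> u} \<in> edges I) \<and>
        (\<forall>v\<in>{?N..<?N + ?N'}. \<Pi> {0..<k} (coloring I) {u \<in> {0..<?N}. \<psi> u = v} \<le> 0)"
      then obtain \<psi> where *: "\<forall>u\<in>{0..<?N}. \<psi> u \<in> {?N..<?N + ?N'} \<and> {u, \<psi> u} \<in> edges I"
        "\<forall>v\<in>{?N..<?N + ?N'}. \<Pi> {0..<k} (coloring I) {u \<in> {0..<?N}. \<psi> u = v} \<le> 0" by blast
      have \<psi>: "\<And>i. i < ?N \<Longrightarrow> ?N \<le> \<psi> i \<and> \<psi> i < ?N + ?N' \<and> {i, \<psi> i} \<in> edges I"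
        using *(1) by simp
      have fair: "\<And>j. j < ?N' \<Longrightarrow> \<Pi> {0..<k} (coloring I) {i \<in> {0..<?N}. \<psi> i = ?N + j} \<le> 0"
        using *(2) by simp
      define ix where "ix = the_inv_into {0..<?N} ((!) Us)"
      have ix: "ix (Us ! i) = i" if "i < ?N" for i
        unfolding ix_def using Us that by (intro the_inv_into_f_f) (auto simp: inj_on_def nth_eq_iff_index_eq)
      define \<phi> where "\<phi> = (\<lambda>u. Vs ! (\<psi> (ix u) - ?N))"
      have \<phi>: "\<phi> (Us ! i) = Vs ! j \<longleftrightarrow> \<psi> i = ?N + j" if "i < ?N" "j < ?N'" for i j
        using that ix \<psi>[of i] Vs by (auto simp: \<phi>_def nth_eq_iff_index_eq)
      have "fair_assignment P Us Vs col adj \<phi>"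
        unfolding fair_assignment_def
      proof (intro conjI ballI)
        fix u assume "u \<in> set Us"
        then obtain i where i: "i < ?N" "u = Us ! i" by (auto simp: in_set_conv_nth)
        have "\<psi> i - ?N < ?N'" using \<psi>[OF i(1)] by auto
        moreover have "{i, ?N + (\<psi> i - ?N)} \<in> edges I" using \<psi>[OF i(1)] by simp
        ultimately show "\<phi> u \<in> set Vs" "adj u (\<phi> u)" using i edge[of i "\<psi> i - ?N"] ix by (auto simp: \<phi>_def)
      next
        fix v assume "v \<in> set Vs"
        then obtain j where j: "j < ?N'" "v = Vs ! j" by (auto simp: in_set_conv_nth)
        show "P (\<lambda>c. card {u \<in> set Us. col u = c \<and> \<phi> u = v})"
          using fair[OF j(1)] cnt[OF j(1), of \<psi> \<phi>] \<phi>[OF _ j(1)] unfolding P j by simp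
      qed
      then show "\<exists>\<phi>. fair_assignment P Us Vs col adj \<phi>" by blast
    next
      assume "\<exists>\<phi>. fair_assignment P Us Vs col adj \<phi>"
      then obtain \<phi> where \<phi>: "fair_assignment P Us Vs col adj \<phi>" by blast
      define ix where "ix = the_inv_into {0..<?N'} ((!) Vs)"
      have inj: "inj_on ((!) Vs) {0..<?N'}" using Vs by (auto simp: inj_on_def nth_eq_iff_index_eq)
      have im: "(!) Vs ` {0..<?N'} = set Vs" by (auto simp: in_set_conv_nth)
      have ix: "ix v < ?N'" "Vs ! ix v = v" if "v \<in> set Vs" for v
        using that the_inv_into_into[OF inj, of v "{0..<?N'}"] f_the_inv_into_f[OF inj, of v] im by (auto simp: ix_def)
      define \<psi> where "\<psi> = (\<lambda>i. ?N + ix (\<phi> (Us ! i)))"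
      have U: "\<phi> (Us ! i) \<in> set Vs" "adj (Us ! i) (\<phi> (Us ! i))" if "i < ?N" for i
        using \<phi> that by (auto simp: fair_assignment_def)
      have \<psi>: "\<psi> i = ?N + j \<longleftrightarrow> \<phi> (Us ! i) = Vs ! j" if "i < ?N" "j < ?N'" for i j
        using ix[OF U(1)[OF that(1)]] that Vs by (auto simp: \<psi>_def nth_eq_iff_index_eq)
      show "\<exists>\<psi>. (\<forall>u\<in>{0..<?N}. \<psi> u \<in> {?N..<?N + ?N'} \<and> {u, \<psi> u} \<in> edges I) \<and>
        (\<forall>v\<in>{?N..<?N + ?N'}. \<Pi> {0..<k} (coloring I) {u \<in> {0..<?N}. \<psi> u = v} \<le> 0)"
      proof (intro exI[of _ \<psi>] conjI ballI)
        fix i assume "i \<in> {0..<?N}"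
        then have i: "i < ?N" by simp
        show "\<psi> i \<in> {?N..<?N + ?N'}" using ix(1)[OF U(1)[OF i]] by (simp add: \<psi>_def)
        show "{i, \<psi> i} \<in> edges I" using edge[OF i ix(1)[OF U(1)[OF i]]] ix(2)[OF U(1)[OF i]] U(2)[OF i] by (simp add: \<psi>_def)
      next
        fix v assume "v \<in> {?N..<?N + ?N'}"
        then obtain j where j: "j < ?N'" "v = ?N + j" by (metis atLeastLessThan_iff le_Suc_ex nat_add_left_cancel_less)
        have "Vs ! j \<in> set Vs" using j by simp
        then have "P (\<lambda>c. card {u \<in> set Us. col u = c \<and> \<phi> u = Vs ! j})" using \<phi> by (simp add: fair_assignment_def)
        then show "\<Pi> {0..<k} (coloring I) {u \<in> {0..<?N}. \<psi> u = v} \<le> 0"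
          using cnt[OF j(1), of \<psi> \<phi>] \<psi>[OF _ j(1)] unfolding P j by simp
      qed
    qed
  qed
  ultimately show ?thesis by blast
qed

text \<open>Both reductions use full boxes of triples as vertex sets, which keeps the encoding
  uniform; surplus left vertices serve as fillers and surplus right vertices stay empty.\<close>

definition triples :: "nat \<Rightarrow> nat \<Rightarrow> nat \<Rightarrow> (nat \<times> nat \<times> nat) list" where
  "triples k n m = concat (map (\<lambda>a. concat (map (\<lambda>b. map (\<lambda>c. (a, b, c)) [0..<m]) [0..<n])) [0..<k])"

lemma set_triples: "set (triples k n m) = {..<k} \<times> {..<n} \<times> {..<m}"
proof -
  have "t \<in> set (triples k n m) \<longleftrightarrow> t \<in> {..<k} \<times> {..<n} \<times> {..<m}" for t
    by (cases t) (simp add: triples_def image_iff)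
  then show ?thesis by blast
qed

lemma distinct_triples: "distinct (triples k n m)"
proof -
  have "triples k n m = List.product [0..<k] (List.product [0..<n] [0..<m])"
    by (simp add: triples_def product_concat_map map_concat comp_def)
  then show ?thesis by (simp add: distinct_product)
qed

section \<open>From satisfiability to fair matchings\<close>

text \<open>The additional atom \<open>[]\<close> guarantees at least one variable.\<close>

definition atoms :: "clause list \<Rightarrow> nat list list" where
  "atoms F = fold (\<lambda>a s. if list_ex (\<lambda>b. b = a) s then s else a # s) ([] # concat (map (\<lambda>cl. fst cl @ snd cl) F)) []"

text \<open>Giving the truth value \<open>b\<close> to variable \<open>x\<close> satisfies clause
  \<open>j\<close>.\<close>

definition lit :: "clause list \<Rightarrow> nat \<Rightarrow> nat \<Rightarrow> bool \<Rightarrow> bool" where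
  "lit F x j b = list_ex (\<lambda>a. a = nth_default [] (atoms F) x)
     (if b then snd (nth_default ([], []) F j) else fst (nth_default ([], []) F j))"

lemma fold_insert_distinct:
  assumes "distinct s"
  shows "set (fold (\<lambda>a s. if list_ex (\<lambda>b. b = a) s then s else a # s) xs s) = set xs \<union> set s \<and>
    distinct (fold (\<lambda>a s. if list_ex (\<lambda>b. b = a) s then s else a # s) xs s)"
  using assms
proof (induction xs arbitrary: s)
  case (Cons x xs)
  show ?case
    using Cons.IH[of "if list_ex (\<lambda>b. b = x) s then s else x # s"] Cons.prems
    by (auto simp: list_ex_iff)
qed simp

lemma set_atoms: "set (atoms F) = insert [] (\<Union>cl\<in>set F. set (fst cl) \<union> set (snd cl))"
  and distinct_atoms: "distinct (atoms F)"
proof -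
  note * = fold_insert_distinct[of "[]" "[] # concat (map (\<lambda>cl. fst cl @ snd cl) F)", folded atoms_def]
  show "distinct (atoms F)" using * by simp
  have "set (atoms F) = set ([] # concat (map (\<lambda>cl. fst cl @ snd cl) F)) \<union> set []"
    by (rule *[THEN conjunct1]) simp
  then show "set (atoms F) = insert [] (\<Union>cl\<in>set F. set (fst cl) \<union> set (snd cl))" by simp
qed

lemma sat_lit:
  "(\<exists>\<nu>. \<forall>cl\<in>set F. sat \<nu> cl) \<longleftrightarrow> (\<exists>v. \<forall>j<length F. \<exists>x<length (atoms F). lit F x j (v x))"
proof
  assume "\<exists>\<nu>. \<forall>cl\<in>set F. sat \<nu> cl"
  then obtain \<nu> where \<nu>: "\<forall>cl\<in>set F. sat \<nu> cl" by blast
  have "\<exists>x<length (atoms F). lit F x j (\<nu> (atoms F ! x))" if j: "j < length F" for j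
  proof -
    from \<nu> j have sat: "sat \<nu> (F ! j)" by simp
    have "\<exists>a. a \<in> set (if \<nu> a then snd (F ! j) else fst (F ! j))"
    proof (cases "\<exists>a\<in>set (fst (F ! j)). \<not> \<nu> a")
      case True
      then obtain a where "a \<in> set (fst (F ! j))" "\<not> \<nu> a" by blast
      then show ?thesis by (intro exI[of _ a]) simp
    next
      case False
      then obtain a where "a \<in> set (snd (F ! j))" "\<nu> a" using sat by (auto simp: sat_def)
      then show ?thesis by (intro exI[of _ a]) simp
    qed
    then obtain a where a: "a \<in> set (if \<nu> a then snd (F ! j) else fst (F ! j))" by blast
    then have "a \<in> set (fst (F ! j)) \<union> set (snd (F ! j))" by (cases "\<nu> a") simp_all
    then have "a \<in> set (atoms F)" using nth_mem[OF j] unfolding set_atoms by blast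
    then obtain x where "x < length (atoms F)" "atoms F ! x = a" by (auto simp: in_set_conv_nth)
    moreover have "lit F x j (\<nu> a)" using a j calculation unfolding lit_def list_ex_iff nth_default_def
      by (cases "\<nu> a") simp_all
    ultimately show ?thesis by (intro exI[of _ x]) simp
  qed
  then show "\<exists>v. \<forall>j<length F. \<exists>x<length (atoms F). lit F x j (v x)"
    by (intro exI[of _ "\<lambda>x. \<nu> (atoms F ! x)"]) blast
next
  assume "\<exists>v. \<forall>j<length F. \<exists>x<length (atoms F). lit F x j (v x)"
  then obtain v where v: "\<And>j. j < length F \<Longrightarrow> \<exists>x<length (atoms F). lit F x j (v x)" by blast
  define \<nu> where "\<nu> = (\<lambda>a. \<exists>x<length (atoms F). atoms F ! x = a \<and> v x)"
  have \<nu>: "\<nu> (atoms F ! x) = v x" if "x < length (atoms F)" for x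
    using that distinct_atoms[of F] by (auto simp: \<nu>_def nth_eq_iff_index_eq)
  have "sat \<nu> cl" if cl: "cl \<in> set F" for cl
  proof -
    obtain j where j: "j < length F" "cl = F ! j" using cl by (metis in_set_conv_nth)
    obtain x where x: "x < length (atoms F)" "lit F x j (v x)" using v[OF j(1)] by blast
    have "atoms F ! x \<in> set (if v x then snd (F ! j) else fst (F ! j))"
      using x j unfolding lit_def list_ex_iff nth_default_def by (cases "v x") simp_all
    then show ?thesis using j(2) \<nu>[OF x(1)] unfolding sat_def by (cases "v x") auto
  qed
  then show "\<exists>\<nu>. \<forall>cl\<in>set F. sat \<nu> cl" by blast
qed

lemma ball_triples: "(\<forall>u\<in>{..<a} \<times> {..<b} \<times> {..<c}. Q u) \<longleftrightarrow> (\<forall>\<kappa><a. \<forall>x<b. \<forall>j<c. Q (\<kappa>, x, j))"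
  by auto

lemma mov_count_le_upt:
  fixes k :: nat
  assumes "2 \<le> k"
  shows "mov_count {0..<k} f \<le> l \<longleftrightarrow> (\<exists>c<k. \<exists>d<k. c \<noteq> d \<and> (\<forall>e<k. f e \<le> f c) \<and> f c \<le> f d + l)"
proof -
  have "2 \<le> card {0..<k}" using assms by simp
  note * = mov_count_le[OF finite_atLeastLessThan this, of f l]
  show ?thesis unfolding * Bex_def Ball_def atLeastLessThan_iff by blast
qed

definition adj3 :: "(nat \<Rightarrow> nat \<Rightarrow> nat \<Rightarrow> nat \<Rightarrow> nat \<Rightarrow> nat \<Rightarrow> bool) \<Rightarrow> nat \<times> nat \<times> nat \<Rightarrow> nat \<times> nat \<times> nat \<Rightarrow> bool" where
  "adj3 A u v = A (fst u) (fst (snd u)) (snd (snd u)) (fst v) (fst (snd v)) (snd (snd v))"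

subsection \<open>Margin of victory\<close>

text \<open>In a variable node \<open>(0, x, 0)\<close> there are \<open>m\<close> dedicated vertices of color 1, so with threshold 0
  it must receive all \<open>m\<close> vertices \<open>(0, x, j)\<close> of color 0 or all \<open>m\<close> vertices \<open>(1, x, j)\<close> of color 2; the
  others are free to satisfy clauses. A clause node \<open>(1, 0, j)\<close> has one dedicated vertex of color 1.
  The nodes \<open>(2, 0, 0)\<close> and \<open>(3, 0, 0)\<close> have enough dedicated vertices of two colors to take any
  number of unused vertices of the third color.\<close>

definition mov_col :: "nat \<Rightarrow> nat" where
  "mov_col \<kappa> = nth_default 0 [0, 2, 1, 0, 1, 1, 2] \<kappa>"

text \<open>The kinds \<kappa> are: 0 and 1 the copies of the positive and the negative literal, 2
  the dedicated vertices of variable nodes, 3 and 4 the fillers of node \<open>(2, 0, 0)\<close>, 5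
  with \<open>x = 0\<close> the dedicated vertex of a clause node. The vertices of kinds 5 and 6
  with \<open>x > 0\<close> fill node \<open>(3, 0, 0)\<close>; those of kind 6 with
  \<open>x = 0\<close> have no purpose of their own and go to \<open>(2, 0, 0)\<close>.\<close>

definition mov_adj :: "(nat \<Rightarrow> nat \<Rightarrow> bool \<Rightarrow> bool) \<Rightarrow> nat \<Rightarrow> nat \<Rightarrow> nat \<Rightarrow> nat \<Rightarrow> nat \<Rightarrow> nat \<Rightarrow> bool" where
  "mov_adj li \<kappa> x j \<beta> y i \<longleftrightarrow>
     (if \<kappa> = 0 then (\<beta> = 0 \<and> y = x \<and> i = 0) \<or> (\<beta> = 3 \<and> y = 0 \<and> i = 0) \<or> (\<beta> = 1 \<and> y = 0 \<and> i = j \<and> li x j True)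
      else if \<kappa> = 1 then (\<beta> = 0 \<and> y = x \<and> i = 0) \<or> (\<beta> = 2 \<and> y = 0 \<and> i = 0) \<or> (\<beta> = 1 \<and> y = 0 \<and> i = j \<and> li x j False)
      else if \<kappa> = 2 then \<beta> = 0 \<and> y = x \<and> i = 0
      else if \<kappa> = 3 \<or> \<kappa> = 4 then \<beta> = 2 \<and> y = 0 \<and> i = 0
      else if \<kappa> = 5 then (if x = 0 then \<beta> = 1 \<and> y = 0 \<and> i = j else \<beta> = 3 \<and> y = 0 \<and> i = 0)
      else (if x = 0 then \<beta> = 2 \<and> y = 0 \<and> i = 0 else \<beta> = 3 \<and> y = 0 \<and> i = 0))"

lemma mov_col: "\<kappa> < 7 \<Longrightarrow> mov_col \<kappa> = 0 \<longleftrightarrow> \<kappa> = 0 \<or> \<kappa> = 3"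
  "\<kappa> < 7 \<Longrightarrow> mov_col \<kappa> = Suc 0 \<longleftrightarrow> \<kappa> = 2 \<or> \<kappa> = 4 \<or> \<kappa> = 5"
  "\<kappa> < 7 \<Longrightarrow> mov_col \<kappa> = 2 \<longleftrightarrow> \<kappa> = 1 \<or> \<kappa> = 6"
  "mov_col \<kappa> < 3"
  by (auto simp: mov_col_def nth_default_def numeral_eq_Suc less_Suc_eq)

lemma mov_col_simps [simp]: "mov_col 0 = 0" "mov_col (Suc 0) = 2" "mov_col 2 = 1" "mov_col 3 = 0"
  "mov_col 4 = 1" "mov_col 5 = 1" "mov_col 6 = 2"
  by (simp_all add: mov_col_def nth_default_def)

locale mov_reduction =
  fixes n m k :: nat and li :: "nat \<Rightarrow> nat \<Rightarrow> bool \<Rightarrow> bool"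
  assumes nm: "1 \<le> n" "1 \<le> m" "3 \<le> k"
begin

definition S :: "(nat \<times> nat \<times> nat \<Rightarrow> nat \<times> nat \<times> nat) \<Rightarrow> nat \<times> nat \<times> nat \<Rightarrow> nat \<Rightarrow> (nat \<times> nat \<times> nat) set" where
  "S \<phi> v c = {u \<in> {..<7} \<times> {..<n} \<times> {..<m}. mov_col (fst u) = c \<and> \<phi> u = v}"

lemma mem_S: "(\<kappa>, x, j) \<in> S \<phi> v c \<longleftrightarrow> \<kappa> < 7 \<and> x < n \<and> j < m \<and> mov_col \<kappa> = c \<and> \<phi> (\<kappa>, x, j) = v"
  by (simp add: S_def)

lemma S_iff:
  "t \<in> S \<phi> v 0 \<longleftrightarrow> (\<exists>x j. t = (0, x, j) \<and> x < n \<and> j < m \<and> \<phi> (0, x, j) = v) \<or>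
     (\<exists>x j. t = (3, x, j) \<and> x < n \<and> j < m \<and> \<phi> (3, x, j) = v)"
  "t \<in> S \<phi> v (Suc 0) \<longleftrightarrow> (\<exists>x j. t = (2, x, j) \<and> x < n \<and> j < m \<and> \<phi> (2, x, j) = v) \<or>
     (\<exists>x j. t = (4, x, j) \<and> x < n \<and> j < m \<and> \<phi> (4, x, j) = v) \<or>
     (\<exists>x j. t = (5, x, j) \<and> x < n \<and> j < m \<and> \<phi> (5, x, j) = v)"
  "t \<in> S \<phi> v 2 \<longleftrightarrow> (\<exists>x j. t = (Suc 0, x, j) \<and> x < n \<and> j < m \<and> \<phi> (Suc 0, x, j) = v) \<or>
     (\<exists>x j. t = (6, x, j) \<and> x < n \<and> j < m \<and> \<phi> (6, x, j) = v)"
  by (cases t; auto simp: S_def mov_col)+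

lemma finite_S: "finite (S \<phi> v c)"
  by (simp add: S_def)

lemma S_other: "2 < c \<Longrightarrow> S \<phi> v c = {}"
proof -
  assume c: "2 < c"
  have "u \<notin> S \<phi> v c" for u using mov_col(4)[of "fst u"] c by (auto simp: S_def)
  then show ?thesis by blast
qed

abbreviation fair :: "(nat \<times> nat \<times> nat \<Rightarrow> nat \<times> nat \<times> nat) \<Rightarrow> bool" where
  "fair \<phi> \<equiv> fair_assignment (\<lambda>f. mov_count {0..<k} f \<le> 0) (triples 7 n m) (triples 4 n m)
     (\<lambda>u. mov_col (fst u)) (adj3 (mov_adj li)) \<phi>"

lemma fair_iff: "fair \<phi> \<longleftrightarrow>
   (\<forall>\<kappa><7. \<forall>x<n. \<forall>j<m. \<phi> (\<kappa>, x, j) \<in> {..<4} \<times> {..<n} \<times> {..<m} \<and> adj3 (mov_adj li) (\<kappa>, x, j) (\<phi> (\<kappa>, x, j))) \<and>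
   (\<forall>v\<in>{..<4} \<times> {..<n} \<times> {..<m}. \<exists>c<k. \<exists>d<k. c \<noteq> d \<and> (\<forall>e<k. card (S \<phi> v e) \<le> card (S \<phi> v c)) \<and>
      card (S \<phi> v c) \<le> card (S \<phi> v d))"
proof -
  have 1: "fair \<phi> \<longleftrightarrow>
    (\<forall>u\<in>{..<7} \<times> {..<n} \<times> {..<m}. \<phi> u \<in> {..<4} \<times> {..<n} \<times> {..<m} \<and> adj3 (mov_adj li) u (\<phi> u)) \<and>
    (\<forall>v\<in>{..<4} \<times> {..<n} \<times> {..<m}. mov_count {0..<k} (\<lambda>c. card (S \<phi> v c)) \<le> 0)"
    unfolding fair_assignment_def set_triples S_def by (rule refl)
  have "2 \<le> k" using nm by simp
  note 2 = mov_count_le_upt[OF this, of "\<lambda>c. card (S \<phi> v c)" 0 for v, unfolded add_0_right]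
  show ?thesis unfolding 1 2 by (subst ball_triples) (rule refl)
qed

lemma sound:
  assumes "fair \<phi>"
  shows "\<exists>v. \<forall>j<m. \<exists>x<n. li x j (v x)"
proof -
  have A: "adj3 (mov_adj li) (\<kappa>, x, j) (\<phi> (\<kappa>, x, j))" if "\<kappa> < 7" "x < n" "j < m" for \<kappa> x j
    using assms[unfolded fair_iff, THEN conjunct1, rule_format, OF that] by blast
  \<comment> \<open>The maximum is attained by two colors, one of which differs from color
    1.\<close>
  have F: "\<exists>e. e \<noteq> 1 \<and> card (S \<phi> v 1) \<le> card (S \<phi> v e)" if v: "v \<in> {..<4} \<times> {..<n} \<times> {..<m}" for v
  proof -
    obtain c d where cd: "c \<noteq> d" "\<forall>e<k. card (S \<phi> v e) \<le> card (S \<phi> v c)" "card (S \<phi> v c) \<le> card (S \<phi> v d)"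
      using bspec[OF assms[unfolded fair_iff, THEN conjunct2] v] by blast
    have "card (S \<phi> v 1) \<le> card (S \<phi> v c)" using cd(2) nm by simp
    then show ?thesis using cd(1,3) by (cases "c = 1") (auto intro: exI[of _ c] exI[of _ d])
  qed
  \<comment> \<open>The \<open>m\<close> dedicated vertices demand \<open>m\<close> vertices of
    another color, and each of the other two colors has only the \<open>m\<close> copies of one
    literal to offer.\<close>
  have full: "(\<forall>j<m. \<phi> (0, x, j) = (0, x, 0)) \<or> (\<forall>j<m. \<phi> (1, x, j) = (0, x, 0))" if x: "x < n" for x
  proof -
    have "(\<lambda>j. (2, x, j)) ` {..<m} \<subseteq> S \<phi> (0, x, 0) 1"
      using A[of 2 x] x by (auto simp: mem_S mov_col adj3_def mov_adj_def prod_eq_iff)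
    then have "card ((\<lambda>j. (2::nat, x, j)) ` {..<m}) \<le> card (S \<phi> (0, x, 0) 1)"
      by (rule card_mono[OF finite_S])
    then have m1: "m \<le> card (S \<phi> (0, x, 0) 1)" by (simp add: card_image inj_on_def)
    obtain e where e: "e \<noteq> 1" "m \<le> card (S \<phi> (0, x, 0) e)"
      using F[of "(0, x, 0)"] m1 x nm by (auto intro: le_trans)
    have "e = 0 \<or> e = 2"
    proof (rule ccontr)
      assume "\<not> (e = 0 \<or> e = 2)"
      then have "2 < e" using e(1) by linarith
      then show False using S_other[of e] e(2) nm by simp
    qed
    then obtain \<kappa> where \<kappa>: "\<kappa> = 0 \<or> \<kappa> = 1" "e = 2 * \<kappa>" by auto
    have sub: "S \<phi> (0, x, 0) e \<subseteq> (\<lambda>j. (\<kappa>, x, j)) ` {..<m}"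
      using \<kappa>(1)
    proof
      assume "\<kappa> = 0"
      then show ?thesis
        using A[of 0] A[of 3] unfolding \<kappa>(2) by (fastforce simp: S_iff adj3_def mov_adj_def)
    next
      assume "\<kappa> = 1"
      then show ?thesis
        using A[of 1] A[of 6] unfolding \<kappa>(2) by (fastforce simp: S_iff adj3_def mov_adj_def split: if_splits)
    qed
    have "card ((\<lambda>j. (\<kappa>, x, j)) ` {..<m}) = m" by (simp add: card_image inj_on_def)
    then have "S \<phi> (0, x, 0) e = (\<lambda>j. (\<kappa>, x, j)) ` {..<m}"
      using sub e(2) by (intro card_seteq) auto
    then have "(\<kappa>, x, j) \<in> S \<phi> (0, x, 0) e" if "j < m" for j using that by auto
    then have "\<forall>j<m. \<phi> (\<kappa>, x, j) = (0, x, 0)" by (simp add: mem_S)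
    then show ?thesis using \<kappa> by auto
  qed
  \<comment> \<open>A variable is false if its node holds all positive copies. Otherwise
    \<open>full\<close> keeps all negative copies there. Either way only copies of the true literal
    reach clause nodes.\<close>
  define v where "v = (\<lambda>x. \<not> (\<forall>j<m. \<phi> (0, x, j) = (0, x, 0)))"
  have "\<exists>x<n. li x j (v x)" if j: "j < m" for j
  proof -
    have "(5, 0, j) \<in> S \<phi> (1, 0, j) 1"
      using A[of 5 0 j] j nm by (auto simp: mem_S mov_col adj3_def mov_adj_def prod_eq_iff)
    then have "card (S \<phi> (1, 0, j) 1) > 0" using finite_S card_gt_0_iff by blast
    moreover obtain e where e: "e \<noteq> 1" "card (S \<phi> (1, 0, j) 1) \<le> card (S \<phi> (1, 0, j) e)"
      using F[of "(1, 0, j)"] j nm by auto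
    ultimately have "S \<phi> (1, 0, j) e \<noteq> {}" by auto
    then obtain \<kappa> x j' where u: "(\<kappa>, x, j') \<in> S \<phi> (1, 0, j) e" by (metis all_not_in_conv prod_cases3)
    have "e = 0 \<or> e = 2" using u e(1) S_other[of e] by (cases "2 < e") (auto)
    then have "(\<kappa> = 0 \<and> li x j True \<or> \<kappa> = 1 \<and> li x j False) \<and> j' = j \<and> x < n"
    proof
      assume "e = 0"
      then show ?thesis using u A[of 0 x j'] A[of 3 x j'] by (auto simp: S_iff adj3_def mov_adj_def)
    next
      assume "e = 2"
      then show ?thesis using u A[of 1 x j'] A[of 6 x j']
        by (auto simp: S_iff adj3_def mov_adj_def split: if_splits)
    qed
    moreover have "\<phi> (\<kappa>, x, j') = (1, 0, j)" using u by (simp add: mem_S)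
    moreover have "v x" if "\<phi> (0, x, j) = (1, 0, j)" using that j unfolding v_def by auto
    moreover have "\<not> v x" if "x < n" "\<phi> (1, x, j) = (1, 0, j)" using full[OF that(1)] that(2) j unfolding v_def by auto
    ultimately have "x < n \<and> li x j (v x)" by (elim conjE disjE) simp_all
    then show ?thesis by (rule exI[of _ x])
  qed
  then show ?thesis by (intro exI[of _ v]) simp
qed

lemma complete:
  assumes "\<And>j. j < m \<Longrightarrow> \<exists>x<n. li x j (v x)"
  shows "\<exists>\<phi>. fair \<phi>"
proof -
  \<comment> \<open>\<open>w j\<close> is a variable whose value satisfies clause \<open>j\<close>;
    one copy of its true literal is sent there.\<close>
  from assms obtain w where w: "\<And>j. j < m \<Longrightarrow> w j < n \<and> li (w j) j (v (w j))" by metis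
  define \<phi> where "\<phi> = (\<lambda>(\<kappa>::nat, x::nat, j::nat). if \<kappa> = 0 \<or> \<kappa> = 1 then
      (if (\<kappa> = 0) \<noteq> v x then (0, x, 0) else if w j = x then (1, 0, j) else if \<kappa> = 0 then (3, 0, 0) else (2, 0, 0))
    else if \<kappa> = 2 then (0, x, 0)
    else if \<kappa> = 3 \<or> \<kappa> = 4 then (2, 0, 0)
    else if \<kappa> = 5 then (if x = 0 then (1, 0, j) else (3, 0, 0))
    else (if x = 0 then (2, 0, 0) else (3::nat, 0::nat, 0::nat)))"
  have \<phi>_eqs: "\<phi> (0, x, j) = (if v x then if w j = x then (1, 0, j) else (3, 0, 0) else (0, x, 0))"
    "\<phi> (Suc 0, x, j) = (if v x then (0, x, 0) else if w j = x then (1, 0, j) else (2, 0, 0))"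
    "\<phi> (2, x, j) = (0, x, 0)" "\<phi> (3, x, j) = (2, 0, 0)" "\<phi> (4, x, j) = (2, 0, 0)"
    "\<phi> (5, x, j) = (if x = 0 then (1, 0, j) else (3, 0, 0))"
    "\<phi> (6, x, j) = (if x = 0 then (2, 0, 0) else (3, 0, 0))" for x j
    by (simp_all add: \<phi>_def)
  have \<phi>: "\<phi> (\<kappa>, x, j) \<in> {..<4} \<times> {..<n} \<times> {..<m} \<and> adj3 (mov_adj li) (\<kappa>, x, j) (\<phi> (\<kappa>, x, j))"
    if "\<kappa> < 7" "x < n" "j < m" for \<kappa> x j
  proof -
    have "\<kappa> = 0 \<or> \<kappa> = Suc 0 \<or> \<kappa> = 2 \<or> \<kappa> = 3 \<or> \<kappa> = 4 \<or> \<kappa> = 5 \<or> \<kappa> = 6" using that by linarith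
    then show ?thesis using that nm w[of j]
      by (elim disjE) (auto simp: \<phi>_eqs adj3_def mov_adj_def)
  qed
  have le: "card (S \<phi> u e) \<le> c" if "e < 3 \<Longrightarrow> card (S \<phi> u e) \<le> c" for u e c
    using that S_other[of e \<phi> u] by (cases "2 < e") auto
  have e3: "e = 0 \<or> e = 1 \<or> e = 2" if "e < 3" for e :: nat using that by auto
  have "\<exists>c<k. \<exists>d<k. c \<noteq> d \<and> (\<forall>e<k. card (S \<phi> u e) \<le> card (S \<phi> u c)) \<and> card (S \<phi> u c) \<le> card (S \<phi> u d)"
    if u: "u \<in> {..<4} \<times> {..<n} \<times> {..<m}" for u
  proof -
    have *: ?thesis if "c < 3" "d < 3" "c \<noteq> d" "card (S \<phi> u c) = card (S \<phi> u d)"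
      "\<And>e. e < 3 \<Longrightarrow> card (S \<phi> u e) \<le> card (S \<phi> u c)" for c d
    proof -
      have "c < k" "d < k" using that nm by linarith+
      moreover have "card (S \<phi> u e) \<le> card (S \<phi> u c)" for e by (rule le) (rule that(5))
      ultimately show ?thesis using that(3,4) by (metis le_refl)
    qed
    obtain \<beta> y i where uu: "u = (\<beta>, y, i)" by (metis prod_cases3)
    then have y: "\<beta> < 4" "y < n" "i < m" using u by auto
    then consider "\<beta> = 0" "i = 0" | "\<beta> = 1" "y = 0" | "\<beta> = 2" "y = 0" "i = 0" | "\<beta> = 3" "y = 0" "i = 0"
      | "\<beta> = 0 \<and> i \<noteq> 0 \<or> \<beta> = 1 \<and> y \<noteq> 0 \<or> 2 \<le> \<beta> \<and> (y \<noteq> 0 \<or> i \<noteq> 0)" by fastforce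
    then show ?thesis
    proof cases
      case 1
      have s1: "S \<phi> u 1 = (\<lambda>j. (2, y, j)) ` {..<m}"
        using y 1 by (auto simp: S_iff uu \<phi>_eqs split: if_splits)
      define \<kappa> where "\<kappa> = (if v y then 1 else 0 :: nat)"
      have s2: "S \<phi> u (2 * \<kappa>) = (\<lambda>j. (\<kappa>, y, j)) ` {..<m}"
        using y 1 by (cases "v y") (auto simp: S_iff uu \<phi>_eqs \<kappa>_def split: if_splits)
      have s3: "S \<phi> u (2 - 2 * \<kappa>) = {}"
        using y 1 by (cases "v y") (auto simp: S_iff uu \<phi>_eqs \<kappa>_def split: if_splits)
      have c: "card (S \<phi> u 1) = m" "card (S \<phi> u (2 * \<kappa>)) = m"
        unfolding s1 s2 by (simp_all add: card_image inj_on_def)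
      show ?thesis
      proof (rule *[of 1 "2 * \<kappa>"])
        fix e :: nat assume "e < 3"
        then have "e = 1 \<or> e = 2 * \<kappa> \<or> e = 2 - 2 * \<kappa>" by (auto simp: \<kappa>_def)
        then show "card (S \<phi> u e) \<le> card (S \<phi> u 1)" using c s3 by auto
      qed (use c in \<open>auto simp: \<kappa>_def\<close>)
    next
      case 2
      define \<kappa> where "\<kappa> = (if v (w i) then 0 else 1 :: nat)"
      have s1: "S \<phi> u 1 = {(5, 0, i)}"
        using y 2 nm by (auto simp: S_iff uu \<phi>_eqs split: if_splits)
      have s2: "S \<phi> u (2 * \<kappa>) = {(\<kappa>, w i, i)}"
        using y 2 w[of i] by (cases "v (w i)") (auto simp: S_iff uu \<phi>_eqs \<kappa>_def split: if_splits)
      have s3: "S \<phi> u (2 - 2 * \<kappa>) = {}"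
        using y 2 by (cases "v (w i)") (auto simp: S_iff uu \<phi>_eqs \<kappa>_def split: if_splits)
      show ?thesis
      proof (rule *[of 1 "2 * \<kappa>"])
        fix e :: nat assume "e < 3"
        then have "e = 1 \<or> e = 2 * \<kappa> \<or> e = 2 - 2 * \<kappa>" by (auto simp: \<kappa>_def)
        then show "card (S \<phi> u e) \<le> card (S \<phi> u 1)" using s1 s2 s3 by auto
      qed (use s1 s2 in \<open>auto simp: \<kappa>_def\<close>)
    next
      case 3
      have s0: "S \<phi> u 0 = {3} \<times> {..<n} \<times> {..<m}"
        using 3 by (auto simp: S_iff uu \<phi>_eqs split: if_splits)
      have s1: "S \<phi> u 1 = {4} \<times> {..<n} \<times> {..<m}"
        using 3 by (auto simp: S_iff uu \<phi>_eqs split: if_splits)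
      \<comment> \<open>For each clause the copy belonging to variable \<open>w j\<close> is
        missing: it is at the clause node or at its variable node. So at most \<open>n - 1\<close>
        free copies per clause remain, plus the \<open>m\<close> vertices of kind 6.\<close>
      have "S \<phi> u 2 \<subseteq> (\<lambda>j. (6, 0, j)) ` {..<m} \<union> (\<lambda>(j, x). (1, x, j)) ` (SIGMA j:{..<m}. {..<n} - {w j})"
        using 3 by (auto simp: S_iff uu \<phi>_eqs image_iff split: if_splits)
      then have "card (S \<phi> u 2) \<le> card ((\<lambda>j. (6::nat, 0::nat, j)) ` {..<m} \<union> (\<lambda>(j, x). (1, x, j)) ` (SIGMA j:{..<m}. {..<n} - {w j}))"
        by (intro card_mono) auto
      also have "\<dots> \<le> m + (\<Sum>j<m. n - 1)"
      proof (rule order_trans[OF card_Un_le add_mono])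
        show "card ((\<lambda>j. (6::nat, 0::nat, j)) ` {..<m}) \<le> m" using card_image_le[of "{..<m}" "\<lambda>j. (6::nat, 0::nat, j)"] by simp
        have "card ((\<lambda>(j, x). (1::nat, x, j)) ` (SIGMA j:{..<m}. {..<n} - {w j})) \<le> card (SIGMA j:{..<m}. {..<n} - {w j})"
          by (intro card_image_le) auto
        also have "\<dots> = (\<Sum>j<m. n - 1)" using w by (simp add: card_SigmaI card_Diff_singleton_if)
        finally show "card ((\<lambda>(j, x). (1::nat, x, j)) ` (SIGMA j:{..<m}. {..<n} - {w j})) \<le> (\<Sum>j<m. n - 1)" .
      qed
      also have "\<dots> = n * m" using nm by (cases n) auto
      finally have c2: "card (S \<phi> u 2) \<le> n * m" .
      show ?thesis
      proof (rule *[of 0 1])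
        fix e :: nat assume "e < 3"
        from e3[OF this] show "card (S \<phi> u e) \<le> card (S \<phi> u 0)"
          using s0 s1 c2 by (elim disjE) (simp_all add: card_cartesian_product)
      qed (use s0 s1 in \<open>simp_all add: card_cartesian_product\<close>)
    next
      case 4
      have s1: "S \<phi> u 1 = {5} \<times> {1..<n} \<times> {..<m}"
        using 4 by (auto simp: S_iff uu \<phi>_eqs split: if_splits)
      have s2: "S \<phi> u 2 = {6} \<times> {1..<n} \<times> {..<m}"
        using 4 by (auto simp: S_iff uu \<phi>_eqs split: if_splits)
      have "S \<phi> u 0 \<subseteq> (\<lambda>(j, x). (0, x, j)) ` (SIGMA j:{..<m}. {..<n} - {w j})"
        using 4 by (auto simp: S_iff uu \<phi>_eqs image_iff split: if_splits)
      then have "card (S \<phi> u 0) \<le> card ((\<lambda>(j, x). (0::nat, x, j)) ` (SIGMA j:{..<m}. {..<n} - {w j}))"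
        by (intro card_mono) auto
      also have "\<dots> \<le> card (SIGMA j:{..<m}. {..<n} - {w j})" by (intro card_image_le) auto
      also have "\<dots> = (\<Sum>j<m. n - 1)" using w by (simp add: card_SigmaI card_Diff_singleton_if)
      also have "\<dots> = (n - 1) * m" by simp
      finally have c0: "card (S \<phi> u 0) \<le> (n - 1) * m" .
      show ?thesis
      proof (rule *[of 1 2])
        fix e :: nat assume "e < 3"
        from e3[OF this] show "card (S \<phi> u e) \<le> card (S \<phi> u 1)"
          using s1 s2 c0 by (elim disjE) (simp_all add: card_cartesian_product)
      qed (use s1 s2 in \<open>simp_all add: card_cartesian_product\<close>)
    next
      case 5
      then have "S \<phi> u 0 = {}" "S \<phi> u (Suc 0) = {}" "S \<phi> u 2 = {}"
        by (auto simp: S_iff uu \<phi>_eqs split: if_splits)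
      note s = this
      show ?thesis
      proof (rule *[of 0 1])
        fix e :: nat assume "e < 3"
        from e3[OF this] show "card (S \<phi> u e) \<le> card (S \<phi> u 0)"
          using s by (elim disjE) simp_all
      qed (use s in simp_all)
    qed
  qed
  note nodes = this
  have "fair \<phi>" unfolding fair_iff
  proof (intro conjI[OF _ ballI] allI impI)
    show "\<phi> (\<kappa>, x, j) \<in> {..<4} \<times> {..<n} \<times> {..<m} \<and> adj3 (mov_adj li) (\<kappa>, x, j) (\<phi> (\<kappa>, x, j))"
      if "\<kappa> < 7" "x < n" "j < m" for \<kappa> x j by (rule \<phi>[OF that])
  qed (rule nodes)
  then show ?thesis by (rule exI[of _ \<phi>])
qed

lemma correct: "(\<exists>\<phi>. fair \<phi>) \<longleftrightarrow> (\<exists>v. \<forall>j<m. \<exists>x<n. li x j (v x))"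
proof
  assume "\<exists>\<phi>. fair \<phi>"
  then show "\<exists>v. \<forall>j<m. \<exists>x<n. li x j (v x)" by (elim exE) (rule sound)
next
  assume "\<exists>v. \<forall>j<m. \<exists>x<n. li x j (v x)"
  then obtain v where "\<forall>j<m. \<exists>x<n. li x j (v x)" by (elim exE)
  then show "\<exists>\<phi>. fair \<phi>" by (intro complete[of v]) simp
qed

end

subsection \<open>Difference of maximum and minimum\<close>

text \<open>With threshold 0 this is three-dimensional matching: the nodes \<open>(0, x, j)\<close> and \<open>(1, x, j)\<close> form for each
  variable a wheel, whose vertices \<open>(0, x, j)\<close> and \<open>(1, x, j)\<close> of colors 0 and 1 can only be matched to all
  nodes of the first or to all nodes of the second kind. These nodes also need their tips
  \<open>(\<kappa>, x, j)\<close>, one for each other color, while the tips of the remaining nodes are free to go to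
  clause nodes \<open>(2, 0, j)\<close>. Free tips that are not used there go to the node \<open>(3, 0, 0)\<close>.\<close>

definition mm_col :: "nat \<Rightarrow> nat \<Rightarrow> nat" where
  "mm_col k \<kappa> = nth_default 0 (map (\<lambda>\<kappa>. if \<kappa> < 4 then \<kappa> mod 2 else \<kappa> div 2) [0..<2 * k]) \<kappa>"

text \<open>For fixed \<open>k\<close> the table is a constant, and list access is already known to
  be polynomial.\<close>

definition mm_par :: "nat \<Rightarrow> nat \<Rightarrow> nat" where
  "mm_par k \<kappa> = nth_default 0 (map (\<lambda>\<kappa>. \<kappa> mod 2) [0..<2 * k]) \<kappa>"

text \<open>Kinds 0 and 1 are the wheel vertices, and kinds \<open>2 * c\<close> and
  \<open>2 * c + 1\<close> the tips of color \<open>c \<ge> 2\<close> for the two kinds of wheel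
  nodes. Kinds 2 and 3 supply the colors 0 and 1 missing elsewhere: for \<open>x = 0\<close> at the
  clause nodes, for \<open>x > 0\<close> at the collector \<open>(3, 0, 0)\<close>.\<close>

definition mm_adj :: "nat \<Rightarrow> nat \<Rightarrow> (nat \<Rightarrow> nat \<Rightarrow> bool \<Rightarrow> bool) \<Rightarrow> nat \<Rightarrow> nat \<Rightarrow> nat \<Rightarrow> nat \<Rightarrow> nat \<Rightarrow> nat \<Rightarrow> bool" where
  "mm_adj k m li \<kappa> x j \<beta> y i \<longleftrightarrow>
     (if \<kappa> = 0 then (\<beta> = 0 \<or> \<beta> = 1) \<and> y = x \<and> i = j
      else if \<kappa> = 1 then y = x \<and> ((\<beta> = 1 \<and> i = j) \<or> (\<beta> = 0 \<and> i = (if Suc j = m then 0 else Suc j)))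
      else if \<kappa> = 2 \<or> \<kappa> = 3 then (if x = 0 then \<beta> = 2 \<and> y = 0 \<and> i = j else \<beta> = 3 \<and> y = 0 \<and> i = 0)
      else (\<beta> = mm_par k \<kappa> \<and> y = x \<and> i = j) \<or> (\<beta> = 3 \<and> y = 0 \<and> i = 0) \<or>
        (\<beta> = 2 \<and> y = 0 \<and> i = j \<and> li x j (mm_par k \<kappa> = 1)))"

lemma mm_par: "c < k \<Longrightarrow> mm_par k (2 * c) = 0" "c < k \<Longrightarrow> mm_par k (Suc (2 * c)) = 1"
  by (simp_all add: mm_par_def nth_default_def)

lemma mm_col:
  assumes "\<kappa> < 2 * k"
  shows "mm_col k \<kappa> = c \<longleftrightarrow> (c = 0 \<and> (\<kappa> = 0 \<or> \<kappa> = 2)) \<or> (c = 1 \<and> (\<kappa> = 1 \<or> \<kappa> = 3)) \<or>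
    (2 \<le> c \<and> (\<kappa> = 2 * c \<or> \<kappa> = Suc (2 * c)))"
proof -
  have "mm_col k \<kappa> = (if \<kappa> < 4 then \<kappa> mod 2 else \<kappa> div 2)"
    using assms by (simp add: mm_col_def nth_default_def)
  moreover have "\<kappa> = 0 \<or> \<kappa> = 1 \<or> \<kappa> = 2 \<or> \<kappa> = 3 \<or> \<not> \<kappa> < 4" by linarith
  moreover have "\<kappa> div 2 = c \<longleftrightarrow> \<kappa> = 2 * c \<or> \<kappa> = Suc (2 * c)" by linarith
  ultimately show ?thesis by (elim disjE) auto
qed

lemma mm_col_less:
  assumes "3 \<le> k" shows "mm_col k \<kappa> < k"
proof (cases "\<kappa> < 2 * k")
  case True
  then show ?thesis using assms mm_col[OF True, of "mm_col k \<kappa>"] by linarith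
next
  case False
  then show ?thesis using assms by (simp add: mm_col_def nth_default_def)
qed

locale mm_reduction =
  fixes n m k :: nat and li :: "nat \<Rightarrow> nat \<Rightarrow> bool \<Rightarrow> bool"
  assumes nm: "1 \<le> n" "1 \<le> m" "3 \<le> k"
begin

definition S :: "(nat \<times> nat \<times> nat \<Rightarrow> nat \<times> nat \<times> nat) \<Rightarrow> nat \<times> nat \<times> nat \<Rightarrow> nat \<Rightarrow> (nat \<times> nat \<times> nat) set" where
  "S \<phi> v c = {u \<in> {..<2 * k} \<times> {..<n} \<times> {..<m}. mm_col k (fst u) = c \<and> \<phi> u = v}"

lemma finite_S: "finite (S \<phi> v c)"
  by (simp add: S_def)

lemma S_iff:
  "t \<in> S \<phi> v 0 \<longleftrightarrow> (\<exists>x j. t = (0, x, j) \<and> x < n \<and> j < m \<and> \<phi> (0, x, j) = v) \<or>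
     (\<exists>x j. t = (2, x, j) \<and> x < n \<and> j < m \<and> \<phi> (2, x, j) = v)"
  "t \<in> S \<phi> v (Suc 0) \<longleftrightarrow> (\<exists>x j. t = (Suc 0, x, j) \<and> x < n \<and> j < m \<and> \<phi> (Suc 0, x, j) = v) \<or>
     (\<exists>x j. t = (3, x, j) \<and> x < n \<and> j < m \<and> \<phi> (3, x, j) = v)"
  "2 \<le> c \<Longrightarrow> c < k \<Longrightarrow> t \<in> S \<phi> v c \<longleftrightarrow> (\<exists>x j. t = (2 * c, x, j) \<and> x < n \<and> j < m \<and> \<phi> (2 * c, x, j) = v) \<or>
     (\<exists>x j. t = (Suc (2 * c), x, j) \<and> x < n \<and> j < m \<and> \<phi> (Suc (2 * c), x, j) = v)"
proof -
  obtain \<kappa> x j where t: "t = (\<kappa>, x, j)" by (metis prod_cases3)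
  have S: "t \<in> S \<phi> v c \<longleftrightarrow> x < n \<and> j < m \<and> \<phi> (\<kappa>, x, j) = v \<and> \<kappa> < 2 * k \<and> mm_col k \<kappa> = c" for c
    by (auto simp: S_def t)
  have 0: "\<kappa> < 2 * k \<and> mm_col k \<kappa> = 0 \<longleftrightarrow> \<kappa> = 0 \<or> \<kappa> = 2"
    using nm by (cases "\<kappa> < 2 * k"; simp add: mm_col[of \<kappa> k 0]; linarith)
  have 1: "\<kappa> < 2 * k \<and> mm_col k \<kappa> = Suc 0 \<longleftrightarrow> \<kappa> = Suc 0 \<or> \<kappa> = 3"
    using nm by (cases "\<kappa> < 2 * k"; simp add: mm_col[of \<kappa> k "Suc 0"]; linarith)
  have 2: "\<kappa> < 2 * k \<and> mm_col k \<kappa> = c \<longleftrightarrow> \<kappa> = 2 * c \<or> \<kappa> = Suc (2 * c)" if "2 \<le> c" "c < k"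
    using that by (cases "\<kappa> < 2 * k"; simp add: mm_col[of \<kappa> k c]; linarith)
  show "t \<in> S \<phi> v 0 \<longleftrightarrow> (\<exists>x j. t = (0, x, j) \<and> x < n \<and> j < m \<and> \<phi> (0, x, j) = v) \<or>
     (\<exists>x j. t = (2, x, j) \<and> x < n \<and> j < m \<and> \<phi> (2, x, j) = v)"
  "t \<in> S \<phi> v (Suc 0) \<longleftrightarrow> (\<exists>x j. t = (Suc 0, x, j) \<and> x < n \<and> j < m \<and> \<phi> (Suc 0, x, j) = v) \<or>
     (\<exists>x j. t = (3, x, j) \<and> x < n \<and> j < m \<and> \<phi> (3, x, j) = v)"
  "2 \<le> c \<Longrightarrow> c < k \<Longrightarrow> t \<in> S \<phi> v c \<longleftrightarrow> (\<exists>x j. t = (2 * c, x, j) \<and> x < n \<and> j < m \<and> \<phi> (2 * c, x, j) = v) \<or>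
     (\<exists>x j. t = (Suc (2 * c), x, j) \<and> x < n \<and> j < m \<and> \<phi> (Suc (2 * c), x, j) = v)"
    unfolding S 0 1 unfolding t by (auto simp: 2)
qed

abbreviation fair :: "(nat \<times> nat \<times> nat \<Rightarrow> nat \<times> nat \<times> nat) \<Rightarrow> bool" where
  "fair \<phi> \<equiv> fair_assignment (\<lambda>f. mm_count {0..<k} f \<le> 0) (triples (2 * k) n m) (triples 4 n m)
     (\<lambda>u. mm_col k (fst u)) (adj3 (mm_adj k m li)) \<phi>"

lemma fair_iff: "fair \<phi> \<longleftrightarrow>
   (\<forall>\<kappa><2 * k. \<forall>x<n. \<forall>j<m. \<phi> (\<kappa>, x, j) \<in> {..<4} \<times> {..<n} \<times> {..<m} \<and> adj3 (mm_adj k m li) (\<kappa>, x, j) (\<phi> (\<kappa>, x, j))) \<and>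
   (\<forall>v\<in>{..<4} \<times> {..<n} \<times> {..<m}. \<forall>c<k. \<forall>d<k. card (S \<phi> v c) \<le> card (S \<phi> v d))"
proof -
  have 1: "fair \<phi> \<longleftrightarrow>
    (\<forall>u\<in>{..<2 * k} \<times> {..<n} \<times> {..<m}. \<phi> u \<in> {..<4} \<times> {..<n} \<times> {..<m} \<and> adj3 (mm_adj k m li) u (\<phi> u)) \<and>
    (\<forall>v\<in>{..<4} \<times> {..<n} \<times> {..<m}. mm_count {0..<k} (\<lambda>c. card (S \<phi> v c)) \<le> 0)"
    unfolding fair_assignment_def set_triples S_def by (rule refl)
  have "{0..<k} \<noteq> {}" using nm by simp
  note 2 = mm_count_le[OF finite_atLeastLessThan this, of "\<lambda>c. card (S \<phi> v c)" 0 for v, unfolded add_0_right ball_upt]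
  show ?thesis unfolding 1 2 by (subst ball_triples) (rule refl)
qed

lemma sound:
  assumes "fair \<phi>"
  shows "\<exists>v. \<forall>j<m. \<exists>x<n. li x j (v x)"
proof -
  have A: "adj3 (mm_adj k m li) (\<kappa>, x, j) (\<phi> (\<kappa>, x, j))" if "\<kappa> < 2 * k" "x < n" "j < m" for \<kappa> x j
    using assms[unfolded fair_iff, THEN conjunct1, rule_format, OF that] by blast
  \<comment> \<open>With threshold 0 all colors are equally frequent at a node.\<close>
  have empty: "S \<phi> (\<beta>, y, i) c = {} \<Longrightarrow> S \<phi> (\<beta>, y, i) d = {}" if "\<beta> < 4" "y < n" "i < m" "c < k" "d < k" for \<beta> y i c d
  proof -
    assume "S \<phi> (\<beta>, y, i) c = {}"
    moreover have "card (S \<phi> (\<beta>, y, i) d) \<le> card (S \<phi> (\<beta>, y, i) c)"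
      using assms[unfolded fair_iff, THEN conjunct2, rule_format, of "(\<beta>, y, i)" d c] that by simp
    ultimately show ?thesis using finite_S card_eq_0_iff by simp
  qed
  have k: "0 < k" "Suc 0 < k" "2 < k" using nm by auto
  have r: "\<phi> (0, x, j) = (0, x, j) \<or> \<phi> (0, x, j) = (1, x, j)" if "x < n" "j < m" for x j
    using A[of 0 x j] that k by (auto simp: adj3_def mm_adj_def prod_eq_iff)
  have s: "\<phi> (Suc 0, x, j) = (1, x, j) \<or> \<phi> (Suc 0, x, j) = (0, x, Suc j)" if "x < n" "Suc j < m" for x j
    using A[of 1 x j] that k by (auto simp: adj3_def mm_adj_def prod_eq_iff)
  have A0: "(\<beta> = 0 \<or> \<beta> = 1) \<and> y = x \<and> i = j" if "\<phi> (0, x, j) = (\<beta>, y, i)" "x < n" "j < m" for \<beta> y i x j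
    using A[OF _ that(2,3), of 0] that(1) k by (simp add: adj3_def mm_adj_def)
  have A1: "y = x \<and> (\<beta> = 1 \<and> i = j \<or> \<beta> = 0 \<and> i = (if Suc j = m then 0 else Suc j))"
    if "\<phi> (Suc 0, x, j) = (\<beta>, y, i)" "x < n" "j < m" for \<beta> y i x j
    using A[OF _ that(2,3), of "Suc 0"] that(1) k by (simp add: adj3_def mm_adj_def)
  have A23: "\<beta> = 2 \<or> \<beta> = 3" if "\<phi> (\<kappa>, x, j) = (\<beta>, y, i)" "x < n" "j < m" "\<kappa> = 2 \<or> \<kappa> = 3" for \<beta> y i x j \<kappa>
    using A[OF _ that(2,3), of \<kappa>] that(1,4) k by (auto simp: adj3_def mm_adj_def split: if_splits)
  have w1r: "S \<phi> (1, x, j) 0 = {}" if "\<phi> (0, x, j) \<noteq> (1, x, j)" for x j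
  proof -
    have False if t: "t \<in> S \<phi> (1, x, j) 0" for t
    proof -
      from t consider x' j' where "x' < n" "j' < m" "\<phi> (0, x', j') = (1, x, j)"
        | x' j' where "x' < n" "j' < m" "\<phi> (2, x', j') = (1, x, j)"
        unfolding S_iff(1) by blast
      then show False
      proof cases
        case 1
        then show False using A0[OF 1(3,1,2)] \<open>\<phi> (0, x, j) \<noteq> (1, x, j)\<close> by (auto split: if_splits)
      next
        case 2
        then show False using A23[OF 2(3,1,2)] by simp
      qed
    qed
    then show ?thesis by blast
  qed
  have w0r: "S \<phi> (0, x, j) 0 = {}" if "\<phi> (0, x, j) \<noteq> (0, x, j)" for x j
  proof -
    have False if t: "t \<in> S \<phi> (0, x, j) 0" for t
    proof -
      from t consider x' j' where "x' < n" "j' < m" "\<phi> (0, x', j') = (0, x, j)"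
        | x' j' where "x' < n" "j' < m" "\<phi> (2, x', j') = (0, x, j)"
        unfolding S_iff(1) by blast
      then show False
      proof cases
        case 1
        then show False using A0[OF 1(3,1,2)] \<open>\<phi> (0, x, j) \<noteq> (0, x, j)\<close> by (auto split: if_splits)
      next
        case 2
        then show False using A23[OF 2(3,1,2)] by simp
      qed
    qed
    then show ?thesis by blast
  qed
  have w1s: "S \<phi> (1, x, j) (Suc 0) = {}" if "\<phi> (Suc 0, x, j) \<noteq> (1, x, j)" for x j
  proof -
    have False if t: "t \<in> S \<phi> (1, x, j) (Suc 0)" for t
    proof -
      from t consider x' j' where "x' < n" "j' < m" "\<phi> (Suc 0, x', j') = (1, x, j)"
        | x' j' where "x' < n" "j' < m" "\<phi> (3, x', j') = (1, x, j)"
        unfolding S_iff(2) by blast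
      then show False
      proof cases
        case 1
        then show False using A1[OF 1(3,1,2)] \<open>\<phi> (Suc 0, x, j) \<noteq> (1, x, j)\<close> by (auto split: if_splits)
      next
        case 2
        then show False using A23[OF 2(3,1,2)] by simp
      qed
    qed
    then show ?thesis by blast
  qed
  have w0s: "S \<phi> (0, x, Suc j) (Suc 0) = {}" if "\<phi> (Suc 0, x, j) \<noteq> (0, x, Suc j)" for x j
  proof -
    have False if t: "t \<in> S \<phi> (0, x, Suc j) (Suc 0)" for t
    proof -
      from t consider x' j' where "x' < n" "j' < m" "\<phi> (Suc 0, x', j') = (0, x, Suc j)"
        | x' j' where "x' < n" "j' < m" "\<phi> (3, x', j') = (0, x, Suc j)"
        unfolding S_iff(2) by blast
      then show False
      proof cases
        case 1
        then show False using A1[OF 1(3,1,2)] \<open>\<phi> (Suc 0, x, j) \<noteq> (0, x, Suc j)\<close> by (auto split: if_splits)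
      next
        case 2
        then show False using A23[OF 2(3,1,2)] by simp
      qed
    qed
    then show ?thesis by blast
  qed
  have mem: "S \<phi> (\<phi> (0, x, j)) 0 \<noteq> {}" "S \<phi> (\<phi> (Suc 0, x, j)) (Suc 0) \<noteq> {}" if "x < n" "j < m" for x j
    using that S_iff(1)[of "(0, x, j)"] S_iff(2)[of "(Suc 0, x, j)"] by blast+
  \<comment> \<open>If the color-0 vertex at \<open>j\<close> chooses node \<open>(1, x, j)\<close>,
    the color-1 vertex at \<open>j\<close> must join it and is missing at
    \<open>(0, x, Suc j)\<close>. That node stays empty, so the next color-0 vertex chooses
    \<open>(1, x, Suc j)\<close>; the converse runs the same way backwards.\<close>
  have step: "\<phi> (0, x, j) = (1, x, j) \<longleftrightarrow> \<phi> (0, x, Suc j) = (1, x, Suc j)" if xj: "x < n" "Suc j < m" for x j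
  proof
    assume "\<phi> (0, x, j) = (1, x, j)"
    then have "S \<phi> (1, x, j) 0 \<noteq> {}" using mem(1)[of x j] xj by simp
    then have "S \<phi> (1, x, j) (Suc 0) \<noteq> {}" using empty[of 1 x j "Suc 0" 0] xj k by auto
    then have "\<phi> (Suc 0, x, j) \<noteq> (0, x, Suc j)" using w1s[of x j] by auto
    then have "S \<phi> (0, x, Suc j) 0 = {}" using w0s[of x j] empty[of 0 x "Suc j" "Suc 0" 0] xj k by auto
    then have "\<phi> (0, x, Suc j) \<noteq> (0, x, Suc j)" using mem(1)[of x "Suc j"] xj by auto
    then show "\<phi> (0, x, Suc j) = (1, x, Suc j)" using r[of x "Suc j"] xj by auto
  next
    assume "\<phi> (0, x, Suc j) = (1, x, Suc j)"
    then have "S \<phi> (0, x, Suc j) 0 = {}" using w0r[of x "Suc j"] by auto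
    then have "S \<phi> (0, x, Suc j) (Suc 0) = {}" using empty[of 0 x "Suc j" 0 "Suc 0"] xj k by auto
    then have "\<phi> (Suc 0, x, j) \<noteq> (0, x, Suc j)" using mem(2)[of x j] xj by auto
    then have "\<phi> (Suc 0, x, j) = (1, x, j)" using s[OF xj] by auto
    then have "S \<phi> (1, x, j) (Suc 0) \<noteq> {}" using mem(2)[of x j] xj by auto
    then have "S \<phi> (1, x, j) 0 \<noteq> {}" using empty[of 1 x j 0 "Suc 0"] xj k by auto
    then show "\<phi> (0, x, j) = (1, x, j)" using w1r[of x j] by auto
  qed
  have wheel: "\<phi> (0, x, j) = (1, x, j) \<longleftrightarrow> \<phi> (0, x, 0) = (1, x, 0)" if "x < n" "j < m" for x j
    using that(2) by (induction j) (use step that(1) in auto)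
  define v where "v = (\<lambda>x. \<phi> (0, x, 0) \<noteq> (1, x, 0))"
  have "\<exists>x<n. li x j (v x)" if j: "j < m" for j
  proof -
    have "\<phi> (2, 0, j) = (2, 0, j)"
      using A[of 2 0 j] j nm by (auto simp: adj3_def mm_adj_def prod_eq_iff)
    then have "(2, 0, j) \<in> S \<phi> (2, 0, j) 0" using j nm by (simp add: S_iff)
    then have "S \<phi> (2, 0, j) 2 \<noteq> {}" using empty[of 2 0 j 2 0] j nm k by auto
    then obtain b x where b: "b < 2" "x < n" "\<phi> (4 + b, x, j) = (2, 0, j)" "li x j (b = 1)"
    proof -
      assume *: "\<And>b x. b < 2 \<Longrightarrow> x < n \<Longrightarrow> \<phi> (4 + b, x, j) = (2, 0, j) \<Longrightarrow> li x j (b = 1) \<Longrightarrow> thesis"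
      assume "S \<phi> (2, 0, j) 2 \<noteq> {}"
      then obtain t where "t \<in> S \<phi> (2, 0, j) 2" by blast
      then consider x j' where "x < n" "j' < m" "\<phi> (4, x, j') = (2, 0, j)"
        | x j' where "x < n" "j' < m" "\<phi> (5, x, j') = (2, 0, j)"
        using S_iff(3)[of 2 t \<phi>] k by auto
      then show thesis
      proof cases
        case 1
        then show thesis using A[of 4 x j'] *[of 0 x] mm_par[of 2 k] k
          by (auto simp: adj3_def mm_adj_def)
      next
        case 2
        then show thesis using A[of 5 x j'] *[of 1 x] mm_par[of 2 k] k
          by (auto simp: adj3_def mm_adj_def)
      qed
    qed
    \<comment> \<open>The color-2 tip of node \<open>(b, x, j)\<close> is spent on the clause and no
      other vertex of color 2 fits there. The node is empty, which fixes the orientation of the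
      wheel and hence the value of \<open>x\<close>.\<close>
    have "S \<phi> (b, x, j) 2 = {}"
    proof -
      have "False" if t: "t \<in> S \<phi> (b, x, j) 2" for t
      proof -
        from t consider x' j' where "x' < n" "j' < m" "\<phi> (4, x', j') = (b, x, j)"
          | x' j' where "x' < n" "j' < m" "\<phi> (5, x', j') = (b, x, j)"
          using S_iff(3)[of 2 t \<phi>] k by auto
        then show False
        proof cases
          case 1
          then show False using A[of 4 x' j'] mm_par[of 2 k] k b(1,3)
            by (auto simp: adj3_def mm_adj_def)
        next
          case 2
          then show False using A[of 5 x' j'] mm_par[of 2 k] k b(1,3)
            by (auto simp: adj3_def mm_adj_def)
        qed
      qed
      then show ?thesis by blast
    qed
    then have "S \<phi> (b, x, j) 0 = {}" using empty[of b x j 2 0] b(1,2) j k by auto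
    then have "\<phi> (0, x, j) \<noteq> (b, x, j)" using mem(1)[OF b(2) j] by auto
    then have "v x = (b = 1)" using r[OF b(2) j] wheel[OF b(2) j] b(1) by (auto simp: v_def less_2_cases_iff)
    then show ?thesis using b(2,4) by (intro exI[of _ x]) simp
  qed
  then show ?thesis by (intro exI[of _ v]) simp
qed

lemma complete:
  assumes "\<And>j. j < m \<Longrightarrow> \<exists>x<n. li x j (v x)"
  shows "\<exists>\<phi>. fair \<phi>"
proof -
  from assms obtain w where w: "\<And>j. j < m \<Longrightarrow> w j < n \<and> li (w j) j (v (w j))" by metis
  define \<phi> where "\<phi> = (\<lambda>(\<kappa>::nat, x::nat, j::nat).
    if \<kappa> = 0 then (if v x then (0, x, j) else (1, x, j))
    else if \<kappa> = 1 then (if v x then (0, x, if Suc j = m then 0 else Suc j) else (1, x, j))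
    else if \<kappa> = 2 \<or> \<kappa> = 3 then (if x = 0 then (2, 0, j) else (3, 0, 0))
    else if (mm_par k \<kappa> = 1) \<noteq> v x then (mm_par k \<kappa>, x, j)
    else if w j = x then (2, 0, j) else (3::nat, 0::nat, 0::nat))"
  have \<phi>_eqs: "\<phi> (0, x, j) = (if v x then (0, x, j) else (1, x, j))"
    "\<phi> (Suc 0, x, j) = (if v x then (0, x, if Suc j = m then 0 else Suc j) else (1, x, j))"
    "\<phi> (2, x, j) = (if x = 0 then (2, 0, j) else (3, 0, 0))"
    "\<phi> (3, x, j) = (if x = 0 then (2, 0, j) else (3, 0, 0))" for x j
    by (simp_all add: \<phi>_def)
  have \<phi>_tip: "\<phi> (2 * c, x, j) = (if v x then (0, x, j) else if w j = x then (2, 0, j) else (3, 0, 0))"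
    "\<phi> (Suc (2 * c), x, j) = (if v x then if w j = x then (2, 0, j) else (3, 0, 0) else (1, x, j))"
    if "2 \<le> c" "c < k" for c x j
    using that mm_par[OF that(2)] by (simp_all add: \<phi>_def)
  have adj: "\<phi> (\<kappa>, x, j) \<in> {..<4} \<times> {..<n} \<times> {..<m} \<and> adj3 (mm_adj k m li) (\<kappa>, x, j) (\<phi> (\<kappa>, x, j))"
    if "\<kappa> < 2 * k" "x < n" "j < m" for \<kappa> x j
  proof -
    have "\<kappa> = 0 \<or> \<kappa> = Suc 0 \<or> \<kappa> = 2 \<or> \<kappa> = 3 \<or> 4 \<le> \<kappa>" by linarith
    moreover have "4 \<le> \<kappa> \<Longrightarrow> 2 \<le> \<kappa> div 2 \<and> \<kappa> div 2 < k" using that(1) by linarith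
    moreover have "\<kappa> = 2 * (\<kappa> div 2) \<or> \<kappa> = Suc (2 * (\<kappa> div 2))" by linarith
    ultimately consider "\<kappa> = 0" | "\<kappa> = Suc 0" | "\<kappa> = 2" | "\<kappa> = 3" | c where "2 \<le> c" "c < k" "\<kappa> = 2 * c"
      | c where "2 \<le> c" "c < k" "\<kappa> = Suc (2 * c)"
      by metis
    then show ?thesis
    proof cases
      case 5
      then show ?thesis using that w[of j] mm_par[OF 5(2)] nm
        by (auto simp: \<phi>_tip adj3_def mm_adj_def)
    next
      case 6
      then show ?thesis using that w[of j] mm_par[OF 6(2)] nm
        by (auto simp: \<phi>_tip adj3_def mm_adj_def)
    qed (use that nm in \<open>auto simp: \<phi>_eqs adj3_def mm_adj_def\<close>)
  qed
  have cards: "\<exists>N. \<forall>c<k. card (S \<phi> (\<beta>, y, i) c) = N" if y: "\<beta> < 4" "y < n" "i < m" for \<beta> y i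
  proof -
    have *: ?thesis if "card (S \<phi> (\<beta>, y, i) 0) = N" "card (S \<phi> (\<beta>, y, i) (Suc 0)) = N"
      "\<And>c. 2 \<le> c \<Longrightarrow> c < k \<Longrightarrow> card (S \<phi> (\<beta>, y, i) c) = N" for N
    proof (intro exI[of _ N] allI impI)
      fix c assume "c < k"
      then consider "c = 0" | "c = Suc 0" | "2 \<le> c" by linarith
      then show "card (S \<phi> (\<beta>, y, i) c) = N" using that \<open>c < k\<close> by cases auto
    qed
    have "(\<beta> = 0 \<or> \<beta> = 1) \<and> (\<beta> = 0) = v y \<or> (\<beta> = 0 \<or> \<beta> = 1) \<and> (\<beta> = 0) \<noteq> v y \<or> \<beta> = 2 \<and> y = 0 \<or> \<beta> = 3 \<and> y = 0 \<and> i = 0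
      \<or> \<beta> = 2 \<and> y \<noteq> 0 \<or> \<beta> = 3 \<and> (y \<noteq> 0 \<or> i \<noteq> 0)" using y(1) by linarith
    then consider "\<beta> = 0" "v y" | "\<beta> = 1" "\<not> v y" | "\<beta> = 2" "y = 0" | "\<beta> = 3" "y = 0" "i = 0"
      | "\<beta> = 0 \<and> \<not> v y \<or> \<beta> = 1 \<and> v y \<or> \<beta> = 2 \<and> y \<noteq> 0 \<or> \<beta> = 3 \<and> (y \<noteq> 0 \<or> i \<noteq> 0)" by blast
    then show ?thesis
    proof cases
      case 1
      have "S \<phi> (\<beta>, y, i) 0 = {(0, y, i)}"
        using 1 y by (auto simp: S_iff \<phi>_eqs split: if_splits)
      \<comment> \<open>The color-1 vertex comes from the predecessor on the wheel.\<close>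
      moreover have "S \<phi> (\<beta>, y, i) (Suc 0) = {(Suc 0, y, if i = 0 then m - 1 else i - 1)}"
        using 1 y by (auto simp: S_iff \<phi>_eqs split: if_splits)
      moreover have "S \<phi> (\<beta>, y, i) c = {(2 * c, y, i)}" if "2 \<le> c" "c < k" for c
        using 1 y by (auto simp: S_iff(3)[OF that] \<phi>_tip[OF that] split: if_splits)
      ultimately show ?thesis by (intro *[of 1]) simp_all
    next
      case 2
      have "S \<phi> (\<beta>, y, i) 0 = {(0, y, i)}"
        using 2 y by (auto simp: S_iff \<phi>_eqs split: if_splits)
      moreover have "S \<phi> (\<beta>, y, i) (Suc 0) = {(Suc 0, y, i)}"
        using 2 y by (auto simp: S_iff \<phi>_eqs split: if_splits)
      moreover have "S \<phi> (\<beta>, y, i) c = {(Suc (2 * c), y, i)}" if "2 \<le> c" "c < k" for c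
        using 2 y by (auto simp: S_iff(3)[OF that] \<phi>_tip[OF that] split: if_splits)
      ultimately show ?thesis by (intro *[of 1]) simp_all
    next
      case 3
      have "S \<phi> (\<beta>, y, i) 0 = {(2, 0, i)}"
        using 3 y by (auto simp: S_iff \<phi>_eqs split: if_splits)
      moreover have "S \<phi> (\<beta>, y, i) (Suc 0) = {(3, 0, i)}"
        using 3 y by (auto simp: S_iff \<phi>_eqs split: if_splits)
      moreover have "S \<phi> (\<beta>, y, i) c = {(if v (w i) then Suc (2 * c) else 2 * c, w i, i)}" if "2 \<le> c" "c < k" for c
        using 3 y w[OF y(3)] by (auto simp: S_iff(3)[OF that] \<phi>_tip[OF that] split: if_splits)
      ultimately show ?thesis by (intro *[of 1]) simp_all
    next
      case 4
      have "S \<phi> (\<beta>, y, i) 0 = {2} \<times> {1..<n} \<times> {..<m}"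
        using 4 by (auto simp: S_iff \<phi>_eqs split: if_splits)
      then have 0: "card (S \<phi> (\<beta>, y, i) 0) = (n - 1) * m" by (simp add: card_cartesian_product)
      have "S \<phi> (\<beta>, y, i) (Suc 0) = {3} \<times> {1..<n} \<times> {..<m}"
        using 4 by (auto simp: S_iff \<phi>_eqs split: if_splits)
      then have 1: "card (S \<phi> (\<beta>, y, i) (Suc 0)) = (n - 1) * m" by (simp add: card_cartesian_product)
      have 2: "card (S \<phi> (\<beta>, y, i) c) = (n - 1) * m" if "2 \<le> c" "c < k" for c
      proof -
        \<comment> \<open>For each clause every variable other than \<open>w j\<close> leaves
          exactly one free tip per color, so all colors \<open>c \<ge> 2\<close> send the same
          number, which equals that of the fillers.\<close>
        have "S \<phi> (\<beta>, y, i) c = (\<lambda>(j, x). (if v x then Suc (2 * c) else 2 * c, x, j)) ` (SIGMA j:{..<m}. {..<n} - {w j})"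
          using 4 by (auto simp: S_iff(3)[OF that] \<phi>_tip[OF that] image_iff split: if_splits)
        moreover have "inj_on (\<lambda>(j, x). (if v x then Suc (2 * c) else 2 * c, x, j)) (SIGMA j:{..<m}. {..<n} - {w j})"
          by (auto simp: inj_on_def)
        moreover have "card (SIGMA j:{..<m}. {..<n} - {w j}) = (n - 1) * m"
          using w by (simp add: card_SigmaI card_Diff_singleton_if)
        ultimately show ?thesis by (simp add: card_image)
      qed
      show ?thesis by (rule *[OF 0 1 2])
    next
      case 5
      have "S \<phi> (\<beta>, y, i) 0 = {}" using 5 by (auto simp: S_iff \<phi>_eqs split: if_splits)
      moreover have "S \<phi> (\<beta>, y, i) (Suc 0) = {}" using 5 by (auto simp: S_iff \<phi>_eqs split: if_splits)
      moreover have "S \<phi> (\<beta>, y, i) c = {}" if "2 \<le> c" "c < k" for c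
        using 5 by (auto simp: S_iff(3)[OF that] \<phi>_tip[OF that] split: if_splits)
      ultimately show ?thesis by (intro *[of 0]) simp_all
    qed
  qed
  have "fair \<phi>" unfolding fair_iff
  proof (intro conjI[OF _ ballI] allI impI)
    show "\<phi> (\<kappa>, x, j) \<in> {..<4} \<times> {..<n} \<times> {..<m} \<and> adj3 (mm_adj k m li) (\<kappa>, x, j) (\<phi> (\<kappa>, x, j))"
      if "\<kappa> < 2 * k" "x < n" "j < m" for \<kappa> x j by (rule adj[OF that])
    fix u :: "nat \<times> nat \<times> nat" and c d assume u: "u \<in> {..<4} \<times> {..<n} \<times> {..<m}" and cd: "c < k" "d < k"
    obtain \<beta> y i where uu: "u = (\<beta>, y, i)" by (metis prod_cases3)
    obtain N where "\<forall>c<k. card (S \<phi> (\<beta>, y, i) c) = N" using cards[of \<beta> y i] u uu by auto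
    then show "card (S \<phi> u c) \<le> card (S \<phi> u d)" using cd uu by simp
  qed
  then show ?thesis by (rule exI[of _ \<phi>])
qed

lemma correct: "(\<exists>\<phi>. fair \<phi>) \<longleftrightarrow> (\<exists>v. \<forall>j<m. \<exists>x<n. li x j (v x))"
proof
  assume "\<exists>\<phi>. fair \<phi>"
  then show "\<exists>v. \<forall>j<m. \<exists>x<n. li x j (v x)" by (elim exE) (rule sound)
next
  assume "\<exists>v. \<forall>j<m. \<exists>x<n. li x j (v x)"
  then obtain v where "\<forall>j<m. \<exists>x<n. li x j (v x)" by (elim exE)
  then show "\<exists>\<phi>. fair \<phi>" by (intro complete[of v]) simp
qed

end

subsection \<open>NP-hardness\<close>

definition reduction :: "nat \<Rightarrow> nat \<Rightarrow> (nat \<Rightarrow> nat) \<Rightarrow> (clause list \<Rightarrow> nat \<Rightarrow> nat \<Rightarrow> nat \<Rightarrow> nat \<Rightarrow> nat \<Rightarrow> nat \<Rightarrow> bool) \<Rightarrow>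
    clause list \<Rightarrow> bool list" where
  "reduction k K col adj F = inst_bits k (triples K (length (atoms F)) (length F))
     (triples 4 (length (atoms F)) (length F)) (\<lambda>u. col (fst u)) (adj3 (adj F))"

lemma pt_atoms: "pt atoms"
  unfolding atoms_def
proof (rule pt_fold_add[where B = "\<lambda>p. Suc (sz p)"])
  show "sz (if list_ex (\<lambda>b. b = a) y then y else a # y) \<le> sz y + Suc (sz (F, a))" for F :: "clause list" and a y
    by simp
qed (intro pt_intro pb_intros)+

lemma pt_lit: "pt f \<Longrightarrow> pt x \<Longrightarrow> pt j \<Longrightarrow> pt b \<Longrightarrow> pt (\<lambda>p. lit (f p) (x p) (j p) (b p))"
proof -
  have "pt (\<lambda>p. lit (fst p) (fst (snd p)) (fst (snd (snd p))) (snd (snd (snd p))))"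
    unfolding lit_def by (intro pt_intro pt_comp[OF pt_atoms])
  note * = pt_comp[OF this, of "\<lambda>p. (f p, x p, j p, b p)", unfolded fst_conv snd_conv]
  show "pt f \<Longrightarrow> pt x \<Longrightarrow> pt j \<Longrightarrow> pt b \<Longrightarrow> ?thesis" by (intro * pt_intro)
qed

lemma pt_reduction:
  assumes col: "pt col"
    and adj: "pt (\<lambda>p. adj (fst p) (fst (fst (snd p))) (fst (snd (fst (snd p)))) (snd (snd (fst (snd p))))
      (fst (snd (snd p))) (fst (snd (snd (snd p)))) (snd (snd (snd (snd p)))))"
  shows "pt (reduction k K col adj)"
proof -
  have "pt (\<lambda>p. triples (fst p) (fst (snd p)) (snd (snd p)))"
    unfolding triples_def by (intro pt_intro)
  note tr = pt_comp[OF this, of "\<lambda>x. (f x, g x, h x)" for f g h, unfolded fst_conv snd_conv, OF pt_pair[OF _ pt_pair]]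
  have unary: "pt (\<lambda>x. unary_enc (f x))" if "pt f" for f :: "clause list \<Rightarrow> nat"
    unfolding unary_enc_def by (intro pt_intro that)
  have c: "pt (\<lambda>p::((clause list \<times> nat \<times> nat \<times> nat) \<times> nat). col (fst (snd (fst p))))"
    by (rule pt_comp[OF col]) (intro pt_intro)
  have a: "pt (\<lambda>p::((clause list \<times> nat \<times> nat \<times> nat) \<times> nat \<times> nat \<times> nat). adj3 (adj (fst (fst p))) (snd (fst p)) (snd p))"
    unfolding adj3_def
    using pt_comp[OF adj, of "\<lambda>p::((clause list \<times> nat \<times> nat \<times> nat) \<times> nat \<times> nat \<times> nat). (fst (fst p), snd (fst p), snd p)"]
    by (simp add: pt_intro)
  show ?thesis unfolding reduction_def inst_bits_def
    by (intro pt_intro tr unary pt_comp[OF pt_atoms] c a)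
qed

lemma pt_mov_reduction: "pt (reduction k 7 mov_col (\<lambda>F. mov_adj (lit F)))"
  by (rule pt_reduction) ((unfold mov_col_def mov_adj_def)[], (intro pt_intro pt_lit)[])+

lemma pt_mm_reduction: "pt (reduction k (2 * k) (mm_col k) (\<lambda>F. mm_adj k (length F) (lit F)))"
  by (rule pt_reduction) ((unfold mm_col_def mm_adj_def mm_par_def)[], (intro pt_intro pt_lit)[])+

theorem NP_hard_fair_matching:
  fixes \<Pi> :: "(nat, nat) measure"
  assumes \<Pi>: "\<Pi> \<in> {max_min, mov}" and k: "3 \<le> k"
  shows "NP_hard (instances_with_colors k) instance_enc (has_fair_matching \<Pi>)"
  unfolding NP_hard_def
proof
  fix L assume "L \<in> NP"
  then obtain F :: "bool list \<Rightarrow> clause list" where F: "pt F" "\<And>x. F x \<noteq> []"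
    "\<And>x. x \<in> L \<longleftrightarrow> (\<exists>\<nu>. \<forall>cl\<in>set (F x). sat \<nu> cl)"
    using NP_to_cnf by blast
  have sizes: "1 \<le> length (atoms (F x))" "1 \<le> length (F x)" for x
    using F(2)[of x] set_atoms[of "F x"] by (auto simp: Suc_le_eq length_greater_0_conv)
  show "\<exists>f. poly_time_computable f \<and> (\<forall>x. \<exists>I\<in>instances_with_colors k. f x = instance_enc I \<and> (x \<in> L \<longleftrightarrow> has_fair_matching \<Pi> I))"
  proof (cases "\<Pi> = max_min")
    case True
    let ?r = "reduction k (2 * k) (mm_col k) (\<lambda>F. mm_adj k (length F) (lit F))"
    have "poly_time_computable (\<lambda>x. ?r (F x))"
      by (rule pt_computable[OF pt_comp[OF pt_mm_reduction F(1)]])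
    moreover have "\<exists>I\<in>instances_with_colors k. ?r (F x) = instance_enc I \<and> (x \<in> L \<longleftrightarrow> has_fair_matching \<Pi> I)" for x
    proof -
      let ?n = "length (atoms (F x))" and ?m = "length (F x)"
      interpret mm_reduction ?n ?m k "lit (F x)" by unfold_locales (rule sizes k)+
      have "\<exists>I\<in>instances_with_colors k. instance_enc I = ?r (F x) \<and> colors I = {0..<k} \<and>
        (\<forall>\<Pi> P. (\<forall>U'. \<Pi> {0..<k} (coloring I) U' \<le> 0 \<longleftrightarrow> P (color_count (coloring I) U')) \<longrightarrow>
          (has_fair_matching \<Pi> I \<longleftrightarrow> (\<exists>\<phi>. fair_assignment P (triples (2 * k) ?n ?m) (triples 4 ?n ?m)
            (\<lambda>u. mm_col k (fst u)) (adj3 (mm_adj k ?m (lit (F x)))) \<phi>)))"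
        unfolding reduction_def by (rule instance_exists[OF distinct_triples distinct_triples mm_col_less[OF k]])
      then obtain J where I: "J \<in> instances_with_colors k" "instance_enc J = ?r (F x)" and
        R: "\<forall>\<Pi> P. (\<forall>U'. \<Pi> {0..<k} (coloring J) U' \<le> 0 \<longleftrightarrow> P (color_count (coloring J) U')) \<longrightarrow>
          (has_fair_matching \<Pi> J \<longleftrightarrow> (\<exists>\<phi>. fair_assignment P (triples (2 * k) ?n ?m) (triples 4 ?n ?m)
            (\<lambda>u. mm_col k (fst u)) (adj3 (mm_adj k ?m (lit (F x)))) \<phi>))"
        by (elim bexE conjE)
      have "has_fair_matching \<Pi> J \<longleftrightarrow> (\<exists>\<phi>. fair \<phi>)"
        by (rule R[THEN spec, THEN spec, THEN mp]) (simp add: True max_min_count)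
      also have "\<dots> \<longleftrightarrow> x \<in> L" unfolding F(3) sat_lit by (rule correct)
      finally show ?thesis using I(1,2) by (intro bexI[of _ J]) simp_all
    qed
    ultimately show ?thesis by blast
  next
    case False
    then have \<Pi>: "\<Pi> = mov" using \<Pi> by simp
    let ?r = "reduction k 7 mov_col (\<lambda>F. mov_adj (lit F))"
    have "poly_time_computable (\<lambda>x. ?r (F x))"
      by (rule pt_computable[OF pt_comp[OF pt_mov_reduction F(1)]])
    moreover have "\<exists>I\<in>instances_with_colors k. ?r (F x) = instance_enc I \<and> (x \<in> L \<longleftrightarrow> has_fair_matching \<Pi> I)" for x
    proof -
      let ?n = "length (atoms (F x))" and ?m = "length (F x)"
      interpret mov_reduction ?n ?m k "lit (F x)" by unfold_locales (rule sizes k)+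
      have col: "mov_col \<kappa> < k" for \<kappa> using mov_col(4)[of \<kappa>] k by linarith
      have "\<exists>I\<in>instances_with_colors k. instance_enc I = ?r (F x) \<and> colors I = {0..<k} \<and>
        (\<forall>\<Pi> P. (\<forall>U'. \<Pi> {0..<k} (coloring I) U' \<le> 0 \<longleftrightarrow> P (color_count (coloring I) U')) \<longrightarrow>
          (has_fair_matching \<Pi> I \<longleftrightarrow> (\<exists>\<phi>. fair_assignment P (triples 7 ?n ?m) (triples 4 ?n ?m)
            (\<lambda>u. mov_col (fst u)) (adj3 (mov_adj (lit (F x)))) \<phi>)))"
        unfolding reduction_def by (rule instance_exists[OF distinct_triples distinct_triples col])
      then obtain J where I: "J \<in> instances_with_colors k" "instance_enc J = ?r (F x)" and
        R: "\<forall>\<Pi> P. (\<forall>U'. \<Pi> {0..<k} (coloring J) U' \<le> 0 \<longleftrightarrow> P (color_count (coloring J) U')) \<longrightarrow>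
          (has_fair_matching \<Pi> J \<longleftrightarrow> (\<exists>\<phi>. fair_assignment P (triples 7 ?n ?m) (triples 4 ?n ?m)
            (\<lambda>u. mov_col (fst u)) (adj3 (mov_adj (lit (F x)))) \<phi>))"
        by (elim bexE conjE)
      have "has_fair_matching \<Pi> J \<longleftrightarrow> (\<exists>\<phi>. fair \<phi>)"
        by (rule R[THEN spec, THEN spec, THEN mp]) (simp add: \<Pi> mov_count)
      also have "\<dots> \<longleftrightarrow> x \<in> L" unfolding F(3) sat_lit by (rule correct)
      finally show ?thesis using I(1,2) by (intro bexI[of _ J]) simp_all
    qed
    ultimately show ?thesis by blast
  qed
qed

section \<open>Two colors: a min-max theorem\<close>

text \<open>The argument of Halmos and Vaughan: if some nonempty proper subset is tight, it and the
  rest are matched separately. Otherwise every such subset has a neighbor to spare, so any element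
  may take any of its neighbors.\<close>

lemma hall:
  assumes "finite X" "\<And>x. x \<in> X \<Longrightarrow> finite (\<Gamma> x)" "\<And>A. A \<subseteq> X \<Longrightarrow> card A \<le> card (\<Union>(\<Gamma> ` A))"
  shows "\<exists>f. inj_on f X \<and> (\<forall>x\<in>X. f x \<in> \<Gamma> x)"
  using assms
proof (induction "card X" arbitrary: X \<Gamma> rule: less_induct)
  case less
  show ?case
  proof (cases "X = {}")
    case False
    then obtain x where x: "x \<in> X" by blast
    have fU: "finite (\<Union>(\<Gamma> ` A))" if "A \<subseteq> X" for A
      using that less.prems(1,2) by (auto intro: finite_subset)
    show ?thesis
    proof (cases "\<exists>A\<subset>X. A \<noteq> {} \<and> card (\<Union>(\<Gamma> ` A)) \<le> card A")
      case True
      then obtain A where A: "A \<subset> X" "A \<noteq> {}" "card (\<Union>(\<Gamma> ` A)) \<le> card A" by blast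
      have fA: "finite A" using A(1) less.prems(1) by (meson finite_subset psubset_imp_subset)
      have "\<exists>f. inj_on f A \<and> (\<forall>x\<in>A. f x \<in> \<Gamma> x)"
      proof (rule less.hyps)
        show "card A < card X" using psubset_card_mono[OF less.prems(1) A(1)] .
      qed (use A(1) less.prems fA in auto)
      then obtain f where f: "inj_on f A" "\<And>x. x \<in> A \<Longrightarrow> f x \<in> \<Gamma> x" by blast
      let ?\<Gamma> = "\<lambda>x. \<Gamma> x - \<Union>(\<Gamma> ` A)"
      have "\<exists>g. inj_on g (X - A) \<and> (\<forall>x\<in>X - A. g x \<in> ?\<Gamma> x)"
      proof (rule less.hyps)
        show "card (X - A) < card X" using A less.prems(1) by (intro psubset_card_mono) auto
        fix B assume B: "B \<subseteq> X - A"
        have "card B + card A = card (B \<union> A)"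
          using B fA less.prems(1) by (intro card_Un_disjoint[symmetric]) (auto intro: finite_subset)
        also have "\<dots> \<le> card (\<Union>(\<Gamma> ` (B \<union> A)))" using B A(1) by (intro less.prems(3)) auto
        also have "\<Union>(\<Gamma> ` (B \<union> A)) = \<Union>(?\<Gamma> ` B) \<union> \<Union>(\<Gamma> ` A)" by auto
        also have "card \<dots> \<le> card (\<Union>(?\<Gamma> ` B)) + card (\<Union>(\<Gamma> ` A))" by (rule card_Un_le)
        finally show "card B \<le> card (\<Union>(?\<Gamma> ` B))" using A(3) by linarith
      qed (use less.prems in auto)
      then obtain g where g: "inj_on g (X - A)" "\<And>x. x \<in> X - A \<Longrightarrow> g x \<in> ?\<Gamma> x" by blast
      let ?h = "\<lambda>x. if x \<in> A then f x else g x"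
      have "inj_on ?h X"
      proof (rule inj_onI)
        fix a b assume ab: "a \<in> X" "b \<in> X" "?h a = ?h b"
        have dis: "f c \<noteq> g d" if "c \<in> A" "d \<in> X - A" for c d using f(2)[OF that(1)] g(2)[OF that(2)] that(1) by auto
        show "a = b"
          using ab dis[of a b] dis[of b a] inj_onD[OF f(1), of a b] inj_onD[OF g(1), of a b]
          by (cases "a \<in> A"; cases "b \<in> A") auto
      qed
      moreover have "\<forall>x\<in>X. ?h x \<in> \<Gamma> x" using f(2) g(2) by auto
      ultimately show ?thesis by (intro exI[of _ ?h]) simp
    next
      case False
      have "card {x} \<le> card (\<Union>(\<Gamma> ` {x}))" using x by (intro less.prems(3)) simp
      then have "\<Gamma> x \<noteq> {}" by auto
      then obtain y where y: "y \<in> \<Gamma> x" by blast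
      let ?\<Gamma> = "\<lambda>z. \<Gamma> z - {y}"
      have "\<exists>f. inj_on f (X - {x}) \<and> (\<forall>z\<in>X - {x}. f z \<in> ?\<Gamma> z)"
      proof (rule less.hyps)
        show "card (X - {x}) < card X" using x less.prems(1) by (intro psubset_card_mono) auto
        fix A assume A: "A \<subseteq> X - {x}"
        show "card A \<le> card (\<Union>(?\<Gamma> ` A))"
        proof (cases "A = {}")
          case neq: False
          have "A \<subset> X" using A x by auto
          then have "card A < card (\<Union>(\<Gamma> ` A))" using False neq by (meson not_le)
          moreover have "\<Union>(?\<Gamma> ` A) = \<Union>(\<Gamma> ` A) - {y}" by auto
          moreover have "card (\<Union>(\<Gamma> ` A)) - 1 \<le> card (\<Union>(\<Gamma> ` A) - {y})"
            using fU[of A] A by (simp add: card_Diff_singleton_if)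
          ultimately show ?thesis by simp
        qed simp
      qed (use less.prems in auto)
      then obtain f where f: "inj_on f (X - {x})" "\<And>z. z \<in> X - {x} \<Longrightarrow> f z \<in> ?\<Gamma> z" by blast
      have "inj_on (f(x := y)) X"
      proof (rule inj_onI)
        fix a b assume ab: "a \<in> X" "b \<in> X" "(f(x := y)) a = (f(x := y)) b"
        show "a = b"
          using ab f(2)[of a] f(2)[of b] inj_onD[OF f(1), of a b] by (cases "a = x"; cases "b = x") auto
      qed
      moreover have "\<forall>z\<in>X. (f(x := y)) z \<in> \<Gamma> z" using f(2) y by auto
      ultimately show ?thesis by (intro exI[of _ "f(x := y)"]) simp
    qed
  qed simp
qed

text \<open>The Mendelsohn-Dulmage theorem, by Banach's decomposition of \<open>A\<close> and \<open>B\<close>.\<close>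

lemma combine_matchings:
  fixes f :: "'a \<Rightarrow> 'b" and g :: "'b \<Rightarrow> 'a"
  assumes "inj_on f A" "inj_on g B"
  obtains \<mu> \<nu> where "\<And>a. a \<in> A \<Longrightarrow> \<mu> a = f a \<or> \<mu> a \<in> B \<and> g (\<mu> a) = a"
    "\<And>b. b \<in> B \<Longrightarrow> \<nu> b = g b \<or> \<nu> b \<in> A \<and> f (\<nu> b) = b"
    "\<And>a b. a \<in> A \<Longrightarrow> \<mu> a = b \<Longrightarrow> \<nu> b = a" "\<And>a b. b \<in> B \<Longrightarrow> \<nu> b = a \<Longrightarrow> \<mu> a = b"
proof -
  \<comment> \<open>At a fixed point \<open>Z\<close>, the map \<open>f\<close> on \<open>Z\<close>
    and the inverse of \<open>g\<close> on the rest of \<open>A\<close> have disjoint images and fit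
    together to one matching.\<close>
  define F where "F = (\<lambda>Z. A - g ` (B - f ` Z))"
  have "mono F" unfolding F_def by (rule monoI) blast
  then have "lfp F = F (lfp F)" by (rule lfp_unfold)
  then obtain Z where Z: "Z = A - g ` (B - f ` Z)" unfolding F_def by blast
  let ?W = "B - f ` Z"
  have ZA: "Z \<subseteq> A" and dis: "Z \<inter> g ` ?W = {}" and cov: "A - Z \<subseteq> g ` ?W" using Z by blast+
  have fZ: "inj_on f Z" and gW: "inj_on g ?W" using assms ZA by (auto intro: inj_on_subset)
  define \<mu> where "\<mu> = (\<lambda>a. if a \<in> Z then f a else inv_into ?W g a)"
  define \<nu> where "\<nu> = (\<lambda>b. if b \<in> f ` Z then inv_into Z f b else g b)"
  have \<mu>1: "\<mu> a = f a" "\<nu> (f a) = a" if "a \<in> Z" for a using that fZ by (auto simp: \<mu>_def \<nu>_def)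
  have \<mu>2: "\<mu> (g b) = b" "\<nu> b = g b" if "b \<in> ?W" for b
    using that gW dis by (auto simp: \<mu>_def \<nu>_def)
  show ?thesis
  proof (rule that[of \<mu> \<nu>])
    fix a b assume a: "a \<in> A"
    then consider "a \<in> Z" | c where "c \<in> ?W" "a = g c" using cov by blast
    then show "\<mu> a = f a \<or> \<mu> a \<in> B \<and> g (\<mu> a) = a" and "\<mu> a = b \<Longrightarrow> \<nu> b = a"
      by (cases; use \<mu>1 \<mu>2 in auto)+
  next
    fix a b assume b: "b \<in> B"
    then consider c where "c \<in> Z" "b = f c" | "b \<in> ?W" by blast
    then show "\<nu> b = g b \<or> \<nu> b \<in> A \<and> f (\<nu> b) = b" and "\<nu> b = a \<Longrightarrow> \<mu> a = b"
      by (cases; use \<mu>1 \<mu>2 ZA in auto)+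
  qed
qed

text \<open>A right vertex \<open>v\<close> is split into slots: \<open>Xs v j\<close> takes a vertex of the first color, \<open>Ys v j\<close> one of
  the second color, and \<open>Ss v i\<close> takes at most one vertex of each color. For \<open>j < m\<close> the slots \<open>Xs v j\<close> and
  \<open>Ys v j\<close> have to be filled, while for \<open>j \<ge> m\<close> they may be matched with each other; \<open>Ss v i\<close> must
  not stay empty if \<open>i < q\<close>.\<close>

datatype elt = Uv nat | Xs nat nat | Ys nat nat | Ss nat nat

section \<open>The slot graph of a two-colored instance\<close>

locale two_colors =
  fixes nU nV l p :: nat and red :: "nat \<Rightarrow> bool" and adj :: "nat \<Rightarrow> nat \<Rightarrow> bool"
begin

definition feasible :: bool where
  "feasible \<longleftrightarrow> (\<exists>\<phi>. (\<forall>u<nU. \<phi> u < nV \<and> adj u (\<phi> u)) \<and>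
     (\<forall>v<nV. card {u. u < nU \<and> red u \<and> \<phi> u = v} \<le> card {u. u < nU \<and> \<not> red u \<and> \<phi> u = v} + l \<and>
        card {u. u < nU \<and> \<not> red u \<and> \<phi> u = v} \<le> card {u. u < nU \<and> red u \<and> \<phi> u = v} + l \<and>
        p \<le> card {u. u < nU \<and> red u \<and> \<phi> u = v} + card {u. u < nU \<and> \<not> red u \<and> \<phi> u = v}))"

text \<open>A difference of at most \<open>l\<close> and a sum of at least \<open>p\<close> force
  both counts to be at least \<open>(p - l) / 2\<close>; \<open>m\<close> is this value rounded up.
  What is then still missing from \<open>p\<close> is \<open>q\<close>, and
  \<open>q \<le> l\<close>.\<close>

definition m :: nat where "m = (p - l + 1) div 2"
definition q :: nat where "q = p - 2 * m"
text \<open>Leaves more than \<open>nU\<close> pairs beyond the mandatory ones, so no possible count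
  is cut off, and never vanishes, so the minima in \<open>certificate\<close> exist.\<close>

definition N :: nat where "N = m + Suc nU"

text \<open>Without the slots \<open>Ss\<close> the relation \<open>nb\<close> is bipartite with
  sides \<open>A\<close> and \<open>B\<close>. A slot \<open>Ss\<close> counts for both sides, since
  it may receive one vertex of either color.\<close>

definition A :: "elt set" where "A = Uv ` {u. u < nU \<and> red u} \<union> (\<lambda>(v, j). Ys v j) ` ({..<nV} \<times> {..<N})"
definition B :: "elt set" where "B = Uv ` {u. u < nU \<and> \<not> red u} \<union> (\<lambda>(v, j). Xs v j) ` ({..<nV} \<times> {..<N})"
definition Sg :: "elt set" where "Sg = (\<lambda>(v, i). Ss v i) ` ({..<nV} \<times> {..<l})"
definition Sm :: "elt set" where "Sm = (\<lambda>(v, i). Ss v i) ` ({..<nV} \<times> {..<q})"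
definition E :: "elt set" where "E = A \<union> B \<union> Sg"

fun nb1 :: "elt \<Rightarrow> elt \<Rightarrow> bool" where
  "nb1 (Uv u) (Xs v j) \<longleftrightarrow> red u \<and> adj u v"
| "nb1 (Uv u) (Ys v j) \<longleftrightarrow> \<not> red u \<and> adj u v"
| "nb1 (Uv u) (Ss v i) \<longleftrightarrow> adj u v"
| "nb1 (Xs v j) (Ys v' j') \<longleftrightarrow> v = v' \<and> j = j' \<and> m \<le> j"
| "nb1 _ _ \<longleftrightarrow> False"

definition nb :: "elt \<Rightarrow> elt \<Rightarrow> bool" where "nb e e' \<longleftrightarrow> nb1 e e' \<or> nb1 e' e"

text \<open>The tag is the side on which \<open>e\<close> acts, with \<open>True\<close> standing
  for \<open>A\<close>, so every \<open>e'\<close> is available once per side. An element of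
  \<open>Sm\<close> need only be covered from one side and chooses it together with its
  partner.\<close>

definition \<Gamma> :: "elt \<Rightarrow> (elt \<times> bool) set" where
  "\<Gamma> e = (\<lambda>e'. (e', e \<in> A \<or> e' \<in> B)) ` {e' \<in> E. nb e e'}"

lemma mem: "Uv u \<in> A \<longleftrightarrow> u < nU \<and> red u" "Uv u \<in> B \<longleftrightarrow> u < nU \<and> \<not> red u"
  "Uv u \<notin> Sg" "Uv u \<notin> Sm"
  "Xs v j \<notin> A" "Xs v j \<in> B \<longleftrightarrow> v < nV \<and> j < N" "Xs v j \<notin> Sg" "Xs v j \<notin> Sm"
  "Ys v j \<in> A \<longleftrightarrow> v < nV \<and> j < N" "Ys v j \<notin> B" "Ys v j \<notin> Sg" "Ys v j \<notin> Sm"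
  "Ss v i \<notin> A" "Ss v i \<notin> B" "Ss v i \<in> Sg \<longleftrightarrow> v < nV \<and> i < l" "Ss v i \<in> Sm \<longleftrightarrow> v < nV \<and> i < q"
  by (auto simp: A_def B_def Sg_def Sm_def)

lemma memE: "Uv u \<in> E \<longleftrightarrow> u < nU" "Xs v j \<in> E \<longleftrightarrow> v < nV \<and> j < N"
  "Ys v j \<in> E \<longleftrightarrow> v < nV \<and> j < N" "Ss v i \<in> E \<longleftrightarrow> v < nV \<and> i < l"
  by (auto simp: E_def mem)

lemma finite_E: "finite E"
  by (simp add: E_def A_def B_def Sg_def)

lemma q_le: "q \<le> l" "p \<le> 2 * m + q"
  by (auto simp: q_def m_def)

lemma Sm_Sg: "Sm \<subseteq> Sg"
  using q_le by (auto simp: Sg_def Sm_def)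

text \<open>The two sides of the double give two injections, which the Mendelsohn-Dulmage theorem
  merges into one matching. Every left vertex goes to the right vertex that owns its slot. Slots
  \<open>Xs\<close> and \<open>Ys\<close> are filled equally often, so the counts differ only by
  slots \<open>Ss\<close>, of which there are \<open>l\<close>.\<close>

lemma feasible_of_matching:
  assumes h: "inj_on h (A \<union> B \<union> Sm)" "\<And>e. e \<in> A \<union> B \<union> Sm \<Longrightarrow> h e \<in> \<Gamma> e"
  shows feasible
proof -
  have hE: "fst (h e) \<in> E" "nb e (fst (h e))" "snd (h e) \<longleftrightarrow> e \<in> A \<or> fst (h e) \<in> B" if "e \<in> A \<union> B \<union> Sm" for e
    using h(2)[OF that] by (auto simp: \<Gamma>_def)
  have nbB: "e' \<notin> B" if "nb e e'" "e \<in> B" for e e'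
    using that by (cases e; cases e') (auto simp: nb_def mem)
  \<comment> \<open>The tag puts each slot of \<open>Sm\<close> on one side. As tags agree within a
    side, injectivity of \<open>h\<close> passes to its first component.\<close>
  define A' where "A' = A \<union> {s \<in> Sm. snd (h s)}"
  define B' where "B' = B \<union> {s \<in> Sm. \<not> snd (h s)}"
  have AB: "A \<inter> B = {}" by (auto simp: A_def B_def)
  have sA: "e \<in> A \<union> B \<union> Sm" "snd (h e)" if "e \<in> A'" for e using that hE(3)[of e] by (auto simp: A'_def)
  have sB: "e \<in> A \<union> B \<union> Sm" "\<not> snd (h e)" if "e \<in> B'" for e
    using that hE(2,3)[of e] nbB[of e "fst (h e)"] AB by (auto simp: B'_def)
  have "inj_on (\<lambda>e. fst (h e)) A'"
  proof (rule inj_onI)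
    fix a b assume "a \<in> A'" "b \<in> A'" "fst (h a) = fst (h b)"
    then show "a = b" using sA[of a] sA[of b] by (intro inj_onD[OF h(1), of a b]) (simp_all add: prod_eq_iff)
  qed
  moreover have "inj_on (\<lambda>e. fst (h e)) B'"
  proof (rule inj_onI)
    fix a b assume "a \<in> B'" "b \<in> B'" "fst (h a) = fst (h b)"
    then show "a = b" using sB[of a] sB[of b] by (intro inj_onD[OF h(1), of a b]) (simp_all add: prod_eq_iff)
  qed
  ultimately obtain \<mu> \<nu> where
    \<mu>: "\<And>a. a \<in> A' \<Longrightarrow> \<mu> a = fst (h a) \<or> \<mu> a \<in> B' \<and> fst (h (\<mu> a)) = a" and
    \<nu>: "\<And>b. b \<in> B' \<Longrightarrow> \<nu> b = fst (h b) \<or> \<nu> b \<in> A' \<and> fst (h (\<nu> b)) = b" and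
    \<mu>\<nu>: "\<And>a b. a \<in> A' \<Longrightarrow> \<mu> a = b \<Longrightarrow> \<nu> b = a" and \<nu>\<mu>: "\<And>a b. b \<in> B' \<Longrightarrow> \<nu> b = a \<Longrightarrow> \<mu> a = b"
    by (rule combine_matchings) blast
  have nb_sym: "nb e e' \<longleftrightarrow> nb e' e" for e e' by (auto simp: nb_def)
  have A'E: "A' \<subseteq> E" "B' \<subseteq> E" using Sm_Sg by (auto simp: A'_def B'_def E_def)
  have \<mu>_nb: "nb a (\<mu> a) \<and> \<mu> a \<in> E" if "a \<in> A'" for a
    using \<mu>[OF that] hE(1,2)[of a] hE(2)[of "\<mu> a"] sA(1)[OF that] sB(1)[of "\<mu> a"] A'E by (auto simp: nb_sym)
  have \<nu>_nb: "nb b (\<nu> b) \<and> \<nu> b \<in> E" if "b \<in> B'" for b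
    using \<nu>[OF that] hE(1,2)[of b] hE(2)[of "\<nu> b"] sB(1)[OF that] sA(1)[of "\<nu> b"] A'E by (auto simp: nb_sym)
  have inA: "a \<in> A'" if "a \<in> A" for a using that by (simp add: A'_def)
  have inB: "b \<in> B'" if "b \<in> B" for b using that by (simp add: B'_def)
  define pr where "pr = (\<lambda>u. if red u then \<mu> (Uv u) else \<nu> (Uv u))"
  define node where "node = (\<lambda>e. case e of Xs v j \<Rightarrow> v | Ys v j \<Rightarrow> v | Ss v i \<Rightarrow> v | Uv u \<Rightarrow> 0)"
  have pr: "(red u \<and> (\<exists>v j. pr u = Xs v j \<and> v < nV \<and> j < N \<and> adj u v)) \<or>
      (\<not> red u \<and> (\<exists>v j. pr u = Ys v j \<and> v < nV \<and> j < N \<and> adj u v)) \<or>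
      (\<exists>v i. pr u = Ss v i \<and> v < nV \<and> i < l \<and> adj u v)" if "u < nU" for u
  proof (cases "red u")
    case True
    then have "nb (Uv u) (pr u)" "pr u \<in> E" using \<mu>_nb[OF inA, of "Uv u"] that by (auto simp: mem pr_def)
    then show ?thesis using True by (cases "pr u") (auto simp: nb_def memE)
  next
    case False
    then have "nb (Uv u) (pr u)" "pr u \<in> E" using \<nu>_nb[OF inB, of "Uv u"] that by (auto simp: mem pr_def)
    then show ?thesis using False by (cases "pr u") (auto simp: nb_def memE)
  qed
  have inj_pr: "u = u'" if "u < nU" "u' < nU" "red u = red u'" "pr u = pr u'" for u u'
  proof (cases "red u")
    case True
    then show ?thesis
      using that \<mu>\<nu>[of "Uv u" "pr u"] \<mu>\<nu>[of "Uv u'" "pr u"] inA by (auto simp: pr_def mem)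
  next
    case False
    then show ?thesis
      using that \<nu>\<mu>[of "Uv u" "pr u"] \<nu>\<mu>[of "Uv u'" "pr u"] inB by (auto simp: pr_def mem)
  qed
  define \<phi> where "\<phi> = (\<lambda>u. node (pr u))"
  define J where "J = (\<lambda>v. {j. j < N \<and> (\<exists>u<nU. red u \<and> pr u = Xs v j)})"
  define J' where "J' = (\<lambda>v. {j. j < N \<and> (\<exists>u<nU. \<not> red u \<and> pr u = Ys v j)})"
  define I where "I = (\<lambda>r v. {i. i < l \<and> (\<exists>u<nU. red u = r \<and> pr u = Ss v i)})"
  have X: "(\<exists>u<nU. red u \<and> pr u = Xs v j) \<or> \<nu> (Xs v j) = Ys v j \<and> m \<le> j" if "v < nV" "j < N" for v j
  proof -
    have "nb (Xs v j) (\<nu> (Xs v j))" "\<nu> (Xs v j) \<in> E" using \<nu>_nb[OF inB, of "Xs v j"] that by (auto simp: mem)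
    moreover have "\<mu> (\<nu> (Xs v j)) = Xs v j" using \<nu>\<mu>[of "Xs v j" "\<nu> (Xs v j)"] inB that by (auto simp: mem)
    ultimately show ?thesis by (cases "\<nu> (Xs v j)") (auto simp: nb_def memE pr_def)
  qed
  have Y: "(\<exists>u<nU. \<not> red u \<and> pr u = Ys v j) \<or> \<mu> (Ys v j) = Xs v j \<and> m \<le> j" if "v < nV" "j < N" for v j
  proof -
    have "nb (Ys v j) (\<mu> (Ys v j))" "\<mu> (Ys v j) \<in> E" using \<mu>_nb[OF inA, of "Ys v j"] that by (auto simp: mem)
    moreover have "\<nu> (\<mu> (Ys v j)) = Ys v j" using \<mu>\<nu>[of "Ys v j" "\<mu> (Ys v j)"] inA that by (auto simp: mem)
    ultimately show ?thesis by (cases "\<mu> (Ys v j)") (auto simp: nb_def memE pr_def)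
  qed
  \<comment> \<open>A slot \<open>Xs v j\<close> without a left vertex must be matched with
    \<open>Ys v j\<close>, and conversely; so the two are filled together or empty together.\<close>
  have JJ: "J v = J' v" if v: "v < nV" for v
  proof (intro set_eqI iffI)
    fix j assume "j \<in> J v"
    then obtain u where j: "j < N" and u: "u < nU" "red u" "\<mu> (Uv u) = Xs v j" by (auto simp: J_def pr_def)
    then have "\<nu> (Xs v j) = Uv u" using \<mu>\<nu>[of "Uv u"] inA by (auto simp: mem)
    then have "\<mu> (Ys v j) \<noteq> Xs v j" using \<mu>\<nu>[of "Ys v j" "Xs v j"] inA[of "Ys v j"] v j by (auto simp: mem)
    then show "j \<in> J' v" using Y[OF v j] j by (auto simp: J'_def)
  next
    fix j assume "j \<in> J' v"
    then obtain u where j: "j < N" and u: "u < nU" "\<not> red u" "\<nu> (Uv u) = Ys v j" by (auto simp: J'_def pr_def)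
    then have "\<mu> (Ys v j) = Uv u" using \<nu>\<mu>[of "Uv u"] inB by (auto simp: mem)
    then have "\<nu> (Xs v j) \<noteq> Ys v j" using \<nu>\<mu>[of "Xs v j" "Ys v j"] inB[of "Xs v j"] v j by (auto simp: mem)
    then show "j \<in> J v" using X[OF v j] j by (auto simp: J_def)
  qed
  have mJ: "m \<le> card (J v)" if v: "v < nV" for v
  proof -
    have "j \<in> J v" if "j < m" for j
      using X[OF v, of j] that by (auto simp: J_def N_def)
    then have "{..<m} \<subseteq> J v" by blast
    moreover have "finite (J v)" by (simp add: J_def)
    ultimately show ?thesis using card_mono[of "J v" "{..<m}"] by simp
  qed
  have count: "card {u. u < nU \<and> red u = r \<and> \<phi> u = v} = card (if r then J v else J' v) + card (I r v)"
    if v: "v < nV" for r v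
  proof -
    let ?C = "{u. u < nU \<and> red u = r \<and> \<phi> u = v}"
    let ?sl = "(if r then Xs v else Ys v) ` (if r then J v else J' v) \<union> Ss v ` I r v"
    have sl: "pr ` ?C = ?sl"
    proof (intro set_eqI iffI)
      fix e assume "e \<in> pr ` ?C"
      then obtain u where "u < nU" "red u = r" "\<phi> u = v" "e = pr u" by auto
      then show "e \<in> ?sl" using pr[of u] by (auto simp: \<phi>_def node_def J_def J'_def I_def image_iff)
    next
      fix e assume "e \<in> ?sl"
      then obtain u where "u < nU" "red u = r" "pr u = e" "node e = v"
        by (cases r) (auto simp: J_def J'_def I_def node_def)
      then show "e \<in> pr ` ?C" by (auto simp: \<phi>_def)
    qed
    have "inj_on pr ?C" using inj_pr by (auto intro!: inj_onI)
    then have "card ?C = card (pr ` ?C)" by (rule card_image[symmetric])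
    also have "\<dots> = card ?sl" by (rule arg_cong[OF sl])
    also have "\<dots> = card ((if r then Xs v else Ys v) ` (if r then J v else J' v)) + card (Ss v ` I r v)"
      by (rule card_Un_disjoint) (cases r; auto simp: J_def J'_def I_def)+
    also have "card ((if r then Xs v else Ys v) ` (if r then J v else J' v)) = card (if r then J v else J' v)"
      by (auto intro!: card_image simp: inj_on_def)
    also have "card (Ss v ` I r v) = card (I r v)" by (auto intro!: card_image simp: inj_on_def)
    finally show ?thesis .
  qed
  have I_le: "card (I r v) \<le> l" for r v
    using card_mono[of "{..<l}" "I r v"] by (auto simp: I_def)
  \<comment> \<open>Each of the first \<open>q\<close> slots \<open>Ss v i\<close> is covered from
    some side, hence holds a vertex of some color.\<close>
  have q_cov: "q \<le> card (I True v) + card (I False v)" if v: "v < nV" for v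
  proof -
    have "{..<q} \<subseteq> I True v \<union> I False v"
    proof
      fix i assume i: "i \<in> {..<q}"
      let ?s = "Ss v i"
      have s: "?s \<in> Sm" "i < l" using i v q_le by (auto simp: mem)
      show "i \<in> I True v \<union> I False v"
      proof (cases "snd (h ?s)")
        case True
        then have sA': "?s \<in> A'" using s by (simp add: A'_def)
        then have "nb ?s (\<mu> ?s)" "\<mu> ?s \<in> E" "\<nu> (\<mu> ?s) = ?s" using \<mu>_nb \<mu>\<nu> by auto
        moreover have "\<mu> ?s \<in> B"
        proof -
          from \<mu>[OF sA'] consider "\<mu> ?s = fst (h ?s)" | "\<mu> ?s \<in> B'" by blast
          then show ?thesis
          proof cases
            case 1
            then show ?thesis using hE(3)[of ?s] s True by (auto simp: mem)
          next
            case 2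
            then have "\<mu> ?s \<in> B \<or> \<mu> ?s \<in> Sm" by (auto simp: B'_def)
            then show ?thesis using \<open>nb ?s (\<mu> ?s)\<close> by (cases "\<mu> ?s") (auto simp: nb_def mem)
          qed
        qed
        ultimately show ?thesis using s(2) by (cases "\<mu> ?s") (auto simp: nb_def mem I_def pr_def)
      next
        case False
        then have sB': "?s \<in> B'" using s by (simp add: B'_def)
        then have "nb ?s (\<nu> ?s)" "\<nu> ?s \<in> E" "\<mu> (\<nu> ?s) = ?s" using \<nu>_nb \<nu>\<mu> by auto
        moreover have "\<nu> ?s \<in> A"
        proof -
          from \<nu>[OF sB'] consider "\<nu> ?s = fst (h ?s)" | "\<nu> ?s \<in> A'" by blast
          then show ?thesis
          proof cases
            case 1
            then have "\<nu> ?s \<notin> B" using hE(3)[of ?s] s False by (auto simp: mem)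
            then show ?thesis using \<open>nb ?s (\<nu> ?s)\<close> \<open>\<nu> ?s \<in> E\<close> by (cases "\<nu> ?s") (auto simp: nb_def mem memE)
          next
            case 2
            then have "\<nu> ?s \<in> A \<or> \<nu> ?s \<in> Sm" by (auto simp: A'_def)
            then show ?thesis using \<open>nb ?s (\<nu> ?s)\<close> by (cases "\<nu> ?s") (auto simp: nb_def mem)
          qed
        qed
        ultimately show ?thesis using s(2) by (cases "\<nu> ?s") (auto simp: nb_def mem I_def pr_def)
      qed
    qed
    then have "card {..<q} \<le> card (I True v \<union> I False v)" by (intro card_mono) (auto simp: I_def)
    then show ?thesis using card_Un_le[of "I True v" "I False v"] by simp
  qed
  show feasible
    unfolding feasible_def
  proof (intro exI[of _ \<phi>] conjI allI impI)
    fix u assume "u < nU"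
    from pr[OF this] show "\<phi> u < nV" "adj u (\<phi> u)" by (auto simp: \<phi>_def node_def)
  next
    fix v assume v: "v < nV"
    have c: "card {u. u < nU \<and> red u \<and> \<phi> u = v} = card (J v) + card (I True v)"
      "card {u. u < nU \<and> \<not> red u \<and> \<phi> u = v} = card (J v) + card (I False v)"
      using count[OF v, of True] count[OF v, of False] JJ[OF v] by simp_all
    show "card {u. u < nU \<and> red u \<and> \<phi> u = v} \<le> card {u. u < nU \<and> \<not> red u \<and> \<phi> u = v} + l"
      "card {u. u < nU \<and> \<not> red u \<and> \<phi> u = v} \<le> card {u. u < nU \<and> red u \<and> \<phi> u = v} + l"
      unfolding c using I_le[of True v] I_le[of False v] by linarith+
    show "p \<le> card {u. u < nU \<and> red u \<and> \<phi> u = v} + card {u. u < nU \<and> \<not> red u \<and> \<phi> u = v}"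
      unfolding c using mJ[OF v] q_cov[OF v] q_le by linarith
  qed
qed


section \<open>From a violation of Hall's condition to a bounded certificate\<close>

lemma violator:
  assumes "\<not> feasible"
  obtains X where "X \<subseteq> A \<union> B \<union> Sm" "card (\<Union>(\<Gamma> ` X)) < card X"
proof -
  have "finite (A \<union> B \<union> Sm)" using finite_subset[OF _ finite_E, of "A \<union> B \<union> Sm"] Sm_Sg by (auto simp: E_def)
  moreover have "finite (\<Gamma> e)" for e using finite_E by (simp add: \<Gamma>_def)
  ultimately have "\<exists>X\<subseteq>A \<union> B \<union> Sm. \<not> card X \<le> card (\<Union>(\<Gamma> ` X))"
    using hall[of "A \<union> B \<union> Sm" \<Gamma>] feasible_of_matching assms by blast
  then show ?thesis using that by (auto simp: not_le)
qed

lemma sum_E: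
  "(\<Sum>e\<in>E. f e) = (\<Sum>u<nU. f (Uv u)) +
     (\<Sum>v<nV. (\<Sum>j<N. f (Xs v j) + f (Ys v j)) + (\<Sum>i<l. f (Ss v i)))" for f :: "elt \<Rightarrow> int"
proof -
  let ?X = "(\<lambda>(v, j). Xs v j) ` ({..<nV} \<times> {..<N})" and ?Y = "(\<lambda>(v, j). Ys v j) ` ({..<nV} \<times> {..<N})"
  have slots: "sum f ((\<lambda>(v, j). C v j) ` ({..<nV} \<times> {..<k})) = (\<Sum>v<nV. \<Sum>j<k. f (C v j))"
    if C: "\<And>v j v' j'. C v j = C v' j' \<Longrightarrow> v = v' \<and> j = j'" for C k
  proof -
    have "inj_on (\<lambda>(v, j). C v j) ({..<nV} \<times> {..<k})"
      by (rule inj_onI) (use C in \<open>force split: prod.splits\<close>)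
    from sum.reindex[OF this, of f] show ?thesis
      by (simp add: sum.cartesian_product o_def case_prod_unfold)
  qed
  have E: "E = Uv ` {..<nU} \<union> (?X \<union> (?Y \<union> Sg))"
    by (auto simp: E_def A_def B_def)
  have h0: "sum f E = sum f (Uv ` {..<nU}) + (sum f ?X + (sum f ?Y + sum f Sg))"
  proof -
    have 1: "sum f (?Y \<union> Sg) = sum f ?Y + sum f Sg"
      by (rule sum.union_disjoint) (auto simp: Sg_def)
    have 2: "sum f (?X \<union> (?Y \<union> Sg)) = sum f ?X + sum f (?Y \<union> Sg)"
      by (rule sum.union_disjoint) (auto simp: Sg_def)
    have 3: "sum f (Uv ` {..<nU} \<union> (?X \<union> (?Y \<union> Sg))) = sum f (Uv ` {..<nU}) + sum f (?X \<union> (?Y \<union> Sg))"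
      by (rule sum.union_disjoint) (auto simp: Sg_def)
    show ?thesis unfolding E 3 2 1 ..
  qed
  have h1: "sum f (Uv ` {..<nU}) = (\<Sum>u<nU. f (Uv u))"
    using sum.reindex[of Uv "{..<nU}" f] by (simp add: inj_on_def o_def)
  have h2: "sum f ?X = (\<Sum>v<nV. \<Sum>j<N. f (Xs v j))" by (rule slots) simp
  have h3: "sum f ?Y = (\<Sum>v<nV. \<Sum>j<N. f (Ys v j))" by (rule slots) simp
  have h4: "sum f Sg = (\<Sum>v<nV. \<Sum>i<l. f (Ss v i))" unfolding Sg_def by (rule slots) simp
  show ?thesis unfolding h0 h1 h2 h3 h4 by (simp add: sum.distrib)
qed

text \<open>The potential of \<open>e\<close> counts its copies among the neighbors of a violating
  set \<open>X\<close>, minus one if \<open>e\<close> is in \<open>X\<close>. Its sum is therefore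
  negative. A neighbor of an element of \<open>X\<close> has a copy, which makes the sum along every
  edge nonnegative. Two copies per element are the origin of the bound 2.\<close>

lemma potential:
  assumes "\<not> feasible"
  obtains \<pi> :: "elt \<Rightarrow> int" where "\<And>e. - 1 \<le> \<pi> e \<and> \<pi> e \<le> 2"
    "\<And>e e'. e \<in> E \<Longrightarrow> e' \<in> E \<Longrightarrow> nb e e' \<Longrightarrow> 0 \<le> \<pi> e + \<pi> e'"
    "\<And>v i. q \<le> i \<Longrightarrow> 0 \<le> \<pi> (Ss v i)" "(\<Sum>e\<in>E. \<pi> e) \<le> - 1"
proof -
  obtain X where X: "X \<subseteq> A \<union> B \<union> Sm" "card (\<Union>(\<Gamma> ` X)) < card X" using violator[OF assms] .
  define NX where "NX = \<Union>(\<Gamma> ` X)"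
  define \<pi> where "\<pi> = (\<lambda>e. (of_bool ((e, True) \<in> NX) + of_bool ((e, False) \<in> NX) - of_bool (e \<in> X) :: int))"
  have XE: "X \<subseteq> E" using X(1) Sm_Sg by (auto simp: E_def)
  have NE: "NX \<subseteq> E \<times> UNIV" by (auto simp: NX_def \<Gamma>_def)
  have ge0: "0 \<le> \<pi> e" if "e \<notin> X" for e using that by (simp add: \<pi>_def)
  have nbX: "1 \<le> \<pi> e' + of_bool (e' \<in> X)" if "e \<in> X" "e' \<in> E" "nb e e'" for e e'
  proof -
    have "(e', e \<in> A \<or> e' \<in> B) \<in> NX" using that by (auto simp: NX_def \<Gamma>_def)
    then show ?thesis by (cases "e \<in> A \<or> e' \<in> B") (auto simp: \<pi>_def)
  qed
  show ?thesis
  proof (rule that[of \<pi>])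
    show "- 1 \<le> \<pi> e \<and> \<pi> e \<le> 2" for e by (simp add: \<pi>_def)
    show "0 \<le> \<pi> (Ss v i)" if "q \<le> i" for v i
      using X(1) that by (intro ge0) (auto simp: mem dest: subsetD)
  next
    fix e e' assume e: "e \<in> E" "e' \<in> E" "nb e e'"
    then have "nb e' e" by (auto simp: nb_def)
    moreover have "- 1 \<le> \<pi> e" "- 1 \<le> \<pi> e'" by (simp_all add: \<pi>_def)
    ultimately show "0 \<le> \<pi> e + \<pi> e'"
      using nbX[of e e'] nbX[of e' e] ge0[of e] ge0[of e'] e by (cases "e \<in> X"; cases "e' \<in> X") auto
  next
    have "int (card NX) = (\<Sum>x\<in>E \<times> UNIV. of_bool (x \<in> NX))"
      using NE finite_E by (simp add: Int_absorb1)
    also have "\<dots> = (\<Sum>e\<in>E. \<Sum>b\<in>UNIV. of_bool ((e, b) \<in> NX))"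
      by (simp add: sum.cartesian_product del: sum_of_bool_eq)
    also have "\<dots> = (\<Sum>e\<in>E. of_bool ((e, True) \<in> NX) + of_bool ((e, False) \<in> NX))"
      by (simp add: UNIV_bool add.commute del: sum_of_bool_eq)
    finally have 1: "int (card NX) = \<dots>" .
    have 2: "int (card X) = (\<Sum>e\<in>E. of_bool (e \<in> X))"
      using XE finite_E by (simp add: Int_absorb1)
    have "(\<Sum>e\<in>E. \<pi> e) = int (card NX) - int (card X)"
      unfolding 1 2 \<pi>_def by (simp add: sum_subtractf)
    then show "(\<Sum>e\<in>E. \<pi> e) \<le> - 1" using X(2) by (simp add: NX_def)
  qed
qed

end

text \<open>Weak duality at one right vertex, where \<open>r\<close> and \<open>b\<close> bound the
  slot potentials from below. The first \<open>m\<close> slots pay for \<open>m\<close> vertices of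
  each color, and later pairs pay at least \<open>max 0 (r + b)\<close>. If
  \<open>M = max r b\<close> is nonnegative, the pairs pay for the common part of the remaining
  counts and the slots \<open>s i\<close> for the surplus of at most \<open>l\<close>. If
  \<open>M\<close> is negative, only slots with \<open>i < q\<close> may contribute negatively, and
  at least \<open>q\<close> further vertices cost at most \<open>M\<close> each.\<close>

lemma slot_sum:
  fixes x y s :: "nat \<Rightarrow> int" and r b :: int
  assumes x: "\<And>j. j < m + Suc n \<Longrightarrow> r \<le> x j" and y: "\<And>j. j < m + Suc n \<Longrightarrow> b \<le> y j"
    and xy: "\<And>j. m \<le> j \<Longrightarrow> j < m + Suc n \<Longrightarrow> 0 \<le> x j + y j"
    and s: "\<And>i. i < l \<Longrightarrow> r \<le> s i \<and> b \<le> s i" and s0: "\<And>i. i < l \<Longrightarrow> q \<le> i \<Longrightarrow> 0 \<le> s i"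
    and q: "q \<le> l" and \<alpha>: "m \<le> \<alpha>" "\<alpha> \<le> n" "m \<le> \<beta>" "\<beta> \<le> n" "\<alpha> \<le> \<beta> + l" "\<beta> \<le> \<alpha> + l" "q + 2 * m \<le> \<alpha> + \<beta>"
  shows "r * int \<alpha> + b * int \<beta> \<le> (\<Sum>j<m + Suc n. x j + y j) + (\<Sum>i<l. s i)"
proof -
  have "(\<Sum>j<m. r + b) \<le> (\<Sum>j<m. x j + y j)" using x y by (intro sum_mono add_mono) auto
  then have 1: "int m * (r + b) \<le> (\<Sum>j<m. x j + y j)" by simp
  have split: "(\<Sum>j<m + Suc n. x j + y j) = (\<Sum>j<m. x j + y j) + (\<Sum>j=m..<m + Suc n. x j + y j)"
    using sum.atLeastLessThan_concat[of 0 m "m + Suc n" "\<lambda>j. x j + y j"] by (simp add: lessThan_atLeast0)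
  have "(\<Sum>j=m..<m + Suc n. max 0 (r + b)) \<le> (\<Sum>j=m..<m + Suc n. x j + y j)"
    using x y xy by (intro sum_mono) (simp add: add_mono)
  then have 2: "int (Suc n) * max 0 (r + b) \<le> (\<Sum>j=m..<m + Suc n. x j + y j)" by simp
  define M where "M = max r b"
  have rb: "r \<le> M" "b \<le> M" "r + b = M + min r b" by (auto simp: M_def)
  obtain a c where ac: "\<alpha> = m + a" "\<beta> = m + c" using \<alpha> by (meson le_Suc_ex)
  have "r * int a + b * int c \<le> int (Suc n) * max 0 (r + b) + (\<Sum>i<l. s i)"
  proof (cases "0 \<le> M")
    case True
    have "(\<Sum>i<l. M) \<le> (\<Sum>i<l. s i)" using s by (intro sum_mono) (simp add: M_def)
    then have l: "int l * M \<le> (\<Sum>i<l. s i)" by simp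
    have "int (min a c) * (r + b) \<le> int (min a c) * max 0 (r + b)" by (intro mult_left_mono) auto
    also have "\<dots> \<le> int (Suc n) * max 0 (r + b)" using \<alpha> ac by (intro mult_right_mono) auto
    finally have n: "int (min a c) * (r + b) \<le> int (Suc n) * max 0 (r + b)" .
    have "r * int a + b * int c \<le> int (min a c) * (r + b) + int l * M"
    proof (cases "a \<le> c")
      case ac': True
      have "b * (int c - int a) \<le> M * (int c - int a)" using ac' rb by (intro mult_right_mono) auto
      also have "\<dots> \<le> M * int l" using True \<alpha> ac by (intro mult_left_mono) auto
      finally show ?thesis using ac' by (simp add: algebra_simps)
    next
      case ac': False
      have "r * (int a - int c) \<le> M * (int a - int c)" using ac' rb by (intro mult_right_mono) auto
      also have "\<dots> \<le> M * int l" using True \<alpha> ac by (intro mult_left_mono) auto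
      finally show ?thesis using ac' by (simp add: algebra_simps)
    qed
    then show ?thesis using l n by linarith
  next
    case False
    have "(\<Sum>i<l. if i < q then M else 0) \<le> (\<Sum>i<l. s i)"
      using s s0 by (intro sum_mono) (auto simp: M_def)
    moreover have "(\<Sum>i<l. if i < q then M else 0) = int q * M"
    proof -
      have "{..<l} \<inter> {i. i < q} = {..<q}" using q by auto
      then show ?thesis by (simp add: sum.If_cases)
    qed
    ultimately have l: "int q * M \<le> (\<Sum>i<l. s i)" by simp
    have "r * int a + b * int c \<le> M * int a + M * int c" using rb by (intro add_mono mult_right_mono) auto
    also have "\<dots> = M * (int a + int c)" by (simp add: algebra_simps)
    also have "\<dots> \<le> M * int q" using False \<alpha>(7) ac by (intro mult_left_mono_neg) auto
    finally have "r * int a + b * int c \<le> M * int q" .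
    also have "\<dots> \<le> (\<Sum>i<l. s i)" using l by (simp add: mult.commute)
    finally show ?thesis by (rule add_increasing[rotated]) simp
  qed
  then show ?thesis using 1 2 split by (simp add: ac algebra_simps)
qed

context two_colors
begin

text \<open>Let \<open>yr v\<close> and \<open>yb v\<close> be the smallest potentials of the slots
  of \<open>v\<close> that accept the respective color. The edge inequalities bound the prices of
  the left vertices from below, \<open>slot_sum\<close> bounds those of the counts from above, and
  the total potential of at most -1 supplies the gap. No relation between \<phi> and the counts
  enters, so the gap holds for all combinations of choices.\<close>

theorem certificate:
  assumes "\<not> feasible"
  obtains yr yb :: "nat \<Rightarrow> int" where "\<And>v. \<bar>yr v\<bar> \<le> 2" "\<And>v. \<bar>yb v\<bar> \<le> 2"
    "\<And>\<phi> \<alpha> \<beta>. \<forall>u<nU. \<phi> u < nV \<and> adj u (\<phi> u) \<Longrightarrow>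
      \<forall>v<nV. \<alpha> v \<le> nU \<and> \<beta> v \<le> nU \<and> \<alpha> v \<le> \<beta> v + l \<and> \<beta> v \<le> \<alpha> v + l \<and> p \<le> \<alpha> v + \<beta> v \<Longrightarrow>
      1 \<le> (\<Sum>u<nU. if red u then yr (\<phi> u) else yb (\<phi> u)) -
        (\<Sum>v<nV. yr v * int (\<alpha> v) + yb v * int (\<beta> v))"
proof -
  obtain \<pi> :: "elt \<Rightarrow> int" where \<pi>: "\<And>e. - 1 \<le> \<pi> e \<and> \<pi> e \<le> 2"
    "\<And>e e'. e \<in> E \<Longrightarrow> e' \<in> E \<Longrightarrow> nb e e' \<Longrightarrow> 0 \<le> \<pi> e + \<pi> e'"
    "\<And>v i. q \<le> i \<Longrightarrow> 0 \<le> \<pi> (Ss v i)" "(\<Sum>e\<in>E. \<pi> e) \<le> - 1"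
    by (rule potential[OF assms]) (rule that; assumption)
  define Rv where "Rv = (\<lambda>v. Xs v ` {..<N} \<union> Ss v ` {..<l})"
  define Bv where "Bv = (\<lambda>v. Ys v ` {..<N} \<union> Ss v ` {..<l})"
  define yr where "yr = (\<lambda>v. Min (\<pi> ` Rv v))"
  define yb where "yb = (\<lambda>v. Min (\<pi> ` Bv v))"
  have N: "0 < N" by (simp add: N_def)
  have fin: "finite (Rv v)" "Rv v \<noteq> {}" "finite (Bv v)" "Bv v \<noteq> {}" for v
    using N by (auto simp: Rv_def Bv_def)
  have "yr v \<in> \<pi> ` Rv v" "yb v \<in> \<pi> ` Bv v" for v
    unfolding yr_def yb_def using fin by (auto intro!: Min_in simp del: Min_in)
  then have yr_in: "\<exists>e\<in>Rv v. yr v = \<pi> e" and yb_in: "\<exists>e\<in>Bv v. yb v = \<pi> e" for v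
    by (simp_all add: image_iff)
  have yr_le: "yr v \<le> \<pi> e" if "e \<in> Rv v" for v e using that fin by (simp add: yr_def)
  have yb_le: "yb v \<le> \<pi> e" if "e \<in> Bv v" for v e using that fin by (simp add: yb_def)
  show ?thesis
  proof (rule that[of yr yb])
    show "\<bar>yr v\<bar> \<le> 2" for v
    proof -
      obtain e where "yr v = \<pi> e" using yr_in by blast
      then show ?thesis using \<pi>(1)[of e] by linarith
    qed
    show "\<bar>yb v\<bar> \<le> 2" for v
    proof -
      obtain e where "yb v = \<pi> e" using yb_in by blast
      then show ?thesis using \<pi>(1)[of e] by linarith
    qed
  next
    fix \<phi> \<alpha> \<beta>
    assume A: "\<forall>u<nU. \<phi> u < nV \<and> adj u (\<phi> u)"
      "\<forall>v<nV. \<alpha> v \<le> nU \<and> \<beta> v \<le> nU \<and> \<alpha> v \<le> \<beta> v + l \<and> \<beta> v \<le> \<alpha> v + l \<and> p \<le> \<alpha> v + \<beta> v"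
    note \<phi> = A(1)[rule_format] and ab = A(2)[rule_format]
    have "- \<pi> (Uv u) \<le> (if red u then yr (\<phi> u) else yb (\<phi> u))" if u: "u < nU" for u
    proof (cases "red u")
      case True
      obtain e where e: "e \<in> Rv (\<phi> u)" "yr (\<phi> u) = \<pi> e" using yr_in by blast
      then have "nb (Uv u) e" "e \<in> E" using \<phi>[OF u] True by (auto simp: Rv_def nb_def memE)
      then show ?thesis using \<pi>(2)[of "Uv u" e] u e True by (simp add: memE)
    next
      case False
      obtain e where e: "e \<in> Bv (\<phi> u)" "yb (\<phi> u) = \<pi> e" using yb_in by blast
      then have "nb (Uv u) e" "e \<in> E" using \<phi>[OF u] False by (auto simp: Bv_def nb_def memE)
      then show ?thesis using \<pi>(2)[of "Uv u" e] u e False by (simp add: memE)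
    qed
    then have 1: "(\<Sum>u<nU. - \<pi> (Uv u)) \<le> (\<Sum>u<nU. if red u then yr (\<phi> u) else yb (\<phi> u))"
      by (intro sum_mono) simp
    have 2: "yr v * int (\<alpha> v) + yb v * int (\<beta> v) \<le> (\<Sum>j<N. \<pi> (Xs v j) + \<pi> (Ys v j)) + (\<Sum>i<l. \<pi> (Ss v i))"
      if v: "v < nV" for v
      unfolding N_def
    proof (rule slot_sum[where q = q])
      show "yr v \<le> \<pi> (Xs v j)" "yb v \<le> \<pi> (Ys v j)" if "j < m + Suc nU" for j
        using that by (auto intro!: yr_le yb_le simp: Rv_def Bv_def N_def)
      show "0 \<le> \<pi> (Xs v j) + \<pi> (Ys v j)" if "m \<le> j" "j < m + Suc nU" for j
        using that v by (intro \<pi>(2)) (auto simp: memE nb_def N_def)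
      show "yr v \<le> \<pi> (Ss v i) \<and> yb v \<le> \<pi> (Ss v i)" if "i < l" for i
        using that by (auto intro!: yr_le yb_le simp: Rv_def Bv_def)
      show "0 \<le> \<pi> (Ss v i)" if "q \<le> i" for i using \<pi>(3) that by simp
      show "q \<le> l" by (rule q_le)
      show "m \<le> \<alpha> v" "m \<le> \<beta> v" using ab[OF v] by (auto simp: m_def)
      then show "q + 2 * m \<le> \<alpha> v + \<beta> v" using ab[OF v] by (auto simp: q_def)
    qed (use ab[OF v] in auto)
    have "(\<Sum>v<nV. yr v * int (\<alpha> v) + yb v * int (\<beta> v)) \<le>
        (\<Sum>v<nV. (\<Sum>j<N. \<pi> (Xs v j) + \<pi> (Ys v j)) + (\<Sum>i<l. \<pi> (Ss v i)))"
      using 2 by (intro sum_mono) simp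
    then show "1 \<le> (\<Sum>u<nU. if red u then yr (\<phi> u) else yb (\<phi> u)) -
        (\<Sum>v<nV. yr v * int (\<alpha> v) + yb v * int (\<beta> v))"
      using 1 \<pi>(4) unfolding sum_E by (simp add: sum_negf)
  qed
qed

end

section \<open>A perceptron for zero-sum choices\<close>

text \<open>Each list in \<open>P\<close> offers some integer vectors, and we look for a choice of one vector from each list that
  sums up to zero. The weight \<open>w\<close> accumulates the choices that are best against the current weight;
  a weight with positive gain refutes the existence of such a choice.\<close>

definition dot :: "int list \<Rightarrow> int list \<Rightarrow> int" where
  "dot w s = sum_list (map (\<lambda>i. nth_default 0 w i * nth_default 0 s i) [0..<length w])"

definition best :: "int list \<Rightarrow> int list list \<Rightarrow> int list" where
  "best w ss = (case filter (\<lambda>s. list_all (\<lambda>x. dot w s \<le> dot w x) ss) ss of [] \<Rightarrow> [] | s # _ \<Rightarrow> s)"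

definition play :: "int list list list \<Rightarrow> int list \<times> bool \<Rightarrow> int list \<times> bool" where
  "play P st =
    (map (\<lambda>i. nth_default 0 (fst st) i + sum_list (map (\<lambda>ss. nth_default 0 (best (fst st) ss) i) P)) [0..<length (fst st)],
     snd st \<and> sum_list (map (\<lambda>ss. dot (fst st) (best (fst st) ss)) P) \<le> 0)"

text \<open>With \<open>Z = D * (K * R)\<^sup>2\<close>, a bound on the squared length of the sum
  added in one round, this is \<open>1 + D * (Z + 1)\<^sup>2\<close>.\<close>

definition rounds :: "nat \<Rightarrow> nat \<Rightarrow> nat \<Rightarrow> nat" where
  "rounds D R K = Suc (D * (Suc (D * (K * R * (K * R))) * Suc (D * (K * R * (K * R)))))"

definition perceptron :: "nat \<times> nat \<times> int list list list \<Rightarrow> bool" where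
  "perceptron x = snd ((play (snd (snd x)) ^^ rounds (fst x) (fst (snd x)) (length (snd (snd x)))) (replicate (fst x) 0, True))"

lemma dot_sum: "dot w s = (\<Sum>i<length w. nth_default 0 w i * nth_default 0 s i)"
  by (simp add: dot_def interv_sum_list_conv_sum_set_nat lessThan_atLeast0)

lemma best:
  assumes "ss \<noteq> []"
  shows "best w ss \<in> set ss" "x \<in> set ss \<Longrightarrow> dot w (best w ss) \<le> dot w x"
proof -
  let ?F = "filter (\<lambda>s. list_all (\<lambda>x. dot w s \<le> dot w x) ss) ss"
  have "Min (dot w ` set ss) \<in> dot w ` set ss" using assms by (intro Min_in) auto
  then obtain s where s: "s \<in> set ss" "dot w s = Min (dot w ` set ss)" by (metis imageE)
  then have "s \<in> set ?F" by (simp add: list_all_iff)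
  then obtain t ts where t: "?F = t # ts" by (cases ?F) auto
  then have "t \<in> set ?F" by simp
  then have "t \<in> set ss \<and> (\<forall>x\<in>set ss. dot w t \<le> dot w x)" by (simp add: list_all_iff)
  moreover have "best w ss = t" by (simp add: best_def t)
  ultimately show "best w ss \<in> set ss" "x \<in> set ss \<Longrightarrow> dot w (best w ss) \<le> dot w x" by auto
qed

lemma best_mem: "best w ss = [] \<or> best w ss \<in> set ss"
  using best(1)[of ss w] by (cases "ss = []") (auto simp: best_def)

lemma sum_list_nth: "sum_list (map f P) = (\<Sum>k<length P. f (P ! k))" for f :: "'a \<Rightarrow> int"
  by (simp add: sum_list_sum_nth lessThan_atLeast0)

lemma nth_default_map_upt: "nth_default d (map f [0..<n]) i = (if i < n then f i else d)"
  by (simp add: nth_default_def)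

section \<open>Correctness of the perceptron\<close>

locale choices =
  fixes D R :: nat and P :: "int list list list"
  assumes nonempty: "[] \<notin> set P"
begin

definition w :: "nat \<Rightarrow> nat \<Rightarrow> int" where
  "w t i = nth_default 0 (fst ((play P ^^ t) (replicate D 0, True))) i"

definition wl :: "nat \<Rightarrow> int list" where "wl t = fst ((play P ^^ t) (replicate D 0, True))"

definition z :: "nat \<Rightarrow> nat \<Rightarrow> int" where
  "z t i = (\<Sum>k<length P. nth_default 0 (best (wl t) (P ! k)) i)"

lemma length_wl: "length (wl t) = D"
  by (induction t) (simp_all add: wl_def play_def)

lemma w_0: "w 0 i = 0"
  by (simp add: w_def nth_default_def)

lemma w_Suc: "i < D \<Longrightarrow> w (Suc t) i = w t i + z t i"
  using length_wl[of t] by (simp add: w_def wl_def z_def play_def nth_default_map_upt sum_list_nth)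

lemma gain: "sum_list (map (\<lambda>ss. dot (wl t) (best (wl t) ss)) P) = (\<Sum>i<D. w t i * z t i)"
proof -
  have "sum_list (map (\<lambda>ss. dot (wl t) (best (wl t) ss)) P) =
      (\<Sum>k<length P. \<Sum>i<D. w t i * nth_default 0 (best (wl t) (P ! k)) i)"
    by (simp add: sum_list_nth dot_sum length_wl w_def flip: wl_def)
  also have "\<dots> = (\<Sum>i<D. w t i * z t i)"
    by (subst sum.swap) (simp add: z_def sum_distrib_left)
  finally show ?thesis .
qed

lemma ok_iff: "snd ((play P ^^ t) (replicate D 0, True)) \<longleftrightarrow> (\<forall>s<t. (\<Sum>i<D. w s i * z s i) \<le> 0)"
proof (induction t)
  case (Suc t)
  have "snd ((play P ^^ Suc t) (replicate D 0, True)) \<longleftrightarrow>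
      snd ((play P ^^ t) (replicate D 0, True)) \<and> (\<Sum>i<D. w t i * z t i) \<le> 0"
    unfolding gain[symmetric] by (simp add: play_def wl_def)
  then show ?case unfolding Suc less_Suc_eq by auto
qed simp

text \<open>The best choices cost no more than the choices \<open>ch\<close>, whose sum has inner
  product zero with every weight.\<close>

lemma accepts:
  assumes ch: "\<And>k. k < length P \<Longrightarrow> ch k \<in> set (P ! k)"
    and zero: "\<And>i. i < D \<Longrightarrow> (\<Sum>k<length P. nth_default 0 (ch k) i) = 0"
  shows "snd ((play P ^^ t) (replicate D 0, True))"
  unfolding ok_iff
proof (intro allI impI)
  fix t
  have "(\<Sum>i<D. w t i * z t i) = (\<Sum>k<length P. dot (wl t) (best (wl t) (P ! k)))"
    unfolding gain[symmetric] by (simp add: sum_list_nth)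
  also have "\<dots> \<le> (\<Sum>k<length P. dot (wl t) (ch k))"
    using ch nonempty by (intro sum_mono best(2)) (auto dest: nth_mem)
  also have "\<dots> = (\<Sum>k<length P. \<Sum>i<D. w t i * nth_default 0 (ch k) i)"
    by (simp add: dot_sum length_wl w_def flip: wl_def)
  also have "\<dots> = (\<Sum>i<D. w t i * (\<Sum>k<length P. nth_default 0 (ch k) i))"
    by (subst sum.swap) (simp add: sum_distrib_left)
  also have "\<dots> = 0" using zero by simp
  finally show "(\<Sum>i<D. w t i * z t i) \<le> 0" .
qed

text \<open>Novikoff's argument: while no gain is positive, the squared length of the weight grows
  by at most \<open>Z\<close> per round, whereas its inner product with the certificate
  \<open>y\<close> grows by at least 1.\<close>

lemma rejects:
  assumes R: "\<And>ss s i. ss \<in> set P \<Longrightarrow> s \<in> set ss \<Longrightarrow> \<bar>nth_default 0 s i\<bar> \<le> int R"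
    and y2: "\<And>i. \<bar>y i\<bar> \<le> 2"
    and y: "\<And>ch. (\<And>k. k < length P \<Longrightarrow> ch k \<in> set (P ! k)) \<Longrightarrow>
      1 \<le> (\<Sum>i<D. y i * (\<Sum>k<length P. nth_default 0 (ch k) i))"
  shows "\<not> snd ((play P ^^ rounds D R (length P)) (replicate D 0, True))"
proof
  define T where "T = rounds D R (length P)"
  define Z where "Z = int (D * (length P * R * (length P * R)))"
  assume "snd ((play P ^^ rounds D R (length P)) (replicate D 0, True))"
  then have neg: "(\<Sum>i<D. w t i * z t i) \<le> 0" if "t < T" for t using that by (simp add: ok_iff T_def)
  have best_in: "best (wl t) (P ! k) \<in> set (P ! k)" if "k < length P" for t k
    using that nonempty by (intro best(1)) (auto dest: nth_mem)
  have z_le: "\<bar>z t i\<bar> \<le> int (length P * R)" for t i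
  proof -
    have "\<bar>z t i\<bar> \<le> (\<Sum>k<length P. \<bar>nth_default 0 (best (wl t) (P ! k)) i\<bar>)" unfolding z_def by (rule sum_abs)
    also have "\<dots> \<le> (\<Sum>k<length P. int R)" using best_in by (intro sum_mono R) auto
    finally show ?thesis by simp
  qed
  have zz: "(\<Sum>i<D. z t i * z t i) \<le> Z" for t
  proof -
    have "z t i * z t i \<le> int (length P * R) * int (length P * R)" for i
      using mult_mono[OF z_le[of t i] z_le[of t i]] by (simp add: abs_mult_self_eq)
    then have "(\<Sum>i<D. z t i * z t i) \<le> (\<Sum>i<D. int (length P * R) * int (length P * R))" by (intro sum_mono)
    then show ?thesis by (simp add: Z_def)
  qed
  have ww: "(\<Sum>i<D. w t i * w t i) \<le> int t * Z" if "t \<le> T" for t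
    using that
  proof (induction t)
    case (Suc t)
    have "(\<Sum>i<D. w (Suc t) i * w (Suc t) i) = (\<Sum>i<D. w t i * w t i + 2 * (w t i * z t i) + z t i * z t i)"
      by (intro sum.cong) (simp_all add: w_Suc algebra_simps)
    also have "\<dots> = (\<Sum>i<D. w t i * w t i) + 2 * (\<Sum>i<D. w t i * z t i) + (\<Sum>i<D. z t i * z t i)"
      by (simp add: sum.distrib sum_distrib_left)
    also have "\<dots> \<le> int t * Z + 0 + Z" using Suc neg[of t] zz[of t] by (intro add_mono) auto
    finally show ?case by (simp add: algebra_simps)
  qed (simp add: w_0)
  have yw: "int t \<le> (\<Sum>i<D. y i * w t i)" for t
  proof (induction t)
    case (Suc t)
    have "1 \<le> (\<Sum>i<D. y i * z t i)" unfolding z_def using best_in by (intro y)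
    moreover have "(\<Sum>i<D. y i * w (Suc t) i) = (\<Sum>i<D. y i * w t i) + (\<Sum>i<D. y i * z t i)"
      by (simp add: w_Suc distrib_left sum.distrib)
    ultimately show ?case using Suc by simp
  qed (simp add: w_0)
  \<comment> \<open>In place of the Cauchy-Schwarz inequality, \<open>c * (y i * w T i)\<close> is
    at most \<open>w T i * w T i + c * c\<close> in each coordinate. The excess of \<open>c\<close>
    over \<open>Z\<close> leaves \<open>T\<close> itself after subtracting
    \<open>T * Z\<close>.\<close>
  define c where "c = Z + 1"
  have Z0: "0 \<le> Z" by (simp add: Z_def)
  have "c * (y i * w T i) \<le> w T i * w T i + c * c" for i
  proof -
    have "y i * w T i \<le> \<bar>y i\<bar> * \<bar>w T i\<bar>" by (metis abs_ge_self abs_mult)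
    also have "\<dots> \<le> 2 * \<bar>w T i\<bar>" using y2 by (intro mult_right_mono) auto
    finally have "c * (y i * w T i) \<le> c * (2 * \<bar>w T i\<bar>)" using Z0 by (intro mult_left_mono) (auto simp: c_def)
    moreover have "0 \<le> (\<bar>w T i\<bar> - c) * (\<bar>w T i\<bar> - c)" by simp
    then have "c * (2 * \<bar>w T i\<bar>) \<le> \<bar>w T i\<bar> * \<bar>w T i\<bar> + c * c" by (simp add: algebra_simps)
    ultimately show ?thesis by (simp add: abs_mult_self_eq)
  qed
  then have "(\<Sum>i<D. c * (y i * w T i)) \<le> (\<Sum>i<D. w T i * w T i + c * c)" by (intro sum_mono)
  then have "c * (\<Sum>i<D. y i * w T i) \<le> (\<Sum>i<D. w T i * w T i) + int D * (c * c)"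
    by (simp add: sum_distrib_left sum.distrib)
  moreover have "c * int T \<le> c * (\<Sum>i<D. y i * w T i)" using yw Z0 by (intro mult_left_mono) (auto simp: c_def)
  ultimately have "c * int T \<le> int T * Z + int D * (c * c)" using ww[of T] by linarith
  then have "int T \<le> int D * (c * c)" by (simp add: c_def algebra_simps)
  moreover have "int T = 1 + int D * (c * c)"
    by (simp add: T_def rounds_def c_def Z_def algebra_simps)
  ultimately show False by linarith
qed

end

section \<open>Running time of the perceptron\<close>

lemma pt_dot: "pt f \<Longrightarrow> pt g \<Longrightarrow> pt (\<lambda>x. dot (f x) (g x))"
proof -
  have "pt (\<lambda>p. dot (fst p) (snd p))" unfolding dot_def by (intro pt_intro)
  then show "pt f \<Longrightarrow> pt g \<Longrightarrow> ?thesis" using pt_comp[of "\<lambda>p. dot (fst p) (snd p)" "\<lambda>x. (f x, g x)"] by (simp add: pt_pair)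
qed

lemma pt_best: "pt f \<Longrightarrow> pt g \<Longrightarrow> pt (\<lambda>x. best (f x) (g x))"
proof -
  have "pt (\<lambda>p. best (fst p) (snd p))" unfolding best_def by (intro pt_intro pt_dot)
  then show "pt f \<Longrightarrow> pt g \<Longrightarrow> ?thesis" using pt_comp[of "\<lambda>p. best (fst p) (snd p)" "\<lambda>x. (f x, g x)"] by (simp add: pt_pair)
qed

text \<open>Weights grow at most linearly with the number of rounds, which keeps their unary codes
  polynomial.\<close>

lemma weight_le: "\<bar>nth_default 0 (fst ((play P ^^ t) (replicate D 0, b))) i\<bar> \<le> int (t * (length P * sz P))"
proof (induction t)
  case 0
  then show ?case by (simp add: nth_default_def)
next
  case (Suc t)
  let ?st = "(play P ^^ t) (replicate D 0, b)"
  have e: "\<bar>nth_default 0 (best (fst ?st) (P ! k)) i\<bar> \<le> int (sz P)" if "k < length P" for k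
  proof (cases "best (fst ?st) (P ! k) \<in> set (P ! k) \<and> i < length (best (fst ?st) (P ! k))")
    case True
    let ?s = "best (fst ?st) (P ! k)"
    have "sz (?s ! i) < sz ?s" "sz ?s < sz (P ! k)" "sz (P ! k) < sz P" using True that by (auto intro: sz_mem)
    then show ?thesis using True by (simp add: nth_default_def sz_int)
  next
    case False
    then show ?thesis using best_mem[of "fst ?st" "P ! k"] by (auto simp: nth_default_def)
  qed
  have "\<bar>\<Sum>k<length P. nth_default 0 (best (fst ?st) (P ! k)) i\<bar> \<le>
      (\<Sum>k<length P. \<bar>nth_default 0 (best (fst ?st) (P ! k)) i\<bar>)" by (rule sum_abs)
  also have "\<dots> \<le> (\<Sum>k<length P. int (sz P))" using e by (intro sum_mono) auto
  finally have "\<bar>\<Sum>k<length P. nth_default 0 (best (fst ?st) (P ! k)) i\<bar> \<le> int (length P * sz P)" by simp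
  moreover have "nth_default 0 (fst ((play P ^^ Suc t) (replicate D 0, b))) i =
      (if i < length (fst ?st) then nth_default 0 (fst ?st) i + (\<Sum>k<length P. nth_default 0 (best (fst ?st) (P ! k)) i) else 0)"
    by (simp add: play_def nth_default_map_upt sum_list_nth)
  ultimately show ?case using Suc by (auto simp: algebra_simps)
qed

lemma length_weight: "length (fst ((play P ^^ t) (replicate D 0, b))) = D"
  by (induction t) (simp_all add: play_def)

lemma pt_perceptron: "pt perceptron"
proof -
  let ?n = "\<lambda>x :: nat \<times> nat \<times> int list list list. rounds (fst x) (fst (snd x)) (length (snd (snd x)))"
  have n: "pt ?n" unfolding rounds_def by (intro pt_intro)
  have "pt (\<lambda>x. (play (snd (snd x)) ^^ ?n x) (replicate (fst x) 0, True))"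
  proof (rule pt_iterate[where b = "\<lambda>x. 5 + sz x * (4 + 2 * (sz (?n x) * (sz x * sz x)))"])
    show "pt ?n" by (rule n)
    show "pt (\<lambda>p :: (nat \<times> nat \<times> int list list list) \<times> (int list \<times> bool). play (snd (snd (fst p))) (snd p))"
      unfolding play_def by (intro pt_intro pt_dot pt_best)
    show "pb (\<lambda>x. 5 + sz x * (4 + 2 * (sz (?n x) * (sz x * sz x))))" by (intro pb_intros pt_sz n)
    fix x :: "nat \<times> nat \<times> int list list list" and t assume t: "t \<le> ?n x"
    obtain D R P where x: "x = (D, R, P)" by (cases x)
    let ?st = "(play P ^^ t) (replicate D 0, True)"
    have le: "D \<le> sz x" "length P \<le> sz x" "sz P \<le> sz x" "t \<le> sz (?n x)"
      using x length_sz[of P] t by auto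
    have "t * (length P * sz P) \<le> sz (?n x) * (sz x * sz x)" using le by (intro mult_mono) auto
    then have e: "\<bar>nth_default 0 (fst ?st) i\<bar> \<le> int (sz (?n x) * (sz x * sz x))" for i
      using weight_le[where P = P and t = t and D = D and b = True and i = i] by linarith
    have "sz (fst ?st) \<le> 1 + length (fst ?st) * (1 + (3 + 2 * (sz (?n x) * (sz x * sz x))))"
    proof (rule sz_list_le)
      fix a assume "a \<in> set (fst ?st)"
      then obtain i where "i < length (fst ?st)" "a = fst ?st ! i" by (metis in_set_conv_nth)
      then have "a = nth_default 0 (fst ?st) i" by (simp add: nth_default_def)
      then have "nat \<bar>a\<bar> \<le> sz (?n x) * (sz x * sz x)" unfolding nat_le_iff using e[of i] by (simp only:)
      then show "sz a \<le> 3 + 2 * (sz (?n x) * (sz x * sz x))" unfolding sz_int by linarith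
    qed
    also have "\<dots> \<le> 1 + sz x * (4 + 2 * (sz (?n x) * (sz x * sz x)))"
      unfolding length_weight using mult_right_mono[OF le(1), of "4 + 2 * (sz (?n x) * (sz x * sz x))"] by simp
    finally have "sz (fst ?st) \<le> 1 + sz x * (4 + 2 * (sz (?n x) * (sz x * sz x)))" .
    moreover have "sz ?st = Suc (sz (fst ?st) + sz (snd ?st))" by (metis prod.collapse sz_prod)
    ultimately have "sz ?st \<le> 5 + sz x * (4 + 2 * (sz (?n x) * (sz x * sz x)))"
      using sz_bool[of "snd ?st"] by linarith
    then show "sz ((play (snd (snd x)) ^^ t) (replicate (fst x) 0, True)) \<le> 5 + sz x * (4 + 2 * (sz (?n x) * (sz x * sz x)))"
      by (simp add: x)
  qed (intro pt_intro)+
  then show ?thesis unfolding perceptron_def by (rule pt_snd)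
qed

section \<open>Deciding the two-color problem\<close>

definition vec :: "nat \<Rightarrow> nat \<Rightarrow> int \<Rightarrow> nat \<Rightarrow> int \<Rightarrow> int list" where
  "vec n a x b y = map (\<lambda>i. (if i = a then x else 0) + (if i = b then y else 0)) [0..<n]"

text \<open>A row consists of two color indicators and \<open>nV\<close> adjacency bits; with two
  colors the first indicator determines the color.\<close>

definition table_red :: "nat \<Rightarrow> bool list \<Rightarrow> nat \<Rightarrow> bool" where
  "table_red nV M u = nth_default False M (u * (2 + nV))"

definition table_adj :: "nat \<Rightarrow> bool list \<Rightarrow> nat \<Rightarrow> nat \<Rightarrow> bool" where
  "table_adj nV M u v = nth_default False M (u * (2 + nV) + (2 + v))"

text \<open>Coordinates \<open>v\<close> and \<open>nV + v\<close> count the vertices of the first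
  and the second color placed at \<open>v\<close>. The choices of right vertices subtract admissible
  counts, so a sum of zero says that the placement has exactly those counts.\<close>

definition left_choices :: "nat \<Rightarrow> bool list \<Rightarrow> nat \<Rightarrow> int list list" where
  "left_choices nV M u =
     map (\<lambda>v. vec (2 * nV) (if table_red nV M u then v else nV + v) 1 0 0) (filter (table_adj nV M u) [0..<nV])"

definition right_choices :: "nat \<Rightarrow> nat \<Rightarrow> nat \<Rightarrow> nat \<Rightarrow> nat \<Rightarrow> int list list" where
  "right_choices nU nV l p v =
     concat (map (\<lambda>a. map (\<lambda>b. vec (2 * nV) v (- int a) (nV + v) (- int b))
       (filter (\<lambda>b. a \<le> b + l \<and> b \<le> a + l \<and> p \<le> a + b) [0..<Suc nU])) [0..<Suc nU])"

definition all_choices :: "nat \<Rightarrow> nat \<Rightarrow> nat \<Rightarrow> nat \<Rightarrow> bool list \<Rightarrow> int list list list" where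
  "all_choices nU nV l p M = map (left_choices nV M) [0..<nU] @ map (right_choices nU nV l p) [0..<nV]"

text \<open>An empty list of choices must be rejected separately, as the perceptron would read it as
  the zero vector.\<close>

definition decide_table :: "nat \<Rightarrow> nat \<Rightarrow> nat \<Rightarrow> nat \<Rightarrow> bool list \<Rightarrow> bool" where
  "decide_table nU nV l p M \<longleftrightarrow>
     list_all (\<lambda>ss. 0 < length ss) (all_choices nU nV l p M) \<and> perceptron (2 * nV, Suc nU, all_choices nU nV l p M)"

section \<open>Correctness of the decision procedure on tables\<close>

lemma sum_vec:
  assumes "a < n" "b < n"
  shows "(\<Sum>i<n. y i * nth_default 0 (vec n a x b x') i) = y a * x + y b * x'"
proof -
  have "(\<Sum>i<n. y i * nth_default 0 (vec n a x b x') i) =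
      (\<Sum>i<n. (if i = a then y i * x else 0) + (if i = b then y i * x' else 0))"
    by (intro sum.cong) (auto simp: vec_def nth_default_map_upt distrib_left)
  also have "\<dots> = y a * x + y b * x'" using assms by (simp add: sum.distrib algebra_simps)
  finally show ?thesis .
qed

lemma sum_lessThan_add: "(\<Sum>k<m + n. f k) = (\<Sum>k<m. f k) + (\<Sum>k<n. f (m + k))" for f :: "nat \<Rightarrow> int"
  by (induction n) simp_all

lemma length_all_choices [simp]: "length (all_choices nU nV l p M) = nU + nV"
  by (simp add: all_choices_def)

lemma nth_all_choices:
  "u < nU \<Longrightarrow> all_choices nU nV l p M ! u = left_choices nV M u"
  "v < nV \<Longrightarrow> all_choices nU nV l p M ! (nU + v) = right_choices nU nV l p v"
  by (simp_all add: all_choices_def nth_append)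

lemma decide_table: "decide_table nU nV l p M \<longleftrightarrow> two_colors.feasible nU nV l p (table_red nV M) (table_adj nV M)"
proof -
  let ?P = "all_choices nU nV l p M" and ?r = "table_red nV M" and ?a = "table_adj nV M"
  interpret two_colors nU nV l p ?r ?a .
  show ?thesis
  proof
    assume feasible
    then obtain \<phi> where \<phi>: "\<forall>u<nU. \<phi> u < nV \<and> ?a u (\<phi> u)" and
      c: "\<forall>v<nV. card {u. u < nU \<and> ?r u \<and> \<phi> u = v} \<le> card {u. u < nU \<and> \<not> ?r u \<and> \<phi> u = v} + l \<and>
        card {u. u < nU \<and> \<not> ?r u \<and> \<phi> u = v} \<le> card {u. u < nU \<and> ?r u \<and> \<phi> u = v} + l \<and>
        p \<le> card {u. u < nU \<and> ?r u \<and> \<phi> u = v} + card {u. u < nU \<and> \<not> ?r u \<and> \<phi> u = v}"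
      unfolding feasible_def by (elim exE conjE)
    define \<alpha> where "\<alpha> = (\<lambda>v. card {u. u < nU \<and> ?r u \<and> \<phi> u = v})"
    define \<beta> where "\<beta> = (\<lambda>v. card {u. u < nU \<and> \<not> ?r u \<and> \<phi> u = v})"
    have le: "\<alpha> v \<le> nU" "\<beta> v \<le> nU" for v
      using card_mono[of "{..<nU}" "{u. u < nU \<and> ?r u \<and> \<phi> u = v}"]
        card_mono[of "{..<nU}" "{u. u < nU \<and> \<not> ?r u \<and> \<phi> u = v}"] by (auto simp: \<alpha>_def \<beta>_def)
    define s where "s = (\<lambda>u. vec (2 * nV) (if ?r u then \<phi> u else nV + \<phi> u) 1 0 0)"
    define t where "t = (\<lambda>v. vec (2 * nV) v (- int (\<alpha> v)) (nV + v) (- int (\<beta> v)))"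
    define ch where "ch = (\<lambda>k. if k < nU then s k else t (k - nU))"
    have s: "s u \<in> set (?P ! u)" if "u < nU" for u
      using \<phi> that by (auto simp: nth_all_choices left_choices_def s_def)
    have t: "t v \<in> set (?P ! (nU + v))" if v: "v < nV" for v
    proof -
      have "\<alpha> v \<le> \<beta> v + l \<and> \<beta> v \<le> \<alpha> v + l \<and> p \<le> \<alpha> v + \<beta> v" using c v by (simp add: \<alpha>_def \<beta>_def)
      then show ?thesis using le[of v] v
        by (auto simp: nth_all_choices right_choices_def t_def less_Suc_eq_le simp del: upt_Suc intro!: bexI[of _ "\<alpha> v"] imageI)
    qed
    have ch: "ch k \<in> set (?P ! k)" if "k < length ?P" for k
      using that s[of k] t[of "k - nU"] by (auto simp: ch_def not_less)
    have "[] \<notin> set ?P"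
    proof
      assume "[] \<in> set ?P"
      then obtain k where "k < length ?P" "?P ! k = []" by (metis in_set_conv_nth)
      then show False using ch[of k] by simp
    qed
    then interpret choices "2 * nV" "Suc nU" ?P by unfold_locales
    have "(\<Sum>k<length ?P. nth_default 0 (ch k) i) = 0" if i: "i < 2 * nV" for i
    proof -
      have "(\<Sum>k<length ?P. nth_default 0 (ch k) i) = (\<Sum>u<nU. nth_default 0 (s u) i) + (\<Sum>v<nV. nth_default 0 (t v) i)"
        by (simp add: sum_lessThan_add ch_def)
      also have "(\<Sum>v<nV. nth_default 0 (t v) i) = (if i < nV then - int (\<alpha> i) else - int (\<beta> (i - nV)))"
      proof -
        have "(\<Sum>v<nV. nth_default 0 (t v) i) =
            (\<Sum>v<nV. if v = (if i < nV then i else i - nV) then (if i < nV then - int (\<alpha> i) else - int (\<beta> (i - nV))) else 0)"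
          using i by (intro sum.cong) (auto simp: t_def vec_def nth_default_map_upt)
        then show ?thesis using i by auto
      qed
      also have "(\<Sum>u<nU. nth_default 0 (s u) i) = (if i < nV then int (\<alpha> i) else int (\<beta> (i - nV)))"
      proof -
        have "(\<Sum>u<nU. nth_default 0 (s u) i) =
            (\<Sum>u<nU. of_bool (if i < nV then ?r u \<and> \<phi> u = i else \<not> ?r u \<and> \<phi> u = i - nV))"
          using i \<phi> by (intro sum.cong) (auto simp: s_def vec_def nth_default_map_upt)
        also have "\<dots> = int (card {u. u < nU \<and> (if i < nV then ?r u \<and> \<phi> u = i else \<not> ?r u \<and> \<phi> u = i - nV)})"
          by (simp add: Int_def)
        finally show ?thesis by (simp add: \<alpha>_def \<beta>_def)
      qed
      finally show ?thesis by simp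
    qed
    then have "perceptron (2 * nV, Suc nU, ?P)"
      unfolding perceptron_def using accepts[OF ch] by simp
    moreover have "list_all (\<lambda>ss. 0 < length ss) ?P"
      using nonempty by (auto simp: list_all_iff)
    ultimately show "decide_table nU nV l p M" by (simp add: decide_table_def)
  next
    assume dec: "decide_table nU nV l p M"
    show feasible
    proof (rule ccontr)
      assume "\<not> feasible"
      then obtain yr yb :: "nat \<Rightarrow> int" where y2: "\<And>v. \<bar>yr v\<bar> \<le> 2" "\<And>v. \<bar>yb v\<bar> \<le> 2" and
        y: "\<And>\<phi> \<alpha> \<beta>. \<forall>u<nU. \<phi> u < nV \<and> ?a u (\<phi> u) \<Longrightarrow>
          \<forall>v<nV. \<alpha> v \<le> nU \<and> \<beta> v \<le> nU \<and> \<alpha> v \<le> \<beta> v + l \<and> \<beta> v \<le> \<alpha> v + l \<and> p \<le> \<alpha> v + \<beta> v \<Longrightarrow>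
          1 \<le> (\<Sum>u<nU. if ?r u then yr (\<phi> u) else yb (\<phi> u)) -
            (\<Sum>v<nV. yr v * int (\<alpha> v) + yb v * int (\<beta> v))"
        by (rule certificate) (rule that; assumption)
      have "[] \<notin> set ?P" using dec by (auto simp: decide_table_def list_all_iff)
      then interpret choices "2 * nV" "Suc nU" ?P by unfold_locales
      \<comment> \<open>The two parts of the certificate as one vector in the coordinates of the
        choices.\<close>
      define Y where "Y = (\<lambda>i. if i < nV then yr i else yb (i - nV))"
      have "\<not> snd ((play ?P ^^ rounds (2 * nV) (Suc nU) (length ?P)) (replicate (2 * nV) 0, True))"
      proof (rule rejects)
        show "\<bar>Y i\<bar> \<le> 2" for i using y2 by (simp add: Y_def)
      next
        fix ss s i assume ss: "ss \<in> set ?P" and s: "s \<in> set ss"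
        \<comment> \<open>The last condition keeps two entries from adding up in one
          coordinate.\<close>
        obtain a x b x' where "s = vec (2 * nV) a x b x'" "\<bar>x\<bar> \<le> int (Suc nU)" "\<bar>x'\<bar> \<le> int (Suc nU)" "x' = 0 \<or> a \<noteq> b"
          using ss s by (auto simp: all_choices_def left_choices_def right_choices_def simp del: upt_Suc)
        then show "\<bar>nth_default 0 s i\<bar> \<le> int (Suc nU)"
          by (auto simp: vec_def nth_default_map_upt)
      next
        fix ch assume ch: "\<And>k. k < length ?P \<Longrightarrow> ch k \<in> set (?P ! k)"
        have "\<exists>v. v < nV \<and> ?a u v \<and> ch u = vec (2 * nV) (if ?r u then v else nV + v) 1 0 0" if "u < nU" for u
          using ch[of u] that by (auto simp: nth_all_choices left_choices_def)
        then obtain \<phi> where \<phi>: "\<And>u. u < nU \<Longrightarrow> \<phi> u < nV \<and> ?a u (\<phi> u) \<and>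
            ch u = vec (2 * nV) (if ?r u then \<phi> u else nV + \<phi> u) 1 0 0" by metis
        have "\<exists>a b. a \<le> nU \<and> b \<le> nU \<and> a \<le> b + l \<and> b \<le> a + l \<and> p \<le> a + b \<and>
            ch (nU + v) = vec (2 * nV) v (- int a) (nV + v) (- int b)" if "v < nV" for v
          using ch[of "nU + v"] that by (auto simp: nth_all_choices right_choices_def less_Suc_eq_le simp del: upt_Suc)
        then obtain \<alpha> \<beta> where ab: "\<And>v. v < nV \<Longrightarrow> \<alpha> v \<le> nU \<and> \<beta> v \<le> nU \<and> \<alpha> v \<le> \<beta> v + l \<and> \<beta> v \<le> \<alpha> v + l \<and>
            p \<le> \<alpha> v + \<beta> v \<and> ch (nU + v) = vec (2 * nV) v (- int (\<alpha> v)) (nV + v) (- int (\<beta> v))" by metis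
        have "(\<Sum>i<2 * nV. Y i * (\<Sum>k<length ?P. nth_default 0 (ch k) i)) =
            (\<Sum>k<length ?P. \<Sum>i<2 * nV. Y i * nth_default 0 (ch k) i)"
          by (subst sum.swap) (simp add: sum_distrib_left)
        also have "\<dots> = (\<Sum>u<nU. \<Sum>i<2 * nV. Y i * nth_default 0 (ch u) i) +
            (\<Sum>v<nV. \<Sum>i<2 * nV. Y i * nth_default 0 (ch (nU + v)) i)"
          by (simp add: sum_lessThan_add)
        also have "(\<Sum>u<nU. \<Sum>i<2 * nV. Y i * nth_default 0 (ch u) i) = (\<Sum>u<nU. if ?r u then yr (\<phi> u) else yb (\<phi> u))"
        proof (rule sum.cong[OF refl])
          fix u assume "u \<in> {..<nU}"
          then have f: "\<phi> u < nV" "ch u = vec (2 * nV) (if ?r u then \<phi> u else nV + \<phi> u) 1 0 0" using \<phi>[of u] by auto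
          show "(\<Sum>i<2 * nV. Y i * nth_default 0 (ch u) i) = (if ?r u then yr (\<phi> u) else yb (\<phi> u))"
            unfolding f(2) using f(1) by (subst sum_vec) (auto simp: Y_def)
        qed
        also have "(\<Sum>v<nV. \<Sum>i<2 * nV. Y i * nth_default 0 (ch (nU + v)) i) =
            (\<Sum>v<nV. - (yr v * int (\<alpha> v) + yb v * int (\<beta> v)))"
        proof (rule sum.cong[OF refl])
          fix v assume v: "v \<in> {..<nV}"
          then have f: "ch (nU + v) = vec (2 * nV) v (- int (\<alpha> v)) (nV + v) (- int (\<beta> v))" using ab[of v] by auto
          show "(\<Sum>i<2 * nV. Y i * nth_default 0 (ch (nU + v)) i) = - (yr v * int (\<alpha> v) + yb v * int (\<beta> v))"
            unfolding f using v by (subst sum_vec) (auto simp: Y_def)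
        qed
        also have "(\<Sum>u<nU. if ?r u then yr (\<phi> u) else yb (\<phi> u)) + (\<Sum>v<nV. - (yr v * int (\<alpha> v) + yb v * int (\<beta> v))) =
            (\<Sum>u<nU. if ?r u then yr (\<phi> u) else yb (\<phi> u)) - (\<Sum>v<nV. yr v * int (\<alpha> v) + yb v * int (\<beta> v))"
          by (simp only: sum_negf diff_conv_add_uminus)
        finally show "1 \<le> (\<Sum>i<2 * nV. Y i * (\<Sum>k<length ?P. nth_default 0 (ch k) i))"
          using y[of \<phi> \<alpha> \<beta>] \<phi> ab by simp
      qed
      then show False using dec by (simp add: decide_table_def perceptron_def)
    qed
  qed
qed

lemma pt_vec:
  assumes "pt n" "pt a" "pt x" "pt b" "pt y"
  shows "pt (\<lambda>i. vec (n i) (a i) (x i) (b i) (y i))"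
proof -
  let ?F = "\<lambda>q :: nat \<times> nat \<times> int \<times> nat \<times> int. vec (fst q) (fst (snd q)) (fst (snd (snd q))) (fst (snd (snd (snd q)))) (snd (snd (snd (snd q))))"
  have "pt ?F" unfolding vec_def by (intro pt_intro)
  from pt_comp[OF this, of "\<lambda>i. (n i, a i, x i, b i, y i)"] show ?thesis using assms by (simp add: pt_pair)
qed

lemma pt_decide_table:
  assumes "pt nU" "pt nV" "pt l" "pt p" "pt M"
  shows "pt (\<lambda>x. decide_table (nU x) (nV x) (l x) (p x) (M x))"
proof -
  let ?F = "\<lambda>G (q :: nat \<times> nat \<times> nat \<times> nat \<times> bool list).
    G (fst q) (fst (snd q)) (fst (snd (snd q))) (fst (snd (snd (snd q)))) (snd (snd (snd (snd q))))"
  have P: "pt (?F all_choices)"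
    unfolding all_choices_def left_choices_def right_choices_def table_red_def table_adj_def by (intro pt_intro pt_vec)
  have "pt (\<lambda>q. perceptron (2 * fst (snd q), Suc (fst q), ?F all_choices q))"
    by (rule pt_comp[OF pt_perceptron]) (intro pt_intro P)
  moreover have "pt (\<lambda>q. list_all (\<lambda>ss. 0 < length ss) (?F all_choices q))" by (intro pt_intro P)
  ultimately have "pt (?F decide_table)" unfolding decide_table_def by (intro pt_conj)
  from pt_comp[OF this, of "\<lambda>x. (nU x, nV x, l x, p x, M x)"] show ?thesis using assms by (simp add: pt_pair)
qed

section \<open>Decoding instances\<close>

text \<open>With \<open>c = 1\<close> this reads a number in unary, with \<open>c = 2\<close> the length of the first component of a pair.\<close>

definition ones :: "nat \<Rightarrow> bool list \<Rightarrow> nat" where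
  "ones c z = length (filter (\<lambda>i. list_all (\<lambda>j. nth_default False z (c * j)) [0..<Suc i]) [0..<length z])"

text \<open>A binary number can be exponential in its length, so its value is cut off at
  \<open>c\<close> during evaluation. Folding from the right starts with the most significant
  bit.\<close>

definition capped :: "nat \<Rightarrow> bool list \<Rightarrow> nat" where
  "capped c bs = foldr (\<lambda>b n. if c \<le> n + n then c else if b then Suc (n + n) else n + n) bs 0"

text \<open>The offset \<open>nV + 4\<close> skips the unary \<open>nV\<close> and the unary number
  2 of colors, each with its terminator. No count exceeds \<open>nU\<close>, so cutting threshold
  and lower bound off at \<open>Suc nU\<close> preserves the answer.\<close>

definition decide_sized :: "nat \<Rightarrow> nat \<Rightarrow> bool list \<Rightarrow> bool list \<Rightarrow> bool" where
  "decide_sized nU nV z b = decide_table nU nV (capped (Suc nU) (drop (nU * (2 + nV)) (drop (nV + 4) z)))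
     (capped (Suc nU) b) (drop (nV + 4) z)"

definition decide_bits :: "bool list \<Rightarrow> bool list \<Rightarrow> bool" where
  "decide_bits z b = decide_sized (ones 1 z) (ones 1 (drop (Suc (ones 1 z)) z)) (drop (Suc (ones 1 z)) z) b"

definition first_bits :: "bool list \<Rightarrow> bool list" where
  "first_bits z = map (\<lambda>i. nth_default False z (Suc (2 * i))) [0..<ones 2 z]"

text \<open>A negative lower bound demands nothing and is read as zero.\<close>

definition lower_bits :: "bool list \<Rightarrow> bool list" where
  "lower_bits e = (case e of [] \<Rightarrow> [] | s # b \<Rightarrow> if s then [] else b)"

section \<open>Correctness of the decoder\<close>

lemma ones:
  assumes "\<And>j. j < k \<Longrightarrow> nth_default False z (c * j)" "\<not> nth_default False z (c * k)" "k \<le> length z"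
  shows "ones c z = k"
proof -
  have "list_all (\<lambda>j. nth_default False z (c * j)) [0..<Suc i] \<longleftrightarrow> i < k" for i
  proof
    assume *: "list_all (\<lambda>j. nth_default False z (c * j)) [0..<Suc i]"
    show "i < k"
    proof (rule ccontr)
      assume "\<not> i < k"
      then have "k \<in> set [0..<Suc i]" by (simp del: upt_Suc)
      then show False using * assms(2) unfolding list_all_iff by blast
    qed
  next
    assume "i < k"
    then show "list_all (\<lambda>j. nth_default False z (c * j)) [0..<Suc i]"
      using assms(1) by (simp add: list_all_iff del: upt_Suc)
  qed
  then have "ones c z = length (filter (\<lambda>i. i < k) [0..<length z])" by (simp add: ones_def del: upt_Suc)
  also have "\<dots> = card {i. i < length z \<and> i < k}"
    by (simp add: length_filter_conv_card) (rule arg_cong[where f = card], auto)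
  also have "{i. i < length z \<and> i < k} = {..<k}" using assms(3) by auto
  finally show ?thesis by simp
qed

lemma ones_unary: "ones (Suc 0) (replicate n True @ False # r) = n"
  by (rule ones) (auto simp: nth_default_def nth_append)

lemma pair_enc_Cons: "pair_enc (b # x) y = True # b # pair_enc x y"
  by (simp add: pair_enc_def)

lemma length_pair_enc: "length (pair_enc x y) = Suc (2 * length x + length y)"
  by (induction x) (simp_all add: pair_enc_Cons, simp add: pair_enc_def)

lemma nth_default_pair_enc:
  "nth_default False (pair_enc x y) (2 * j) \<longleftrightarrow> j < length x" if "j \<le> length x"
  using that
proof (induction x arbitrary: j)
  case (Cons b x)
  then show ?case by (cases j) (simp_all add: pair_enc_Cons)
qed (simp add: pair_enc_def)

lemma ones_pair_enc: "ones 2 (pair_enc x y) = length x"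
  by (rule ones) (simp_all add: nth_default_pair_enc length_pair_enc)

lemma first_bits_pair_enc: "first_bits (pair_enc x y) = x"
proof -
  have "nth_default False (pair_enc x y) (Suc (2 * i)) = x ! i" if "i < length x" for i
    using that
  proof (induction x arbitrary: i)
    case (Cons b x)
    then show ?case by (cases i) (simp_all add: pair_enc_Cons)
  qed simp
  then show ?thesis by (auto simp: first_bits_def ones_pair_enc intro: nth_equalityI)
qed

lemma drop_pair_enc: "drop (Suc (2 * length x)) (pair_enc x y) = y"
  by (induction x) (simp_all add: pair_enc_Cons, simp add: pair_enc_def)

lemma capped_nat_enc: "capped c (nat_enc n) = min c n"
proof (induction n rule: nat_enc.induct)
  case (1 n)
  show ?case
  proof (cases "n = 0")
    case True
    then show ?thesis by (simp add: capped_def nat_enc.simps)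
  next
    case False
    then have "capped c (nat_enc (n div 2)) = min c (n div 2)" by (rule 1)
    moreover have "n = (n div 2 + n div 2) + (if odd n then 1 else 0)" by presburger
    ultimately show ?thesis
      unfolding nat_enc.simps[of n] using False by (auto simp: capped_def min_def)
  qed
qed

lemma capped_lower_bits: "capped c (lower_bits (int_enc p)) = min c (nat p)"
  by (simp add: int_enc_def lower_bits_def capped_nat_enc) (simp add: capped_def)

lemma concat_rows:
  assumes "\<And>r. r \<in> set rs \<Longrightarrow> length r = w"
  shows "drop (length rs * w) (concat rs @ t) = t"
    and "u < length rs \<Longrightarrow> j < w \<Longrightarrow> nth_default d (concat rs @ t) (u * w + j) = rs ! u ! j"
proof -
  show "drop (length rs * w) (concat rs @ t) = t" using assms by (induction rs) simp_all
  show "u < length rs \<Longrightarrow> j < w \<Longrightarrow> nth_default d (concat rs @ t) (u * w + j) = rs ! u ! j"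
    using assms
  proof (induction rs arbitrary: u)
    case (Cons r rs)
    then show ?case
      by (cases u) (simp_all add: nth_default_append nth_default_nth add.assoc)
  qed simp
qed

lemma pt_ones: "pt c \<Longrightarrow> pt z \<Longrightarrow> pt (\<lambda>x. ones (c x) (z x))"
proof -
  have "pt (\<lambda>p. ones (fst p) (snd p))" unfolding ones_def by (intro pt_intro)
  then show "pt c \<Longrightarrow> pt z \<Longrightarrow> ?thesis" using pt_comp[of "\<lambda>p. ones (fst p) (snd p)" "\<lambda>x. (c x, z x)"] by (simp add: pt_pair)
qed

lemma pt_capped: "pt c \<Longrightarrow> pt z \<Longrightarrow> pt (\<lambda>x. capped (c x) (z x))"
proof -
  have *: "foldr (\<lambda>b n. if c \<le> n + n then c else if b then Suc (n + n) else n + n) bs 0 \<le> c" for c :: nat and bs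
    by (induction bs) auto
  have "pt (\<lambda>p. capped (fst p) (snd p))" unfolding capped_def foldr_conv_fold
  proof (rule pt_fold[where b = "\<lambda>p. 2 * sz p + 1"])
    fix x :: "nat \<times> bool list" and ys
    show "sz (fold (\<lambda>b n. if fst x \<le> n + n then fst x else if b then Suc (n + n) else n + n) ys 0) \<le> 2 * sz x + 1"
      using *[of "fst x" "rev ys"] by (cases x) (simp add: foldr_conv_fold)
  qed (intro pt_intro pb_intros)+
  then show "pt c \<Longrightarrow> pt z \<Longrightarrow> ?thesis" using pt_comp[of "\<lambda>p. capped (fst p) (snd p)" "\<lambda>x. (c x, z x)"] by (simp add: pt_pair)
qed

lemma pt_decide_bits: "pt z \<Longrightarrow> pt b \<Longrightarrow> pt (\<lambda>x. decide_bits (z x) (b x))"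
  unfolding decide_bits_def decide_sized_def by (intro pt_decide_table pt_capped pt_intro pt_ones)

lemma pt_lower_bits: "pt e \<Longrightarrow> pt (\<lambda>x. lower_bits (e x))"
  unfolding lower_bits_def by (intro pt_intro)

lemma pt_first_bits: "pt first_bits"
  unfolding first_bits_def by (intro pt_intro pt_ones)

section \<open>Instances with two colors\<close>

lemma two_color_measure:
  assumes "\<Pi> \<in> {max_min, mov}" "c \<noteq> d"
  shows "\<Pi> {c, d} col U' \<le> l \<longleftrightarrow>
    color_count col U' c \<le> color_count col U' d + l \<and> color_count col U' d \<le> color_count col U' c + l"
proof (cases "\<Pi> = max_min")
  case True
  then show ?thesis by (auto simp: max_min_count mm_count_le)
next
  case False
  then have "\<Pi> {c, d} col U' \<le> l \<longleftrightarrow> mov_count {c, d} (color_count col U') \<le> l"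
    using assms(1) by (simp add: mov_count)
  also have "\<dots> \<longleftrightarrow> color_count col U' c \<le> color_count col U' d + l \<and> color_count col U' d \<le> color_count col U' c + l"
    using assms(2) by (subst mov_count_le) auto
  finally show ?thesis .
qed

lemma two_color_solution:
  assumes I: "fair_instance I" and \<Pi>: "\<Pi> \<in> {max_min, mov}" and C: "colors I = {c, d}" "c \<noteq> d"
    and us: "set us = left_side I" "distinct us" and vs: "set vs = right_side I" "distinct vs"
    and red: "\<And>u. u < length us \<Longrightarrow> red u \<longleftrightarrow> coloring I (us ! u) = c"
    and adj: "\<And>u v. u < length us \<Longrightarrow> v < length vs \<Longrightarrow> adj u v \<longleftrightarrow> {us ! u, vs ! v} \<in> edges I"
  shows "(\<exists>M. fair_solution \<Pi> I M \<and> (\<forall>v\<in>right_side I. p \<le> int (card (matched M v)))) \<longleftrightarrow>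
    two_colors.feasible (length us) (length vs) (min (Suc (length us)) (threshold I))
      (min (Suc (length us)) (nat p)) red adj"
proof -
  let ?n = "length us" and ?L = "left_side I" and ?R = "right_side I" and ?col = "coloring I"
  let ?l = "min (Suc ?n) (threshold I)" and ?p = "min (Suc ?n) (nat p)"
  have col: "?col x = c \<or> ?col x = d" if "x \<in> ?L" for x using I C that by (auto simp: fair_instance_def)
  let ?S = "\<lambda>\<phi> v. {u \<in> ?L. \<phi> u = v}"
  have node: "(\<Pi> (colors I) ?col (?S \<phi> (vs ! v)) \<le> threshold I \<and> p \<le> int (card (?S \<phi> (vs ! v)))) \<longleftrightarrow>
      card {u. u < ?n \<and> red u \<and> \<phi>' u = v} \<le> card {u. u < ?n \<and> \<not> red u \<and> \<phi>' u = v} + ?l \<and>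
      card {u. u < ?n \<and> \<not> red u \<and> \<phi>' u = v} \<le> card {u. u < ?n \<and> red u \<and> \<phi>' u = v} + ?l \<and>
      ?p \<le> card {u. u < ?n \<and> red u \<and> \<phi>' u = v} + card {u. u < ?n \<and> \<not> red u \<and> \<phi>' u = v}"
    if v: "v < length vs" and \<phi>: "\<forall>u<?n. \<phi>' u < length vs \<and> \<phi> (us ! u) = vs ! (\<phi>' u)" for v \<phi> \<phi>'
  proof -
    have cnt: "card {x \<in> ?S \<phi> (vs ! v). ?col x = e} = card {u. u < ?n \<and> ?col (us ! u) = e \<and> \<phi>' u = v}" for e
    proof -
      have "{x \<in> ?S \<phi> (vs ! v). ?col x = e} = (!) us ` {u. u < ?n \<and> ?col (us ! u) = e \<and> \<phi>' u = v}"
      proof (intro set_eqI iffI)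
        fix x assume x: "x \<in> {x \<in> ?S \<phi> (vs ! v). ?col x = e}"
        then have "x \<in> set us" using us(1) by simp
        then obtain u where u: "u < ?n" "x = us ! u" by (metis in_set_conv_nth)
        then have "vs ! (\<phi>' u) = vs ! v" "\<phi>' u < length vs" using x \<phi> by auto
        then have "\<phi>' u = v" using vs(2) v by (simp add: nth_eq_iff_index_eq)
        then show "x \<in> (!) us ` {u. u < ?n \<and> ?col (us ! u) = e \<and> \<phi>' u = v}" using u x by auto
      next
        fix x assume "x \<in> (!) us ` {u. u < ?n \<and> ?col (us ! u) = e \<and> \<phi>' u = v}"
        then show "x \<in> {x \<in> ?S \<phi> (vs ! v). ?col x = e}" using \<phi> us(1) nth_mem by fastforce
      qed
      moreover have "inj_on ((!) us) {u. u < ?n \<and> ?col (us ! u) = e \<and> \<phi>' u = v}"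
        using us(2) by (auto simp: inj_on_def nth_eq_iff_index_eq)
      ultimately show ?thesis by (simp add: card_image)
    qed
    define a where "a = card {u. u < ?n \<and> red u \<and> \<phi>' u = v}"
    define b where "b = card {u. u < ?n \<and> \<not> red u \<and> \<phi>' u = v}"
    have "{u. u < ?n \<and> ?col (us ! u) = c \<and> \<phi>' u = v} = {u. u < ?n \<and> red u \<and> \<phi>' u = v}"
      using red by auto
    then have a: "color_count ?col (?S \<phi> (vs ! v)) c = a" using cnt[of c] by (simp add: color_count_def a_def)
    have "{u. u < ?n \<and> ?col (us ! u) = d \<and> \<phi>' u = v} = {u. u < ?n \<and> \<not> red u \<and> \<phi>' u = v}"
      using red col us(1) C(2) nth_mem by fastforce
    then have b: "color_count ?col (?S \<phi> (vs ! v)) d = b" using cnt[of d] by (simp add: color_count_def b_def)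
    have fin: "finite ?L" using us(1) by (metis List.finite_set)
    have "?S \<phi> (vs ! v) = {x \<in> ?S \<phi> (vs ! v). ?col x = c} \<union> {x \<in> ?S \<phi> (vs ! v). ?col x = d}"
      using col by auto
    then have "card (?S \<phi> (vs ! v)) = card ({x \<in> ?S \<phi> (vs ! v). ?col x = c} \<union> {x \<in> ?S \<phi> (vs ! v). ?col x = d})"
      by (rule arg_cong)
    also have "\<dots> = a + b" using fin C(2) a b by (subst card_Un_disjoint) (auto simp: color_count_def)
    finally have ab: "card (?S \<phi> (vs ! v)) = a + b" .
    have "card (?S \<phi> (vs ! v)) \<le> card ?L" using fin by (intro card_mono) auto
    \<comment> \<open>With both counts summing up to at most \<open>?n\<close>, capping at
      \<open>Suc ?n\<close> changes none of the three inequalities.\<close>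
    then have le: "a + b \<le> ?n" unfolding ab using us by (metis distinct_card)
    show ?thesis
      unfolding C(1) two_color_measure[OF \<Pi> C(2)] a b ab a_def[symmetric] b_def[symmetric] using le by linarith
  qed
  have V: "vs ! v \<in> ?R" if "v < length vs" for v using nth_mem[OF that] by (simp only: vs(1))
  have ex_iff: "(\<exists>\<phi>. (\<forall>u\<in>?L. \<phi> u \<in> ?R \<and> {u, \<phi> u} \<in> edges I) \<and>
      (\<forall>v\<in>?R. \<Pi> (colors I) ?col (?S \<phi> v) \<le> threshold I \<and> p \<le> int (card (?S \<phi> v)))) \<longleftrightarrow>
      two_colors.feasible ?n (length vs) ?l ?p red adj"
    unfolding two_colors.feasible_def
  proof
    assume "\<exists>\<phi>. (\<forall>u\<in>?L. \<phi> u \<in> ?R \<and> {u, \<phi> u} \<in> edges I) \<and>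
      (\<forall>v\<in>?R. \<Pi> (colors I) ?col (?S \<phi> v) \<le> threshold I \<and> p \<le> int (card (?S \<phi> v)))"
    then obtain \<phi> where 1: "\<forall>u\<in>?L. \<phi> u \<in> ?R \<and> {u, \<phi> u} \<in> edges I"
      and 2: "\<forall>v\<in>?R. \<Pi> (colors I) ?col (?S \<phi> v) \<le> threshold I \<and> p \<le> int (card (?S \<phi> v))"
      by (elim exE conjE)
    have "\<forall>u. \<exists>j. u < ?n \<longrightarrow> j < length vs \<and> \<phi> (us ! u) = vs ! j"
    proof
      fix u
      have "u < ?n \<Longrightarrow> \<phi> (us ! u) \<in> set vs" using 1 us(1) vs(1) by auto
      then show "\<exists>j. u < ?n \<longrightarrow> j < length vs \<and> \<phi> (us ! u) = vs ! j" by (metis in_set_conv_nth)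
    qed
    from choice[OF this] obtain \<phi>' where \<phi>': "\<forall>u<?n. \<phi>' u < length vs \<and> \<phi> (us ! u) = vs ! (\<phi>' u)"
      by (elim exE)
    have A: "\<forall>u<?n. \<phi>' u < length vs \<and> adj u (\<phi>' u)"
    proof (intro allI impI)
      fix u assume u: "u < ?n"
      have "us ! u \<in> ?L" using nth_mem[OF u] by (simp only: us(1))
      then have "{us ! u, \<phi> (us ! u)} \<in> edges I" by (rule 1[THEN bspec, THEN conjunct2])
      moreover have f: "\<phi>' u < length vs" "\<phi> (us ! u) = vs ! (\<phi>' u)" using \<phi>' u by (simp_all only: simp_thms)
      ultimately have "{us ! u, vs ! (\<phi>' u)} \<in> edges I" by (simp only:)
      then show "\<phi>' u < length vs \<and> adj u (\<phi>' u)" using adj[OF u f(1)] f(1) by (simp only: simp_thms)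
    qed
    note N = node[OF _ \<phi>', THEN iffD1, OF _ bspec[OF 2]]
    show "\<exists>\<phi>. (\<forall>u<?n. \<phi> u < length vs \<and> adj u (\<phi> u)) \<and>
     (\<forall>v<length vs. card {u. u < ?n \<and> red u \<and> \<phi> u = v} \<le> card {u. u < ?n \<and> \<not> red u \<and> \<phi> u = v} + ?l \<and>
        card {u. u < ?n \<and> \<not> red u \<and> \<phi> u = v} \<le> card {u. u < ?n \<and> red u \<and> \<phi> u = v} + ?l \<and>
        ?p \<le> card {u. u < ?n \<and> red u \<and> \<phi> u = v} + card {u. u < ?n \<and> \<not> red u \<and> \<phi> u = v})"
      by (rule exI[of _ \<phi>'], rule conjI[OF A], rule allI, rule impI, rule N, assumption, rule V, assumption)
  next
    assume "\<exists>\<phi>. (\<forall>u<?n. \<phi> u < length vs \<and> adj u (\<phi> u)) \<and>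
     (\<forall>v<length vs. card {u. u < ?n \<and> red u \<and> \<phi> u = v} \<le> card {u. u < ?n \<and> \<not> red u \<and> \<phi> u = v} + ?l \<and>
        card {u. u < ?n \<and> \<not> red u \<and> \<phi> u = v} \<le> card {u. u < ?n \<and> red u \<and> \<phi> u = v} + ?l \<and>
        ?p \<le> card {u. u < ?n \<and> red u \<and> \<phi> u = v} + card {u. u < ?n \<and> \<not> red u \<and> \<phi> u = v})"
    then obtain \<phi>' where 1: "\<forall>u<?n. \<phi>' u < length vs \<and> adj u (\<phi>' u)" and
      2: "\<forall>v<length vs. card {u. u < ?n \<and> red u \<and> \<phi>' u = v} \<le> card {u. u < ?n \<and> \<not> red u \<and> \<phi>' u = v} + ?l \<and>
        card {u. u < ?n \<and> \<not> red u \<and> \<phi>' u = v} \<le> card {u. u < ?n \<and> red u \<and> \<phi>' u = v} + ?l \<and>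
        ?p \<le> card {u. u < ?n \<and> red u \<and> \<phi>' u = v} + card {u. u < ?n \<and> \<not> red u \<and> \<phi>' u = v}"
      by (elim exE conjE)
    define \<phi> where "\<phi> = (\<lambda>x. vs ! (\<phi>' (THE u. u < ?n \<and> us ! u = x)))"
    have the: "(THE j. j < ?n \<and> us ! j = us ! u) = u" if "u < ?n" for u
      using that us(2) by (intro the_equality) (auto simp: nth_eq_iff_index_eq)
    have \<phi>: "\<forall>u<?n. \<phi>' u < length vs \<and> \<phi> (us ! u) = vs ! (\<phi>' u)" using 1 the by (simp add: \<phi>_def)
    have "\<phi> x \<in> ?R \<and> {x, \<phi> x} \<in> edges I" if "x \<in> ?L" for x
    proof -
      have "x \<in> set us" using that by (simp only: us(1))
      then obtain u where u: "u < ?n" "x = us ! u" by (metis in_set_conv_nth)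
      have f: "\<phi>' u < length vs" "\<phi> x = vs ! (\<phi>' u)" "adj u (\<phi>' u)"
        using \<phi>[rule_format, OF u(1)] 1[rule_format, OF u(1)] unfolding u(2) by blast+
      show ?thesis unfolding f(2) using adj[OF u(1) f(1)] f(3) V[OF f(1)] u(2) by blast
    qed
    moreover have "\<Pi> (colors I) ?col (?S \<phi> y) \<le> threshold I \<and> p \<le> int (card (?S \<phi> y))" if "y \<in> ?R" for y
    proof -
      have "y \<in> set vs" using that by (simp only: vs(1))
      then obtain v where v: "v < length vs" "y = vs ! v" by (metis in_set_conv_nth)
      show ?thesis unfolding v(2) by (rule node[OF v(1) \<phi>, THEN iffD2]) (rule 2[rule_format, OF v(1)])
    qed
    ultimately show "\<exists>\<phi>. (\<forall>u\<in>?L. \<phi> u \<in> ?R \<and> {u, \<phi> u} \<in> edges I) \<and>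
      (\<forall>v\<in>?R. \<Pi> (colors I) ?col (?S \<phi> v) \<le> threshold I \<and> p \<le> int (card (?S \<phi> v)))"
      by (intro exI[of _ \<phi>]) simp
  qed
  show ?thesis
    unfolding fair_matching_function[OF I, of \<Pi> "\<lambda>S. p \<le> int (card S)"] by (rule ex_iff)
qed

lemma decide_bits_instance:
  assumes I: "I \<in> instances_with_colors 2" and \<Pi>: "\<Pi> \<in> {max_min, mov}"
    and b: "\<And>c. capped c b = min c (nat p)"
  shows "decide_bits (instance_enc I) b \<longleftrightarrow>
    (\<exists>M. fair_solution \<Pi> I M \<and> (\<forall>v\<in>right_side I. p \<le> int (card (matched M v))))"
proof -
  have fi: "fair_instance I" and card2: "card (colors I) = 2" using I by (auto simp: instances_with_colors_def)
  then have fin: "finite (left_side I)" "finite (right_side I)" "finite (colors I)"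
    by (auto simp: fair_instance_def bipartite_graph_def)
  define us where "us = sorted_list_of_set (left_side I)"
  define vs where "vs = sorted_list_of_set (right_side I)"
  have us: "set us = left_side I" "distinct us" "length us = card (left_side I)"
    and vs: "set vs = right_side I" "distinct vs" "length vs = card (right_side I)"
    using fin by (simp_all add: us_def vs_def)
  have "length (sorted_list_of_set (colors I)) = 2" using card2 by simp
  then obtain c d where cs: "sorted_list_of_set (colors I) = [c, d]"
    unfolding numeral_2_eq_2 length_Suc_conv by auto
  then have C: "colors I = {c, d}" "c \<noteq> d"
    using set_sorted_list_of_set[OF fin(3)] distinct_sorted_list_of_set[of "colors I"] by auto
  define row where "row = (\<lambda>u. [coloring I u = c, coloring I u = d] @ map (\<lambda>v. {u, v} \<in> edges I) vs)"
  define M where "M = concat (map row us) @ nat_enc (threshold I)"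
  define z where "z = replicate (length vs) True @ False # True # True # False # M"
  have enc: "instance_enc I = replicate (length us) True @ False # z"
    by (simp add: instance_enc_def unary_enc_def us(3)[symmetric] vs(3)[symmetric] card2 cs z_def M_def row_def
        numeral_2_eq_2 flip: us_def vs_def)
  have sizes: "ones 1 (instance_enc I) = length us" "drop (Suc (length us)) (instance_enc I) = z" "ones 1 z = length vs"
    unfolding enc z_def by (simp_all add: ones_unary)
  have dM: "drop (length vs + 4) z = M" by (simp add: z_def)
  have rows: "length r = 2 + length vs" if "r \<in> set (map row us)" for r using that by (auto simp: row_def)
  have drop: "drop (length us * (2 + length vs)) M = nat_enc (threshold I)"
    using concat_rows(1)[of "map row us", OF rows] by (simp add: M_def)
  have nth: "nth_default False M (u * (2 + length vs) + j) = row (us ! u) ! j" if "u < length us" "j < 2 + length vs" for u j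
    using concat_rows(2)[of "map row us", OF rows] that by (simp add: M_def)
  have "decide_bits (instance_enc I) b \<longleftrightarrow> two_colors.feasible (length us) (length vs)
      (min (Suc (length us)) (threshold I)) (min (Suc (length us)) (nat p)) (table_red (length vs) M) (table_adj (length vs) M)"
    unfolding decide_bits_def decide_sized_def sizes dM drop capped_nat_enc b decide_table ..
  also have "\<dots> \<longleftrightarrow> (\<exists>M. fair_solution \<Pi> I M \<and> (\<forall>v\<in>right_side I. p \<le> int (card (matched M v))))"
  proof (rule two_color_solution[symmetric, OF fi \<Pi> C us(1,2) vs(1,2)])
    fix u assume u: "u < length us"
    then show "table_red (length vs) M u \<longleftrightarrow> coloring I (us ! u) = c"
      using nth[OF u, of 0] by (simp add: table_red_def row_def)
    fix v assume "v < length vs"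
    then show "table_adj (length vs) M u v \<longleftrightarrow> {us ! u, vs ! v} \<in> edges I"
      using nth[OF u, of "2 + v"] by (simp add: table_adj_def row_def)
  qed
  finally show ?thesis .
qed

theorem theorem16:
  fixes \<Pi> :: "(nat, nat) measure"
  assumes "\<Pi> \<in> {max_min, mov}"
  shows "poly_time_solvable (instances_with_colors 2) instance_enc (has_fair_matching \<Pi>)
    \<and> (\<forall>k\<ge>3. NP_hard (instances_with_colors k) instance_enc (has_fair_matching \<Pi>))
    \<and> poly_time_solvable (instances_with_colors 2 \<times> UNIV) instance_lb_enc (has_fair_matching_lb \<Pi>)"
proof (intro conjI allI impI)
  \<comment> \<open>The empty word stands for the lower bound 0.\<close>
  have "pt (\<lambda>z. decide_bits z [])" by (intro pt_decide_bits pt_intro)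
  then show "poly_time_solvable (instances_with_colors 2) instance_enc (has_fair_matching \<Pi>)"
  proof (rule pt_decides)
    fix I assume I: "I \<in> instances_with_colors 2"
    show "decide_bits (instance_enc I) [] = has_fair_matching \<Pi> I"
      using decide_bits_instance[OF I assms, of "[]" 0] by (simp add: has_fair_matching_def capped_def)
  qed
next
  fix k :: nat assume "3 \<le> k"
  then show "NP_hard (instances_with_colors k) instance_enc (has_fair_matching \<Pi>)"
    by (rule NP_hard_fair_matching[OF assms])
next
  have "pt (\<lambda>z. decide_bits (first_bits z) (lower_bits (drop (Suc (2 * ones 2 z)) z)))"
    by (intro pt_decide_bits pt_first_bits pt_lower_bits pt_intro pt_ones)
  then show "poly_time_solvable (instances_with_colors 2 \<times> UNIV) instance_lb_enc (has_fair_matching_lb \<Pi>)"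
  proof (rule pt_decides)
    fix J :: "instance_data \<times> int" assume "J \<in> instances_with_colors 2 \<times> UNIV"
    then obtain I p where J: "J = (I, p)" and I: "I \<in> instances_with_colors 2" by auto
    have "decide_bits (instance_enc I) (lower_bits (int_enc p)) = has_fair_matching_lb \<Pi> (I, p)"
      using decide_bits_instance[OF I assms capped_lower_bits] by (simp add: has_fair_matching_lb_def)
    then show "decide_bits (first_bits (instance_lb_enc J))
        (lower_bits (drop (Suc (2 * ones 2 (instance_lb_enc J))) (instance_lb_enc J))) = has_fair_matching_lb \<Pi> J"
      by (simp add: J instance_lb_enc_def first_bits_pair_enc ones_pair_enc drop_pair_enc)
  qed
qed

end
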